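(* Let $A$ be the generator of an analytic $C_0$-semigroup $(T(t))_{t\ge 0}$ in a complex Banach space $\mathbb{X}$, and let $f\in BUC_C(\mathbb{R}^+,\mathbb{X})$ be such that $\sigma(A)\cap i\cdot sp(f)=\emptyset$. Then there exists an asymptotic mild solution $w\in BUC_C(\mathbb{R}^+,\mathbb{X})$ of the equation $u'(t)=Au(t)+f(t)$, $t\ge 0$, with $$sp(w)\subset sp(f),$$ and it is unique up to a function in $C_0(\mathbb{R}^+,\mathbb{X})$; that is, any two asymptotic mild solutions $w_1,w_2\in BUC_C(\mathbb{R}^+,\mathbb{X})$ of this equation with $sp(w_j)\subset sp(f)$, $j=1,2$, satisfy $w_1-w_2\in C_0(\mathbb{R}^+,\mathbb{X})$.
   Context: Let $\mathbb{R}^+=[0,\infty)$. $BUC(\mathbb{R}^+,\mathbb{X})$ is the Banach space (sup norm) of bounded uniformly continuous functions $\mathbb{R}^+\to\mathbb{X}$. $BUC_C(\mathbb{R}^+,\mathbb{X})$ is its closed subspace of functions with precompact range. $C_0(\mathbb{R}^+,\mathbb{X})$ is its closed subspace of functions $g$ with $\lim_{t\to\infty}g(t)=0$. $\sigma(A)$ is the spectrum of $A$, and $i\cdot sp(f)=\{i\xi:\xi\in sp(f)\}$. Spectrum of a function on the half line: let $\mathbb{Y}=BUC(\mathbb{R}^+,\mathbb{X})/C_0(\mathbb{R}^+,\mathbb{X})$ with the quotient norm, and let $\tilde g$ be the class of $g$. Let $\mathcal{D}=d/dt$ in $BUC(\mathbb{R}^+,\mathbb{X})$ with domain $D(\mathcal{D})=\{g\in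 BUC(\mathbb{R}^+,\mathbb{X}): g' \text{ exists and } g'\in BUC(\mathbb{R}^+,\mathbb{X})\}$. The operator $\tilde{\mathcal{D}}$ in $\mathbb{Y}$ has domain consisting of all classes $\tilde g$ that contain some $u\in D(\mathcal{D})$, and $\tilde{\mathcal{D}}\tilde g:=\widetilde{\mathcal{D}u}$ for such a $u$. It is well defined and generates a strongly continuous group of isometries of $\mathbb{Y}$ (the extension of the semigroup induced by the translations $(S(t)g)(\cdot)=g(t+\cdot)$). For $g\in BUC(\mathbb{R}^+,\mathbb{X})$ put $\hat g(\lambda)=(\lambda-\tilde{\mathcal{D}})^{-1}\tilde g$ for $\lambda\in\mathbb{C}\setminus i\mathbb{R}$. The spectrum $sp(g)$ is the set of all $\xi_0\in\mathbb{R}$ such that $\hat g$ has no analytic extension to any neighborhood of $i\xi_0$. Asymptotic mild solution: $u\in BUC(\mathbb{R}^+,\mathbb{X})$ is an asymptotic mild solution of $u'(t)=Au(t)+f(t)$, $t\ge0$, if there is $\varepsilon\in C_0(\mathbb{R}^+,\mathbb{X})$ such that $u(t)=T(t)u(0)+\int_0^tT(t-s)\left(f(s)+\varepsilon(s)\right)ds$ for all $t\ge 0$. *)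

theory Defs
  imports "HOL-Analysis.Analysis"
begin

section \<open>Complex normed spaces\<close>

class complex_normed_vector = real_normed_vector +
  fixes scaleC :: "complex \<Rightarrow> 'a \<Rightarrow> 'a"  (infixr "*\<^sub>C" 75)
  assumes scaleC_add_right: "c *\<^sub>C (x + y) = c *\<^sub>C x + c *\<^sub>C y"
    and scaleC_add_left: "(c + d) *\<^sub>C x = c *\<^sub>C x + d *\<^sub>C x"
    and scaleC_scaleC: "c *\<^sub>C (d *\<^sub>C x) = (c * d) *\<^sub>C x"
    and scaleC_of_real: "complex_of_real r *\<^sub>C x = r *\<^sub>R x"
    and norm_scaleC: "norm (c *\<^sub>C x) = cmod c * norm x"

lemma bounded_linear_scaleC_right: "bounded_linear (\<lambda>x::'a::complex_normed_vector. c *\<^sub>C x)"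
proof (rule bounded_linear_intro)
  show "c *\<^sub>C (x + y) = c *\<^sub>C x + c *\<^sub>C y" for x y :: 'a
    by (rule scaleC_add_right)
  show "c *\<^sub>C (r *\<^sub>R x) = r *\<^sub>R (c *\<^sub>C x)" for r and x :: 'a
    by (simp add: scaleC_of_real [symmetric] scaleC_scaleC mult.commute)
  show "norm (c *\<^sub>C x) \<le> norm x * cmod c" for x :: 'a
    by (simp add: norm_scaleC mult.commute)
qed

lemma scaleC_one: "1 *\<^sub>C x = (x :: 'a::complex_normed_vector)"
  using scaleC_of_real [of 1 x] by simp

lemma scaleC_minus1: "(-1) *\<^sub>C x = - (x :: 'a::complex_normed_vector)"
  using scaleC_of_real [of "-1" x] by simp

lemma scaleC_diff_right: "c *\<^sub>C (x - y) = c *\<^sub>C x - c *\<^sub>C (y :: 'a::complex_normed_vector)"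
  using scaleC_add_right [of c "x - y" y] by simp

text \<open>
  A function of a complex variable with values in a complex normed space. The complex structure
  enters only through the form of the Frechet derivative.
\<close>
definition vholomorphic_on :: "(complex \<Rightarrow> 'b::complex_normed_vector) \<Rightarrow> complex set \<Rightarrow> bool"
  where "vholomorphic_on F U \<longleftrightarrow>
    (\<forall>z\<in>U. \<exists>F'. (F has_derivative (\<lambda>h. h *\<^sub>C F')) (at z within U))"

text \<open>
  The bounded real-linear maps into a complex normed space form a complex normed space under
  pointwise scalar multiplication; the complex-linear ones are the closed complex subspace
  singled out by \<open>clinear_op\<close>.
\<close>
instantiation blinfun :: (real_normed_vector, complex_normed_vector) complex_normed_vector
begin

lift_definition scaleC_blinfun :: "complex \<Rightarrow> ('a \<Rightarrow>\<^sub>L 'b) \<Rightarrow> ('a \<Rightarrow>\<^sub>L 'b)"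
  is "\<lambda>c f x. c *\<^sub>C f x"
  by (rule bounded_linear_compose [OF bounded_linear_scaleC_right])

instance
proof
  fix c d :: complex and r :: real and f g :: "'a \<Rightarrow>\<^sub>L 'b"
  show "c *\<^sub>C (f + g) = c *\<^sub>C f + c *\<^sub>C g"
    by transfer (simp add: scaleC_add_right)
  show "(c + d) *\<^sub>C f = c *\<^sub>C f + d *\<^sub>C f"
    by transfer (simp add: scaleC_add_left)
  show "c *\<^sub>C (d *\<^sub>C f) = (c * d) *\<^sub>C f"
    by transfer (simp add: scaleC_scaleC)
  show "complex_of_real r *\<^sub>C f = r *\<^sub>R f"
    by transfer (simp add: scaleC_of_real)
  show "norm (c *\<^sub>C f) = cmod c * norm f"
  proof -
    have "norm (c *\<^sub>C f) = onorm (\<lambda>x. c *\<^sub>C blinfun_apply f x)"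
      by (simp add: norm_blinfun.rep_eq scaleC_blinfun.rep_eq)
    also have "\<dots> = onorm (\<lambda>x. cmod c *\<^sub>R blinfun_apply f x)"
      by (simp add: onorm_def norm_scaleC)
    also have "\<dots> = cmod c * norm f"
      by (simp add: onorm_scaleR blinfun.bounded_linear_right norm_blinfun.rep_eq)
    finally show ?thesis .
  qed
qed

end

definition clinear_op :: "('a::complex_normed_vector \<Rightarrow>\<^sub>L 'b::complex_normed_vector) \<Rightarrow> bool"
  where "clinear_op B \<longleftrightarrow> (\<forall>c x. blinfun_apply B (c *\<^sub>C x) = c *\<^sub>C blinfun_apply B x)"

section \<open>Unbounded operators\<close>

text \<open>
  An unbounded operator is represented by its graph: \<open>(x, y) \<in> A\<close> means that \<open>x\<close> lies in
  the domain of \<open>A\<close> and \<open>A x = y\<close>.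
\<close>

text \<open>The map \<open>(\<lambda> - A)\<^sup>-\<^sup>1\<close>; meaningful where \<open>\<lambda> - A\<close> is a bijection of the domain onto the space.\<close>
definition resolvent :: "('b::complex_normed_vector \<times> 'b) set \<Rightarrow> complex \<Rightarrow> 'b \<Rightarrow> 'b"
  where "resolvent A l y = (THE x. \<exists>z. (x, z) \<in> A \<and> l *\<^sub>C x - z = y)"

definition resolvent_set :: "('b::complex_normed_vector \<times> 'b) set \<Rightarrow> complex set"
  where "resolvent_set A =
    {l. (\<forall>y. \<exists>!x. \<exists>z. (x, z) \<in> A \<and> l *\<^sub>C x - z = y) \<and> bounded_linear (resolvent A l)}"

definition spectrum :: "('b::complex_normed_vector \<times> 'b) set \<Rightarrow> complex set"
  where "spectrum A = - resolvent_set A"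

section \<open>Semigroups\<close>

text \<open>Values of \<open>T\<close> at negative times are irrelevant.\<close>
definition C0_semigroup :: "(real \<Rightarrow> 'a::complex_normed_vector \<Rightarrow>\<^sub>L 'a) \<Rightarrow> bool"
  where "C0_semigroup T \<longleftrightarrow>
    (\<forall>t\<ge>0. clinear_op (T t)) \<and>
    T 0 = id_blinfun \<and>
    (\<forall>s\<ge>0. \<forall>t\<ge>0. T (s + t) = T s o\<^sub>L T t) \<and>
    (\<forall>x. ((\<lambda>t. blinfun_apply (T t) x) \<longlongrightarrow> x) (at_right 0))"

definition generator :: "(real \<Rightarrow> 'a::complex_normed_vector \<Rightarrow>\<^sub>L 'a) \<Rightarrow> ('a \<times> 'a) set"
  where "generator T =
    {(x, y). ((\<lambda>h. (1 / h) *\<^sub>R (blinfun_apply (T h) x - x)) \<longlongrightarrow> y) (at_right 0)}"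

definition sector :: "real \<Rightarrow> complex set"
  where "sector \<theta> = {z. z \<noteq> 0 \<and> \<bar>Arg z\<bar> < \<theta>}"

text \<open>
  \<open>T\<close> extends to an operator-norm holomorphic semigroup on an open sector around the positive
  half-axis which is strongly continuous at \<open>0\<close> on every smaller sector. No boundedness
  on the whole of a sector is required.
\<close>
definition analytic_C0_semigroup :: "(real \<Rightarrow> 'a::complex_normed_vector \<Rightarrow>\<^sub>L 'a) \<Rightarrow> bool"
  where "analytic_C0_semigroup T \<longleftrightarrow> C0_semigroup T \<and>
    (\<exists>\<theta> S. 0 < \<theta> \<and> \<theta> \<le> pi / 2 \<and>
      (\<forall>t\<ge>0. S (complex_of_real t) = T t) \<and>
      (\<forall>z\<in>sector \<theta>. clinear_op (S z)) \<and>
      (\<forall>z\<in>sector \<theta>. \<forall>w\<in>sector \<theta>. S (z + w) = S z o\<^sub>L S w) \<and>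
      vholomorphic_on S (sector \<theta>) \<and>
      (\<forall>\<theta>'. 0 < \<theta>' \<and> \<theta>' < \<theta> \<longrightarrow>
        (\<forall>x. ((\<lambda>z. blinfun_apply (S z) x) \<longlongrightarrow> x) (at 0 within sector \<theta>'))))"

section \<open>Functions on the half-line\<close>

text \<open>
  A function on the closed half-line is represented by a function on the reals of which only
  the values on \<open>{0..}\<close> matter.
\<close>

definition BUC :: "(real \<Rightarrow> 'a::real_normed_vector) set"
  where "BUC = {f. uniformly_continuous_on {0..} f \<and> bounded (f ` {0..})}"

definition BUC_C :: "(real \<Rightarrow> 'a::real_normed_vector) set"
  where "BUC_C = {f \<in> BUC. compact (closure (f ` {0..}))}"

definition C0 :: "(real \<Rightarrow> 'a::real_normed_vector) set"
  where "C0 = {f \<in> BUC. (f \<longlongrightarrow> 0) at_top}"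

definition sup_norm :: "(real \<Rightarrow> 'a::real_normed_vector) \<Rightarrow> real"
  where "sup_norm f = (SUP t\<in>{0..}. norm (f t))"

lemma BUC_zero: "(\<lambda>_. 0) \<in> BUC"
  by (auto simp: BUC_def uniformly_continuous_on_const image_constant_conv)

lemma BUC_add: "f \<in> BUC \<Longrightarrow> g \<in> BUC \<Longrightarrow> (\<lambda>t. f t + g t) \<in> BUC"
  unfolding BUC_def by (auto intro: uniformly_continuous_on_add bounded_plus_comp)

lemma BUC_scaleC:
  fixes f :: "real \<Rightarrow> 'a::complex_normed_vector"
  assumes "f \<in> BUC"
  shows "(\<lambda>t. c *\<^sub>C f t) \<in> BUC"
  using assms bounded_linear.uniformly_continuous_on [OF bounded_linear_scaleC_right, of "{0..}" f c]
    bounded_linear_image [OF _ bounded_linear_scaleC_right, of "f ` {0..}" c]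
  unfolding BUC_def by (auto simp: image_image)

lemma C0_zero: "(\<lambda>_. 0) \<in> C0"
  by (simp add: C0_def BUC_zero)

lemma C0_add: "f \<in> C0 \<Longrightarrow> g \<in> C0 \<Longrightarrow> (\<lambda>t. f t + g t) \<in> C0"
  unfolding C0_def by (auto intro: BUC_add tendsto_add_zero)

lemma C0_scaleC:
  fixes f :: "real \<Rightarrow> 'a::complex_normed_vector"
  shows "f \<in> C0 \<Longrightarrow> (\<lambda>t. c *\<^sub>C f t) \<in> C0"
  unfolding C0_def
  using bounded_linear.tendsto_zero [OF bounded_linear_scaleC_right, of f _ c] by (auto intro: BUC_scaleC)

lemma C0_uminus:
  fixes f :: "real \<Rightarrow> 'a::complex_normed_vector"
  shows "f \<in> C0 \<Longrightarrow> (\<lambda>t. - f t) \<in> C0"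
  using C0_scaleC [of f "-1"] by (simp add: scaleC_minus1)

lemma norm_le_sup_norm: "f \<in> BUC \<Longrightarrow> 0 \<le> t \<Longrightarrow> norm (f t) \<le> sup_norm f"
  unfolding sup_norm_def BUC_def
  by (intro cSUP_upper) (auto simp: bounded_norm_comp bounded_imp_bdd_above)

lemma sup_norm_leI: "(\<And>t. 0 \<le> t \<Longrightarrow> norm (f t) \<le> b) \<Longrightarrow> sup_norm f \<le> b"
  unfolding sup_norm_def by (rule cSUP_least) auto

lemma sup_norm_nonneg: "f \<in> BUC \<Longrightarrow> 0 \<le> sup_norm f"
  using norm_le_sup_norm [of f 0] norm_ge_zero [of "f 0"] by linarith

section \<open>The quotient of \<open>BUC\<close> by \<open>C0\<close>\<close>

definition buc_eq :: "(real \<Rightarrow> 'a::real_normed_vector) \<Rightarrow> (real \<Rightarrow> 'a) \<Rightarrow> bool"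
  where "buc_eq f g \<longleftrightarrow> f \<in> BUC \<and> g \<in> BUC \<and> (\<lambda>t. f t - g t) \<in> C0"

text \<open>\<open>abs_BUC_quot g\<close> is the class of \<open>g\<close>, for \<open>g \<in> BUC\<close>.\<close>
quotient_type (overloaded) 'a BUC_quot = "real \<Rightarrow> 'a::complex_normed_vector" / partial: buc_eq
proof (rule part_equivpI)
  show "\<exists>f. buc_eq f (f :: real \<Rightarrow> 'a)"
    by (rule exI [of _ "\<lambda>_. 0"]) (simp add: buc_eq_def BUC_zero C0_zero)
  show "symp (buc_eq :: (real \<Rightarrow> 'a) \<Rightarrow> _)"
    using C0_uminus by (fastforce simp: symp_def buc_eq_def)
  show "transp (buc_eq :: (real \<Rightarrow> 'a) \<Rightarrow> _)"
  proof (rule transpI)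
    fix f g h :: "real \<Rightarrow> 'a"
    assume "buc_eq f g" "buc_eq g h"
    then show "buc_eq f h"
      using C0_add [of "\<lambda>t. f t - g t" "\<lambda>t. g t - h t"] by (simp add: buc_eq_def)
  qed
qed

lemma abs_BUC_quot_eq_iff:
  "f \<in> BUC \<Longrightarrow> g \<in> BUC \<Longrightarrow> abs_BUC_quot f = abs_BUC_quot g \<longleftrightarrow> (\<lambda>t. f t - g t) \<in> C0"
  using Quotient3_rel [OF Quotient3_BUC_quot, of f g] by (auto simp: buc_eq_def C0_zero)

lemma BUC_quot_cases:
  obtains f where "f \<in> BUC" "x = abs_BUC_quot f"
proof
  show "rep_BUC_quot x \<in> BUC"
    using Quotient3_rep_reflp [OF Quotient3_BUC_quot, of x] by (simp add: buc_eq_def)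
  show "x = abs_BUC_quot (rep_BUC_quot x)"
    by (simp add: Quotient3_abs_rep [OF Quotient3_BUC_quot])
qed

instantiation BUC_quot :: (complex_normed_vector) complex_normed_vector
begin

lift_definition zero_BUC_quot :: "'a BUC_quot" is "\<lambda>_. 0"
  by (simp add: buc_eq_def BUC_zero C0_zero)

lift_definition plus_BUC_quot :: "'a BUC_quot \<Rightarrow> 'a BUC_quot \<Rightarrow> 'a BUC_quot"
  is "\<lambda>f g t. f t + g t"
  subgoal for f f' g g'
    using C0_add [of "\<lambda>t. f t - f' t" "\<lambda>t. g t - g' t"]
    by (simp add: buc_eq_def BUC_add algebra_simps)
  done

lift_definition scaleC_BUC_quot :: "complex \<Rightarrow> 'a BUC_quot \<Rightarrow> 'a BUC_quot"
  is "\<lambda>c f t. c *\<^sub>C f t"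
  subgoal for c f f'
    using C0_scaleC [of "\<lambda>t. f t - f' t" c]
    by (simp add: buc_eq_def BUC_scaleC scaleC_diff_right)
  done

definition scaleR_BUC_quot :: "real \<Rightarrow> 'a BUC_quot \<Rightarrow> 'a BUC_quot"
  where "scaleR_BUC_quot r x = complex_of_real r *\<^sub>C x"

definition uminus_BUC_quot :: "'a BUC_quot \<Rightarrow> 'a BUC_quot"
  where "uminus_BUC_quot x = (-1) *\<^sub>C x"

definition minus_BUC_quot :: "'a BUC_quot \<Rightarrow> 'a BUC_quot \<Rightarrow> 'a BUC_quot"
  where "minus_BUC_quot x y = x + - y"

definition norm_BUC_quot :: "'a BUC_quot \<Rightarrow> real"
  where "norm_BUC_quot x = (INF f\<in>{f \<in> BUC. abs_BUC_quot f = x}. sup_norm f)"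

definition sgn_BUC_quot :: "'a BUC_quot \<Rightarrow> 'a BUC_quot"
  where "sgn_BUC_quot x = inverse (norm x) *\<^sub>R x"

definition dist_BUC_quot :: "'a BUC_quot \<Rightarrow> 'a BUC_quot \<Rightarrow> real"
  where "dist_BUC_quot x y = norm (x - y)"

definition uniformity_BUC_quot :: "('a BUC_quot \<times> 'a BUC_quot) filter"
  where "uniformity_BUC_quot = (INF e\<in>{0<..}. principal {(x, y). dist x y < e})"

definition open_BUC_quot :: "'a BUC_quot set \<Rightarrow> bool"
  where "open_BUC_quot U \<longleftrightarrow> (\<forall>x\<in>U. eventually (\<lambda>(x', y). x' = x \<longrightarrow> y \<in> U) uniformity)"

lemma abs_BUC_quot_add:
  "f \<in> BUC \<Longrightarrow> g \<in> BUC \<Longrightarrow> abs_BUC_quot f + abs_BUC_quot g = abs_BUC_quot (\<lambda>t. f t + g t)"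
  by (rule plus_BUC_quot.abs_eq) (simp_all add: buc_eq_def C0_zero)

lemma abs_BUC_quot_scaleC:
  "f \<in> BUC \<Longrightarrow> c *\<^sub>C abs_BUC_quot f = abs_BUC_quot (\<lambda>t. c *\<^sub>C f t)"
  by (rule scaleC_BUC_quot.abs_eq) (simp add: buc_eq_def C0_zero)

lemma norm_BUC_quot_le: "f \<in> BUC \<Longrightarrow> norm (abs_BUC_quot f) \<le> sup_norm f"
  unfolding norm_BUC_quot_def
  by (rule cINF_lower) (auto intro!: bdd_belowI [of _ 0] simp: sup_norm_nonneg)

lemma norm_BUC_quot_less:
  assumes "norm x < b"
  obtains f where "f \<in> BUC" "abs_BUC_quot f = x" "sup_norm f < b"
proof -
  have "{f \<in> BUC. abs_BUC_quot f = x} \<noteq> {}"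
    by (rule BUC_quot_cases [of x]) auto
  moreover have "bdd_below (sup_norm ` {f \<in> BUC. abs_BUC_quot f = x})"
    by (auto intro!: bdd_belowI [of _ 0] simp: sup_norm_nonneg)
  ultimately show thesis
    using assms that unfolding norm_BUC_quot_def by (auto simp: cINF_less_iff)
qed

lemma norm_BUC_quot_nonneg: "0 \<le> norm (x :: 'a BUC_quot)"
  by (metis norm_BUC_quot_less not_less sup_norm_nonneg less_imp_le)

lemma norm_BUC_quot_scaleC_le: "norm (c *\<^sub>C x) \<le> cmod c * norm (x :: 'a BUC_quot)"
proof -
  have *: "norm (c *\<^sub>C x) \<le> cmod c * (norm x + e)" if e: "0 < e" for e
  proof -
    obtain f where f: "f \<in> BUC" "abs_BUC_quot f = x" "sup_norm f < norm x + e"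
      using norm_BUC_quot_less [of x "norm x + e"] e by auto
    have "norm (c *\<^sub>C x) \<le> sup_norm (\<lambda>t. c *\<^sub>C f t)"
      using norm_BUC_quot_le [OF BUC_scaleC [OF f(1), of c]] f by (auto simp: abs_BUC_quot_scaleC)
    also have "\<dots> \<le> cmod c * sup_norm f"
      by (intro sup_norm_leI) (simp add: norm_scaleC mult_left_mono norm_le_sup_norm f(1))
    also have "\<dots> \<le> cmod c * (norm x + e)"
      using f(3) by (intro mult_left_mono) auto
    finally show ?thesis .
  qed
  show ?thesis
  proof (rule tendsto_lowerbound)
    show "((\<lambda>e. cmod c * (norm x + e)) \<longlongrightarrow> cmod c * norm x) (at_right 0)"
      by (auto intro!: tendsto_eq_intros)
    show "\<forall>\<^sub>F e in at_right 0. norm (c *\<^sub>C x) \<le> cmod c * (norm x + e)"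
      using * by (auto simp: eventually_at_filter)
  qed simp
qed

instance
proof
  fix x y z :: "'a BUC_quot" and c d :: complex and r s :: real
  have add_assoc': "x + y + z = x + (y + z)" for x y z :: "'a BUC_quot"
    by (cases x rule: BUC_quot_cases, cases y rule: BUC_quot_cases, cases z rule: BUC_quot_cases)
      (simp add: abs_BUC_quot_add BUC_add add.assoc)
  have add_commute': "x + y = y + x" for x y :: "'a BUC_quot"
    by (cases x rule: BUC_quot_cases, cases y rule: BUC_quot_cases)
      (simp add: abs_BUC_quot_add add.commute)
  have zero: "(0 :: 'a BUC_quot) = abs_BUC_quot (\<lambda>_. 0)"
    by (simp add: zero_BUC_quot_def)
  have scC_one: "1 *\<^sub>C x = x" for x :: "'a BUC_quot"
    by (cases x rule: BUC_quot_cases) (simp add: abs_BUC_quot_scaleC scaleC_one)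
  have scC_right: "c *\<^sub>C (x + y) = c *\<^sub>C x + c *\<^sub>C y" for c and x y :: "'a BUC_quot"
    by (cases x rule: BUC_quot_cases, cases y rule: BUC_quot_cases)
      (simp add: abs_BUC_quot_add abs_BUC_quot_scaleC BUC_add BUC_scaleC scaleC_add_right)
  have scC_left: "(c + d) *\<^sub>C x = c *\<^sub>C x + d *\<^sub>C x" for c d and x :: "'a BUC_quot"
    by (cases x rule: BUC_quot_cases)
      (simp add: abs_BUC_quot_add abs_BUC_quot_scaleC BUC_add BUC_scaleC scaleC_add_left)
  have scC_scC: "c *\<^sub>C (d *\<^sub>C x) = (c * d) *\<^sub>C x" for c d and x :: "'a BUC_quot"
    by (cases x rule: BUC_quot_cases) (simp add: abs_BUC_quot_scaleC BUC_scaleC scaleC_scaleC)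
  have scC_zero: "0 *\<^sub>C x = 0" for x :: "'a BUC_quot"
  proof (cases x rule: BUC_quot_cases)
    case (1 f)
    have "0 *\<^sub>C v = 0" for v :: 'a
      using scaleC_of_real [of 0 v] by simp
    with 1 show ?thesis
      by (simp add: abs_BUC_quot_scaleC zero)
  qed
  show "x + y + z = x + (y + z)" "x + y = y + x"
    by (fact add_assoc' add_commute')+
  show "0 + x = x"
    by (cases x rule: BUC_quot_cases) (simp add: zero abs_BUC_quot_add BUC_zero)
  show "- x + x = 0"
    using scC_left [of "-1" 1 x] by (simp add: uminus_BUC_quot_def scC_one scC_zero)
  show "x - y = x + - y"
    by (rule minus_BUC_quot_def)
  show "r *\<^sub>R (x + y) = r *\<^sub>R x + r *\<^sub>R y" "(r + s) *\<^sub>R x = r *\<^sub>R x + s *\<^sub>R x"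
    "r *\<^sub>R (s *\<^sub>R x) = (r * s) *\<^sub>R x" "1 *\<^sub>R x = x"
    by (simp_all add: scaleR_BUC_quot_def scC_right scC_left scC_scC scC_one)
  show "dist x y = norm (x - y)"
    by (rule dist_BUC_quot_def)
  show "sgn x = inverse (norm x) *\<^sub>R x"
    by (rule sgn_BUC_quot_def)
  show "(uniformity :: ('a BUC_quot \<times> 'a BUC_quot) filter) =
      (INF e\<in>{0<..}. principal {(x, y). dist x y < e})"
    by (rule uniformity_BUC_quot_def)
  show "open U \<longleftrightarrow> (\<forall>x\<in>U. eventually (\<lambda>(x', y). x' = x \<longrightarrow> y \<in> U) uniformity)"
    for U :: "'a BUC_quot set"
    by (rule open_BUC_quot_def)
  have norm_zero': "norm (0 :: 'a BUC_quot) = 0"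
    using norm_BUC_quot_scaleC_le [of 0 "0 :: 'a BUC_quot"] norm_BUC_quot_nonneg [of "0 :: 'a BUC_quot"]
    by (simp add: scC_zero)
  show "norm x = 0 \<longleftrightarrow> x = 0"
  proof
    assume nx: "norm x = 0"
    obtain g where g: "g \<in> BUC" "x = abs_BUC_quot g"
      by (rule BUC_quot_cases)
    have "(g \<longlongrightarrow> 0) at_top"
    proof (rule tendstoI)
      fix e :: real
      assume e: "0 < e"
      obtain f where f: "f \<in> BUC" "abs_BUC_quot f = x" "sup_norm f < e / 2"
        using norm_BUC_quot_less [of x "e / 2"] nx e by auto
      have "((\<lambda>t. g t - f t) \<longlongrightarrow> 0) at_top"
        using abs_BUC_quot_eq_iff [OF g(1) f(1)] g f by (simp add: C0_def)
      then have "\<forall>\<^sub>F t in at_top. dist (g t - f t) 0 < e / 2"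
        using e by (intro tendstoD) auto
      then show "\<forall>\<^sub>F t in at_top. dist (g t) 0 < e"
        using eventually_ge_at_top [of 0]
      proof eventually_elim
        case (elim t)
        have "norm (g t) \<le> norm (g t - f t) + norm (f t)"
          by (metis diff_add_cancel norm_triangle_ineq)
        with elim f norm_le_sup_norm [of f t] show ?case
          by simp
      qed
    qed
    then have "(\<lambda>t. g t - 0) \<in> C0"
      using g by (simp add: C0_def)
    then show "x = 0"
      using abs_BUC_quot_eq_iff [OF g(1) BUC_zero] g by (simp add: zero)
  qed (simp add: norm_zero')
  show "norm (x + y) \<le> norm x + norm y"
  proof (rule field_le_epsilon)
    fix e :: real
    assume e: "0 < e"
    obtain f where f: "f \<in> BUC" "abs_BUC_quot f = x" "sup_norm f < norm x + e / 2"
      using norm_BUC_quot_less [of x "norm x + e / 2"] e by auto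
    obtain g where g: "g \<in> BUC" "abs_BUC_quot g = y" "sup_norm g < norm y + e / 2"
      using norm_BUC_quot_less [of y "norm y + e / 2"] e by auto
    have "norm (x + y) \<le> sup_norm (\<lambda>t. f t + g t)"
      using norm_BUC_quot_le [OF BUC_add [OF f(1) g(1)]] f g by (auto simp: abs_BUC_quot_add)
    also have "\<dots> \<le> sup_norm f + sup_norm g"
      by (intro sup_norm_leI norm_triangle_le add_mono norm_le_sup_norm f(1) g(1))
    finally show "norm (x + y) \<le> norm x + norm y + e"
      using f(3) g(3) by linarith
  qed
  show nC: "norm (c *\<^sub>C x) = cmod c * norm x" for c and x :: "'a BUC_quot"
  proof (cases "c = 0")
    case False
    have "norm x = norm (inverse c *\<^sub>C (c *\<^sub>C x))"
      using False by (simp add: scC_scC scC_one)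
    also have "\<dots> \<le> cmod (inverse c) * norm (c *\<^sub>C x)"
      by (rule norm_BUC_quot_scaleC_le)
    finally have "cmod c * norm x \<le> norm (c *\<^sub>C x)"
      using False by (simp add: norm_inverse norm_divide field_simps)
    with norm_BUC_quot_scaleC_le [of c x] show ?thesis
      by simp
  qed (simp add: scC_zero norm_zero')
  show "norm (r *\<^sub>R x) = \<bar>r\<bar> * norm x"
    by (simp add: scaleR_BUC_quot_def nC)
  show "c *\<^sub>C (x + y) = c *\<^sub>C x + c *\<^sub>C y" "(c + d) *\<^sub>C x = c *\<^sub>C x + d *\<^sub>C x"
    "c *\<^sub>C (d *\<^sub>C x) = (c * d) *\<^sub>C x"
    by (fact scC_right scC_left scC_scC)+
  show "complex_of_real r *\<^sub>C x = r *\<^sub>R x"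
    by (simp add: scaleR_BUC_quot_def)
qed

end

section \<open>The spectrum of a function on the half-line\<close>

text \<open>The graph of \<open>d/dt\<close> in \<open>BUC\<close>; the derivative at \<open>0\<close> is one-sided.\<close>
definition deriv_op :: "((real \<Rightarrow> 'a::real_normed_vector) \<times> (real \<Rightarrow> 'a)) set"
  where "deriv_op = {(u, v). u \<in> BUC \<and> v \<in> BUC \<and>
    (\<forall>t\<ge>0. (u has_vector_derivative v t) (at t within {0..}))}"

definition deriv_quot :: "('a::complex_normed_vector BUC_quot \<times> 'a BUC_quot) set"
  where "deriv_quot = {(abs_BUC_quot u, abs_BUC_quot v) | u v. (u, v) \<in> deriv_op}"

definition hat :: "(real \<Rightarrow> 'a::complex_normed_vector) \<Rightarrow> complex \<Rightarrow> 'a BUC_quot"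
  where "hat g l = resolvent deriv_quot l (abs_BUC_quot g)"

text \<open>For \<open>g \<in> BUC\<close>; \<open>hat g\<close> is considered off the imaginary axis only.\<close>
definition sp :: "(real \<Rightarrow> 'a::complex_normed_vector) \<Rightarrow> real set"
  where "sp g = {\<xi>. \<not> (\<exists>U F. open U \<and> \<i> * complex_of_real \<xi> \<in> U \<and> vholomorphic_on F U \<and>
    (\<forall>l\<in>U. Re l \<noteq> 0 \<longrightarrow> F l = hat g l))}"

section \<open>Asymptotic mild solutions\<close>

text \<open>Asymptotic mild solutions of \<open>u' = A u + f\<close>, where \<open>A\<close> is the generator of \<open>T\<close>.\<close>
definition asymptotic_mild_solution ::
    "(real \<Rightarrow> 'a::{complex_normed_vector, banach} \<Rightarrow>\<^sub>L 'a) \<Rightarrow> (real \<Rightarrow> 'a) \<Rightarrow> (real \<Rightarrow> 'a) \<Rightarrow> bool"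
  where "asymptotic_mild_solution T f u \<longleftrightarrow> u \<in> BUC \<and>
    (\<exists>\<epsilon>\<in>C0. \<forall>t\<ge>0. u t = blinfun_apply (T t) (u 0) +
      integral {0..t} (\<lambda>s. blinfun_apply (T (t - s)) (f s + \<epsilon> s)))"

end

(*
  On the quotient Y = BUC / C_0 let P be the resolvent of D = d/dt, let Q be the resolvent of A
  acting pointwise, and let B be the convolution with exp(-mu t) T(t), which inverts D - A + mu.
  Modulo C_0, the mild solutions of w' = A w + f are the solutions of w = B f + mu B w in Y.

  Uniqueness: the class y of a difference of two solutions satisfies y = mu B y, which forces
  P(l) y = Q(l) y, so l |-> P(l) y extends across the part of the imaginary axis in the resolvent
  set of A. By the hypothesis on the spectra it extends to an entire function, which is 0 because
  |Re l| |P(l) y| <= |y|.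

  Existence: let F be the extension of l |-> P(l) f across the imaginary axis off i sp(f), and let
  chi be a cutoff function on the line that is 1 near sp(f) and near infinity and 0 where i x is
  in the spectrum of A; by analyticity Q(l) = O(1 / |Im l|) on vertical strips, so this part of the
  spectrum is compact. With G(l) = Q(l + mu)^2 Q(l) F(l), let v be the integral over x of
  chi(x) (G(a + i x) - G(-a + i x)) - i chi'(x) int_{-a}^a G(s + i x) ds, divided by 2 pi; then
  w = B f + mu B^2 f + mu^2 v is a solution. It lies in every closed subspace that contains f and
  is invariant under P, Q and B, such as the classes of functions with precompact range whose
  image under P extends wherever that of f does. Such extensions survive limits since they obey
  a uniform bound in terms of the norm.
*)
theory Submission
  imports Defs "HOL-Complex_Analysis.Complex_Analysis" "HOL-Real_Asymp.Real_Asymp"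
begin

section \<open>Functionals and vector-valued holomorphic functions\<close>

text \<open>Formally w = (D - A)^-1 f, and B = (D - A + mu)^-1 gives (D - A)^-1 = B + mu B^2 + mu^2
  (D - A)^-1 B^2. The last operator is a Dunford integral of (l - A)^-1 (l + mu - A)^-2 P(l) over
  the boundary of a strip around the imaginary axis. The factor Q(l + mu)^2 provides convergence:
  P(l) f is only bounded on a vertical line, while Q(l + mu) is O(1 / |Im l|) and, mu being large,
  has no singularity in the strip. The obstacle is that sp(f) may be unbounded and that P(l) f and
  Q(l) may both be singular on the axis, so there is no contour around i sp(f) alone. The cutoff
  replaces it. If G is holomorphic on the strip, the jump G(a + i x) - G(-a + i x) is -i times the
  x-derivative of the horizontal integral of G, so the integrand with chi is -i times the derivative
  of chi times this integral, and only boundary terms matter. Applying 1 - mu B to G yields B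
  applied to a difference of two functions: the first is singular only on i sp(f), so chi may be
  replaced by 1; the second only on the spectrum of A, so chi may be replaced by 0.\<close>

interpretation scaleC: bounded_bilinear "scaleC :: complex \<Rightarrow> 'a \<Rightarrow> 'a::complex_normed_vector"
proof
  fix a a' :: complex and b b' :: 'a and r :: real
  show "(a + a') *\<^sub>C b = a *\<^sub>C b + a' *\<^sub>C b" by (rule scaleC_add_left)
  show "a *\<^sub>C (b + b') = a *\<^sub>C b + a *\<^sub>C b'" by (rule scaleC_add_right)
  show "(r *\<^sub>R a) *\<^sub>C b = r *\<^sub>R (a *\<^sub>C b)"
    by (simp add: scaleC_of_real [symmetric] scaleC_scaleC scaleR_conv_of_real)
  show "a *\<^sub>C (r *\<^sub>R b) = r *\<^sub>R (a *\<^sub>C b)"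
    by (simp add: scaleC_of_real [symmetric] scaleC_scaleC mult.commute)
  show "\<exists>K. \<forall>(a::complex) b::'a. norm (a *\<^sub>C b) \<le> norm a * norm b * K"
    by (rule exI [of _ 1]) (simp add: norm_scaleC)
qed

lemmas scaleC_simps [simp] = scaleC.zero_left scaleC.zero_right scaleC_one

lemma scaleC_left_imp_eq: "c *\<^sub>C x = c *\<^sub>C y \<Longrightarrow> c \<noteq> 0 \<Longrightarrow> x = (y :: 'a::complex_normed_vector)"
  by (drule arg_cong [of _ _ "scaleC (inverse c)"]) (simp add: scaleC_scaleC)

section \<open>Norming functionals\<close>

definition sublinear :: "('a::real_vector \<Rightarrow> real) \<Rightarrow> bool"
  where "sublinear p \<longleftrightarrow> (\<forall>x y. p (x + y) \<le> p x + p y) \<and> (\<forall>c x. 0 \<le> c \<longrightarrow> p (c *\<^sub>R x) = c * p x)"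

text \<open>The inequality for c yields the reverse one when applied to \<open>inverse c\<close> and
  \<open>c *\<^sub>R x\<close>.\<close>

lemma sublinearI_le:
  fixes q :: "'a::real_vector \<Rightarrow> real"
  assumes add: "\<And>x y. q (x + y) \<le> q x + q y" and sc: "\<And>c x. 0 < c \<Longrightarrow> q (c *\<^sub>R x) \<le> c * q x"
    and z: "q 0 = 0"
  shows "sublinear q"
  unfolding sublinear_def
proof (intro conjI allI impI add)
  fix c :: real and x
  assume c: "0 \<le> c"
  show "q (c *\<^sub>R x) = c * q x"
  proof (cases "c = 0")
    case False
    with c have "0 < c" by simp
    then show ?thesis
      using sc [of c x] sc [of "inverse c" "c *\<^sub>R x"] by (simp add: field_simps)
  qed (simp add: z)
qed

lemma sublinear_zero: "sublinear p \<Longrightarrow> p 0 = 0"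
proof -
  assume "sublinear p"
  then have "p (0 *\<^sub>R 0) = 0 * p 0" unfolding sublinear_def by blast
  then show ?thesis by simp
qed

lemma sublinear_neg: "sublinear p \<Longrightarrow> - p (- x) \<le> p x"
proof -
  assume p: "sublinear p"
  then have "p (x + - x) \<le> p x + p (- x)" unfolding sublinear_def by blast
  with sublinear_zero [OF p] show ?thesis by simp
qed

text \<open>Take the infimum of p(y + t z) - t p(z) over t \<ge> 0: subadditivity bounds it below by
  - p(- y), t = 0 shows that it is at most p, and t = 1 at - z gives the value - p(z). A minimal
  sublinear functional cannot be lowered in this way and is therefore odd.\<close>

lemma sublinear_shift:
  fixes p :: "'a::real_vector \<Rightarrow> real"
  assumes p: "sublinear p"
  obtains q where "sublinear q" "\<And>y. q y \<le> p y" "q (- z) \<le> - p z"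
proof
  define q where "q y = (INF t\<in>{0..}. p (y + t *\<^sub>R z) - t * p z)" for y
  have padd: "p (x + y) \<le> p x + p y" for x y using p by (auto simp: sublinear_def)
  have psc: "0 \<le> c \<Longrightarrow> p (c *\<^sub>R x) = c * p x" for c x using p by (auto simp: sublinear_def)
  have low: "- p (- y) \<le> p (y + t *\<^sub>R z) - t * p z" if "0 \<le> t" for y t
    using padd [of "y + t *\<^sub>R z" "- y"] psc [OF that, of z] by (simp add: algebra_simps)
  have bdd: "bdd_below ((\<lambda>t. p (y + t *\<^sub>R z) - t * p z) ` {0..})" for y
    using low by (auto intro!: bdd_belowI [of _ "- p (- y)"])
  have qle: "q y \<le> p (y + t *\<^sub>R z) - t * p z" if "0 \<le> t" for y t
    unfolding q_def using bdd that by (intro cINF_lower) auto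
  have qge: "b \<le> q y" if "\<And>t. 0 \<le> t \<Longrightarrow> b \<le> p (y + t *\<^sub>R z) - t * p z" for y b
    unfolding q_def using that by (intro cINF_greatest) auto
  show "q y \<le> p y" for y using qle [of 0 y] by simp
  show "q (- z) \<le> - p z" using qle [of 1 "- z"] sublinear_zero [OF p] by simp
  show "sublinear q"
  proof (rule sublinearI_le)
    show "q 0 = 0"
    proof (rule order_antisym)
      show "0 \<le> q 0" by (rule qge) (simp add: psc)
      show "q 0 \<le> 0" using qle [of 0 0] sublinear_zero [OF p] by simp
    qed
    show "q (c *\<^sub>R x) \<le> c * q x" if c: "0 < c" for c x
    proof -
      have "q (c *\<^sub>R x) / c \<le> q x"
      proof (rule qge)
        fix t :: real assume t: "0 \<le> t"
        have "q (c *\<^sub>R x) \<le> p (c *\<^sub>R x + (c * t) *\<^sub>R z) - c * t * p z"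
          using c t by (intro qle) auto
        also have "c *\<^sub>R x + (c * t) *\<^sub>R z = c *\<^sub>R (x + t *\<^sub>R z)" by (simp add: algebra_simps)
        finally show "q (c *\<^sub>R x) / c \<le> p (x + t *\<^sub>R z) - t * p z"
          using c psc [of c "x + t *\<^sub>R z"] by (simp add: pos_divide_le_eq right_diff_distrib mult.commute [of _ c] mult.assoc)
      qed
      then show ?thesis using c by (simp add: field_simps)
    qed
    show "q (x + y) \<le> q x + q y" for x y
    proof -
      have "q (x + y) - q y \<le> q x"
      proof (rule qge)
        fix t :: real assume t: "0 \<le> t"
        have "q (x + y) - (p (x + t *\<^sub>R z) - t * p z) \<le> q y"
        proof (rule qge)
          fix s :: real assume s: "0 \<le> s"
          have "q (x + y) \<le> p ((x + y) + (t + s) *\<^sub>R z) - (t + s) * p z"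
            using s t by (intro qle) auto
          also have "(x + y) + (t + s) *\<^sub>R z = (x + t *\<^sub>R z) + (y + s *\<^sub>R z)" by (simp add: algebra_simps)
          also have "p \<dots> \<le> p (x + t *\<^sub>R z) + p (y + s *\<^sub>R z)" by (rule padd)
          finally show "q (x + y) - (p (x + t *\<^sub>R z) - t * p z) \<le> p (y + s *\<^sub>R z) - s * p z"
            by (simp add: algebra_simps)
        qed
        then show "q (x + y) - q y \<le> p (x + t *\<^sub>R z) - t * p z" by simp
      qed
      then show ?thesis by simp
    qed
  qed
qed

text \<open>Subadditivity of the infimum has to combine two members \<open>q\<close> and
  \<open>r\<close> evaluated at different points; in a chain one of them lies below both. The lower
  bound \<open>b\<close> keeps the infima finite.\<close>

lemma sublinear_INF_chain:
  fixes C :: "('a::real_vector \<Rightarrow> real) set"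
  assumes C: "C \<noteq> {}" and sub: "\<And>p. p \<in> C \<Longrightarrow> sublinear p"
    and chain: "\<And>p q. p \<in> C \<Longrightarrow> q \<in> C \<Longrightarrow> p \<le> q \<or> q \<le> p"
    and low: "\<And>p x. p \<in> C \<Longrightarrow> b x \<le> p x"
  shows "sublinear (\<lambda>x. INF p\<in>C. p x)"
proof -
  have bdd: "bdd_below ((\<lambda>p. p x) ` C)" for x using low by (auto intro!: bdd_belowI [of _ "b x"])
  have le: "(INF p\<in>C. p x) \<le> q x" if "q \<in> C" for q x using bdd that by (intro cINF_lower) auto
  have ge: "d \<le> (INF p\<in>C. p x)" if "\<And>q. q \<in> C \<Longrightarrow> d \<le> q x" for d x using C that by (intro cINF_greatest) auto
  show ?thesis
  proof (rule sublinearI_le)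
    have "(\<lambda>p. p 0) ` C = {0}" using C sub sublinear_zero by fastforce
    then show "(INF p\<in>C. p 0) = 0" by simp
    show "(INF p\<in>C. p (c *\<^sub>R x)) \<le> c * (INF p\<in>C. p x)" if c: "0 < c" for c x
    proof -
      have "(INF p\<in>C. p (c *\<^sub>R x)) / c \<le> (INF p\<in>C. p x)"
      proof (rule ge)
        fix q assume q: "q \<in> C"
        then have "q (c *\<^sub>R x) = c * q x" using sub c by (auto simp: sublinear_def)
        with le [OF q, of "c *\<^sub>R x"] c show "(INF p\<in>C. p (c *\<^sub>R x)) / c \<le> q x" by (simp add: field_simps)
      qed
      then show ?thesis using c by (simp add: field_simps)
    qed
    show "(INF p\<in>C. p (x + y)) \<le> (INF p\<in>C. p x) + (INF p\<in>C. p y)" for x y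
    proof -
      have "(INF p\<in>C. p (x + y)) - (INF p\<in>C. p y) \<le> (INF p\<in>C. p x)"
      proof (rule ge)
        fix q assume q: "q \<in> C"
        have "(INF p\<in>C. p (x + y)) - q x \<le> (INF p\<in>C. p y)"
        proof (rule ge)
          fix r assume r: "r \<in> C"
          obtain s where s: "s \<in> C" "s x \<le> q x" "s y \<le> r y"
            using chain [OF q r] q r by (auto simp: le_fun_def)
          have "(INF p\<in>C. p (x + y)) \<le> s (x + y)" by (rule le [OF s(1)])
          also have "\<dots> \<le> s x + s y" using sub [OF s(1)] by (auto simp: sublinear_def)
          finally show "(INF p\<in>C. p (x + y)) - q x \<le> r y" using s by linarith
        qed
        then show "(INF p\<in>C. p (x + y)) - (INF p\<in>C. p y) \<le> q x" by linarith
      qed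
      then show ?thesis by linarith
    qed
  qed
qed

text \<open>
  Hahn--Banach: a minimal sublinear functional below the norm is linear, because
  \<open>sublinear_shift\<close> cannot make it smaller.
\<close>

lemma norming_real_functional:
  fixes x :: "'a::real_normed_vector"
  obtains f where "bounded_linear f" "f x = norm x" "\<And>y. \<bar>f y\<bar> \<le> norm y"
proof -
  have sub_norm: "sublinear (norm :: 'a \<Rightarrow> real)"
    by (auto simp: sublinear_def norm_triangle_ineq)
  \<comment> \<open>Minimizing below \<open>q0\<close> instead of below the norm secures the value
    at \<open>x\<close>: an odd f below \<open>q0\<close> has - f(x) = f(- x) \<le> - norm
    x.\<close>
  obtain q0 where q0: "sublinear q0" "\<And>y. q0 y \<le> norm y" "q0 (- x) \<le> - norm x"
    using sublinear_shift [OF sub_norm, of x] by metis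
  define S where "S = {p. sublinear p \<and> p \<le> q0}"
  have low: "- norm x \<le> p x" if "p \<in> S" for p x
  proof -
    have "- p (- x) \<le> p x" using that by (intro sublinear_neg) (simp add: S_def)
    moreover have "p (- x) \<le> norm x" using that q0(2) [of "- x"] by (auto simp: S_def le_fun_def intro: order_trans)
    ultimately show ?thesis by linarith
  qed
  have "\<exists>m\<in>S. \<forall>a\<in>S. m \<ge> a \<longrightarrow> a = m"
  proof (rule predicate_Zorn)
    show "partial_order_on S (relation_of (\<lambda>p q. q \<le> p) S)"
      by (rule partial_order_on_relation_ofI) auto
    fix C assume "C \<in> Chains (relation_of (\<lambda>p q. q \<le> p) S)"
    then have C: "C \<subseteq> S" "\<And>p q. p \<in> C \<Longrightarrow> q \<in> C \<Longrightarrow> p \<le> q \<or> q \<le> p"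
      by (auto simp: Chains_def relation_of_def)
    show "\<exists>u\<in>S. \<forall>a\<in>C. u \<le> a"
    proof (cases "C = {}")
      case True
      then show ?thesis using q0 by (auto simp: S_def)
    next
      case False
      let ?u = "\<lambda>x. INF p\<in>C. p x"
      have bdd: "bdd_below ((\<lambda>p. p x) ` C)" for x
        using low C by (auto intro!: bdd_belowI [of _ "- norm x"])
      have le: "?u \<le> p" if "p \<in> C" for p
        unfolding le_fun_def using that bdd by (auto intro: cINF_lower)
      have "sublinear ?u"
        using False C low by (intro sublinear_INF_chain [where b = "\<lambda>x. - norm x"]) (auto simp: S_def)
      moreover obtain p where p: "p \<in> C" using False by auto
      moreover have "?u \<le> q0" using le [OF p] p C(1) by (auto simp: S_def intro: order_trans)
      ultimately show ?thesis using le by (auto simp: S_def)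
    qed
  qed
  then obtain f where f: "f \<in> S" and min: "\<And>a. a \<in> S \<Longrightarrow> a \<le> f \<Longrightarrow> a = f" by auto
  have fs: "sublinear f" using f by (simp add: S_def)
  have fle: "f y \<le> norm y" for y using f q0(2) [of y] by (auto simp: S_def le_fun_def intro: order_trans)
  have neg: "f (- z) = - f z" for z
  proof -
    obtain q where q: "sublinear q" "\<And>y. q y \<le> f y" "q (- z) \<le> - f z"
      using sublinear_shift [OF fs, of z] by metis
    have "q = f" using q f by (intro min) (auto simp: S_def le_fun_def intro: order_trans)
    then show ?thesis using q(3) sublinear_neg [OF fs, of "- z"] by simp
  qed
  have add: "f (y + z) = f y + f z" for y z
  proof -
    have "f (y + z) \<le> f y + f z" "f (- y + - z) \<le> f (- y) + f (- z)"
      using fs unfolding sublinear_def by blast+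
    moreover have "f (- y + - z) = - f (y + z)" using neg [of "y + z"] by simp
    ultimately show ?thesis by (simp add: neg)
  qed
  have sc: "f (c *\<^sub>R y) = c * f y" for c y
  proof (cases "0 \<le> c")
    case False
    then have "0 \<le> - c" by simp
    then have "f ((- c) *\<^sub>R y) = (- c) * f y" using fs unfolding sublinear_def by blast
    moreover have "f ((- c) *\<^sub>R y) = - f (c *\<^sub>R y)" using neg [of "c *\<^sub>R y"] by simp
    ultimately show ?thesis by simp
  qed (use fs in \<open>auto simp: sublinear_def\<close>)
  have bd: "\<bar>f y\<bar> \<le> norm y" for y using fle [of y] fle [of "- y"] neg [of y] by auto
  have "bounded_linear f"
    by (rule bounded_linear_intro [of f 1]) (auto simp: add sc bd)
  moreover have "f x = norm x"
  proof (rule order_antisym)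
    have "f (- x) \<le> q0 (- x)" using f by (auto simp: S_def le_fun_def)
    with q0(3) neg show "norm x \<le> f x" by simp
  qed (rule fle)
  ultimately show thesis using bd that by blast
qed

text \<open>The constant 2 arises in \<open>norming_functional\<close>, where real and imaginary
  part are each bounded by the norm. One fixed constant makes the estimates below uniform over all
  these functionals, and they still detect the norm.\<close>

definition cfunctional :: "('a::complex_normed_vector \<Rightarrow> complex) \<Rightarrow> bool"
  where "cfunctional \<phi> \<longleftrightarrow> bounded_linear \<phi> \<and> (\<forall>c x. \<phi> (c *\<^sub>C x) = c * \<phi> x) \<and> (\<forall>x. cmod (\<phi> x) \<le> 2 * norm x)"

lemma cfunctionalD:
  assumes "cfunctional \<phi>"
  shows "bounded_linear \<phi>" "\<phi> (c *\<^sub>C x) = c * \<phi> x" "cmod (\<phi> x) \<le> 2 * norm x" "\<phi> (x + y) = \<phi> x + \<phi> y"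
    "\<phi> (x - y) = \<phi> x - \<phi> y" "\<phi> 0 = 0"
  using assms by (auto simp: cfunctional_def linear_simps)

lemma norming_functional:
  fixes x :: "'a::complex_normed_vector"
  obtains \<phi> where "cfunctional \<phi>" "norm x \<le> cmod (\<phi> x)"
proof -
  obtain f where f: "bounded_linear f" "f x = norm x" "\<And>y. \<bar>f y\<bar> \<le> norm y"
    using norming_real_functional [of x] by metis
  interpret f: bounded_linear f by (rule f)
  \<comment> \<open>The complex-linear functional whose real part is \<open>f\<close>.\<close>
  define \<phi> where "\<phi> y = Complex (f y) (- f (\<i> *\<^sub>C y))" for y
  have cm: "cmod (\<phi> y) \<le> 2 * norm y" for y
    using cmod_le [of "\<phi> y"] f(3) [of y] f(3) [of "\<i> *\<^sub>C y"] by (simp add: \<phi>_def norm_scaleC)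
  have ii: "\<i> *\<^sub>C \<i> *\<^sub>C y = - y" for y :: 'a by (simp add: scaleC_scaleC scaleC_minus1)
  have add: "\<phi> (y + z) = \<phi> y + \<phi> z" for y z
    by (simp add: \<phi>_def f.add scaleC_add_right complex_eq_iff)
  have sr: "\<phi> (r *\<^sub>R y) = r *\<^sub>R \<phi> y" for r y
    by (simp add: \<phi>_def f.scaleR scaleC.scaleR_right complex_eq_iff)
  have si: "\<phi> (\<i> *\<^sub>C y) = \<i> * \<phi> y" for y
    by (simp add: \<phi>_def ii f.neg complex_eq_iff)
  have sc: "\<phi> (c *\<^sub>C y) = c * \<phi> y" for c y
  proof -
    have "c *\<^sub>C y = Re c *\<^sub>R y + Im c *\<^sub>R (\<i> *\<^sub>C y)"
    proof -
      have "Re c *\<^sub>R y + Im c *\<^sub>R (\<i> *\<^sub>C y) = (of_real (Re c) + of_real (Im c) * \<i>) *\<^sub>C y"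
        by (simp only: scaleC_of_real [symmetric] scaleC_scaleC scaleC_add_left)
      also have "of_real (Re c) + of_real (Im c) * \<i> = c" by (simp add: complex_eq_iff)
      finally show ?thesis by simp
    qed
    then have "\<phi> (c *\<^sub>C y) = Re c *\<^sub>R \<phi> y + Im c *\<^sub>R (\<i> * \<phi> y)" by (simp add: add sr si)
    then show ?thesis by (simp add: complex_eq_iff)
  qed
  have "bounded_linear \<phi>"
    by (rule bounded_linear_intro [of \<phi> 2]) (use cm in \<open>auto simp: add sr mult.commute\<close>)
  then have "cfunctional \<phi>" by (simp add: cfunctional_def sc cm)
  moreover have "norm x \<le> cmod (\<phi> x)"
    using complex_Re_le_cmod [of "\<phi> x"] f(2) by (simp add: \<phi>_def)
  ultimately show thesis by (rule that)
qed

lemma norm_leI_cfunctional: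
  "(\<And>\<phi>. cfunctional \<phi> \<Longrightarrow> cmod (\<phi> x) \<le> b) \<Longrightarrow> norm (x :: 'a::complex_normed_vector) \<le> b"
  by (meson norming_functional order_trans)

lemma eqI_cfunctional:
  assumes "\<And>\<phi>. cfunctional \<phi> \<Longrightarrow> \<phi> x = \<phi> y" shows "x = (y :: 'a::complex_normed_vector)"
proof -
  have "norm (x - y) \<le> 0"
    by (rule norm_leI_cfunctional) (simp add: cfunctionalD assms)
  then show ?thesis by simp
qed

section \<open>Vector-valued holomorphic functions\<close>

lemma vholomorphic_on_open:
  assumes "open U"
  shows "vholomorphic_on F U \<longleftrightarrow> (\<forall>z\<in>U. \<exists>F'. (F has_derivative (\<lambda>h. h *\<^sub>C F')) (at z))"
  using assms unfolding vholomorphic_on_def by (metis at_within_open)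

lemma vholomorphic_on_subset: "vholomorphic_on F U \<Longrightarrow> V \<subseteq> U \<Longrightarrow> vholomorphic_on F V"
  unfolding vholomorphic_on_def by (meson has_derivative_subset subsetD)

lemma vholomorphic_on_continuous: "vholomorphic_on F U \<Longrightarrow> continuous_on U F"
  unfolding vholomorphic_on_def continuous_on_eq_continuous_within
  using has_derivative_continuous by blast

lemma cfunctional_holomorphic:
  assumes "vholomorphic_on F U" "cfunctional \<phi>"
  shows "(\<lambda>z. \<phi> (F z)) holomorphic_on U"
  unfolding holomorphic_on_def field_differentiable_def
proof
  fix z assume "z \<in> U"
  then obtain F' where "(F has_derivative (\<lambda>h. h *\<^sub>C F')) (at z within U)"
    using assms by (auto simp: vholomorphic_on_def)
  from bounded_linear.has_derivative [OF cfunctionalD(1) [OF assms(2)] this]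
  have "((\<lambda>z. \<phi> (F z)) has_field_derivative \<phi> F') (at z within U)"
    by (simp add: has_field_derivative_def cfunctionalD(2) [OF assms(2)] mult_commute_abs)
  then show "\<exists>f'. ((\<lambda>z. \<phi> (F z)) has_field_derivative f') (at z within U)" by blast
qed

text \<open>
  Uniformly over the functionals, the error of the difference quotients is quadratic; so the
  vector-valued difference quotients are Cauchy.
\<close>

lemma holomorphic_second_order:
  assumes "g holomorphic_on ball z0 r" "\<And>z. z \<in> ball z0 r \<Longrightarrow> cmod (g z) \<le> M" "cmod h < r / 2" "0 < r"
  shows "cmod (g (z0 + h) - g z0 - h * deriv g z0) \<le> 32 * M / r ^ 2 * (cmod h)\<^sup>2"
proof -
  have M: "0 \<le> M" using assms(2) [of z0] assms(4) order_trans [OF norm_ge_zero] by auto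
  have der: "cmod ((deriv ^^ 2) g x) \<le> 32 * M / r ^ 2" if x: "x \<in> ball z0 (r / 2)" for x
  proof -
    have sub: "cball x (r / 4) \<subseteq> ball z0 r"
    proof
      fix y assume "y \<in> cball x (r / 4)"
      then have "dist x y \<le> r / 4" by simp
      moreover have "dist z0 x < r / 2" using x by simp
      ultimately have "dist z0 y < r" using dist_triangle [of z0 y x] assms(4) by linarith
      then show "y \<in> ball z0 r" by simp
    qed
    have h1: "g holomorphic_on ball x (r / 4)"
      using assms(1) by (rule holomorphic_on_subset) (use sub in force)
    have c1: "continuous_on (cball x (r / 4)) g"
      using holomorphic_on_imp_continuous_on [OF assms(1)] sub by (rule continuous_on_subset)
    \<comment> \<open>Cauchy's estimate on a circle of radius r/4, which stays inside the ball for
      every x in the ball of half the radius; the constant is 2 * 16 = 32.\<close>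
    have "cmod ((deriv ^^ 2) g x) \<le> (fact 2) * M / (r / 4) ^ 2"
    proof (rule Cauchy_inequality [OF h1 c1])
      show "cmod (g y) \<le> M" if "cmod (x - y) = r / 4" for y
        using that sub by (intro assms(2)) (auto simp: dist_norm)
    qed (use assms in auto)
    then show ?thesis by (simp add: power2_eq_square field_simps)
  qed
  have hol: "g holomorphic_on ball z0 (r / 2)"
    using assms(1) by (rule holomorphic_on_subset) (use assms(4) in auto)
  have "cmod ((deriv ^^ 0) g (z0 + h) - (\<Sum>i\<le>1. (deriv ^^ i) g z0 * (z0 + h - z0) ^ i / fact i))
    \<le> 32 * M / r ^ 2 * cmod (z0 + h - z0) ^ (Suc 1) / fact 1"
  proof (rule complex_Taylor [where S = "ball z0 (r / 2)"])
    show "((deriv ^^ i) g has_field_derivative (deriv ^^ Suc i) g x) (at x within ball z0 (r / 2))"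
      if "x \<in> ball z0 (r / 2)" for i x
      using holomorphic_derivI [OF holomorphic_higher_deriv [OF hol], of x i] that by (auto intro: has_field_derivative_at_within)
    show "cmod ((deriv ^^ Suc 1) g x) \<le> 32 * M / r ^ 2" if "x \<in> ball z0 (r / 2)" for x
      using der [OF that] by (simp add: numeral_2_eq_2)
  qed (use assms in \<open>auto simp: dist_norm\<close>)
  then show ?thesis by (simp add: power2_eq_square algebra_simps)
qed

lemma weakly_holomorphic_imp_vholomorphic:
  fixes F :: "complex \<Rightarrow> 'a::{complex_normed_vector, banach}"
  assumes weak: "\<And>\<phi>. cfunctional \<phi> \<Longrightarrow> (\<lambda>z. \<phi> (F z)) holomorphic_on ball z0 r"
    and bd: "\<And>z. z \<in> ball z0 r \<Longrightarrow> norm (F z) \<le> M" and r: "0 < r"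
  shows "\<exists>F'. (F has_derivative (\<lambda>h. h *\<^sub>C F')) (at z0)"
proof -
  \<comment> \<open>Twice the constant of \<open>holomorphic_second_order\<close>, because a
    \<open>cfunctional\<close> may take values up to 2 M on the values of F.\<close>
  define K where "K = 64 * M / r ^ 2"
  have M: "0 \<le> M" using bd [of z0] r order_trans [OF norm_ge_zero] by auto
  have K: "0 \<le> K" using M r by (simp add: K_def)
  define dq where "dq h = inverse h *\<^sub>C (F (z0 + h) - F z0)" for h
  have quad: "cmod (\<phi> (dq h) - deriv (\<lambda>z. \<phi> (F z)) z0) \<le> K * cmod h"
    if "cfunctional \<phi>" "cmod h < r / 2" "h \<noteq> 0" for \<phi> h
  proof -
    have "cmod (\<phi> (F z)) \<le> 2 * M" if "z \<in> ball z0 r" for z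
      using cfunctionalD(3) [OF \<open>cfunctional \<phi>\<close>, of "F z"] bd [OF that] by linarith
    from holomorphic_second_order [OF weak [OF that(1)] this that(2) r]
    have *: "cmod (\<phi> (F (z0 + h)) - \<phi> (F z0) - h * deriv (\<lambda>z. \<phi> (F z)) z0) \<le> K * (cmod h)\<^sup>2"
      by (simp add: K_def)
    have "\<phi> (dq h) - deriv (\<lambda>z. \<phi> (F z)) z0 = (\<phi> (F (z0 + h)) - \<phi> (F z0) - h * deriv (\<lambda>z. \<phi> (F z)) z0) / h"
      using that(3) by (simp add: dq_def cfunctionalD [OF that(1)] field_simps)
    also have "cmod \<dots> \<le> K * (cmod h)\<^sup>2 / cmod h"
      using * by (simp add: norm_divide divide_right_mono)
    finally show ?thesis using that(3) by (simp add: power2_eq_square)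
  qed
  have dqd: "norm (dq h - dq k) \<le> K * (cmod h + cmod k)"
    if "cmod h < r / 2" "h \<noteq> 0" "cmod k < r / 2" "k \<noteq> 0" for h k
  proof (rule norm_leI_cfunctional)
    fix \<phi> :: "'a \<Rightarrow> complex" assume p: "cfunctional \<phi>"
    have "cmod (\<phi> (dq h - dq k)) \<le> cmod (\<phi> (dq h) - deriv (\<lambda>z. \<phi> (F z)) z0) + cmod (\<phi> (dq k) - deriv (\<lambda>z. \<phi> (F z)) z0)"
      unfolding cfunctionalD(5) [OF p]
      using norm_triangle_ineq4 [of "\<phi> (dq h) - deriv (\<lambda>z. \<phi> (F z)) z0" "\<phi> (dq k) - deriv (\<lambda>z. \<phi> (F z)) z0"] by simp
    then show "cmod (\<phi> (dq h - dq k)) \<le> K * (cmod h + cmod k)"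
      using quad [OF p that(1,2)] quad [OF p that(3,4)] by (simp add: distrib_left)
  qed
  \<comment> \<open>A single null sequence yields the candidate derivative \<open>D\<close>; all
    other increments are compared with it through \<open>dqd\<close>.\<close>
  define s where "s n = complex_of_real (r / 4 / (real n + 1))" for n
  have sn: "cmod (s n) = r / 4 / (real n + 1)" for n
    using r by (simp add: s_def norm_divide del: of_real_divide of_real_add)
  have s0: "s n \<noteq> 0" "cmod (s n) < r / 2" for n
  proof -
    show "s n \<noteq> 0" using sn [of n] r by auto
    have "r / 4 / (real n + 1) \<le> r / 4 / 1" using r by (intro divide_left_mono) auto
    then show "cmod (s n) < r / 2" using sn [of n] r by simp
  qed
  have slim: "(\<lambda>n. cmod (s n)) \<longlonglongrightarrow> 0"
    unfolding sn by real_asymp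
  have "Cauchy (\<lambda>n. dq (s n))"
  proof (rule metric_CauchyI)
    fix e :: real assume e: "0 < e"
    have "(\<lambda>n. K * cmod (s n)) \<longlonglongrightarrow> K * 0" by (intro tendsto_intros slim)
    then have "\<forall>\<^sub>F n in sequentially. K * cmod (s n) < e / 2" using e by (intro order_tendstoD) auto
    then obtain N where N: "\<And>n. n \<ge> N \<Longrightarrow> K * cmod (s n) < e / 2" by (auto simp: eventually_sequentially)
    show "\<exists>N. \<forall>m\<ge>N. \<forall>n\<ge>N. dist (dq (s m)) (dq (s n)) < e"
    proof (intro exI allI impI)
      fix m n assume "N \<le> m" "N \<le> n"
      with N [of m] N [of n] dqd [of "s m" "s n"] s0 show "dist (dq (s m)) (dq (s n)) < e"
        by (simp add: dist_norm distrib_left)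
    qed
  qed
  then obtain D where D: "(\<lambda>n. dq (s n)) \<longlonglongrightarrow> D" using Cauchy_convergent_iff convergent_def by blast
  have dD: "norm (dq h - D) \<le> K * cmod h" if "cmod h < r / 2" "h \<noteq> 0" for h
  proof (rule tendsto_le [OF _ _ tendsto_norm [OF tendsto_diff [OF tendsto_const D]]])
    have "(\<lambda>n. K * (cmod h + cmod (s n))) \<longlonglongrightarrow> K * (cmod h + 0)" by (intro tendsto_intros slim)
    then show "(\<lambda>n. K * (cmod h + cmod (s n))) \<longlonglongrightarrow> K * cmod h" by simp
  qed (use dqd that s0 in auto)
  have "(F has_derivative (\<lambda>h. h *\<^sub>C D)) (at z0)"
    unfolding has_derivative_iff_norm
  proof
    show "bounded_linear (\<lambda>h. h *\<^sub>C D)" by (rule scaleC.bounded_linear_left)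
    have "(\<lambda>y. norm (F y - F z0 - (y - z0) *\<^sub>C D) / norm (y - z0)) \<midarrow>z0\<rightarrow> 0"
    proof (rule Lim_null_comparison)
      have "\<forall>\<^sub>F y in at z0. y \<in> ball z0 (r / 2) \<and> y \<noteq> z0"
        using r by (auto simp: eventually_at dist_commute intro!: exI [of _ "r / 2"])
      then show "\<forall>\<^sub>F y in at z0. norm (norm (F y - F z0 - (y - z0) *\<^sub>C D) / norm (y - z0)) \<le> K * cmod (y - z0)"
      proof eventually_elim
        case (elim y)
        have "F y - F z0 - (y - z0) *\<^sub>C D = (y - z0) *\<^sub>C (dq (y - z0) - D)"
          using elim by (simp add: dq_def scaleC_diff_right scaleC_scaleC)
        then show ?case using dD [of "y - z0"] elim by (simp add: norm_scaleC dist_norm norm_minus_commute)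
      qed
      show "(\<lambda>y. K * cmod (y - z0)) \<midarrow>z0\<rightarrow> 0" by (auto intro!: tendsto_eq_intros)
    qed
    then show "((\<lambda>y. norm (F y - F z0 - (y - z0) *\<^sub>C D) / norm (y - z0)) \<longlongrightarrow> 0) (at z0)" .
  qed
  then show ?thesis by blast
qed

section \<open>Cauchy's theorem on rectangles\<close>

lemma vertical_primitive:
  assumes "g holomorphic_on V" "open V" "convex V" "\<And>\<sigma> x. \<lbrakk>a \<le> \<sigma>; \<sigma> \<le> b; c \<le> x; x \<le> d\<rbrakk> \<Longrightarrow> Complex \<sigma> x \<in> V" "a \<le> b" "c \<le> d"
  shows "integral {c..d} (\<lambda>x. \<i> * (g (Complex b x) - g (Complex a x))) =
    integral {a..b} (\<lambda>\<sigma>. g (Complex \<sigma> d)) - integral {a..b} (\<lambda>\<sigma>. g (Complex \<sigma> c))"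
proof -
  obtain p where p: "\<And>x. x \<in> V \<Longrightarrow> (p has_field_derivative g x) (at x within V)"
    by (rule holomorphic_convex_primitive' [OF assms(3,2,1)]) blast
  have p': "(p has_field_derivative g x) (at x)" if "x \<in> V" for x
    using p [OF that] at_within_open [OF that assms(2)] by simp
  have cx: "(\<lambda>x. Complex b x) = (\<lambda>x. of_real b + \<i> * of_real x)" for b by (auto simp: complex_eq_iff)
  have cx2: "(\<lambda>\<sigma>. Complex \<sigma> x) = (\<lambda>\<sigma>. of_real \<sigma> + \<i> * of_real x)" for x by (auto simp: complex_eq_iff)
  have dv: "((\<lambda>x. Complex b x) has_vector_derivative \<i>) (at x within S)" for b x S
    unfolding cx by (auto intro!: derivative_eq_intros simp: has_vector_derivative_def scaleR_conv_of_real)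
  have dh: "((\<lambda>\<sigma>. Complex \<sigma> x) has_vector_derivative 1) (at \<sigma> within S)" for \<sigma> x S
    unfolding cx2 by (auto intro!: derivative_eq_intros simp: has_vector_derivative_def scaleR_conv_of_real)
  have v: "((\<lambda>x. \<i> * g (Complex b' x)) has_integral (p (Complex b' d) - p (Complex b' c))) {c..d}" if "a \<le> b'" "b' \<le> b" for b'
  proof (rule fundamental_theorem_of_calculus [OF assms(6)])
    fix x assume "x \<in> {c..d}"
    then have "Complex b' x \<in> V" using assms(4) that by auto
    from field_vector_diff_chain_within [OF dv [of b' x "{c..d}"] has_field_derivative_at_within [OF p' [OF this]]]
    show "((\<lambda>x. p (Complex b' x)) has_vector_derivative \<i> * g (Complex b' x)) (at x within {c..d})"
      by (simp add: o_def)
  qed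
  have h: "((\<lambda>\<sigma>. g (Complex \<sigma> y)) has_integral (p (Complex b y) - p (Complex a y))) {a..b}" if "c \<le> y" "y \<le> d" for y
  proof (rule fundamental_theorem_of_calculus [OF assms(5)])
    fix x assume "x \<in> {a..b}"
    then have "Complex x y \<in> V" using assms(4) that by auto
    from field_vector_diff_chain_within [OF dh [of y x "{a..b}"] has_field_derivative_at_within [OF p' [OF this]]]
    show "((\<lambda>x. p (Complex x y)) has_vector_derivative g (Complex x y)) (at x within {a..b})"
      by (simp add: o_def)
  qed
  have "((\<lambda>x. \<i> * (g (Complex b x) - g (Complex a x))) has_integral
    (p (Complex b d) - p (Complex b c)) - (p (Complex a d) - p (Complex a c))) {c..d}"
    using has_integral_diff [OF v [of b] v [of a]] assms(5) by (simp add: right_diff_distrib)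
  from integral_unique [OF this] show ?thesis
    using integral_unique [OF h [of d]] integral_unique [OF h [of c]] assms(6) by simp
qed

text \<open>A rectangle thickened by a small ball is a Minkowski sum of convex sets, hence convex,
  and on a convex open set a holomorphic function has a primitive.\<close>

lemma rectangle_in_open_box:
  assumes "open U" "a \<le> b" "c \<le> d" "\<And>\<sigma> x. \<lbrakk>a \<le> \<sigma>; \<sigma> \<le> b; c \<le> x; x \<le> d\<rbrakk> \<Longrightarrow> Complex \<sigma> x \<in> U"
  obtains V where "open V" "convex V" "V \<subseteq> U" "\<And>\<sigma> x. \<lbrakk>a \<le> \<sigma>; \<sigma> \<le> b; c \<le> x; x \<le> d\<rbrakk> \<Longrightarrow> Complex \<sigma> x \<in> V"
proof -
  let ?R = "cbox (Complex a c) (Complex b d)"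
  have R: "?R \<subseteq> U" using assms(4) by (auto simp: in_cbox_complex_iff) (metis complex_surj)
  obtain e where e: "0 < e" "(\<Union>x\<in>?R. ball x e) \<subseteq> U"
    using compact_subset_open_imp_ball_epsilon_subset [OF compact_cbox assms(1) R] by blast
  have eq: "(\<Union>x\<in>?R. ball x e) = {x + y |x y. x \<in> ?R \<and> y \<in> ball 0 e}"
  proof (intro equalityI subsetI)
    fix z assume "z \<in> (\<Union>x\<in>?R. ball x e)"
    then obtain x where "x \<in> ?R" "dist x z < e" by auto
    then have "z = x + (z - x) \<and> x \<in> ?R \<and> z - x \<in> ball 0 e" by (auto simp: dist_norm norm_minus_commute)
    then show "z \<in> {x + y |x y. x \<in> ?R \<and> y \<in> ball 0 e}" by blast
  next
    fix z assume "z \<in> {x + y |x y. x \<in> ?R \<and> y \<in> ball 0 e}"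
    then obtain x y where "z = x + y" "x \<in> ?R" "cmod y < e" by auto
    then show "z \<in> (\<Union>x\<in>?R. ball x e)" by (intro UN_I [of x]) (auto simp: dist_norm)
  qed
  have "convex (\<Union>x\<in>?R. ball x e)"
    unfolding eq
  proof -
    have "{x + y |x y. x \<in> ?R \<and> y \<in> ball 0 e} = (\<Union>x\<in>?R. \<Union>y\<in>ball 0 e. {x + y})" by blast
    then show "convex {x + y |x y. x \<in> ?R \<and> y \<in> ball 0 e}"
      by (simp only: convex_sums [OF convex_box(1) convex_ball])
  qed
  moreover have "Complex \<sigma> x \<in> (\<Union>x\<in>?R. ball x e)" if "a \<le> \<sigma>" "\<sigma> \<le> b" "c \<le> x" "x \<le> d" for \<sigma> x
    using that e(1) by (auto simp: in_cbox_complex_iff intro!: bexI [of _ "Complex \<sigma> x"])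
  ultimately show thesis using that [OF _ _ e(2)] by blast
qed

lemma integral_cfunctional:
  fixes h :: "real \<Rightarrow> 'a::{complex_normed_vector, banach}"
  assumes "cfunctional \<phi>" "h integrable_on S"
  shows "\<phi> (integral S h) = integral S (\<lambda>x. \<phi> (h x))"
  using integral_linear [OF assms(2) cfunctionalD(1) [OF assms(1)]] by (simp add: o_def)

lemma continuous_on_Complex [continuous_intros]:
  "continuous_on S f \<Longrightarrow> continuous_on S g \<Longrightarrow> continuous_on S (\<lambda>x. Complex (f x) (g x))"
  unfolding Complex_eq by (intro continuous_intros)

text \<open>Functionals reduce this to the scalar case. With the vertical sides on the left and the
  horizontal ones on the right it reads as the fundamental theorem of calculus for the horizontal
  integral as a function of the height.\<close>

lemma Cauchy_rectangle:
  fixes G :: "complex \<Rightarrow> 'a::{complex_normed_vector, banach}"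
  assumes G: "vholomorphic_on G U" and U: "open U" and le: "a \<le> b" "c \<le> d"
    and R: "\<And>\<sigma> x. \<lbrakk>a \<le> \<sigma>; \<sigma> \<le> b; c \<le> x; x \<le> d\<rbrakk> \<Longrightarrow> Complex \<sigma> x \<in> U"
  shows "integral {c..d} (\<lambda>x. \<i> *\<^sub>C (G (Complex b x) - G (Complex a x))) =
    integral {a..b} (\<lambda>\<sigma>. G (Complex \<sigma> d)) - integral {a..b} (\<lambda>\<sigma>. G (Complex \<sigma> c))"
proof (rule eqI_cfunctional)
  fix \<phi> :: "'a \<Rightarrow> complex" assume p: "cfunctional \<phi>"
  obtain V where V: "open V" "convex V" "V \<subseteq> U" "\<And>\<sigma> x. \<lbrakk>a \<le> \<sigma>; \<sigma> \<le> b; c \<le> x; x \<le> d\<rbrakk> \<Longrightarrow> Complex \<sigma> x \<in> V"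
    using rectangle_in_open_box [OF U le R] by blast
  have cG: "continuous_on U G" using G by (rule vholomorphic_on_continuous)
  have cv: "continuous_on {c..d} (\<lambda>x. G (Complex b' x))" if "a \<le> b'" "b' \<le> b" for b'
    by (rule continuous_on_compose2 [OF cG]) (use that R in \<open>auto intro!: continuous_intros\<close>)
  have ch: "continuous_on {a..b} (\<lambda>\<sigma>. G (Complex \<sigma> y))" if "c \<le> y" "y \<le> d" for y
    by (rule continuous_on_compose2 [OF cG]) (use that R in \<open>auto intro!: continuous_intros\<close>)
  have i1: "(\<lambda>x. \<i> *\<^sub>C (G (Complex b x) - G (Complex a x))) integrable_on {c..d}"
    by (intro integrable_continuous_real scaleC.continuous_on continuous_intros cv le order_refl)
  have i2: "(\<lambda>\<sigma>. G (Complex \<sigma> y)) integrable_on {a..b}" if "c \<le> y" "y \<le> d" for y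
    by (intro integrable_continuous_real ch that)
  have hol: "(\<lambda>z. \<phi> (G z)) holomorphic_on V"
    using cfunctional_holomorphic [OF vholomorphic_on_subset [OF G V(3)] p] .
  show "\<phi> (integral {c..d} (\<lambda>x. \<i> *\<^sub>C (G (Complex b x) - G (Complex a x)))) =
    \<phi> (integral {a..b} (\<lambda>\<sigma>. G (Complex \<sigma> d)) - integral {a..b} (\<lambda>\<sigma>. G (Complex \<sigma> c)))"
    unfolding cfunctionalD(5) [OF p] integral_cfunctional [OF p i1]
      integral_cfunctional [OF p i2 [OF le(2) order_refl]] integral_cfunctional [OF p i2 [OF order_refl le(2)]]
    using vertical_primitive [OF hol V(1,2,4) le] by (simp add: cfunctionalD [OF p])
qed

text \<open>The assumed bound degenerates at the two points where the circle of radius r' meets the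
  imaginary axis. With c the centre, the factor r'^2 + (z - c)^2 vanishes exactly there and has
  modulus 2 r' |Re z| on the circle, so its product with g is bounded by 2 r' C and the maximum
  principle applies.\<close>

lemma scalar_imaginary_bound:
  assumes "g holomorphic_on ball (\<i> * of_real \<xi>) r" "\<And>z. z \<in> ball (\<i> * of_real \<xi>) r \<Longrightarrow> Re z \<noteq> 0 \<Longrightarrow> cmod (g z) * \<bar>Re z\<bar> \<le> C"
    and "0 \<le> s" "s < r'" "r' < r" "cmod (z - \<i> * of_real \<xi>) \<le> s" "0 \<le> C"
  shows "cmod (g z) \<le> 2 * r' * C / (r'\<^sup>2 - s\<^sup>2)"
proof -
  let ?c = "\<i> * complex_of_real \<xi>"
  define k where "k z = (of_real r' ^ 2 + (z - ?c) ^ 2) * g z" for z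
  have r': "0 < r'" using assms by linarith
  have sub: "cball ?c r' \<subseteq> ball ?c r" using assms by auto
  have pos: "0 < r'\<^sup>2 - s\<^sup>2" using assms(3,4) by (simp add: power_strict_mono)
  have "cmod (k z) \<le> 2 * r' * C"
  proof (rule maximum_modulus_frontier [of k "cball ?c r'"])
    show "k holomorphic_on interior (cball ?c r')"
      unfolding k_def using sub by (intro holomorphic_intros holomorphic_on_subset [OF assms(1)]) auto
    show "continuous_on (closure (cball ?c r')) k"
      unfolding k_def using sub by (intro continuous_intros holomorphic_on_imp_continuous_on holomorphic_on_subset [OF assms(1)]) auto
    show "z \<in> cball ?c r'" using assms by (simp add: dist_norm norm_minus_commute)
    fix w assume "w \<in> frontier (cball ?c r')"
    then have w: "cmod (w - ?c) = r'" using r' by (auto simp: sphere_def dist_norm norm_minus_commute)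
    have eq: "of_real r' ^ 2 + (w - ?c) ^ 2 = (w - ?c) * of_real (2 * Re w)"
    proof -
      have "of_real r' ^ 2 = (w - ?c) * cnj (w - ?c)"
        using complex_norm_square [of "w - ?c"] unfolding w by simp
      moreover have "cnj (w - ?c) + (w - ?c) = of_real (2 * Re w)" by (simp add: complex_eq_iff)
      ultimately show ?thesis by (metis distrib_left power2_eq_square)
    qed
    show "cmod (k w) \<le> 2 * r' * C"
    proof (cases "Re w = 0")
      case True
      then show ?thesis using eq r' assms(7) by (simp add: k_def)
    next
      case False
      have "w \<in> ball ?c r" using w assms(5) by (simp add: dist_norm norm_minus_commute)
      from assms(2) [OF this False] show ?thesis
        using w r' by (simp add: k_def eq norm_mult mult.assoc mult_left_mono mult.commute [of "cmod (g w)"])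
    qed
  qed simp
  moreover have "(r'\<^sup>2 - s\<^sup>2) * cmod (g z) \<le> cmod (k z)"
  proof -
    have "r'\<^sup>2 - s\<^sup>2 \<le> cmod (of_real r' ^ 2) - cmod ((z - ?c) ^ 2)"
      using assms r' by (simp add: norm_power power_mono)
    also have "\<dots> \<le> cmod (of_real r' ^ 2 + (z - ?c) ^ 2)" by (rule norm_diff_ineq)
    finally show ?thesis unfolding k_def norm_mult by (intro mult_right_mono) auto
  qed
  ultimately have "(r'\<^sup>2 - s\<^sup>2) * cmod (g z) \<le> 2 * r' * C" by linarith
  then show ?thesis using pos by (simp add: field_simps)
qed

lemma imaginary_bound:
  fixes F :: "complex \<Rightarrow> 'a::complex_normed_vector"
  assumes "vholomorphic_on F (ball (\<i> * of_real \<xi>) r)" "\<And>z. z \<in> ball (\<i> * of_real \<xi>) r \<Longrightarrow> Re z \<noteq> 0 \<Longrightarrow> norm (F z) * \<bar>Re z\<bar> \<le> C"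
    and "0 \<le> s" "s < r'" "r' < r" "cmod (z - \<i> * of_real \<xi>) \<le> s" "0 \<le> C"
  shows "norm (F z) \<le> 4 * r' * C / (r'\<^sup>2 - s\<^sup>2)"
proof (rule norm_leI_cfunctional)
  fix \<phi> :: "'a \<Rightarrow> complex" assume p: "cfunctional \<phi>"
  have "cmod (\<phi> (F z)) \<le> 2 * r' * (2 * C) / (r'\<^sup>2 - s\<^sup>2)"
  proof (rule scalar_imaginary_bound [OF cfunctional_holomorphic [OF assms(1) p] _ assms(3-6)])
    fix w assume w: "w \<in> ball (\<i> * of_real \<xi>) r" "Re w \<noteq> 0"
    have "cmod (\<phi> (F w)) * \<bar>Re w\<bar> \<le> 2 * norm (F w) * \<bar>Re w\<bar>"
      by (intro mult_right_mono cfunctionalD(3) p) auto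
    then show "cmod (\<phi> (F w)) * \<bar>Re w\<bar> \<le> 2 * C" using assms(2) [OF w] by linarith
  qed (use assms in auto)
  then show "cmod (\<phi> (F z)) \<le> 4 * r' * C / (r'\<^sup>2 - s\<^sup>2)" by simp
qed

text \<open>The bound in \<open>imaginary_bound\<close> is O(1 / r') as the radius r' tends to
  infinity.\<close>

lemma imaginary_Liouville:
  fixes F :: "complex \<Rightarrow> 'a::complex_normed_vector"
  assumes F: "vholomorphic_on F UNIV" and b: "\<And>z. Re z \<noteq> 0 \<Longrightarrow> norm (F z) * \<bar>Re z\<bar> \<le> C" and C: "0 \<le> C"
  shows "F z = 0"
proof -
  let ?s = "cmod z"
  have le: "norm (F z) \<le> 4 * r' * C / (r'\<^sup>2 - ?s\<^sup>2)" if "?s < r'" for r'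
    by (rule imaginary_bound [of F 0 "r' + 1"]) (use that F b C in \<open>auto intro: vholomorphic_on_subset\<close>)
  have lim: "((\<lambda>r'. 4 * r' * C / (r'\<^sup>2 - ?s\<^sup>2)) \<longlongrightarrow> 0) at_top"
    by real_asymp
  have "norm (F z) \<le> 0"
  proof (rule tendsto_lowerbound [OF lim])
    show "\<forall>\<^sub>F r' in at_top. norm (F z) \<le> 4 * r' * C / (r'\<^sup>2 - ?s\<^sup>2)"
      using eventually_gt_at_top [of ?s] by eventually_elim (rule le)
  qed simp
  then show ?thesis by simp
qed

section \<open>Integrals\<close>

text \<open>\<Psi> is the antiderivative of - k that vanishes at infinity, so it measures the tail
  of the majorant k. Exponential and quadratic decay are both instances.\<close>

lemma improper_integral:
  fixes K :: "real \<Rightarrow> 'a::banach"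
  assumes K: "continuous_on {0..} K" and N: "0 \<le> N"
    and der: "\<And>x. N \<le> x \<Longrightarrow> (\<Psi> has_real_derivative - k x) (at x)"
    and le: "\<And>x. N \<le> x \<Longrightarrow> norm (K x) \<le> k x"
    and pos: "\<And>x. N \<le> x \<Longrightarrow> 0 \<le> \<Psi> x" and lim: "(\<Psi> \<longlongrightarrow> 0) at_top"
  shows "\<exists>I. ((\<lambda>t. integral {0..t} K) \<longlongrightarrow> I) at_top \<and> (\<forall>t\<ge>N. norm (I - integral {0..t} K) \<le> \<Psi> t)"
proof -
  have int: "K integrable_on {s..t}" if "0 \<le> s" for s t
    by (intro integrable_continuous_real continuous_on_subset [OF K]) (use that in auto)
  have bd: "norm (integral {0..t} K - integral {0..s} K) \<le> \<Psi> s" if "N \<le> s" "s \<le> t" for s t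
  proof -
    have eq: "integral {0..t} K - integral {0..s} K = integral {s..t} K"
      using Henstock_Kurzweil_Integration.integral_combine [of 0 s t K] int [of 0 t] that N
      by (simp add: algebra_simps)
    have i: "((\<lambda>x. - k x) has_integral (\<Psi> t - \<Psi> s)) {s..t}"
      using that by (intro fundamental_theorem_of_calculus)
        (auto intro!: has_field_derivative_at_within der simp flip: has_real_derivative_iff_has_vector_derivative)
    have i': "(k has_integral (\<Psi> s - \<Psi> t)) {s..t}"
      using has_integral_neg [OF i] by simp
    have "norm (integral {s..t} K) \<le> integral {s..t} k"
      using that N by (intro integral_norm_bound_integral int le) (auto simp: has_integral_integrable [OF i'])
    also have "\<dots> = \<Psi> s - \<Psi> t" using i' by (rule integral_unique)
    finally show ?thesis using pos [of t] that eq by simp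
  qed
  have "Cauchy (\<lambda>n. integral {0..real n} K)"
  proof (rule metric_CauchyI)
    fix e :: real assume e: "0 < e"
    have "\<forall>\<^sub>F x in at_top. \<Psi> x < e" using lim e by (intro order_tendstoD)
    then obtain M where M: "\<And>x. x \<ge> M \<Longrightarrow> \<Psi> x < e" by (auto simp: eventually_at_top_linorder)
    obtain n0 :: nat where n0: "real n0 \<ge> max M N" using real_arch_simple by blast
    have "dist (integral {0..real m} K) (integral {0..real n} K) < e" if "n0 \<le> n" "n \<le> m" for m n
      using bd [of "real n" "real m"] M [of "real n"] n0 that by (simp add: dist_norm)
    then show "\<exists>M. \<forall>m\<ge>M. \<forall>n\<ge>M. dist (integral {0..real m} K) (integral {0..real n} K) < e"
      by (metis dist_commute nat_le_linear)
  qed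
  then obtain I where I: "(\<lambda>n. integral {0..real n} K) \<longlonglongrightarrow> I"
    using Cauchy_convergent_iff convergent_def by blast
  have bI: "norm (I - integral {0..t} K) \<le> \<Psi> t" if "N \<le> t" for t
  proof (rule tendsto_upperbound)
    show "(\<lambda>n. norm (integral {0..real n} K - integral {0..t} K)) \<longlonglongrightarrow> norm (I - integral {0..t} K)"
      by (intro tendsto_intros I)
    have "\<forall>\<^sub>F n in sequentially. t \<le> real n"
      using filterlim_real_sequentially by (auto simp: filterlim_at_top)
    then show "\<forall>\<^sub>F n in sequentially. norm (integral {0..real n} K - integral {0..t} K) \<le> \<Psi> t"
      by eventually_elim (use bd that in auto)
  qed simp
  have "((\<lambda>t. integral {0..t} K - I) \<longlongrightarrow> 0) at_top"
  proof (rule Lim_null_comparison [OF _ lim])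
    show "\<forall>\<^sub>F t in at_top. norm (integral {0..t} K - I) \<le> \<Psi> t"
      using eventually_ge_at_top [of N] by eventually_elim (use bI in \<open>simp add: norm_minus_commute\<close>)
  qed
  then have "((\<lambda>t. integral {0..t} K) \<longlongrightarrow> I) at_top" by (simp add: LIM_zero_iff)
  with bI show ?thesis by blast
qed

lemma improper_integral_exp:
  fixes K :: "real \<Rightarrow> 'a::banach"
  assumes "continuous_on {0..} K" "0 < \<kappa>" "0 \<le> C" "\<And>x. 0 \<le> x \<Longrightarrow> norm (K x) \<le> C * exp (- \<kappa> * x)"
  shows "\<exists>I. ((\<lambda>t. integral {0..t} K) \<longlongrightarrow> I) at_top \<and> (\<forall>t\<ge>0. norm (I - integral {0..t} K) \<le> C / \<kappa> * exp (- \<kappa> * t))"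
proof (rule improper_integral [where k = "\<lambda>x. C * exp (- \<kappa> * x)"])
  show "((\<lambda>x. C / \<kappa> * exp (- \<kappa> * x)) has_real_derivative - (C * exp (- \<kappa> * x))) (at x)" for x
    using assms(2) by (auto intro!: derivative_eq_intros)
  show "((\<lambda>x. C / \<kappa> * exp (- \<kappa> * x)) \<longlongrightarrow> 0) at_top"
    using assms(2) by real_asymp
qed (use assms in auto)

lemma norm_improper_integral_exp:
  fixes K :: "real \<Rightarrow> 'a::banach"
  assumes "continuous_on {0..} K" "0 < \<kappa>" "0 \<le> C" "\<And>x. 0 \<le> x \<Longrightarrow> norm (K x) \<le> C * exp (- \<kappa> * x)"
    "((\<lambda>t. integral {0..t} K) \<longlongrightarrow> I) at_top"
  shows "norm I \<le> C / \<kappa>" "0 \<le> t \<Longrightarrow> norm (integral {0..t} K) \<le> C / \<kappa>"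
proof -
  have *: "norm (integral {0..t} K) \<le> C / \<kappa>" if t: "0 \<le> t" for t
  proof -
    have i: "((\<lambda>x. C * exp (- \<kappa> * x)) has_integral (- (C / \<kappa> * exp (- \<kappa> * t)) - - (C / \<kappa> * exp (- \<kappa> * 0)))) {0..t}"
    proof (rule fundamental_theorem_of_calculus [OF t])
      show "((\<lambda>x. - (C / \<kappa> * exp (- \<kappa> * x))) has_vector_derivative C * exp (- \<kappa> * x)) (at x within {0..t})" for x
        unfolding has_real_derivative_iff_has_vector_derivative [symmetric]
        using assms(2) by (auto intro!: derivative_eq_intros)
    qed
    have "norm (integral {0..t} K) \<le> integral {0..t} (\<lambda>x. C * exp (- \<kappa> * x))"
      using assms(1,4) by (intro integral_norm_bound_integral integrable_continuous_real)
        (auto intro!: continuous_intros intro: continuous_on_subset)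
    also have "\<dots> = C / \<kappa> - C / \<kappa> * exp (- \<kappa> * t)" using integral_unique [OF i] by simp
    also have "\<dots> \<le> C / \<kappa>" using assms(2,3) by simp
    finally show ?thesis .
  qed
  then show "0 \<le> t \<Longrightarrow> norm (integral {0..t} K) \<le> C / \<kappa>" .
  show "norm I \<le> C / \<kappa>"
  proof (rule tendsto_upperbound [OF tendsto_norm [OF assms(5)]])
    show "\<forall>\<^sub>F t in at_top. norm (integral {0..t} K) \<le> C / \<kappa>"
      using eventually_ge_at_top [of 0] by eventually_elim (rule *)
  qed simp
qed

lemma integral_symmetric_interval:
  fixes D :: "real \<Rightarrow> 'a::banach"
  assumes "continuous_on UNIV D" "0 \<le> n"
  shows "integral {-n..n} D = integral {0..n} (\<lambda>x. D x + D (- x))"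
proof -
  have c: "continuous_on S D" "continuous_on S (\<lambda>x. D (- x))" for S
    using assms(1) by (auto intro: continuous_on_subset continuous_on_compose2 [OF _ continuous_on_minus [OF continuous_on_id]])
  have i: "D integrable_on {a..b}" "(\<lambda>x. D (- x)) integrable_on {a..b}" for a b
    by (auto intro: integrable_continuous_real c)
  have "integral {-n..n} D = integral {-n..0} D + integral {0..n} D"
    using assms(2) i by (intro Henstock_Kurzweil_Integration.integral_combine [symmetric]) auto
  also have "integral {-n..0} D = integral {0..n} (\<lambda>x. D (- x))"
    using Henstock_Kurzweil_Integration.integral_reflect_real [of n 0 "\<lambda>x. D (-x)"] by simp
  finally show ?thesis by (simp add: integral_add i add.commute)
qed

text \<open>Folding the line at 0 turns the symmetric limit into a one-sided improper integral of
  D(x) + D(- x).\<close>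

lemma symmetric_improper_integral:
  fixes D :: "real \<Rightarrow> 'a::banach"
  assumes D: "continuous_on UNIV D" and N: "0 < N" and b: "\<And>x. N \<le> \<bar>x\<bar> \<Longrightarrow> norm (D x) \<le> C / x\<^sup>2"
  shows "\<exists>I. ((\<lambda>t. integral {-t..t} D) \<longlongrightarrow> I) at_top"
proof -
  have C: "0 \<le> C"
  proof -
    have "0 \<le> C / N\<^sup>2" using order_trans [OF norm_ge_zero b [of N]] N by simp
    moreover have "C = C / N\<^sup>2 * N\<^sup>2" using N by simp
    ultimately show ?thesis by (metis mult_nonneg_nonneg zero_le_power2)
  qed
  have "\<exists>I. ((\<lambda>t. integral {0..t} (\<lambda>x. D x + D (- x))) \<longlongrightarrow> I) at_top \<and>
    (\<forall>t\<ge>N. norm (I - integral {0..t} (\<lambda>x. D x + D (- x))) \<le> 2 * C / t)"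
  proof (rule improper_integral [where k = "\<lambda>x. 2 * C / x\<^sup>2"])
    show "continuous_on {0..} (\<lambda>x. D x + D (- x))"
      by (intro continuous_intros continuous_on_compose2 [OF D]) (auto intro: continuous_on_subset [OF D])
    show "((\<lambda>x. 2 * C / x) has_real_derivative - (2 * C / x\<^sup>2)) (at x)" if "N \<le> x" for x
      using that N by (auto intro!: derivative_eq_intros simp: power2_eq_square)
    show "norm (D x + D (- x)) \<le> 2 * C / x\<^sup>2" if "N \<le> x" for x
      using norm_triangle_ineq [of "D x" "D (- x)"] b [of x] b [of "- x"] that N by simp
    show "((\<lambda>x. 2 * C / x) \<longlongrightarrow> 0) at_top" by real_asymp
    show "0 \<le> 2 * C / x" if "N \<le> x" for x using that N C by simp
  qed (use N in auto)
  then obtain I where I: "((\<lambda>t. integral {0..t} (\<lambda>x. D x + D (- x))) \<longlongrightarrow> I) at_top" by blast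
  have "((\<lambda>t. integral {-t..t} D) \<longlongrightarrow> I) at_top"
  proof (rule Lim_transform_eventually [OF I])
    show "\<forall>\<^sub>F t in at_top. integral {0..t} (\<lambda>x. D x + D (- x)) = integral {-t..t} D"
      using eventually_ge_at_top [of 0] by eventually_elim (simp add: integral_symmetric_interval [OF D])
  qed
  then show ?thesis by blast
qed

text \<open>Riemann sums over tagged divisions lie in W; if the integral lay outside, a ball around
  it would miss W.\<close>

lemma integral_in_closed_subspace:
  fixes h :: "real \<Rightarrow> 'a::banach"
  assumes h: "h integrable_on {a..b}" and W: "subspace W" "closed W" "\<And>x. x \<in> {a..b} \<Longrightarrow> h x \<in> W"
  shows "integral {a..b} h \<in> W"
proof (rule ccontr)
  assume "integral {a..b} h \<notin> W"
  then obtain e where e: "0 < e" "ball (integral {a..b} h) e \<subseteq> - W"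
    using W(2) by (metis ComplI open_Compl open_contains_ball)
  have "(h has_integral integral {a..b} h) (cbox a b)" using h by (simp add: integrable_integral)
  then obtain \<gamma> where g: "gauge \<gamma>" and
    \<gamma>: "\<And>p. p tagged_division_of cbox a b \<Longrightarrow> \<gamma> fine p \<Longrightarrow>
      norm ((\<Sum>(x, K)\<in>p. measure lborel K *\<^sub>R h x) - integral {a..b} h) < e"
    by (rule has_integralD [OF _ e(1)]) blast
  obtain p where p: "p tagged_division_of cbox a b" "\<gamma> fine p"
    by (rule fine_division_exists [OF g])
  have "(\<Sum>(x, K)\<in>p. measure lborel K *\<^sub>R h x) \<in> W"
  proof (rule subspace_sum [OF W(1)], clarify)
    fix x K assume "(x, K) \<in> p"
    then have "x \<in> {a..b}" using tagged_division_ofD(2,3) [OF p(1), of x K] by auto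
    then show "measure lborel K *\<^sub>R h x \<in> W" using W by (auto intro: subspace_scale)
  qed
  moreover have "(\<Sum>(x, K)\<in>p. measure lborel K *\<^sub>R h x) \<in> ball (integral {a..b} h) e"
    using \<gamma> [OF p] by (simp add: dist_norm norm_minus_commute)
  ultimately show False using e by blast
qed

lemma integral_scaleC:
  fixes h :: "real \<Rightarrow> 'a::{complex_normed_vector, banach}"
  assumes "h integrable_on S"
  shows "integral S (\<lambda>x. c *\<^sub>C h x) = c *\<^sub>C integral S h"
  using integral_linear [OF assms bounded_linear_scaleC_right] by (simp add: o_def)

lemma integral_blinfun:
  fixes h :: "real \<Rightarrow> 'a::banach" and L :: "'a \<Rightarrow>\<^sub>L 'b::banach"
  assumes "h integrable_on S"
  shows "integral S (\<lambda>x. L (h x)) = L (integral S h)"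
  using integral_linear [OF assms blinfun.bounded_linear_right] by (simp add: o_def)

section \<open>Resolvents\<close>

definition clinear_graph :: "('b::complex_normed_vector \<times> 'b) set \<Rightarrow> bool"
  where "clinear_graph A \<longleftrightarrow>
    (\<forall>x z y w. (x, z) \<in> A \<longrightarrow> (y, w) \<in> A \<longrightarrow> (x + y, z + w) \<in> A) \<and>
    (\<forall>c x z. (x, z) \<in> A \<longrightarrow> (c *\<^sub>C x, c *\<^sub>C z) \<in> A)"

definition Res :: "('b::complex_normed_vector \<times> 'b) set \<Rightarrow> complex \<Rightarrow> ('b \<Rightarrow>\<^sub>L 'b)"
  where "Res A l = Blinfun (resolvent A l)"

lemma clinear_opD: "clinear_op L \<Longrightarrow> L (c *\<^sub>C x) = c *\<^sub>C L x"
  by (simp add: clinear_op_def)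

lemma scaleC_blinfun_apply [simp]: "blinfun_apply (c *\<^sub>C L) x = c *\<^sub>C L x"
  by transfer simp

lemma resolvent_setI:
  assumes L: "bounded_linear L" "\<And>y. (L y, l *\<^sub>C L y - y) \<in> A" "\<And>x z. (x, z) \<in> A \<Longrightarrow> L (l *\<^sub>C x - z) = x"
  shows "l \<in> resolvent_set A" "blinfun_apply (Res A l) = L"
proof -
  have ex: "\<exists>!x. \<exists>z. (x, z) \<in> A \<and> l *\<^sub>C x - z = y" for y
  proof (rule ex1I [of _ "L y"])
    show "\<exists>z. (L y, z) \<in> A \<and> l *\<^sub>C L y - z = y" using L(2) [of y] by force
    show "\<And>x. \<exists>z. (x, z) \<in> A \<and> l *\<^sub>C x - z = y \<Longrightarrow> x = L y" using L(3) by auto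
  qed
  have "resolvent A l y = L y" for y
    unfolding resolvent_def
  proof (rule the_equality)
    show "\<exists>z. (L y, z) \<in> A \<and> l *\<^sub>C L y - z = y" using L(2) [of y] by force
    show "\<And>x. \<exists>z. (x, z) \<in> A \<and> l *\<^sub>C x - z = y \<Longrightarrow> x = L y" using L(3) by auto
  qed
  then have eq: "resolvent A l = L" by auto
  with ex L show "l \<in> resolvent_set A" by (simp add: resolvent_set_def)
  show "blinfun_apply (Res A l) = L" unfolding Res_def eq by (rule bounded_linear_Blinfun_apply [OF L(1)])
qed

lemma resolvent_setD:
  assumes "l \<in> resolvent_set A"
  shows "(Res A l y, l *\<^sub>C Res A l y - y) \<in> A" "(x, z) \<in> A \<Longrightarrow> Res A l (l *\<^sub>C x - z) = x"
    "blinfun_apply (Res A l) = resolvent A l"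
proof -
  have ex: "\<exists>!x. \<exists>z. (x, z) \<in> A \<and> l *\<^sub>C x - z = y" for y
    using assms by (auto simp: resolvent_set_def)
  have b: "bounded_linear (resolvent A l)" using assms by (auto simp: resolvent_set_def)
  have eq: "blinfun_apply (Res A l) = resolvent A l" unfolding Res_def by (rule bounded_linear_Blinfun_apply [OF b])
  then show "blinfun_apply (Res A l) = resolvent A l" .
  have "\<exists>z. (resolvent A l y, z) \<in> A \<and> l *\<^sub>C resolvent A l y - z = y"
    unfolding resolvent_def by (rule theI' [OF ex])
  then have "(resolvent A l y, l *\<^sub>C resolvent A l y - y) \<in> A" by (auto simp: algebra_simps)
  then show "(Res A l y, l *\<^sub>C Res A l y - y) \<in> A" by (simp add: eq)
  assume "(x, z) \<in> A"
  then show "Res A l (l *\<^sub>C x - z) = x"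
    unfolding eq unfolding resolvent_def by (intro the1_equality [OF ex]) auto
qed

lemma clinear_op_Res:
  assumes "l \<in> resolvent_set A" "clinear_graph A"
  shows "clinear_op (Res A l)"
  unfolding clinear_op_def
proof (intro allI)
  fix c y
  have "(c *\<^sub>C Res A l y, c *\<^sub>C (l *\<^sub>C Res A l y - y)) \<in> A"
    using resolvent_setD(1) [OF assms(1)] assms(2) by (auto simp: clinear_graph_def)
  from resolvent_setD(2) [OF assms(1) this]
  show "Res A l (c *\<^sub>C y) = c *\<^sub>C Res A l y"
    by (simp add: scaleC_diff_right scaleC_scaleC mult.commute)
qed

lemma Res_identity:
  assumes "l \<in> resolvent_set A" "m \<in> resolvent_set A" "clinear_graph A"
  shows "Res A l y - Res A m y = (m - l) *\<^sub>C Res A l (Res A m y)"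
proof -
  from resolvent_setD(2) [OF assms(1) resolvent_setD(1) [OF assms(2)], of y]
  moreover have "l *\<^sub>C Res A m y - (m *\<^sub>C Res A m y - y) = (l - m) *\<^sub>C Res A m y + y"
    by (simp add: scaleC.diff_left)
  ultimately have "Res A l ((l - m) *\<^sub>C Res A m y) + Res A l y = Res A m y"
    by (simp add: blinfun.add_right)
  then show ?thesis
    unfolding clinear_opD [OF clinear_op_Res [OF assms(1,3)]] by (simp add: scaleC.diff_left algebra_simps)
qed

text \<open>Resolvent identity and local boundedness, stated without an unbounded operator: the
  resolvents of \<open>deriv_quot\<close> have these properties, and so does the pointwise action of
  the resolvents of A on classes of functions.\<close>

definition pseudo_resolvent :: "(complex \<Rightarrow> 'b::complex_normed_vector \<Rightarrow>\<^sub>L 'b) \<Rightarrow> complex set \<Rightarrow> bool"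
  where "pseudo_resolvent Q U \<longleftrightarrow> open U \<and> (\<forall>l\<in>U. clinear_op (Q l)) \<and>
    (\<forall>l\<in>U. \<forall>m\<in>U. \<forall>y. Q l y - Q m y = (m - l) *\<^sub>C Q l (Q m y)) \<and>
    (\<forall>l\<in>U. \<exists>e>0. \<exists>M. \<forall>m\<in>U. dist m l < e \<longrightarrow> norm (Q m) \<le> M)"

text \<open>The left-hand sides of the identity for (l, m) and for (m, l) differ only in
  sign.\<close>

lemma pseudo_resolvent_commute:
  assumes "pseudo_resolvent Q U" "l \<in> U" "m \<in> U"
  shows "Q l (Q m y) = Q m (Q l y)"
proof (cases "l = m")
  case False
  have 1: "Q l y - Q m y = (m - l) *\<^sub>C Q l (Q m y)" and 2: "Q m y - Q l y = (l - m) *\<^sub>C Q m (Q l y)"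
    using assms by (auto simp: pseudo_resolvent_def)
  have "(m - l) *\<^sub>C Q l (Q m y) = (- (l - m)) *\<^sub>C Q m (Q l y)"
    unfolding 1 [symmetric] scaleC.minus_left 2 [symmetric] by simp
  also have "\<dots> = (m - l) *\<^sub>C Q m (Q l y)" by simp
  finally have "(m - l) *\<^sub>C Q l (Q m y) = (m - l) *\<^sub>C Q m (Q l y)" .
  then show ?thesis by (rule scaleC_left_imp_eq) (use False in simp)
qed auto

lemma pseudo_resolvent_vholomorphic:
  assumes Q: "pseudo_resolvent Q U"
  shows "vholomorphic_on Q U"
  unfolding vholomorphic_on_open [OF conjunct1 [OF Q [unfolded pseudo_resolvent_def]]]
proof
  fix l assume l: "l \<in> U"
  have U: "open U" and id: "\<And>l m y. l \<in> U \<Longrightarrow> m \<in> U \<Longrightarrow> Q l y - Q m y = (m - l) *\<^sub>C Q l (Q m y)"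
    and cl: "\<And>l. l \<in> U \<Longrightarrow> clinear_op (Q l)"
    using Q by (auto simp: pseudo_resolvent_def)
  obtain e M where e: "0 < e" and M: "\<And>m. m \<in> U \<Longrightarrow> dist m l < e \<Longrightarrow> norm (Q m) \<le> M"
    using Q l unfolding pseudo_resolvent_def by blast
  have M0: "0 \<le> M" using M [OF l] e order_trans [OF norm_ge_zero] by auto
  have id': "Q m - Q l = (l - m) *\<^sub>C (Q m o\<^sub>L Q l)" if "m \<in> U" for m
    by (rule blinfun_eqI) (simp add: blinfun.diff_left id [OF that l])
  \<comment> \<open>The resolvent identity is used twice, for the difference quotient and again for
    its distance from \<open>D\<close>; this makes the error quadratic.\<close>
  define D where "D = - (Q l o\<^sub>L Q l)"
  have key: "norm (Q m - Q l - (m - l) *\<^sub>C D) \<le> (M ^ 3) * cmod (m - l) ^ 2" if "m \<in> U" "dist m l < e" for m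
  proof -
    have "(m - l) *\<^sub>C D = (l - m) *\<^sub>C (Q l o\<^sub>L Q l)"
      unfolding D_def scaleC.minus_right by (simp add: scaleC.minus_left [symmetric] del: scaleC_simps)
    then have "Q m - Q l - (m - l) *\<^sub>C D = (l - m) *\<^sub>C (Q m o\<^sub>L Q l) - (l - m) *\<^sub>C (Q l o\<^sub>L Q l)"
      using id' [OF that(1)] by simp
    also have "\<dots> = (l - m) *\<^sub>C ((Q m - Q l) o\<^sub>L Q l)"
      by (simp only: scaleC_diff_right bounded_bilinear.diff_left [OF bounded_bilinear_blinfun_compose])
    finally have "norm (Q m - Q l - (m - l) *\<^sub>C D) \<le> cmod (m - l) * (norm (Q m - Q l) * norm (Q l))"
      by (simp add: norm_scaleC norm_minus_commute [of l] mult_left_mono norm_blinfun_compose)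
    also have "\<dots> \<le> cmod (m - l) * ((cmod (m - l) * (M * M)) * M)"
    proof -
      have "norm (Q m - Q l) \<le> cmod (m - l) * (norm (Q m) * norm (Q l))"
        unfolding id' [OF that(1)] norm_scaleC norm_minus_commute [of l] by (intro mult_left_mono norm_blinfun_compose) simp
      also have "\<dots> \<le> cmod (m - l) * (M * M)"
        using M [OF that] M [OF l] e M0 by (intro mult_left_mono mult_mono) auto
      finally show ?thesis
        using M [OF l] e M0 by (intro mult_left_mono mult_mono) auto
    qed
    finally show ?thesis by (simp add: power2_eq_square power3_eq_cube algebra_simps)
  qed
  have "(Q has_derivative (\<lambda>h. h *\<^sub>C D)) (at l)"
    unfolding has_derivative_iff_norm
  proof
    show "bounded_linear (\<lambda>h. h *\<^sub>C D)" by (rule scaleC.bounded_linear_left)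
    have "(\<lambda>y. norm (Q y - Q l - (y - l) *\<^sub>C D) / norm (y - l)) \<midarrow>l\<rightarrow> 0"
    proof (rule Lim_null_comparison)
      have "\<forall>\<^sub>F y in at l. y \<in> U" using U l by (rule eventually_at_in_open')
      moreover have "\<forall>\<^sub>F y in at l. dist y l < e \<and> y \<noteq> l"
        using e by (auto simp: eventually_at)
      ultimately show "\<forall>\<^sub>F y in at l. norm (norm (Q y - Q l - (y - l) *\<^sub>C D) / norm (y - l)) \<le> M ^ 3 * cmod (y - l)"
      proof eventually_elim
        case (elim y)
        then have "norm (Q y - Q l - (y - l) *\<^sub>C D) / norm (y - l) \<le> (M ^ 3 * cmod (y - l) ^ 2) / cmod (y - l)"
          by (intro divide_right_mono key) auto
        then show ?case using elim by (simp add: power2_eq_square)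
      qed
      show "(\<lambda>y. M ^ 3 * cmod (y - l)) \<midarrow>l\<rightarrow> 0" by (auto intro!: tendsto_eq_intros)
    qed
    then show "((\<lambda>y. norm (Q y - Q l - (y - l) *\<^sub>C D) / norm (y - l)) \<longlongrightarrow> 0) (at l)" .
  qed
  then show "\<exists>F'. (Q has_derivative (\<lambda>h. h *\<^sub>C F')) (at l)" by blast
qed

lemma vholomorphic_on_apply:
  fixes F :: "complex \<Rightarrow> 'b::complex_normed_vector" and K :: "complex \<Rightarrow> ('b \<Rightarrow>\<^sub>L 'c::complex_normed_vector)"
  assumes K: "vholomorphic_on K U" "\<And>l. l \<in> U \<Longrightarrow> clinear_op (K l)" and F: "vholomorphic_on F U"
  shows "vholomorphic_on (\<lambda>l. K l (F l)) U"
  unfolding vholomorphic_on_def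
proof
  fix z assume z: "z \<in> U"
  obtain K' where K': "(K has_derivative (\<lambda>h. h *\<^sub>C K')) (at z within U)" using K z by (auto simp: vholomorphic_on_def)
  obtain F' where F': "(F has_derivative (\<lambda>h. h *\<^sub>C F')) (at z within U)" using F z by (auto simp: vholomorphic_on_def)
  from blinfun.FDERIV [OF K' F']
  have "((\<lambda>l. K l (F l)) has_derivative (\<lambda>h. h *\<^sub>C (K z F' + K' (F z)))) (at z within U)"
    by (simp add: clinear_opD [OF K(2) [OF z]] scaleC_add_right)
  then show "\<exists>F'. ((\<lambda>l. K l (F l)) has_derivative (\<lambda>h. h *\<^sub>C F')) (at z within U)" by blast
qed

lemma vholomorphic_on_const: "vholomorphic_on (\<lambda>_. c) U"
  unfolding vholomorphic_on_def by (auto intro!: exI [of _ 0])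

lemma vholomorphic_on_diff: "vholomorphic_on F U \<Longrightarrow> vholomorphic_on G U \<Longrightarrow> vholomorphic_on (\<lambda>z. F z - G z) U"
  unfolding vholomorphic_on_def
proof
  fix z assume a: "\<forall>z\<in>U. \<exists>F'. (F has_derivative (\<lambda>h. h *\<^sub>C F')) (at z within U)"
    "\<forall>z\<in>U. \<exists>F'. (G has_derivative (\<lambda>h. h *\<^sub>C F')) (at z within U)" and z: "z \<in> U"
  then obtain F' G' where "(F has_derivative (\<lambda>h. h *\<^sub>C F')) (at z within U)" "(G has_derivative (\<lambda>h. h *\<^sub>C G')) (at z within U)"
    by blast
  from has_derivative_diff [OF this]
  have "((\<lambda>z. F z - G z) has_derivative (\<lambda>h. h *\<^sub>C (F' - G'))) (at z within U)" by (simp add: scaleC_diff_right)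
  then show "\<exists>F'. ((\<lambda>z. F z - G z) has_derivative (\<lambda>h. h *\<^sub>C F')) (at z within U)" by blast
qed

lemma vholomorphic_on_add: "vholomorphic_on F U \<Longrightarrow> vholomorphic_on G U \<Longrightarrow> vholomorphic_on (\<lambda>z. F z + G z) U"
  unfolding vholomorphic_on_def
proof
  fix z assume a: "\<forall>z\<in>U. \<exists>F'. (F has_derivative (\<lambda>h. h *\<^sub>C F')) (at z within U)"
    "\<forall>z\<in>U. \<exists>F'. (G has_derivative (\<lambda>h. h *\<^sub>C F')) (at z within U)" and z: "z \<in> U"
  then obtain F' G' where "(F has_derivative (\<lambda>h. h *\<^sub>C F')) (at z within U)" "(G has_derivative (\<lambda>h. h *\<^sub>C G')) (at z within U)"
    by blast
  from has_derivative_add [OF this]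
  have "((\<lambda>z. F z + G z) has_derivative (\<lambda>h. h *\<^sub>C (F' + G'))) (at z within U)" by (simp add: scaleC_add_right)
  then show "\<exists>F'. ((\<lambda>z. F z + G z) has_derivative (\<lambda>h. h *\<^sub>C F')) (at z within U)" by blast
qed

lemma vholomorphic_on_scaleC:
  assumes g: "g holomorphic_on U" and F: "vholomorphic_on F U"
  shows "vholomorphic_on (\<lambda>z. g z *\<^sub>C F z) U"
  unfolding vholomorphic_on_def
proof
  fix z assume z: "z \<in> U"
  obtain F' where F': "(F has_derivative (\<lambda>h. h *\<^sub>C F')) (at z within U)" using F z by (auto simp: vholomorphic_on_def)
  obtain g' where g': "(g has_derivative (\<lambda>h. g' * h)) (at z within U)"
    using g z by (auto simp: holomorphic_on_def field_differentiable_def has_field_derivative_def)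
  from scaleC.FDERIV [OF g' F']
  have "((\<lambda>z. g z *\<^sub>C F z) has_derivative (\<lambda>h. h *\<^sub>C (g z *\<^sub>C F' + g' *\<^sub>C F z))) (at z within U)"
    by (simp add: scaleC_add_right scaleC_scaleC mult.commute)
  then show "\<exists>F'. ((\<lambda>z. g z *\<^sub>C F z) has_derivative (\<lambda>h. h *\<^sub>C F')) (at z within U)" by blast
qed

lemma vholomorphic_on_shift:
  assumes "vholomorphic_on F U"
  shows "vholomorphic_on (\<lambda>z. F (z + c)) ((\<lambda>z. z - c) ` U)"
  unfolding vholomorphic_on_def
proof
  fix z assume z: "z \<in> (\<lambda>z. z - c) ` U"
  have im: "(\<lambda>z. z + c) ` (\<lambda>z. z - c) ` U = U" by (auto simp: image_image)
  obtain F' where F': "(F has_derivative (\<lambda>h. h *\<^sub>C F')) (at (z + c) within U)" using assms z by (auto simp: vholomorphic_on_def)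
  have "((\<lambda>z. z + c) has_derivative (\<lambda>h. h)) (at z within (\<lambda>z. z - c) ` U)" by (auto intro!: derivative_eq_intros)
  from has_derivative_in_compose [OF this] F' im
  have "((\<lambda>z. F (z + c)) has_derivative (\<lambda>h. h *\<^sub>C F')) (at z within (\<lambda>z. z - c) ` U)" by simp
  then show "\<exists>F'. ((\<lambda>z. F (z + c)) has_derivative (\<lambda>h. h *\<^sub>C F')) (at z within (\<lambda>z. z - c) ` U)" by blast
qed

text \<open>With R the resolvent at l, the equation (m - A) x = y is equivalent to x = R(y + (l - m)
  x), whose right-hand side is a contraction with constant 1/2. Banach's fixed point theorem gives
  the inverse, and the fixed point equation gives its bound.\<close>

lemma resolvent_set_near:
  fixes A :: "('b::{complex_normed_vector, banach} \<times> 'b) set"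
  assumes l: "l \<in> resolvent_set A" and A: "clinear_graph A" and m: "cmod (m - l) * norm (Res A l) \<le> 1 / 2"
  shows "m \<in> resolvent_set A" "norm (Res A m) \<le> 2 * norm (Res A l)"
proof -
  let ?R = "Res A l"
  have cl: "?R (c *\<^sub>C y) = c *\<^sub>C ?R y" for c y using clinear_opD [OF clinear_op_Res [OF l A]] .
  have half: "norm (?R ((l - m) *\<^sub>C x)) \<le> 1 / 2 * norm x" for x
  proof -
    have "norm (?R ((l - m) *\<^sub>C x)) \<le> norm ?R * norm ((l - m) *\<^sub>C x)" by (rule norm_blinfun)
    also have "\<dots> = (cmod (m - l) * norm ?R) * norm x" by (simp add: norm_scaleC norm_minus_commute)
    also have "\<dots> \<le> 1 / 2 * norm x" using m by (intro mult_right_mono) auto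
    finally show ?thesis .
  qed
  have fixp: "\<exists>!x. ?R (y + (l - m) *\<^sub>C x) = x" for y
  proof -
    have "\<exists>!x. ?R (y + (l - m) *\<^sub>C x) = x"
    proof (rule banach_fix_type [where c = "1 / 2"], simp, simp, intro allI)
      fix x x' :: 'b
      have "?R (y + (l - m) *\<^sub>C x) - ?R (y + (l - m) *\<^sub>C x') = ?R ((l - m) *\<^sub>C (x - x'))"
        by (simp add: blinfun.diff_right [symmetric] scaleC_diff_right)
      then show "dist (?R (y + (l - m) *\<^sub>C x)) (?R (y + (l - m) *\<^sub>C x')) \<le> 1 / 2 * dist x x'"
        using half [of "x - x'"] by (simp add: dist_norm)
    qed
    then show ?thesis .
  qed
  define L where "L y = (THE x. ?R (y + (l - m) *\<^sub>C x) = x)" for y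
  have L: "?R (y + (l - m) *\<^sub>C L y) = L y" for y unfolding L_def by (rule theI' [OF fixp])
  have Lu: "L y = x" if "?R (y + (l - m) *\<^sub>C x) = x" for x y using L fixp that by blast
  have Lb: "norm (L y) \<le> 2 * norm ?R * norm y" for y
  proof -
    have "norm (L y) \<le> norm (?R y) + norm (?R ((l - m) *\<^sub>C L y))"
      by (subst L [symmetric]) (simp add: blinfun.add_right norm_triangle_ineq)
    with half [of "L y"] norm_blinfun [of ?R y] show ?thesis by simp
  qed
  have bl: "bounded_linear L"
  proof (rule bounded_linear_intro [of L "2 * norm ?R"])
    show "L (x + y) = L x + L y" for x y
    proof (rule Lu)
      have "?R (x + y + (l - m) *\<^sub>C (L x + L y)) = ?R (x + (l - m) *\<^sub>C L x) + ?R (y + (l - m) *\<^sub>C L y)"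
        by (simp add: blinfun.add_right scaleC_add_right)
      then show "?R (x + y + (l - m) *\<^sub>C (L x + L y)) = L x + L y" by (simp add: L)
    qed
    show "L (r *\<^sub>R x) = r *\<^sub>R L x" for r x
    proof (rule Lu)
      have "?R (r *\<^sub>R x + (l - m) *\<^sub>C (r *\<^sub>R L x)) = r *\<^sub>R ?R (x + (l - m) *\<^sub>C L x)"
        by (simp add: blinfun.scaleR_right [symmetric] scaleC.scaleR_right scaleR_add_right)
      then show "?R (r *\<^sub>R x + (l - m) *\<^sub>C (r *\<^sub>R L x)) = r *\<^sub>R L x" by (simp add: L)
    qed
    show "norm (L x) \<le> norm x * (2 * norm ?R)" for x using Lb [of x] by (simp add: mult.commute)
  qed
  have 1: "(L y, m *\<^sub>C L y - y) \<in> A" for y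
    using resolvent_setD(1) [OF l, of "y + (l - m) *\<^sub>C L y"] unfolding L
    by (simp add: scaleC.diff_left algebra_simps)
  have 2: "L (m *\<^sub>C x - z) = x" if "(x, z) \<in> A" for x z
    by (rule Lu) (use resolvent_setD(2) [OF l that] in \<open>simp add: scaleC.diff_left algebra_simps\<close>)
  show "m \<in> resolvent_set A" by (rule resolvent_setI [OF bl 1 2])
  have "blinfun_apply (Res A m) = L" by (rule resolvent_setI [OF bl 1 2])
  then show "norm (Res A m) \<le> 2 * norm ?R" using Lb by (intro norm_blinfun_bound) auto
qed

lemma open_resolvent_set:
  fixes A :: "('b::{complex_normed_vector, banach} \<times> 'b) set"
  assumes A: "clinear_graph A"
  shows "open (resolvent_set A)"
  unfolding open_dist
proof
  fix l assume l: "l \<in> resolvent_set A"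
  have "cmod (m - l) * norm (Res A l) \<le> 1 / 2" if "dist m l < 1 / (2 * norm (Res A l) + 2)" for m
  proof -
    have "cmod (m - l) * norm (Res A l) \<le> 1 / (2 * norm (Res A l) + 2) * norm (Res A l)"
      using that by (intro mult_right_mono) (auto simp: dist_norm)
    also have "\<dots> \<le> 1 / 2" by (simp add: field_simps add_pos_nonneg)
    finally show ?thesis .
  qed
  then show "\<exists>e>0. \<forall>m. dist m l < e \<longrightarrow> m \<in> resolvent_set A"
    using resolvent_set_near(1) [OF l A]
    by (intro exI [of _ "1 / (2 * norm (Res A l) + 2)"]) (auto simp: add_nonneg_pos)
qed

lemma Res_locally_bounded:
  fixes A :: "('b::{complex_normed_vector, banach} \<times> 'b) set"
  assumes A: "clinear_graph A" and l: "l \<in> resolvent_set A"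
  shows "\<exists>e>0. \<forall>m. dist m l < e \<longrightarrow> norm (Res A m) \<le> 2 * norm (Res A l)"
proof -
  have "cmod (m - l) * norm (Res A l) \<le> 1 / 2" if "dist m l < 1 / (2 * norm (Res A l) + 2)" for m
  proof -
    have "cmod (m - l) * norm (Res A l) \<le> 1 / (2 * norm (Res A l) + 2) * norm (Res A l)"
      using that by (intro mult_right_mono) (auto simp: dist_norm)
    also have "\<dots> \<le> 1 / 2" by (simp add: field_simps add_pos_nonneg)
    finally show ?thesis .
  qed
  then show ?thesis
    using resolvent_set_near(2) [OF l A]
    by (intro exI [of _ "1 / (2 * norm (Res A l) + 2)"]) (auto simp: add_nonneg_pos)
qed

section \<open>Strip integrals with a cutoff\<close>

definition jump :: "real \<Rightarrow> (complex \<Rightarrow> 'b::complex_normed_vector) \<Rightarrow> real \<Rightarrow> 'b"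
  where "jump a G x = G (Complex a x) - G (Complex (- a) x)"

definition hor :: "real \<Rightarrow> (complex \<Rightarrow> 'b::{complex_normed_vector, banach}) \<Rightarrow> real \<Rightarrow> 'b"
  where "hor a G x = integral {- a..a} (\<lambda>\<sigma>. G (Complex \<sigma> x))"

text \<open>The heights at which the whole segment across the strip stays in the domain of
  holomorphy; over these the jump can be traded for the horizontal integral.\<close>

definition segs :: "real \<Rightarrow> complex set \<Rightarrow> real set"
  where "segs a U = {x. \<forall>\<sigma>. \<bar>\<sigma>\<bar> \<le> a \<longrightarrow> Complex \<sigma> x \<in> U}"

lemma open_segs:
  assumes "open U"
  shows "open (segs a U)"
  unfolding open_dist
proof
  fix x assume x: "x \<in> segs a U"
  let ?K = "(\<lambda>\<sigma>. Complex \<sigma> x) ` {-a..a}"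
  have "compact ?K" by (intro compact_continuous_image continuous_intros compact_Icc)
  moreover have "?K \<subseteq> U" using x by (auto simp: segs_def)
  ultimately obtain e where e: "0 < e" "(\<Union>z\<in>?K. ball z e) \<subseteq> U"
    using compact_subset_open_imp_ball_epsilon_subset [of ?K U] assms by blast
  have "y \<in> segs a U" if "dist y x < e" for y
    unfolding segs_def
  proof (intro CollectI allI impI)
    fix \<sigma> assume "\<bar>\<sigma>\<bar> \<le> a"
    then have "Complex \<sigma> x \<in> ?K" by (intro imageI) (simp add: abs_le_iff)
    moreover have "dist (Complex \<sigma> x) (Complex \<sigma> y) < e"
      using that by (simp add: dist_norm complex_diff complex_norm abs_minus_commute)
    ultimately show "Complex \<sigma> y \<in> U" using e(2) by (meson UN_I mem_ball subsetD)
  qed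
  then show "\<exists>e>0. \<forall>y. dist y x < e \<longrightarrow> y \<in> segs a U" using e(1) by blast
qed

lemma continuous_on_jump:
  assumes "vholomorphic_on G U" "\<And>x. x \<in> S \<Longrightarrow> Complex a x \<in> U" "\<And>x. x \<in> S \<Longrightarrow> Complex (- a) x \<in> U"
  shows "continuous_on S (jump a G)"
proof -
  have G: "continuous_on U G" using assms(1) by (rule vholomorphic_on_continuous)
  have c: "continuous_on S (\<lambda>x. Complex b x)" for b
    by (intro continuous_on_Complex continuous_on_const continuous_on_id)
  show ?thesis
    unfolding jump_def
    by (intro continuous_on_diff continuous_on_compose2 [OF G c]) (use assms in auto)
qed

text \<open>Cauchy's theorem on the rectangle between two heights. Consequently \<eta> jump - i
  \<eta>' hor = -i (\<eta> hor)', which is the identity behind the cutoff.\<close>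

lemma hor_derivative:
  fixes G :: "complex \<Rightarrow> 'b::{complex_normed_vector, banach}"
  assumes G: "vholomorphic_on G U" and U: "open U" and a: "0 \<le> a" and x: "x \<in> segs a U"
  shows "(hor a G has_vector_derivative \<i> *\<^sub>C jump a G x) (at x)"
proof -
  obtain d where d: "0 < d" "ball x d \<subseteq> segs a U"
    using open_segs [OF U] x by (meson open_contains_ball)
  define c where "c = x - d / 2"
  let ?I = "{c..x + d / 2}"
  have sub: "?I \<subseteq> segs a U" using d by (force simp: c_def dist_real_def)
  have cj: "continuous_on ?I (\<lambda>x. \<i> *\<^sub>C jump a G x)"
    by (intro scaleC.continuous_on continuous_on_const continuous_on_jump [OF G])
      (use sub a in \<open>auto simp: segs_def\<close>)
  have eq: "hor a G y = hor a G c + integral {c..y} (\<lambda>x. \<i> *\<^sub>C jump a G x)" if "y \<in> ?I" for y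
  proof -
    have "integral {c..y} (\<lambda>x. \<i> *\<^sub>C (G (Complex a x) - G (Complex (-a) x))) =
      integral {-a..a} (\<lambda>\<sigma>. G (Complex \<sigma> y)) - integral {-a..a} (\<lambda>\<sigma>. G (Complex \<sigma> c))"
    proof (rule Cauchy_rectangle [OF G U])
      fix \<sigma> z assume "- a \<le> \<sigma>" "\<sigma> \<le> a" "c \<le> z" "z \<le> y"
      then have "z \<in> segs a U" using sub that by auto
      then show "Complex \<sigma> z \<in> U" using \<open>- a \<le> \<sigma>\<close> \<open>\<sigma> \<le> a\<close> by (auto simp: segs_def)
    qed (use that a in auto)
    then show ?thesis by (simp add: hor_def jump_def)
  qed
  have xI: "x \<in> interior ?I" using d by (simp add: c_def)
  have "((\<lambda>y. hor a G c + integral {c..y} (\<lambda>x. \<i> *\<^sub>C jump a G x)) has_vector_derivative 0 + \<i> *\<^sub>C jump a G x) (at x within ?I)"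
    by (intro has_vector_derivative_add has_vector_derivative_const integral_has_vector_derivative cj)
      (use d in \<open>auto simp: c_def\<close>)
  then have "(hor a G has_vector_derivative 0 + \<i> *\<^sub>C jump a G x) (at x within ?I)"
  proof (rule has_vector_derivative_transform [rotated 2])
    show "x \<in> ?I" using d by (simp add: c_def)
  qed (rule eq)
  then show ?thesis using at_within_interior [OF xI] by simp
qed

lemma continuous_on_hor:
  fixes G :: "complex \<Rightarrow> 'b::{complex_normed_vector, banach}"
  assumes "vholomorphic_on G U" "open U" "0 \<le> a"
  shows "continuous_on (segs a U) (hor a G)"
  using hor_derivative [OF assms] has_vector_derivative_continuous
  by (metis continuous_at_imp_continuous_on)

text \<open>The function g is controlled only near the carrier S of \<eta>; off S the product is 0,
  and the two open sets cover the line.\<close>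

lemma cutoff_continuous:
  fixes g :: "real \<Rightarrow> 'b::real_normed_vector"
  assumes "continuous_on UNIV \<eta>" "closed S" "S \<subseteq> V" "open V" "\<And>x. x \<notin> S \<Longrightarrow> \<eta> x = 0" "continuous_on V g"
  shows "continuous_on UNIV (\<lambda>x. \<eta> x *\<^sub>R g x)"
proof -
  have "continuous_on V (\<lambda>x. \<eta> x *\<^sub>R g x)"
    by (intro continuous_intros continuous_on_subset [OF assms(1)] assms(6)) auto
  moreover have "continuous_on (- S) (\<lambda>x. \<eta> x *\<^sub>R g x)"
    by (rule continuous_on_eq [OF continuous_on_const [of _ 0]]) (simp add: assms(5))
  moreover have "V \<union> - S = UNIV" using assms(3) by auto
  ultimately show ?thesis
    using continuous_on_open_Un [of V "- S" "\<lambda>x. \<eta> x *\<^sub>R g x"] assms(2,4) by auto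
qed

text \<open>Differentiability of h is available on V only. Outside V the product vanishes on the
  whole open complement of S, so its derivative there is 0 whatever h is.\<close>

lemma cutoff_by_parts:
  fixes h :: "real \<Rightarrow> 'b::banach"
  assumes \<eta>: "\<And>x. (\<eta> has_real_derivative \<eta>' x) (at x)" and S: "closed S" "S \<subseteq> V"
    and z: "\<And>x. x \<notin> S \<Longrightarrow> \<eta> x = 0 \<and> \<eta>' x = 0"
    and h: "\<And>x. x \<in> V \<Longrightarrow> (h has_vector_derivative h' x) (at x)" and pq: "p \<le> q"
  shows "((\<lambda>x. \<eta> x *\<^sub>R h' x + \<eta>' x *\<^sub>R h x) has_integral (\<eta> q *\<^sub>R h q - \<eta> p *\<^sub>R h p)) {p..q}"
proof (rule fundamental_theorem_of_calculus [OF pq])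
  fix x :: real
  show "((\<lambda>x. \<eta> x *\<^sub>R h x) has_vector_derivative \<eta> x *\<^sub>R h' x + \<eta>' x *\<^sub>R h x) (at x within {p..q})"
  proof (rule has_vector_derivative_at_within, cases "x \<in> V")
    case True
    show "((\<lambda>x. \<eta> x *\<^sub>R h x) has_vector_derivative \<eta> x *\<^sub>R h' x + \<eta>' x *\<^sub>R h x) (at x)"
      by (rule has_vector_derivative_scaleR [OF \<eta> h [OF True]])
  next
    case False
    then have x: "x \<in> - S" using S by auto
    have "((\<lambda>x. 0) has_vector_derivative (0::'b)) (at x)" by simp
    then have "((\<lambda>x. \<eta> x *\<^sub>R h x) has_vector_derivative 0) (at x)"
      by (rule has_vector_derivative_transform_within_open [of _ _ _ "- S"]) (use S x z in auto)
    then show "((\<lambda>x. \<eta> x *\<^sub>R h x) has_vector_derivative \<eta> x *\<^sub>R h' x + \<eta>' x *\<^sub>R h x) (at x)"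
      using z x by simp
  qed
qed

text \<open>A moving average of a ramp in the distance from K: averaging makes a continuous function
  continuously differentiable. The closed sets \<open>SA\<close> and \<open>SB\<close> carry \<eta>
  and 1 - \<eta> together with the derivative, which is the form in which integration by parts uses
  them.\<close>

lemma smooth_cutoff:
  fixes K L :: "real set"
  assumes K: "compact K" and L: "closed L" "K \<inter> L = {}"
  obtains \<eta> \<eta>' SA SB where "\<And>x. (\<eta> has_real_derivative \<eta>' x) (at x)" "continuous_on UNIV \<eta>'"
    "closed SA" "closed SB" "SA \<inter> K = {}" "SB \<inter> L = {}"
    "\<And>x. x \<notin> SA \<Longrightarrow> \<eta> x = 0 \<and> \<eta>' x = (0::real)" "\<And>x. x \<notin> SB \<Longrightarrow> \<eta> x = 1 \<and> \<eta>' x = 0"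
proof (cases "K = {}")
  case True
  show thesis by (rule that [of "\<lambda>_. 1" "\<lambda>_. 0" UNIV "{}"]) (use True in auto)
next
  case ne: False
  obtain d where d: "0 < d" "\<And>x y. x \<in> K \<Longrightarrow> y \<in> L \<Longrightarrow> d \<le> dist x y"
    using separate_compact_closed [OF K L] by blast
  define u where "u x = infdist x K" for x
  have u_cont: "continuous_on S u" for S unfolding u_def by (intro continuous_intros)
  have u_lip: "\<bar>u x - u y\<bar> \<le> \<bar>x - y\<bar>" for x y
    using infdist_triangle_abs [of x K y] by (simp add: u_def dist_real_def)
  define g where "g s = max 0 (min 1 (3 * u s / d - 1))" for s
  have g_cont: "continuous_on S g" for S unfolding g_def using d(1) by (intro continuous_intros u_cont) auto
  have g0: "g s = 0" if "u s \<le> d / 3" for s using that d by (simp add: g_def field_simps)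
  have g1: "g s = 1" if "2 * d / 3 \<le> u s" for s using that d by (simp add: g_def field_simps)
  \<comment> \<open>The averaging window changes \<open>u\<close> by at most d/6: starting from u <
    d/6 it stays below d/3, where g = 0, and starting from u > 5d/6 it stays above 2d/3, where g =
    1.\<close>
  define \<delta> where "\<delta> = d / 6"
  have \<delta>: "0 < \<delta>" using d by (simp add: \<delta>_def)
  define \<eta> where "\<eta> x = integral {x..x + \<delta>} g / \<delta>" for x
  define \<eta>' where "\<eta>' x = (g (x + \<delta>) - g x) / \<delta>" for x
  show thesis
  proof (rule that [of \<eta> \<eta>' "{x. d / 6 \<le> u x}" "{x. u x \<le> 5 * d / 6}"])
    show "(\<eta> has_real_derivative \<eta>' x) (at x)" for x
    proof -
      define I where "I y = integral {x - 1..y} g" for y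
      have I: "(I has_real_derivative g y) (at y)" if "x - 1 < y" "y < x + \<delta> + 1" for y
      proof -
        have "(I has_real_derivative g y) (at y within {x - 1..x + \<delta> + 1})"
          unfolding I_def by (intro integral_has_real_derivative g_cont) (use that in auto)
        then show ?thesis using that at_within_interior [of y "{x - 1..x + \<delta> + 1}"] by simp
      qed
      have eq: "\<eta> y = (I (y + \<delta>) - I y) / \<delta>" if "y \<in> {x - 1<..}" for y
        using Henstock_Kurzweil_Integration.integral_combine [of "x - 1" y "y + \<delta>" g] that \<delta>
        by (simp add: \<eta>_def I_def integrable_continuous_real g_cont)
      have "((\<lambda>y. (I (y + \<delta>) - I y) / \<delta>) has_real_derivative \<eta>' x) (at x)"
        unfolding \<eta>'_def
        by (intro DERIV_cdivide DERIV_diff I DERIV_shift [THEN iffD1]) (use \<delta> in auto)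
      then show ?thesis
        by (rule has_field_derivative_transform_within_open [of _ _ _ "{x - 1<..}"]) (auto simp: eq)
    qed
    show "continuous_on UNIV \<eta>'"
      unfolding \<eta>'_def by (intro continuous_intros g_cont continuous_on_compose2 [OF g_cont]) (use \<delta> in auto)
    show "closed {x. d / 6 \<le> u x}" "closed {x. u x \<le> 5 * d / 6}"
      by (intro closed_Collect_le continuous_intros u_cont)+
    show "{x. d / 6 \<le> u x} \<inter> K = {}" using d by (auto simp: u_def)
    show "{x. u x \<le> 5 * d / 6} \<inter> L = {}"
    proof -
      have "d \<le> u y" if "y \<in> L" for y
        unfolding u_def infdist_notempty [OF ne] using d(2) that ne
        by (intro cINF_greatest) (auto simp: dist_commute)
      then show ?thesis using d(1) by force
    qed
    show "\<eta> x = 0 \<and> \<eta>' x = 0" if "x \<notin> {x. d / 6 \<le> u x}" for x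
    proof -
      have "g y = 0" if "x \<le> y" "y \<le> x + \<delta>" for y
        using u_lip [of y x] that \<open>x \<notin> _\<close> by (intro g0) (auto simp: \<delta>_def abs_le_iff)
      moreover from this have "integral {x..x + \<delta>} g = integral {x..x + \<delta>} (\<lambda>_. 0)" by (intro integral_cong) auto
      ultimately show ?thesis using \<delta> by (simp add: \<eta>_def \<eta>'_def)
    qed
    show "\<eta> x = 1 \<and> \<eta>' x = 0" if "x \<notin> {x. u x \<le> 5 * d / 6}" for x
    proof -
      have "g y = 1" if "x \<le> y" "y \<le> x + \<delta>" for y
        using u_lip [of y x] that \<open>x \<notin> _\<close> by (intro g1) (auto simp: \<delta>_def abs_le_iff)
      moreover from this have "integral {x..x + \<delta>} g = integral {x..x + \<delta>} (\<lambda>_. 1)" by (intro integral_cong) auto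
      ultimately show ?thesis using \<delta> by (simp add: \<eta>_def \<eta>'_def)
    qed
  qed
qed

lemma agree_off_imaginary_axis:
  fixes g h :: "complex \<Rightarrow> 'b::t2_space"
  assumes U: "open U" and g: "continuous_on U g" and h: "continuous_on U h"
    and eq: "\<And>l. l \<in> U \<Longrightarrow> Re l \<noteq> 0 \<Longrightarrow> g l = h l" and l: "l \<in> U"
  shows "g l = h l"
proof (cases "Re l = 0")
  case True
  define s where "s n = l + of_real (inverse (real (Suc n)))" for n
  have s: "s \<longlonglongrightarrow> l"
    unfolding s_def using tendsto_add [OF tendsto_const [of l] tendsto_of_real [OF LIMSEQ_inverse_real_of_nat]] by simp
  have sU: "\<forall>\<^sub>F n in sequentially. s n \<in> U" using topological_tendstoD [OF s U l] .
  have "(\<lambda>n. g (s n)) \<longlonglongrightarrow> g l" "(\<lambda>n. h (s n)) \<longlonglongrightarrow> h l"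
    using g h l U s by (auto simp: continuous_on_eq_continuous_at isCont_tendsto_compose)
  moreover have "\<forall>\<^sub>F n in sequentially. g (s n) = h (s n)"
    using sU by eventually_elim (use True in \<open>auto intro!: eq simp: s_def\<close>)
  ultimately show ?thesis
    using tendsto_unique [of sequentially "\<lambda>n. h (s n)"] tendsto_cong by (metis sequentially_bot)
qed (use eq l in simp)

lemma norm_hor_le:
  fixes G :: "complex \<Rightarrow> 'b::{complex_normed_vector, banach}"
  assumes "vholomorphic_on G U" "x \<in> segs a U" "0 \<le> a" "\<And>\<sigma>. \<bar>\<sigma>\<bar> \<le> a \<Longrightarrow> norm (G (Complex \<sigma> x)) \<le> b"
  shows "norm (hor a G x) \<le> 2 * a * b"
proof -
  have "continuous_on {-a..a} (\<lambda>\<sigma>. G (Complex \<sigma> x))"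
    by (rule continuous_on_compose2 [OF vholomorphic_on_continuous [OF assms(1)]])
      (use assms(2) in \<open>auto intro!: continuous_intros simp: segs_def\<close>)
  then have "norm (hor a G x) \<le> b * (a - - a)"
    unfolding hor_def by (intro integral_bound) (use assms in auto)
  then show ?thesis by (simp add: mult.commute)
qed

lemma hor_tendsto_zero:
  fixes G :: "complex \<Rightarrow> 'b::{complex_normed_vector, banach}"
  assumes "vholomorphic_on G U" "0 \<le> a" "\<And>x. N \<le> \<bar>x\<bar> \<Longrightarrow> x \<in> segs a U"
    "\<And>\<sigma> x. \<bar>\<sigma>\<bar> \<le> a \<Longrightarrow> N \<le> \<bar>x\<bar> \<Longrightarrow> norm (G (Complex \<sigma> x)) \<le> M / \<bar>x\<bar>"
  shows "(hor a G \<longlongrightarrow> 0) at_top" "((\<lambda>t. hor a G (- t)) \<longlongrightarrow> 0) at_top"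
proof -
  have b: "norm (hor a G x) \<le> 2 * a * (M / \<bar>x\<bar>)" if "N \<le> \<bar>x\<bar>" for x
    by (rule norm_hor_le [OF assms(1,3,2,4)]) (use that in auto)
  have lim: "((\<lambda>t. 2 * a * (M / \<bar>t\<bar>)) \<longlongrightarrow> 0) at_top" by real_asymp
  show "(hor a G \<longlongrightarrow> 0) at_top"
  proof (rule Lim_null_comparison [OF _ lim])
    show "\<forall>\<^sub>F t in at_top. norm (hor a G t) \<le> 2 * a * (M / \<bar>t\<bar>)"
      using eventually_ge_at_top [of "\<bar>N\<bar>"] by eventually_elim (rule b, simp)
  qed
  show "((\<lambda>t. hor a G (- t)) \<longlongrightarrow> 0) at_top"
  proof (rule Lim_null_comparison [OF _ lim])
    show "\<forall>\<^sub>F t in at_top. norm (hor a G (- t)) \<le> 2 * a * (M / \<bar>t\<bar>)"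
      using eventually_ge_at_top [of "\<bar>N\<bar>"]
    proof eventually_elim
      case (elim t)
      then show ?case using b [of "- t"] by simp
    qed
  qed
qed

text \<open>Without singularities in the strip the jump is an exact derivative, and only the
  horizontal integrals at the heights t and - t remain.\<close>

lemma jump_integral_tendsto_zero:
  fixes G :: "complex \<Rightarrow> 'b::{complex_normed_vector, banach}"
  assumes G: "vholomorphic_on G U" and U: "open U" and a: "0 \<le> a" and s: "\<And>x. x \<in> segs a U"
    and b: "\<And>\<sigma> x. \<bar>\<sigma>\<bar> \<le> a \<Longrightarrow> N \<le> \<bar>x\<bar> \<Longrightarrow> norm (G (Complex \<sigma> x)) \<le> M / \<bar>x\<bar>"
  shows "((\<lambda>t. integral {-t..t} (jump a G)) \<longlongrightarrow> 0) at_top"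
proof -
  have "((\<lambda>t. (- \<i>) *\<^sub>C (hor a G t - hor a G (- t))) \<longlongrightarrow> (- \<i>) *\<^sub>C (0 - 0)) at_top"
    by (intro tendsto_intros scaleC.tendsto hor_tendsto_zero [OF G a s b])
  moreover have "\<forall>\<^sub>F t in at_top. (- \<i>) *\<^sub>C (hor a G t - hor a G (- t)) = integral {-t..t} (jump a G)"
    using eventually_ge_at_top [of 0]
  proof eventually_elim
    case (elim t)
    have "continuous_on {-t..t} (jump a G)"
      by (rule continuous_on_jump [OF G]) (use s a in \<open>auto simp: segs_def\<close>)
    then have int: "jump a G integrable_on {-t..t}" by (rule integrable_continuous_real)
    have "((\<lambda>x. \<i> *\<^sub>C jump a G x) has_integral (hor a G t - hor a G (- t))) {-t..t}"
      by (rule fundamental_theorem_of_calculus, use elim in simp)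
        (rule has_vector_derivative_at_within, rule hor_derivative [OF G U a s])
    then have "\<i> *\<^sub>C integral {-t..t} (jump a G) = hor a G t - hor a G (- t)"
      using integral_scaleC [OF int, of \<i>] by (simp add: integral_unique)
    then show ?case by (simp add: scaleC_scaleC flip: \<open>\<i> *\<^sub>C integral {-t..t} (jump a G) = hor a G t - hor a G (- t)\<close>)
  qed
  ultimately show ?thesis by (simp add: filterlim_cong)
qed

lemma integral_Poisson:
  fixes b :: real
  assumes "0 < b" "0 \<le> t"
  shows "((\<lambda>x. b / (b\<^sup>2 + x\<^sup>2)) has_integral 2 * arctan (t / b)) {-t..t}"
proof -
  have "((\<lambda>x. b / (b\<^sup>2 + x\<^sup>2)) has_integral arctan (t / b) - arctan (- t / b)) {-t..t}"
  proof (rule fundamental_theorem_of_calculus)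
    fix x
    have "((\<lambda>x. arctan (x / b)) has_real_derivative b / (b\<^sup>2 + x\<^sup>2)) (at x within {-t..t})"
    proof (rule DERIV_cong)
      show "((\<lambda>x. arctan (x / b)) has_real_derivative inverse (1 + (x / b)\<^sup>2) * (1 / b)) (at x within {-t..t})"
        by (rule DERIV_chain2 [OF DERIV_arctan]) (use assms in \<open>auto intro!: derivative_eq_intros\<close>)
      have "1 + (x / b)\<^sup>2 = (b\<^sup>2 + x\<^sup>2) / b\<^sup>2" using assms by (simp add: power_divide add_divide_distrib)
      then show "inverse (1 + (x / b)\<^sup>2) * (1 / b) = b / (b\<^sup>2 + x\<^sup>2)"
        using assms by (simp add: power2_eq_square)
    qed
    then show "((\<lambda>x. arctan (x / b)) has_vector_derivative b / (b\<^sup>2 + x\<^sup>2)) (at x within {-t..t})"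
      by (simp add: has_real_derivative_iff_has_vector_derivative)
  qed (use assms in auto)
  then show ?thesis by (simp add: arctan_minus)
qed

section \<open>Sums of commuting operators\<close>

text \<open>
  \<open>P\<close> and \<open>Q\<close> are the resolvents of commuting operators \<open>D\<close> and \<open>A\<close>, where \<open>D\<close> generates an
  isometric group, and \<open>B\<close> plays the role of \<open>(D - A + \<mu>)\<^sup>-\<^sup>1\<close>; the assumption \<open>star\<close> is what
  remains of this when \<open>B\<close> is applied to
  \<open>(D - A + \<mu>) Q(l) P(n) = P(n) - Q(l) + (\<mu> + n - l) Q(l) P(n)\<close>.
\<close>

locale commuting_sum =
  fixes P Q :: "complex \<Rightarrow> 'b::{complex_normed_vector, banach} \<Rightarrow>\<^sub>L 'b" and B :: "'b \<Rightarrow>\<^sub>L 'b"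
    and \<rho> :: "complex set" and \<mu> c N C :: real
  assumes P: "pseudo_resolvent P {l. Re l \<noteq> 0}"
    and P_bound: "\<And>l. Re l \<noteq> 0 \<Longrightarrow> norm (P l) * \<bar>Re l\<bar> \<le> 1"
    and P_inj: "\<And>l x. Re l \<noteq> 0 \<Longrightarrow> P l x = 0 \<Longrightarrow> x = 0"
    and Q: "pseudo_resolvent Q \<rho>"
    and B_clinear: "clinear_op B"
    and PQ: "\<And>l m x. Re l \<noteq> 0 \<Longrightarrow> m \<in> \<rho> \<Longrightarrow> P l (Q m x) = Q m (P l x)"
    and BP: "\<And>l x. Re l \<noteq> 0 \<Longrightarrow> B (P l x) = P l (B x)"
    and BQ: "\<And>m x. m \<in> \<rho> \<Longrightarrow> B (Q m x) = Q m (B x)"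
    and star: "\<And>l n x. l \<in> \<rho> \<Longrightarrow> Re n \<noteq> 0 \<Longrightarrow>
      Q l (P n x) = B (P n x - Q l x + (of_real \<mu> + n - l) *\<^sub>C Q l (P n x))"
    and bnds: "0 < c" "0 < N" "0 \<le> C"
    and right: "\<And>l. \<mu> - c \<le> Re l \<Longrightarrow> l \<in> \<rho>"
    and decay: "\<And>l. - c \<le> Re l \<Longrightarrow> Re l \<le> \<mu> + c \<Longrightarrow> N \<le> \<bar>Im l\<bar> \<Longrightarrow> l \<in> \<rho> \<and> norm (Q l) \<le> C / \<bar>Im l\<bar>"
    and \<mu>_nonneg: "0 \<le> \<mu>"
begin

lemma P_clinear: "Re l \<noteq> 0 \<Longrightarrow> clinear_op (P l)"
  and Q_clinear: "m \<in> \<rho> \<Longrightarrow> clinear_op (Q m)"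
  and open_\<rho>: "open \<rho>"
  using P Q unfolding pseudo_resolvent_def by blast+

lemma P_identity: "Re l \<noteq> 0 \<Longrightarrow> Re m \<noteq> 0 \<Longrightarrow> P l x - P m x = (m - l) *\<^sub>C P l (P m x)"
  using P unfolding pseudo_resolvent_def by blast

lemma norm_P_le: "Re l \<noteq> 0 \<Longrightarrow> norm (P l x) \<le> norm x / \<bar>Re l\<bar>"
proof -
  assume l: "Re l \<noteq> 0"
  have "norm (P l x) * \<bar>Re l\<bar> \<le> norm (P l) * norm x * \<bar>Re l\<bar>"
    by (intro mult_right_mono norm_blinfun) auto
  also have "\<dots> = (norm (P l) * \<bar>Re l\<bar>) * norm x" by simp
  also have "\<dots> \<le> 1 * norm x" by (intro mult_right_mono P_bound l) auto
  finally show ?thesis using l by (simp add: field_simps)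
qed

lemma open_P_plane: "open {l. Re l \<noteq> 0}"
  using P unfolding pseudo_resolvent_def by blast

lemma vholomorphic_P: "vholomorphic_on (\<lambda>l. P l x) {l. Re l \<noteq> 0}"
  by (rule vholomorphic_on_apply [OF pseudo_resolvent_vholomorphic [OF P] _ vholomorphic_on_const])
    (simp add: P_clinear)

lemma vholomorphic_Q:
  assumes "vholomorphic_on F U" "U \<subseteq> \<rho>"
  shows "vholomorphic_on (\<lambda>l. Q l (F l)) U"
  by (rule vholomorphic_on_apply [OF vholomorphic_on_subset [OF pseudo_resolvent_vholomorphic [OF Q] assms(2)] _ assms(1)])
     (use assms(2) Q_clinear in blast)

text \<open>The shift by \<mu> moves the spectrum of A to the left of the strip |Re l| \<le> c.
  These factors therefore add decay on vertical lines but no singularities.\<close>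

definition Qs :: "complex \<Rightarrow> 'b \<Rightarrow>\<^sub>L 'b" where "Qs l = Q (l + of_real \<mu>)"

definition \<rho>s :: "complex set" where "\<rho>s = {l. l + of_real \<mu> \<in> \<rho>}"

lemma open_\<rho>s: "open \<rho>s"
proof -
  have "\<rho>s = (\<lambda>l. l + of_real \<mu>) -` \<rho>" by (auto simp: \<rho>s_def)
  moreover have "open ((\<lambda>l. l + of_real \<mu>) -` \<rho>)"
    by (rule open_vimage [OF open_\<rho>]) (intro continuous_intros)
  ultimately show ?thesis by simp
qed

lemma vholomorphic_Qs:
  assumes "vholomorphic_on F U" "U \<subseteq> \<rho>s"
  shows "vholomorphic_on (\<lambda>l. Qs l (F l)) U"
proof -
  have "vholomorphic_on Qs ((\<lambda>z. z - of_real \<mu>) ` \<rho>)"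
    unfolding Qs_def by (rule vholomorphic_on_shift [OF pseudo_resolvent_vholomorphic [OF Q]])
  moreover have "U \<subseteq> (\<lambda>z. z - of_real \<mu>) ` \<rho>"
  proof
    fix l assume "l \<in> U"
    then have "l = (l + of_real \<mu>) - of_real \<mu>" "l + of_real \<mu> \<in> \<rho>" using assms(2) by (auto simp: \<rho>s_def)
    then show "l \<in> (\<lambda>z. z - of_real \<mu>) ` \<rho>" by blast
  qed
  ultimately have "vholomorphic_on Qs U" by (rule vholomorphic_on_subset)
  then show ?thesis
    by (rule vholomorphic_on_apply [OF _ _ assms(1)]) (use assms(2) Q_clinear in \<open>auto simp: Qs_def \<rho>s_def\<close>)
qed

lemma \<rho>s_right: "- c \<le> Re l \<Longrightarrow> l \<in> \<rho>s"
  unfolding \<rho>s_def by (auto intro: right)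

lemma norm_Q_le: "- c \<le> Re l \<Longrightarrow> Re l \<le> c \<Longrightarrow> N \<le> \<bar>Im l\<bar> \<Longrightarrow> norm (Q l x) \<le> C / \<bar>Im l\<bar> * norm x"
  using decay [of l] \<mu>_nonneg by (intro order_trans [OF norm_blinfun] mult_right_mono) auto

lemma norm_Qs_le: "- c \<le> Re l \<Longrightarrow> Re l \<le> c \<Longrightarrow> N \<le> \<bar>Im l\<bar> \<Longrightarrow> norm (Qs l x) \<le> C / \<bar>Im l\<bar> * norm x"
  using decay [of "l + of_real \<mu>"] \<mu>_nonneg unfolding Qs_def
  by (intro order_trans [OF norm_blinfun] mult_right_mono) auto

lemma norm_QsQs_le:
  assumes "- c \<le> Re l" "Re l \<le> c" "N \<le> \<bar>Im l\<bar>"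
  shows "norm (Qs l (Qs l x)) \<le> C\<^sup>2 * norm x / \<bar>Im l\<bar>\<^sup>2"
proof -
  have "norm (Qs l (Qs l x)) \<le> C / \<bar>Im l\<bar> * (C / \<bar>Im l\<bar> * norm x)"
    using assms bnds by (intro order_trans [OF norm_Qs_le] mult_left_mono norm_Qs_le) auto
  then show ?thesis by (simp add: power2_eq_square field_simps)
qed

text \<open>One step of the expansion of P(l) in powers of 1/l, possible on the range of P(\<nu>),
  that is, on the domain of D.\<close>

lemma P_expansion:
  assumes "Re l \<noteq> 0" "Re \<nu> \<noteq> 0"
  shows "l *\<^sub>C P l (P \<nu> y) = P \<nu> y + P l (\<nu> *\<^sub>C P \<nu> y - y)"
proof -
  have "P l y - P \<nu> y = \<nu> *\<^sub>C P l (P \<nu> y) - l *\<^sub>C P l (P \<nu> y)"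
    using P_identity [OF assms, of y] by (simp add: scaleC.diff_left)
  then show ?thesis
    by (simp add: blinfun.diff_right clinear_opD [OF P_clinear [OF assms(1)]] algebra_simps)
qed

text \<open>Along a vertical line \<open>P(l) g / l\<^sup>2\<close> integrates to \<open>0\<close>: push the line to infinity.\<close>

lemma line_integral_tendsto_zero:
  assumes a: "a \<noteq> 0"
  shows "((\<lambda>t. integral {-t..t} (\<lambda>x. inverse (Complex a x) ^ 2 *\<^sub>C P (Complex a x) g)) \<longlongrightarrow> 0) at_top"
proof (rule tendstoI)
  fix e :: real assume e: "0 < e"
  define G where "G l = inverse l ^ 2 *\<^sub>C P l g" for l
  have holG: "vholomorphic_on G {l. Re l \<noteq> 0}"
    unfolding G_def by (intro vholomorphic_on_scaleC vholomorphic_P holomorphic_intros) auto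
  have Gb: "norm (G (Complex b x)) \<le> norm g / (\<bar>b\<bar> * (\<bar>b\<bar>\<^sup>2 + x\<^sup>2))" if "b \<noteq> 0" for b x
  proof -
    have "norm (G (Complex b x)) = norm (P (Complex b x) g) / (b\<^sup>2 + x\<^sup>2)"
      by (simp add: G_def norm_scaleC norm_power norm_inverse cmod_power2 divide_inverse power_inverse mult.commute)
    also have "\<dots> \<le> (norm g / \<bar>b\<bar>) / (b\<^sup>2 + x\<^sup>2)"
      using norm_P_le [of "Complex b x" g] that by (intro divide_right_mono) auto
    finally show ?thesis by simp
  qed
  have cont: "continuous_on S (\<lambda>x. G (Complex b x))" if "b \<noteq> 0" for b S
    by (rule continuous_on_compose2 [OF vholomorphic_on_continuous [OF holG]])
      (use that in \<open>auto intro!: continuous_on_Complex continuous_on_const continuous_on_id\<close>)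
  have int: "(\<lambda>x. G (Complex b x)) integrable_on {p..q}" if "b \<noteq> 0" for b p q
    by (rule integrable_continuous_real [OF cont [OF that]])
  have line_le: "norm (integral {-t..t} (\<lambda>x. G (Complex b x))) \<le> pi * norm g / b\<^sup>2" if "b \<noteq> 0" "0 \<le> t" for b t
  proof -
    have i: "((\<lambda>x. norm g / b\<^sup>2 * (\<bar>b\<bar> / (\<bar>b\<bar>\<^sup>2 + x\<^sup>2))) has_integral norm g / b\<^sup>2 * (2 * arctan (t / \<bar>b\<bar>))) {-t..t}"
      using that by (intro has_integral_mult_right integral_Poisson) auto
    have "norm (integral {-t..t} (\<lambda>x. G (Complex b x))) \<le> integral {-t..t} (\<lambda>x. norm g / b\<^sup>2 * (\<bar>b\<bar> / (\<bar>b\<bar>\<^sup>2 + x\<^sup>2)))"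
    proof (rule integral_norm_bound_integral [OF int [OF that(1)] has_integral_integrable [OF i]])
      fix x
      have "norm g / (\<bar>b\<bar> * D) = norm g / \<bar>b\<bar>\<^sup>2 * (\<bar>b\<bar> / D)" for D
        using that unfolding power2_eq_square by (simp del: abs_mult_self_eq)
      then have "norm g / (\<bar>b\<bar> * (\<bar>b\<bar>\<^sup>2 + x\<^sup>2)) = norm g / b\<^sup>2 * (\<bar>b\<bar> / (\<bar>b\<bar>\<^sup>2 + x\<^sup>2))"
        by (simp only: power2_abs)
      then show "norm (G (Complex b x)) \<le> norm g / b\<^sup>2 * (\<bar>b\<bar> / (\<bar>b\<bar>\<^sup>2 + x\<^sup>2))" using Gb [OF that(1), of x] by simp
    qed
    also have "\<dots> = norm g / b\<^sup>2 * (2 * arctan (t / \<bar>b\<bar>))" using i by (rule integral_unique)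
    also have "\<dots> \<le> norm g / b\<^sup>2 * pi"
      using arctan_ubound [of "t / \<bar>b\<bar>"] by (intro mult_left_mono) auto
    finally show ?thesis by (simp add: mult.commute)
  qed
  \<comment> \<open>Cauchy's theorem between two lines on the same side of the axis; the horizontal
    sides vanish as t grows.\<close>
  have shift: "((\<lambda>t. integral {-t..t} (\<lambda>x. G (Complex q x)) - integral {-t..t} (\<lambda>x. G (Complex p x))) \<longlongrightarrow> 0) at_top"
    if pq: "p \<le> q" "0 < p \<or> q < 0" for p q
  proof (rule Lim_null_comparison)
    define m where "m = min \<bar>p\<bar> \<bar>q\<bar>"
    have m: "0 < m" and mle: "m \<le> \<bar>\<sigma>\<bar>" if "p \<le> \<sigma>" "\<sigma> \<le> q" for \<sigma> using pq that by (auto simp: m_def)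
    have m0: "0 < m" using m [of p] pq by auto
    show "((\<lambda>t. 2 * (norm g / (m * t\<^sup>2) * (q - p))) \<longlongrightarrow> 0) at_top" using m0 by real_asymp
    have "\<forall>\<^sub>F t::real in at_top. 0 < t" by (rule eventually_gt_at_top)
    then show "\<forall>\<^sub>F t in at_top. norm (integral {-t..t} (\<lambda>x. G (Complex q x)) - integral {-t..t} (\<lambda>x. G (Complex p x)))
      \<le> 2 * (norm g / (m * t\<^sup>2) * (q - p))"
    proof eventually_elim
      case (elim t)
      have nz: "\<sigma> \<noteq> 0" if "p \<le> \<sigma>" "\<sigma> \<le> q" for \<sigma> using that pq by auto
      have hb: "norm (integral {p..q} (\<lambda>\<sigma>. G (Complex \<sigma> x))) \<le> norm g / (m * t\<^sup>2) * (q - p)" if "x\<^sup>2 = t\<^sup>2" for x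
      proof (rule integral_bound [OF pq(1)])
        show "continuous_on {p..q} (\<lambda>\<sigma>. G (Complex \<sigma> x))"
          by (rule continuous_on_compose2 [OF vholomorphic_on_continuous [OF holG]])
            (use nz in \<open>auto intro!: continuous_on_Complex continuous_on_const continuous_on_id\<close>)
        fix \<sigma> assume s: "\<sigma> \<in> {p..q}"
        have "norm (G (Complex \<sigma> x)) \<le> norm g / (\<bar>\<sigma>\<bar> * (\<sigma>\<^sup>2 + x\<^sup>2))" using nz s Gb [of \<sigma> x] by auto
        also have "\<dots> \<le> norm g / (m * t\<^sup>2)"
        proof (rule divide_left_mono)
          show "m * t\<^sup>2 \<le> \<bar>\<sigma>\<bar> * (\<sigma>\<^sup>2 + x\<^sup>2)" using mle [of \<sigma>] s m0 that by (intro mult_mono) auto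
          have "\<bar>\<sigma>\<bar> > 0" using nz [of \<sigma>] s by auto
          then show "0 < \<bar>\<sigma>\<bar> * (\<sigma>\<^sup>2 + x\<^sup>2) * (m * t\<^sup>2)"
            using m0 elim by (intro mult_pos_pos add_pos_nonneg) auto
        qed simp
        finally show "norm (G (Complex \<sigma> x)) \<le> norm g / (m * t\<^sup>2)" .
      qed
      have "integral {-t..t} (\<lambda>x. \<i> *\<^sub>C (G (Complex q x) - G (Complex p x))) =
        integral {p..q} (\<lambda>\<sigma>. G (Complex \<sigma> t)) - integral {p..q} (\<lambda>\<sigma>. G (Complex \<sigma> (- t)))"
        by (rule Cauchy_rectangle [OF holG open_P_plane pq(1)]) (use elim nz in auto)
      moreover have "integral {-t..t} (\<lambda>x. \<i> *\<^sub>C (G (Complex q x) - G (Complex p x))) =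
        \<i> *\<^sub>C (integral {-t..t} (\<lambda>x. G (Complex q x)) - integral {-t..t} (\<lambda>x. G (Complex p x)))"
        using nz pq(1) by (simp add: integral_scaleC integral_diff int integrable_diff)
      ultimately have "norm (integral {-t..t} (\<lambda>x. G (Complex q x)) - integral {-t..t} (\<lambda>x. G (Complex p x))) =
        norm (integral {p..q} (\<lambda>\<sigma>. G (Complex \<sigma> t)) - integral {p..q} (\<lambda>\<sigma>. G (Complex \<sigma> (- t))))"
        by (metis norm_scaleC norm_ii mult_1)
      also have "\<dots> \<le> norm (integral {p..q} (\<lambda>\<sigma>. G (Complex \<sigma> t))) + norm (integral {p..q} (\<lambda>\<sigma>. G (Complex \<sigma> (- t))))"
        by (rule norm_triangle_ineq4)
      also have "\<dots> \<le> norm g / (m * t\<^sup>2) * (q - p) + norm g / (m * t\<^sup>2) * (q - p)"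
        by (intro add_mono hb refl power2_minus)
      finally show ?case by (simp only: mult_2)
    qed
  qed
  \<comment> \<open>On the line of abscissa b the integrals are at most pi |g| / b^2 for every t, so
    b is taken far out on the side of a.\<close>
  obtain b where b: "b \<noteq> 0" "pi * norm g / b\<^sup>2 < e / 2" "(a \<le> b \<and> 0 < a) \<or> (b \<le> a \<and> a < 0)"
  proof -
    have "((\<lambda>b. pi * norm g / b\<^sup>2) \<longlongrightarrow> 0) at_top" by real_asymp
    then have "\<forall>\<^sub>F b in at_top. pi * norm g / b\<^sup>2 < e / 2" using e by (intro order_tendstoD) auto
    then have "\<forall>\<^sub>F b in at_top. pi * norm g / b\<^sup>2 < e / 2 \<and> \<bar>a\<bar> \<le> b"
      using eventually_ge_at_top by (rule eventually_conj)
    then obtain b where "pi * norm g / b\<^sup>2 < e / 2" "\<bar>a\<bar> \<le> b"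
      by (metis (mono_tags, lifting) eventually_at_top_linorder order_refl)
    then show thesis using that [of b] that [of "- b"] a by (cases "0 < a") auto
  qed
  have lim0: "((\<lambda>t. integral {-t..t} (\<lambda>x. G (Complex a x)) - integral {-t..t} (\<lambda>x. G (Complex b x))) \<longlongrightarrow> 0) at_top"
  proof (cases "0 < a")
    case True
    with b shift [of a b] have "((\<lambda>t. integral {-t..t} (\<lambda>x. G (Complex b x)) - integral {-t..t} (\<lambda>x. G (Complex a x))) \<longlongrightarrow> 0) at_top" by auto
    from tendsto_minus [OF this] show ?thesis by simp
  next
    case False
    with a b shift [of b a] show ?thesis by auto
  qed
  have "\<forall>\<^sub>F t in at_top. norm (integral {-t..t} (\<lambda>x. G (Complex a x)) - integral {-t..t} (\<lambda>x. G (Complex b x))) < e / 2"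
    using tendstoD [OF lim0, of "e / 2"] e by simp
  then have "\<forall>\<^sub>F t in at_top. norm (integral {-t..t} (\<lambda>x. G (Complex a x))) < e"
    using eventually_ge_at_top [of 0]
  proof eventually_elim
    case (elim t)
    have "norm (integral {-t..t} (\<lambda>x. G (Complex b x))) < e / 2"
      using line_le [OF b(1) elim(2)] b(2) by linarith
    with elim show ?case using norm_triangle_sub [of "integral {-t..t} (\<lambda>x. G (Complex a x))" "integral {-t..t} (\<lambda>x. G (Complex b x))"]
      by linarith
  qed
  then show "\<forall>\<^sub>F t in at_top. dist (integral {-t..t} (\<lambda>x. inverse (Complex a x) ^ 2 *\<^sub>C P (Complex a x) g)) 0 < e"
    by (simp add: G_def)
qed

lemma jump_inverse_integral:
  assumes "0 < a"
  shows "((\<lambda>t. integral {-t..t} (jump a (\<lambda>l. inverse l *\<^sub>C y))) \<longlongrightarrow> (2 * pi) *\<^sub>R (y :: 'b)) at_top"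
    "(\<lambda>x. jump a (\<lambda>l. inverse l *\<^sub>C y) x) integrable_on {-t..t}"
proof -
  have eq: "jump a (\<lambda>l. inverse l *\<^sub>C y) x = (2 * (a / (a\<^sup>2 + x\<^sup>2))) *\<^sub>R y" for x
  proof -
    have "inverse (Complex a x) - inverse (Complex (- a) x) = of_real (2 * (a / (a\<^sup>2 + x\<^sup>2)))"
      by (simp add: complex_eq_iff add_divide_distrib [symmetric])
    then have "(inverse (Complex a x) - inverse (Complex (- a) x)) *\<^sub>C y = (2 * (a / (a\<^sup>2 + x\<^sup>2))) *\<^sub>R y"
      by (simp only: scaleC_of_real)
    then show ?thesis by (simp add: jump_def scaleC.diff_left)
  qed
  have i: "((\<lambda>x. jump a (\<lambda>l. inverse l *\<^sub>C y) x) has_integral (2 * (2 * arctan (t / a))) *\<^sub>R y) {-t..t}" if "0 \<le> t" for t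
    unfolding eq using integral_Poisson [OF assms that]
    by (intro has_integral_scaleR_left has_integral_mult_right) auto
  have lim: "((\<lambda>t. (2 * (2 * arctan (t / a))) *\<^sub>R y) \<longlongrightarrow> (2 * (2 * (pi / 2))) *\<^sub>R y) at_top"
  proof (intro tendsto_intros filterlim_compose [OF tendsto_arctan_at_top])
    show "filterlim (\<lambda>t. t / a) at_top at_top" using assms by real_asymp
  qed
  have "((\<lambda>t. integral {-t..t} (jump a (\<lambda>l. inverse l *\<^sub>C y))) \<longlongrightarrow> (2 * (2 * (pi / 2))) *\<^sub>R y) at_top"
  proof (rule Lim_transform_eventually [OF lim])
    show "\<forall>\<^sub>F t in at_top. (2 * (2 * arctan (t / a))) *\<^sub>R y = integral {-t..t} (jump a (\<lambda>l. inverse l *\<^sub>C y))"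
      using eventually_ge_at_top [of 0] by eventually_elim (use integral_unique [OF i] in auto)
  qed
  then show "((\<lambda>t. integral {-t..t} (jump a (\<lambda>l. inverse l *\<^sub>C y))) \<longlongrightarrow> (2 * pi) *\<^sub>R y) at_top" by simp
  show "(\<lambda>x. jump a (\<lambda>l. inverse l *\<^sub>C y) x) integrable_on {-t..t}"
    by (cases "0 \<le> t") (use has_integral_integrable [OF i] in auto)
qed

lemma line_inverse_square:
  assumes "a \<noteq> 0"
  shows "((\<lambda>t. integral {-t..t} (\<lambda>x. inverse (Complex a x) ^ 2 *\<^sub>C (y :: 'b))) \<longlongrightarrow> 0) at_top"
proof (rule Lim_null_comparison)
  show "((\<lambda>t. 2 * norm y / t) \<longlongrightarrow> 0) at_top" by real_asymp
  define F where "F x = (\<i> * inverse (Complex a x)) *\<^sub>C y" for x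
  have nz: "Complex a x \<noteq> 0" for x using assms by (simp add: complex_eq_iff)
  have dF: "(F has_vector_derivative inverse (Complex a x) ^ 2 *\<^sub>C y) (at x within S)" for x S
  proof -
    have c: "(\<lambda>x. Complex a x) = (\<lambda>x. of_real a + \<i> * of_real x)" by (auto simp: complex_eq_iff)
    have "((\<lambda>x. Complex a x) has_vector_derivative \<i>) (at x within S)"
      unfolding c by (auto intro!: derivative_eq_intros simp: has_vector_derivative_def scaleR_conv_of_real)
    moreover have "((\<lambda>z. \<i> * inverse z) has_field_derivative - \<i> * inverse (Complex a x) ^ 2) (at (Complex a x) within (\<lambda>x. Complex a x) ` S)"
      using nz [of x] by (auto intro!: derivative_eq_intros simp: power2_eq_square)
    ultimately have "((\<lambda>z. \<i> * inverse z) \<circ> (\<lambda>x. Complex a x) has_vector_derivative \<i> * (- \<i> * inverse (Complex a x) ^ 2)) (at x within S)"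
      by (rule field_vector_diff_chain_within)
    then have "((\<lambda>x. \<i> * inverse (Complex a x)) has_vector_derivative inverse (Complex a x) ^ 2) (at x within S)"
      by (simp add: o_def mult.assoc [symmetric])
    from bounded_linear.has_vector_derivative [OF scaleC.bounded_linear_left this, of y]
    show ?thesis by (simp add: F_def [abs_def])
  qed
  have Fb: "norm (F x) \<le> norm y / \<bar>x\<bar>" if "x \<noteq> 0" for x
  proof -
    have "\<bar>x\<bar> \<le> cmod (Complex a x)" using abs_Im_le_cmod [of "Complex a x"] by simp
    then have "inverse (cmod (Complex a x)) \<le> inverse \<bar>x\<bar>" using that by (intro le_imp_inverse_le) auto
    then show ?thesis
      unfolding F_def norm_scaleC norm_mult norm_inverse using mult_right_mono [of "inverse (cmod (Complex a x))" "inverse \<bar>x\<bar>" "norm y"]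
      by (simp add: divide_inverse mult.commute)
  qed
  have "\<forall>\<^sub>F t::real in at_top. 0 < t" by (rule eventually_gt_at_top)
  then show "\<forall>\<^sub>F t in at_top. norm (integral {-t..t} (\<lambda>x. inverse (Complex a x) ^ 2 *\<^sub>C y)) \<le> 2 * norm y / t"
  proof eventually_elim
    case (elim t)
    have "((\<lambda>x. inverse (Complex a x) ^ 2 *\<^sub>C y) has_integral (F t - F (- t))) {-t..t}"
      using elim by (intro fundamental_theorem_of_calculus dF) auto
    then have "norm (integral {-t..t} (\<lambda>x. inverse (Complex a x) ^ 2 *\<^sub>C y)) = norm (F t - F (- t))"
      by (simp add: integral_unique)
    also have "\<dots> \<le> norm (F t) + norm (F (- t))" by (rule norm_triangle_ineq4)
    finally show ?case using Fb [of t] Fb [of "- t"] elim by simp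
  qed
qed

text \<open>An inversion formula for vectors regular enough to expand P(l) to second order in 1/l:
  the term with 1/l produces the Poisson kernel, of total mass 2 pi, and the terms with 1/l^2
  integrate to 0 in the limit on each of the two lines.\<close>

lemma jump_P_integral:
  fixes f :: 'b
  assumes a: "0 < a"
  defines "f2 \<equiv> P 1 (P 1 f)"
  shows "((\<lambda>t. integral {-t..t} (jump a (\<lambda>l. P l f2))) \<longlongrightarrow> (2 * pi) *\<^sub>R f2) at_top"
proof -
  define y where "y = P 1 f - f"
  define g1 where "g1 = P 1 y"
  define g2 where "g2 = P 1 y - y"
  \<comment> \<open>Two applications of \<open>P_expansion\<close> with \<nu> = 1; each gains a
    factor 1/l and uses up one of the two smoothings by P(1).\<close>
  have exp: "P l f2 = inverse l *\<^sub>C f2 + inverse l ^ 2 *\<^sub>C g1 + inverse l ^ 2 *\<^sub>C P l g2" if "Re l \<noteq> 0" for l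
  proof -
    have l0: "l \<noteq> 0" using that by auto
    have "l *\<^sub>C P l f2 = f2 + P l g1"
      using P_expansion [OF that, of 1 "P 1 f"] by (simp add: f2_def g1_def y_def blinfun.diff_right)
    then have "inverse l *\<^sub>C (l *\<^sub>C P l f2) = inverse l *\<^sub>C (f2 + P l g1)" by simp
    then have 1: "P l f2 = inverse l *\<^sub>C f2 + inverse l *\<^sub>C P l g1" using l0 by (simp add: scaleC_scaleC scaleC_add_right)
    have "l *\<^sub>C P l g1 = g1 + P l g2"
      using P_expansion [OF that, of 1 y] by (simp add: g1_def g2_def)
    then have "inverse l *\<^sub>C (l *\<^sub>C P l g1) = inverse l *\<^sub>C (g1 + P l g2)" by simp
    then have 2: "P l g1 = inverse l *\<^sub>C g1 + inverse l *\<^sub>C P l g2" using l0 by (simp add: scaleC_scaleC scaleC_add_right)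
    show ?thesis by (simp only: 1 2 scaleC_add_right scaleC_scaleC power2_eq_square add.assoc)
  qed
  define G1 where "G1 b x = inverse (Complex b x) ^ 2 *\<^sub>C g1" for b x
  define G2 where "G2 b x = inverse (Complex b x) ^ 2 *\<^sub>C P (Complex b x) g2" for b x
  have cC: "continuous_on S (\<lambda>x. Complex b x)" for b and S :: "real set"
    by (intro continuous_on_Complex continuous_on_const continuous_on_id)
  have cinv: "continuous_on S (\<lambda>x. inverse (Complex b x) ^ 2)" if "b \<noteq> 0" for b and S :: "real set"
    using that by (intro continuous_on_power continuous_on_inverse cC) (auto simp: complex_eq_iff)
  have int1: "G1 b integrable_on {p..q}" if "b \<noteq> 0" for b p q
    unfolding G1_def by (intro integrable_continuous_real scaleC.continuous_on cinv that continuous_on_const)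
  have int2: "G2 b integrable_on {p..q}" if "b \<noteq> 0" for b p q
    unfolding G2_def using that
    by (intro integrable_continuous_real scaleC.continuous_on cinv continuous_on_compose2 [OF vholomorphic_on_continuous [OF vholomorphic_P] cC]) auto
  have J: "jump a (\<lambda>l. P l f2) = (\<lambda>x. jump a (\<lambda>l. inverse l *\<^sub>C f2) x + ((G1 a x - G1 (- a) x) + (G2 a x - G2 (- a) x)))"
    unfolding jump_def G1_def G2_def using a by (subst (1 2) exp) (auto simp: algebra_simps)
  have I: "integral {-t..t} (jump a (\<lambda>l. P l f2)) = integral {-t..t} (jump a (\<lambda>l. inverse l *\<^sub>C f2)) +
    ((integral {-t..t} (G1 a) - integral {-t..t} (G1 (- a))) + (integral {-t..t} (G2 a) - integral {-t..t} (G2 (- a))))" for t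
    unfolding J using a
    by (simp add: integral_add integral_diff jump_inverse_integral(2) int1 int2 integrable_add integrable_diff)
  have "((\<lambda>t. integral {-t..t} (jump a (\<lambda>l. inverse l *\<^sub>C f2)) +
    ((integral {-t..t} (G1 a) - integral {-t..t} (G1 (- a))) + (integral {-t..t} (G2 a) - integral {-t..t} (G2 (- a)))))
    \<longlongrightarrow> (2 * pi) *\<^sub>R f2 + ((0 - 0) + (0 - 0))) at_top"
    unfolding G1_def G2_def using a
    by (intro tendsto_add tendsto_diff jump_inverse_integral(1) line_inverse_square line_integral_tendsto_zero) auto
  then show ?thesis unfolding I by simp
qed

lemma star_shift: "l \<in> \<rho>s \<Longrightarrow> Re l \<noteq> 0 \<Longrightarrow> Qs l (P l x) = B (P l x - Qs l x)"
  using star [of "l + of_real \<mu>" l x] by (simp add: \<rho>s_def Qs_def)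

lemma B_Qs: "l \<in> \<rho>s \<Longrightarrow> B (Qs l x) = Qs l (B x)"
  by (simp add: BQ Qs_def \<rho>s_def)

lemma P_Qs: "Re l \<noteq> 0 \<Longrightarrow> m \<in> \<rho>s \<Longrightarrow> P l (Qs m x) = Qs m (P l x)"
  by (simp add: PQ Qs_def \<rho>s_def)

text \<open>The Dunford integral of (l + \<mu> - A)^-2 against P(l) represents (D - A + \<mu>)^-2,
  which is B^2. By \<open>star_shift\<close> a factor Qs next to P can be exchanged for B at the
  price of a term without P. Such terms are holomorphic across the strip and contribute nothing;
  what remains is B^2 applied to \<open>jump_P_integral\<close>.\<close>

lemma jump_QQP_integral:
  assumes a: "0 < a" "a \<le> c"
  defines "G1 \<equiv> \<lambda>f l. Qs l (Qs l (P l f))"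
  shows "continuous_on UNIV (jump a (G1 f))"
    "((\<lambda>t. integral {-t..t} (jump a (G1 f))) \<longlongrightarrow> (2 * pi) *\<^sub>R B (B f)) at_top"
proof -

  have hol: "vholomorphic_on (G1 f) ({l. Re l \<noteq> 0} \<inter> \<rho>s)" for f
    unfolding G1_def by (intro vholomorphic_Qs vholomorphic_on_subset [OF vholomorphic_P]) auto
  have line: "Complex a x \<in> {l. Re l \<noteq> 0} \<inter> \<rho>s" "Complex (- a) x \<in> {l. Re l \<noteq> 0} \<inter> \<rho>s" for x
    using a by (auto intro: \<rho>s_right)
  have cont: "continuous_on S (jump a (G1 f))" for S f
    by (rule continuous_on_jump [OF hol]) (use line in auto)
  then show "continuous_on UNIV (jump a (G1 f))" .
  have int: "jump a (G1 f) integrable_on {p..q}" for f p q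
    by (rule integrable_continuous_real [OF cont])
  \<comment> \<open>The two factors Qs give decay like 1/x^2, so the limit exists for every f; its
    value is first computed for \<open>P 1 (P 1 f)\<close>.\<close>
  have ex: "\<exists>L. ((\<lambda>t. integral {-t..t} (jump a (G1 f))) \<longlongrightarrow> L) at_top" for f
  proof (rule symmetric_improper_integral [OF cont, where N = N and C = "2 * (C\<^sup>2 * norm f / a)"])
    show "0 < N" by (rule bnds)
    fix x assume x: "N \<le> \<bar>x\<bar>"
    have b: "norm (G1 f (Complex s x)) \<le> C\<^sup>2 * norm f / a / x\<^sup>2" if "\<bar>s\<bar> = a" for s
    proof -
      have "norm (G1 f (Complex s x)) \<le> C\<^sup>2 * norm (P (Complex s x) f) / \<bar>x\<bar>\<^sup>2"
        unfolding G1_def using norm_QsQs_le [of "Complex s x" "P (Complex s x) f"] that a x by auto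
      also have "\<dots> \<le> C\<^sup>2 * (norm f / a) / \<bar>x\<bar>\<^sup>2"
        using norm_P_le [of "Complex s x" f] that a by (intro divide_right_mono mult_left_mono) auto
      finally show ?thesis by simp
    qed
    have "norm (jump a (G1 f) x) \<le> norm (G1 f (Complex a x)) + norm (G1 f (Complex (- a) x))"
      unfolding jump_def by (rule norm_triangle_ineq4)
    with b [of a] b [of "- a"] a show "norm (jump a (G1 f) x) \<le> 2 * (C\<^sup>2 * norm f / a) / x\<^sup>2" by simp
  qed
  have special: "((\<lambda>t. integral {-t..t} (jump a (G1 (P 1 (P 1 f))))) \<longlongrightarrow> (2 * pi) *\<^sub>R B (B (P 1 (P 1 f)))) at_top" for f
  proof -
    define f2 where "f2 = P 1 (P 1 f)"
    define H where "H l = B (B (Qs l f2)) + B (Qs l (Qs l f2))" for l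
    have Bc: "vholomorphic_on (\<lambda>l. B (h l)) U" if "vholomorphic_on h U" for h U
      by (rule vholomorphic_on_apply [OF vholomorphic_on_const B_clinear that])
    have holH: "vholomorphic_on H \<rho>s"
      unfolding H_def by (intro vholomorphic_on_add Bc vholomorphic_Qs vholomorphic_on_const order_refl)
    have eq: "G1 f2 l = B (B (P l f2)) - H l" if "l \<in> {l. Re l \<noteq> 0} \<inter> \<rho>s" for l
    proof -
      have "Qs l (Qs l (P l f2)) = B (Qs l (P l f2) - Qs l (Qs l f2))"
        using that by (simp add: star_shift B_Qs [symmetric] blinfun.diff_right)
      also have "\<dots> = B (B (P l f2 - Qs l f2)) - B (Qs l (Qs l f2))"
        using that by (simp add: star_shift blinfun.diff_right)
      finally show ?thesis by (simp add: G1_def H_def blinfun.diff_right)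
    qed
    have "((\<lambda>t. integral {-t..t} (jump a H)) \<longlongrightarrow> 0) at_top"
    proof (rule jump_integral_tendsto_zero [OF holH open_\<rho>s])
      show "0 \<le> a" using a by simp
      show "x \<in> segs a \<rho>s" for x using a by (auto simp: segs_def intro!: \<rho>s_right)
      fix \<sigma> x :: real assume s: "\<bar>\<sigma>\<bar> \<le> a" and x: "N \<le> \<bar>x\<bar>"
      let ?l = "Complex \<sigma> x" and ?n = "norm B"
      have q: "norm (Qs ?l y) \<le> C / \<bar>x\<bar> * norm y" for y
        using norm_Qs_le [of ?l y] s x a by auto
      have "norm (H ?l) \<le> norm (B (B (Qs ?l f2))) + norm (B (Qs ?l (Qs ?l f2)))"
        unfolding H_def by (rule norm_triangle_ineq)
      also have "\<dots> \<le> ?n * (?n * (C / \<bar>x\<bar> * norm f2)) + ?n * (C / \<bar>x\<bar> * (norm (Qs ?l f2)))"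
        by (intro add_mono order_trans [OF norm_blinfun] mult_left_mono q norm_ge_zero)
      also have "\<dots> \<le> ?n * (?n * (C / \<bar>x\<bar> * norm f2)) + ?n * (C / \<bar>x\<bar> * (C / N * norm f2))"
        using bnds x by (intro add_left_mono mult_left_mono order_trans [OF q] mult_right_mono divide_left_mono) auto
      also have "\<dots> = (?n * ?n * C * norm f2 + ?n * C * (C / N * norm f2)) / \<bar>x\<bar>"
        by (simp add: add_divide_distrib mult.assoc)
      finally show "norm (H ?l) \<le> (?n * ?n * C * norm f2 + ?n * C * (C / N * norm f2)) / \<bar>x\<bar>" .
    qed
    moreover have "((\<lambda>t. B (B (integral {-t..t} (jump a (\<lambda>l. P l f2))))) \<longlongrightarrow> B (B ((2 * pi) *\<^sub>R f2))) at_top"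
      unfolding f2_def by (intro blinfun.tendsto tendsto_const jump_P_integral a)
    ultimately have "((\<lambda>t. B (B (integral {-t..t} (jump a (\<lambda>l. P l f2)))) - integral {-t..t} (jump a H)) \<longlongrightarrow> B (B ((2 * pi) *\<^sub>R f2)) - 0) at_top"
      by (intro tendsto_diff)
    moreover have "B (B (integral {-t..t} (jump a (\<lambda>l. P l f2)))) - integral {-t..t} (jump a H) = integral {-t..t} (jump a (G1 f2))" for t
    proof -
      have iP: "jump a (\<lambda>l. P l f2) integrable_on {-t..t}"
        by (intro integrable_continuous_real continuous_on_jump [OF vholomorphic_P]) (use a in auto)
      have iH: "jump a H integrable_on {-t..t}"
        by (intro integrable_continuous_real continuous_on_jump [OF holH]) (use line in auto)
      have iBP: "(\<lambda>x. B (jump a (\<lambda>l. P l f2) x)) integrable_on {-t..t}"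
        "(\<lambda>x. B (B (jump a (\<lambda>l. P l f2) x))) integrable_on {-t..t}"
        using integrable_linear [OF iP blinfun.bounded_linear_right] integrable_linear [OF integrable_linear [OF iP blinfun.bounded_linear_right] blinfun.bounded_linear_right]
        by (auto simp: o_def)
      have "jump a (G1 f2) = (\<lambda>x. B (B (jump a (\<lambda>l. P l f2) x)) - jump a H x)"
        using line eq by (auto simp: jump_def fun_eq_iff blinfun.diff_right)
      then show ?thesis
        by (simp add: integral_diff iBP iH integral_blinfun iP)
    qed
    ultimately show ?thesis by (simp add: f2_def blinfun.scaleR_right)
  qed
  \<comment> \<open>The operator P(1) is injective and commutes with the integrals, so the limit is
    determined by its image under P(1)^2.\<close>
  obtain L where L: "((\<lambda>t. integral {-t..t} (jump a (G1 f))) \<longlongrightarrow> L) at_top" using ex by blast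
  have P1c: "P 1 (G1 f l) = G1 (P 1 f) l" if "l \<in> {l. Re l \<noteq> 0} \<inter> \<rho>s" for f l
    using that pseudo_resolvent_commute [OF P, of 1 l f] by (simp add: G1_def P_Qs)
  have P1i: "P 1 (integral {-t..t} (jump a (G1 f))) = integral {-t..t} (jump a (G1 (P 1 f)))" for f t
    unfolding integral_blinfun [OF int, symmetric] jump_def
    using line P1c by (intro integral_cong) (auto simp: blinfun.diff_right)
  have "((\<lambda>t. P 1 (P 1 (integral {-t..t} (jump a (G1 f))))) \<longlongrightarrow> P 1 (P 1 L)) at_top"
    by (intro blinfun.tendsto tendsto_const L)
  then have "((\<lambda>t. integral {-t..t} (jump a (G1 (P 1 (P 1 f))))) \<longlongrightarrow> P 1 (P 1 L)) at_top"
    by (simp only: P1i)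
  from tendsto_unique [OF _ this special]
  have "P 1 (P 1 L) = (2 * pi) *\<^sub>R B (B (P 1 (P 1 f)))" by simp
  then have "P 1 (P 1 (L - (2 * pi) *\<^sub>R B (B f))) = 0"
    by (simp add: blinfun.diff_right blinfun.scaleR_right BP)
  then have "P 1 (L - (2 * pi) *\<^sub>R B (B f)) = 0" by (rule P_inj [rotated]) simp
  then have "L - (2 * pi) *\<^sub>R B (B f) = 0" by (rule P_inj [rotated]) simp
  then show "((\<lambda>t. integral {-t..t} (jump a (G1 f))) \<longlongrightarrow> (2 * pi) *\<^sub>R B (B f)) at_top"
    using L by simp
qed

text \<open>Compactness handles |x| < N and the assumption \<open>decay\<close> the rest, so a
  positive width exists even for unbounded S.\<close>

lemma strip_width:
  assumes S: "closed S" and SK: "\<And>x. x \<in> S \<Longrightarrow> Complex 0 x \<in> \<rho>"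
  obtains a where "0 < a" "a \<le> c" "S \<subseteq> segs a \<rho>"
proof -
  let ?K = "(\<lambda>x. Complex 0 x) ` (S \<inter> {-N..N})"
  have "compact ?K"
    by (intro compact_continuous_image continuous_on_Complex continuous_on_const continuous_on_id closed_Int_compact S compact_Icc)
  moreover have "?K \<subseteq> \<rho>" using SK by auto
  ultimately obtain e where e: "0 < e" "(\<Union>z\<in>?K. ball z e) \<subseteq> \<rho>"
    using compact_subset_open_imp_ball_epsilon_subset [of ?K \<rho>] open_\<rho> by blast
  show thesis
  proof (rule that [of "min c (e / 2)"])
    show "0 < min c (e / 2)" "min c (e / 2) \<le> c" using bnds e by auto
    show "S \<subseteq> segs (min c (e / 2)) \<rho>"
    proof
      fix x assume x: "x \<in> S"
      have "Complex \<sigma> x \<in> \<rho>" if s: "\<bar>\<sigma>\<bar> \<le> min c (e / 2)" for \<sigma>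
      proof (cases "N \<le> \<bar>x\<bar>")
        case True
        then show ?thesis using decay [of "Complex \<sigma> x"] s \<mu>_nonneg by auto
      next
        case False
        then have "Complex 0 x \<in> ?K" using x by (intro imageI) auto
        moreover have "Complex \<sigma> x \<in> ball (Complex 0 x) e"
          using s e(1) by (auto simp: dist_norm complex_diff complex_norm)
        ultimately show ?thesis using e(2) by blast
      qed
      then show "x \<in> segs (min c (e / 2)) \<rho>" by (simp add: segs_def)
    qed
  qed
qed

end

context commuting_sum
begin

text \<open>The set W collects the properties that the solution has to inherit from f. The solution
  is built from f by the given operators, by integrals and by one limit, and W is closed under all
  of these.\<close>

lemma existence:
  fixes W :: "'b set"
  assumes \<Lambda>: "closed \<Lambda>" "\<And>x. x \<in> \<Lambda> \<Longrightarrow> Complex 0 x \<in> \<rho>"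
    and F: "vholomorphic_on F {l. Re l \<noteq> 0 \<or> Im l \<notin> \<Lambda>}" "\<And>l. Re l \<noteq> 0 \<Longrightarrow> F l = P l f"
    and W: "subspace W" "closed W" "f \<in> W" "\<And>k g. g \<in> W \<Longrightarrow> k *\<^sub>C g \<in> W"
      "\<And>l g. Re l \<noteq> 0 \<Longrightarrow> g \<in> W \<Longrightarrow> P l g \<in> W"
      "\<And>m g. m \<in> \<rho> \<Longrightarrow> g \<in> W \<Longrightarrow> Q m g \<in> W" "\<And>g. g \<in> W \<Longrightarrow> B g \<in> W"
  shows "\<exists>w\<in>W. w = B f + \<mu> *\<^sub>R B w"
proof -
  define E where "E = {l. Re l \<noteq> 0 \<or> Im l \<notin> \<Lambda>}"
  have openE: "open E"
  proof -
    have "E = {l. Re l \<noteq> 0} \<union> Im -` (- \<Lambda>)" by (auto simp: E_def)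
    moreover have "open (Im -` (- \<Lambda>))"
      using \<Lambda>(1) by (intro open_vimage continuous_intros) (simp add: open_Compl)
    ultimately show ?thesis using open_P_plane by auto
  qed
  have F': "vholomorphic_on F E" using F(1) by (simp add: E_def)
  \<comment> \<open>On the imaginary axis F is a limit of values P(l) f taken to the right of
    it.\<close>
  have FW: "F l \<in> W" if l: "l \<in> E" for l
  proof (cases "Re l = 0")
    case True
    define s where "s n = l + of_real (inverse (real (Suc n)))" for n
    have s: "s \<longlonglongrightarrow> l"
      unfolding s_def using tendsto_add [OF tendsto_const [of l] tendsto_of_real [OF LIMSEQ_inverse_real_of_nat]] by simp
    have "(\<lambda>n. F (s n)) \<longlonglongrightarrow> F l"
      using vholomorphic_on_continuous [OF F'] openE l s by (auto simp: continuous_on_eq_continuous_at isCont_tendsto_compose)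
    moreover have "F (s n) \<in> W" for n using True by (simp add: F(2) W s_def)
    ultimately show ?thesis
      by (intro closed_sequentially [OF W(2), of "\<lambda>n. F (s n)" "F l"]) auto
  qed (simp add: F(2) W)
  define K where "K = {x. Complex 0 x \<notin> \<rho>}"
  have KN: "\<bar>x\<bar> < N" if "x \<in> K" for x
  proof (rule ccontr)
    assume "\<not> \<bar>x\<bar> < N"
    then show False using decay [of "Complex 0 x"] that bnds(1) \<mu>_nonneg by (simp add: K_def)
  qed
  have "closed K"
  proof -
    have "K = (\<lambda>x. Complex 0 x) -` (- \<rho>)" by (auto simp: K_def)
    moreover have "closed ((\<lambda>x. Complex 0 x) -` (- \<rho>))"
      using open_\<rho> by (intro closed_vimage continuous_on_Complex continuous_on_const continuous_on_id) (simp add: closed_Compl)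
    ultimately show ?thesis by simp
  qed
  moreover have "bounded K" using KN by (auto simp: bounded_iff intro!: exI [of _ N] less_imp_le)
  ultimately have Kc: "compact K" by (simp add: compact_eq_bounded_closed)
  \<comment> \<open>Including the points with N \<le> |x| makes \<eta> equal to 1 near infinity, so
    that 1 - \<eta> is carried by |x| < N.\<close>
  define L where "L = \<Lambda> \<union> {x. N \<le> \<bar>x\<bar>}"
  have Lc: "closed L" unfolding L_def
    by (intro closed_Un \<Lambda>(1) closed_Collect_le continuous_intros)
  have KL: "K \<inter> L = {}"
  proof -
    have "x \<notin> L" if "x \<in> K" for x
      using KN [OF that] that \<Lambda>(2) [of x] by (auto simp: K_def L_def)
    then show ?thesis by blast
  qed
  obtain \<eta> \<eta>' SA SB where \<eta>: "\<And>x. (\<eta> has_real_derivative \<eta>' x) (at x)" "continuous_on UNIV \<eta>'"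
    "closed SA" "closed SB" "SA \<inter> K = {}" "SB \<inter> L = {}"
    "\<And>x. x \<notin> SA \<Longrightarrow> \<eta> x = 0 \<and> \<eta>' x = (0::real)" "\<And>x. x \<notin> SB \<Longrightarrow> \<eta> x = 1 \<and> \<eta>' x = 0"
    by (rule smooth_cutoff [OF Kc Lc KL]) blast
  have \<eta>c: "continuous_on UNIV \<eta>"
    using \<eta>(1) by (meson DERIV_isCont continuous_at_imp_continuous_on)
  have SBL: "x \<notin> L" if "x \<in> SB" for x using \<eta>(6) that by blast
  have SBN: "\<bar>x\<bar> < N" if "x \<in> SB" for x using SBL [OF that] by (simp add: L_def)
  obtain a where a: "0 < a" "a \<le> c" "SA \<subseteq> segs a \<rho>"
  proof (rule strip_width [OF \<eta>(3)])
    show "Complex 0 x \<in> \<rho>" if "x \<in> SA" for x using \<eta>(5) that by (auto simp: K_def)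
  qed blast
  have a0: "0 \<le> a" using a by simp
  have seg_s: "x \<in> segs a \<rho>s" for x using a by (auto simp: segs_def intro!: \<rho>s_right)
  have seg_E: "x \<in> segs a E" if "x \<in> SB" for x using SBL [OF that] by (simp add: segs_def E_def L_def)
  \<comment> \<open>\<open>G0\<close> may be singular on \<Lambda> and on \<open>K\<close>,
    \<open>G1\<close> only on \<Lambda> and \<open>G2\<close> only on \<open>K\<close>. As \<eta> is
    1 near \<Lambda> and 0 near \<open>K\<close>, it may be replaced by 1 for \<open>G1\<close> and
    by 0 for \<open>G2\<close>.\<close>
  define G0 where "G0 l = Qs l (Qs l (Q l (F l)))" for l
  define G1 where "G1 l = Qs l (Qs l (F l))" for l
  define G2 where "G2 l = Qs l (Qs l (Q l f))" for l
  let ?U0 = "\<rho> \<inter> \<rho>s \<inter> E" and ?U1 = "\<rho>s \<inter> E" and ?U2 = "\<rho> \<inter> \<rho>s"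
  have U: "open ?U0" "open ?U1" "open ?U2" using open_\<rho> open_\<rho>s openE by auto
  have h0: "vholomorphic_on G0 ?U0" and h1: "vholomorphic_on G1 ?U1" and h2: "vholomorphic_on G2 ?U2"
    unfolding G0_def G1_def G2_def
    by (intro vholomorphic_Qs vholomorphic_Q vholomorphic_on_const vholomorphic_on_subset [OF F']; auto)+
  have lines: "Complex s x \<in> E" if "\<bar>s\<bar> = a" for s x using a that by (auto simp: E_def)
  \<comment> \<open>Where G is holomorphic on the whole segment at height x this is -i times the
    derivative of \<eta> hor. The second term lives on \<open>SA \<inter> SB\<close> only, where the
    segment avoids both sets of singularities; elsewhere the value of \<open>hor\<close> is
    multiplied by 0.\<close>
  define \<Phi> where "\<Phi> G x = \<eta> x *\<^sub>R jump a G x - \<eta>' x *\<^sub>R (\<i> *\<^sub>C hor a G x)" for G :: "complex \<Rightarrow> 'b" and x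
  have \<eta>S: "\<eta> x = 0" if "x \<notin> SA" for x using \<eta>(7) that by blast
  have \<eta>'S: "\<eta>' x = 0" if "x \<notin> SA \<inter> SB" for x using \<eta>(7,8) that by blast
  have \<Phi>_cont: "continuous_on UNIV (\<Phi> G)"
    if G: "vholomorphic_on G V" "open V" and V: "\<And>x s. x \<in> SA \<Longrightarrow> \<bar>s\<bar> = a \<Longrightarrow> Complex s x \<in> V"
      "\<And>x. x \<in> SA \<inter> SB \<Longrightarrow> x \<in> segs a V" for G V
  proof -
    let ?O = "{x. Complex a x \<in> V} \<inter> {x. Complex (- a) x \<in> V}"
    have "open ?O"
      using open_vimage [OF G(2), of "\<lambda>x. Complex a x"] open_vimage [OF G(2), of "\<lambda>x. Complex (- a) x"]
      by (auto simp: vimage_def continuous_on_Complex)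
    then have 1: "continuous_on UNIV (\<lambda>x. \<eta> x *\<^sub>R jump a G x)"
      using V(1) a0 by (intro cutoff_continuous [OF \<eta>c \<eta>(3), where V = ?O] continuous_on_jump [OF G(1)] \<eta>S) auto
    have "continuous_on UNIV (\<lambda>x. \<eta>' x *\<^sub>R hor a G x)"
      using V(2) by (intro cutoff_continuous [OF \<eta>(2) closed_Int [OF \<eta>(3,4)], where V = "segs a V"] continuous_on_hor G a0 open_segs \<eta>'S) auto
    then have 2: "continuous_on UNIV (\<lambda>x. \<i> *\<^sub>C (\<eta>' x *\<^sub>R hor a G x))"
      by (intro scaleC.continuous_on continuous_on_const)
    have "\<Phi> G = (\<lambda>x. \<eta> x *\<^sub>R jump a G x - \<i> *\<^sub>C (\<eta>' x *\<^sub>R hor a G x))"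
      by (simp add: \<Phi>_def scaleC.scaleR_right fun_eq_iff)
    then show ?thesis using 1 2 by (simp add: continuous_on_diff)
  qed
  have V0: "Complex s x \<in> ?U0" if "x \<in> SA" "\<bar>s\<bar> = a" for x s
    using lines [OF that(2)] a(3) seg_s [of x] that by (auto simp: segs_def)
  have V0': "x \<in> segs a ?U0" if "x \<in> SA \<inter> SB" for x
    using a(3) seg_s [of x] seg_E [of x] that by (auto simp: segs_def)
  have c0: "continuous_on UNIV (\<Phi> G0)"
    by (rule \<Phi>_cont [OF h0 U(1) V0 V0'])
  have c1: "continuous_on UNIV (\<Phi> G1)"
    by (rule \<Phi>_cont [OF h1 U(2)]) (use V0 V0' in \<open>auto simp: segs_def\<close>)
  have c2: "continuous_on UNIV (\<Phi> G2)"
    by (rule \<Phi>_cont [OF h2 U(3)]) (use V0 V0' in \<open>auto simp: segs_def\<close>)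
  have int: "\<Phi> G integrable_on {p..q}" if "continuous_on UNIV (\<Phi> G)" for G p q
    using that by (intro integrable_continuous_real) (rule continuous_on_subset, auto)
  have \<Phi>W: "\<Phi> G0 x \<in> W" for x
  proof -
    have GW: "G0 l \<in> W" if "l \<in> ?U0" for l
      using that FW [of l] by (auto simp: G0_def Qs_def \<rho>s_def intro!: W)
    have J: "\<eta> x *\<^sub>R jump a G0 x \<in> W"
    proof (cases "x \<in> SA")
      case True
      then show ?thesis
        unfolding jump_def using V0 [OF True, of a] V0 [OF True, of "- a"] a0
        by (intro subspace_scale subspace_diff W GW) auto
    qed (use W(1) in \<open>simp add: \<eta>S subspace_0\<close>)
    have H: "\<eta>' x *\<^sub>R (\<i> *\<^sub>C hor a G0 x) \<in> W"
    proof (cases "x \<in> SA \<inter> SB")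
      case True
      have "continuous_on {-a..a} (\<lambda>\<sigma>. G0 (Complex \<sigma> x))"
        by (rule continuous_on_compose2 [OF vholomorphic_on_continuous [OF h0]])
          (use V0' [OF True] in \<open>auto simp: segs_def intro!: continuous_on_Complex continuous_on_const continuous_on_id\<close>)
      then have "hor a G0 x \<in> W"
        unfolding hor_def using V0' [OF True]
        by (intro integral_in_closed_subspace integrable_continuous_real W GW) (auto simp: segs_def)
      then show ?thesis by (intro subspace_scale W)
    qed (use W(1) \<eta>'S in \<open>auto simp: subspace_0\<close>)
    show ?thesis unfolding \<Phi>_def using J H by (rule subspace_diff [OF W(1)])
  qed
  \<comment> \<open>This is \<open>star\<close> with n = l, where the coefficient \<mu> + n - l
    reduces to \<mu>; the points on the axis follow by continuity.\<close>
  have pt: "G0 l - \<mu> *\<^sub>R B (G0 l) = B (G1 l - G2 l)" if "l \<in> ?U0" for l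
  proof (rule agree_off_imaginary_axis [OF U(1) _ _ _ that])
    show "continuous_on ?U0 (\<lambda>l. G0 l - \<mu> *\<^sub>R B (G0 l))"
      by (intro continuous_intros vholomorphic_on_continuous [OF h0])
    show "continuous_on ?U0 (\<lambda>l. B (G1 l - G2 l))"
      by (intro continuous_intros vholomorphic_on_continuous vholomorphic_on_subset [OF h1] vholomorphic_on_subset [OF h2]) auto
    fix l assume l: "l \<in> ?U0" "Re l \<noteq> 0"
    have "Q l (P l f) = B (P l f - Q l f + of_real \<mu> *\<^sub>C Q l (P l f))"
      using star [of l l f] l by simp
    then have "Q l (P l f) = B (P l f - Q l f) + \<mu> *\<^sub>R B (Q l (P l f))"
      by (simp only: blinfun.add_right scaleC_of_real blinfun.scaleR_right)
    then have "Q l (P l f) - \<mu> *\<^sub>R B (Q l (P l f)) = B (P l f - Q l f)"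
      by (metis add_diff_cancel_right')
    then have "Qs l (Qs l (Q l (P l f) - \<mu> *\<^sub>R B (Q l (P l f)))) = Qs l (Qs l (B (P l f - Q l f)))" by simp
    then show "G0 l - \<mu> *\<^sub>R B (G0 l) = B (G1 l - G2 l)"
      using l by (simp add: G0_def G1_def G2_def F(2) B_Qs blinfun.diff_right blinfun.scaleR_right)
  qed
  have \<Phi>pt: "\<Phi> G0 x - \<mu> *\<^sub>R B (\<Phi> G0 x) = B (\<Phi> G1 x - \<Phi> G2 x)" for x
  proof -
    have J: "jump a G0 x - \<mu> *\<^sub>R B (jump a G0 x) = B (jump a G1 x - jump a G2 x)" if "x \<in> SA"
    proof -
      have e: "G0 (Complex s x) - \<mu> *\<^sub>R B (G0 (Complex s x)) = B (G1 (Complex s x)) - B (G2 (Complex s x))" if "\<bar>s\<bar> = a" for s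
        using pt [OF V0 [OF \<open>x \<in> SA\<close> that]] by (simp add: blinfun.diff_right)
      have "jump a G0 x - \<mu> *\<^sub>R B (jump a G0 x) =
        (G0 (Complex a x) - \<mu> *\<^sub>R B (G0 (Complex a x))) - (G0 (Complex (- a) x) - \<mu> *\<^sub>R B (G0 (Complex (- a) x)))"
        by (simp add: jump_def blinfun.diff_right scaleR_diff_right)
      also have "\<dots> = B (jump a G1 x - jump a G2 x)"
        using e [of a] e [of "- a"] a0 by (simp add: jump_def blinfun.diff_right)
      finally show ?thesis .
    qed
    have H: "hor a G0 x - \<mu> *\<^sub>R B (hor a G0 x) = B (hor a G1 x - hor a G2 x)" if "x \<in> SA \<inter> SB"
    proof -
      have sx: "Complex \<sigma> x \<in> ?U0" if "\<sigma> \<in> {-a..a}" for \<sigma> using V0' [OF \<open>x \<in> SA \<inter> SB\<close>] that by (auto simp: segs_def)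
      have ig: "(\<lambda>\<sigma>. G (Complex \<sigma> x)) integrable_on {-a..a}" if "vholomorphic_on G V" "?U0 \<subseteq> V" for G :: "complex \<Rightarrow> 'b" and V
        by (intro integrable_continuous_real continuous_on_compose2 [OF vholomorphic_on_continuous [OF that(1)]]
            continuous_on_Complex continuous_on_const continuous_on_id) (use sx that(2) in auto)
      have i: "(\<lambda>\<sigma>. G0 (Complex \<sigma> x)) integrable_on {-a..a}" "(\<lambda>\<sigma>. G1 (Complex \<sigma> x)) integrable_on {-a..a}"
        "(\<lambda>\<sigma>. G2 (Complex \<sigma> x)) integrable_on {-a..a}"
        by (rule ig [OF h0], simp, rule ig [OF h1], force, rule ig [OF h2], force)
      have iB: "(\<lambda>\<sigma>. B (G0 (Complex \<sigma> x))) integrable_on {-a..a}"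
        using integrable_linear [OF i(1) blinfun.bounded_linear_right] by (simp add: o_def)
      have "hor a G0 x - \<mu> *\<^sub>R B (hor a G0 x) = integral {-a..a} (\<lambda>\<sigma>. G0 (Complex \<sigma> x) - \<mu> *\<^sub>R B (G0 (Complex \<sigma> x)))"
        unfolding hor_def using i iB by (simp add: integral_diff integral_cmul integrable_cmul integral_blinfun)
      also have "\<dots> = integral {-a..a} (\<lambda>\<sigma>. B (G1 (Complex \<sigma> x) - G2 (Complex \<sigma> x)))"
        by (intro integral_cong pt sx)
      also have "\<dots> = B (hor a G1 x - hor a G2 x)"
        unfolding hor_def using i by (simp only: integral_blinfun integrable_diff integral_diff)
      finally show ?thesis .
    qed
    have J': "\<eta> x *\<^sub>R (jump a G0 x - \<mu> *\<^sub>R B (jump a G0 x)) = \<eta> x *\<^sub>R B (jump a G1 x - jump a G2 x)"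
      using J \<eta>S by (cases "x \<in> SA") auto
    have H': "\<eta>' x *\<^sub>R (\<i> *\<^sub>C (hor a G0 x - \<mu> *\<^sub>R B (hor a G0 x))) = \<eta>' x *\<^sub>R (\<i> *\<^sub>C B (hor a G1 x - hor a G2 x))"
      using H \<eta>'S by (cases "x \<in> SA \<inter> SB") auto
    have "\<Phi> G0 x - \<mu> *\<^sub>R B (\<Phi> G0 x) = \<eta> x *\<^sub>R (jump a G0 x - \<mu> *\<^sub>R B (jump a G0 x)) -
      \<eta>' x *\<^sub>R (\<i> *\<^sub>C (hor a G0 x - \<mu> *\<^sub>R B (hor a G0 x)))"
      unfolding \<Phi>_def by (simp add: blinfun.diff_right blinfun.scaleR_right clinear_opD [OF B_clinear]
        scaleC.diff_right scaleC.scaleR_right scaleR_diff_right mult.commute algebra_simps)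
    also have "\<dots> = B (\<Phi> G1 x - \<Phi> G2 x)"
      unfolding J' H' \<Phi>_def by (simp add: blinfun.add_right blinfun.diff_right blinfun.scaleR_right clinear_opD [OF B_clinear]
        scaleC.diff_right scaleR_diff_right algebra_simps)
    finally show ?thesis .
  qed
  \<comment> \<open>\<open>G2\<close> is holomorphic across the strip over all of \<open>SA\<close>,
    so its integral reduces to horizontal integrals at the heights t and - t, which decay.\<close>
  have lim2: "((\<lambda>t. integral {-t..t} (\<Phi> G2)) \<longlongrightarrow> 0) at_top"
  proof -
    have b2: "norm (G2 (Complex \<sigma> x)) \<le> (C / N * (C / N * (C * norm f))) / \<bar>x\<bar>" if "\<bar>\<sigma>\<bar> \<le> a" "N \<le> \<bar>x\<bar>" for \<sigma> x
    proof -
      let ?l = "Complex \<sigma> x"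
      have q: "norm (Qs ?l y) \<le> C / N * norm y" for y
        using bnds that a by (intro order_trans [OF norm_Qs_le] mult_right_mono divide_left_mono) auto
      have "norm (G2 ?l) \<le> C / N * (C / N * (C / \<bar>x\<bar> * norm f))"
        unfolding G2_def using norm_Q_le [of ?l f] bnds that a
        by (intro order_trans [OF q] mult_left_mono) auto
      then show ?thesis by simp
    qed
    have sN: "x \<in> segs a ?U2" if "N \<le> \<bar>x\<bar>" for x
    proof -
      have "x \<notin> SB" using SBN [of x] that by auto
      then have "\<eta> x \<noteq> 0" using \<eta>(8) by auto
      then have "x \<in> SA" using \<eta>S by blast
      then show ?thesis using a(3) seg_s [of x] by (auto simp: segs_def)
    qed
    have z: "((\<lambda>t. (- \<i>) *\<^sub>C (hor a G2 t - hor a G2 (- t))) \<longlongrightarrow> (- \<i>) *\<^sub>C (0 - 0)) at_top"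
      by (intro tendsto_intros scaleC.tendsto hor_tendsto_zero [OF h2 a0 sN b2])
    have "\<forall>\<^sub>F t in at_top. (- \<i>) *\<^sub>C (hor a G2 t - hor a G2 (- t)) = integral {-t..t} (\<Phi> G2)"
      using eventually_ge_at_top [of N]
    proof eventually_elim
      case (elim t)
      have t: "- t \<le> t" using elim bnds by simp
      have S2: "SA \<subseteq> segs a ?U2" using a(3) seg_s by (auto simp: segs_def)
      have "((\<lambda>x. \<eta> x *\<^sub>R (\<i> *\<^sub>C jump a G2 x) + \<eta>' x *\<^sub>R hor a G2 x) has_integral
        (\<eta> t *\<^sub>R hor a G2 t - \<eta> (- t) *\<^sub>R hor a G2 (- t))) {-t..t}"
        by (rule cutoff_by_parts [OF \<eta>(1) \<eta>(3) S2 \<eta>(7) hor_derivative [OF h2 U(3) a0] t])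
      moreover have "\<eta> t = 1" "\<eta> (- t) = 1" using \<eta>(8) SBN [of t] SBN [of "- t"] elim by force+
      moreover have "(\<lambda>x. \<eta> x *\<^sub>R (\<i> *\<^sub>C jump a G2 x) + \<eta>' x *\<^sub>R hor a G2 x) = (\<lambda>x. \<i> *\<^sub>C \<Phi> G2 x)"
        by (simp add: \<Phi>_def fun_eq_iff scaleC.diff_right scaleC.scaleR_right scaleC_scaleC scaleC_minus1)
      ultimately have "\<i> *\<^sub>C integral {-t..t} (\<Phi> G2) = hor a G2 t - hor a G2 (- t)"
        using integral_scaleC [where c = "\<i>", OF int [OF c2, of "- t" t]] by (simp add: integral_unique)
      then have "(- \<i>) *\<^sub>C (\<i> *\<^sub>C integral {-t..t} (\<Phi> G2)) = (- \<i>) *\<^sub>C (hor a G2 t - hor a G2 (- t))" by simp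
      then show ?case by (simp add: scaleC_scaleC)
    qed
    then show ?thesis using z by (simp add: filterlim_cong)
  qed
  have Jeq: "jump a G1 = jump a (\<lambda>l. Qs l (Qs l (P l f)))"
    using a by (simp add: jump_def G1_def F(2) fun_eq_iff)
  \<comment> \<open>The difference of the jump and \<Phi> is the same expression formed with 1 -
    \<eta>. Over \<open>SB\<close> the function \<open>G1\<close> is holomorphic across the strip,
    so this difference is an exact derivative, and its end values vanish because \<eta> is 1 there.
    Without the cutoff the limit is known from \<open>jump_QQP_integral\<close>.\<close>
  have lim1: "((\<lambda>t. integral {-t..t} (\<Phi> G1)) \<longlongrightarrow> (2 * pi) *\<^sub>R B (B f)) at_top"
  proof (rule Lim_transform_eventually [OF jump_QQP_integral(2) [OF a(1,2)]])
    show "\<forall>\<^sub>F t in at_top. integral {-t..t} (jump a (\<lambda>l. Qs l (Qs l (P l f)))) = integral {-t..t} (\<Phi> G1)"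
      using eventually_ge_at_top [of N]
    proof eventually_elim
      case (elim t)
      have t: "- t \<le> t" using elim bnds by simp
      have S1: "SB \<subseteq> segs a ?U1" using seg_E seg_s by (auto simp: segs_def)
      have d1: "((\<lambda>x. 1 - \<eta> x) has_real_derivative - \<eta>' x) (at x)" for x
        using \<eta>(1) by (auto intro!: derivative_eq_intros)
      have "((\<lambda>x. (1 - \<eta> x) *\<^sub>R (\<i> *\<^sub>C jump a G1 x) + (- \<eta>' x) *\<^sub>R hor a G1 x) has_integral
        ((1 - \<eta> t) *\<^sub>R hor a G1 t - (1 - \<eta> (- t)) *\<^sub>R hor a G1 (- t))) {-t..t}"
        by (rule cutoff_by_parts [OF d1 \<eta>(4) S1 _ hor_derivative [OF h1 U(2) a0] t]) (use \<eta>(8) in auto)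
      moreover have "\<eta> t = 1" "\<eta> (- t) = 1" using \<eta>(8) SBN [of t] SBN [of "- t"] elim by force+
      moreover have "(\<lambda>x. (1 - \<eta> x) *\<^sub>R (\<i> *\<^sub>C jump a G1 x) + (- \<eta>' x) *\<^sub>R hor a G1 x) = (\<lambda>x. \<i> *\<^sub>C (jump a G1 x - \<Phi> G1 x))"
        by (simp add: \<Phi>_def fun_eq_iff scaleC.diff_right scaleC.scaleR_right scaleC_scaleC scaleC_minus1 scaleR_diff_left)
      moreover have i1: "jump a G1 integrable_on {-t..t}"
        unfolding Jeq using jump_QQP_integral(1) [OF a(1,2)] by (intro integrable_continuous_real) (rule continuous_on_subset, auto)
      ultimately have "\<i> *\<^sub>C (integral {-t..t} (jump a G1) - integral {-t..t} (\<Phi> G1)) = 0"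
        using integral_scaleC [where c = "\<i>", OF integrable_diff [OF i1 int [OF c1]]] by (simp add: integral_unique integral_diff i1 int [OF c1])
      then have "(- \<i>) *\<^sub>C (\<i> *\<^sub>C (integral {-t..t} (jump a G1) - integral {-t..t} (\<Phi> G1))) = 0" by simp
      then show ?case by (simp add: scaleC_scaleC Jeq)
    qed
  qed
  have "\<exists>v. ((\<lambda>t. integral {-t..t} (\<Phi> G0)) \<longlongrightarrow> v) at_top"
  proof (rule symmetric_improper_integral [OF c0, where N = N and C = "2 * (C\<^sup>2 * (C / N * (norm f / a)))"])
    show "0 < N" by (rule bnds)
    fix x assume x: "N \<le> \<bar>x\<bar>"
    have b: "norm (G0 (Complex s x)) \<le> C\<^sup>2 * (C / N * (norm f / a)) / x\<^sup>2" if "\<bar>s\<bar> = a" for s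
    proof -
      let ?l = "Complex s x"
      have r: "Re ?l \<noteq> 0" using that a by auto
      have "norm (Q ?l (P ?l f)) \<le> C / \<bar>x\<bar> * norm (P ?l f)"
        using norm_Q_le [of ?l] that a x by auto
      also have "\<dots> \<le> C / N * (norm f / a)"
        using norm_P_le [OF r, of f] that bnds x by (intro mult_mono divide_left_mono) auto
      finally have q: "norm (Q ?l (P ?l f)) \<le> C / N * (norm f / a)" .
      have "norm (G0 ?l) \<le> C\<^sup>2 * norm (Q ?l (P ?l f)) / \<bar>x\<bar>\<^sup>2"
        unfolding G0_def F(2) [OF r] using norm_QsQs_le [of ?l] that a x by auto
      also have "\<dots> \<le> C\<^sup>2 * (C / N * (norm f / a)) / \<bar>x\<bar>\<^sup>2"
        using q by (intro divide_right_mono mult_left_mono) auto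
      finally show ?thesis by simp
    qed
    have "x \<notin> SB" using SBN [of x] x by auto
    then have "\<Phi> G0 x = jump a G0 x" using \<eta>(8) by (simp add: \<Phi>_def)
    moreover have "norm (jump a G0 x) \<le> norm (G0 (Complex a x)) + norm (G0 (Complex (- a) x))"
      unfolding jump_def by (rule norm_triangle_ineq4)
    moreover have "\<dots> \<le> C\<^sup>2 * (C / N * (norm f / a)) / x\<^sup>2 + C\<^sup>2 * (C / N * (norm f / a)) / x\<^sup>2"
      using a0 by (intro add_mono b) auto
    ultimately have "norm (\<Phi> G0 x) \<le> C\<^sup>2 * (C / N * (norm f / a)) / x\<^sup>2 + C\<^sup>2 * (C / N * (norm f / a)) / x\<^sup>2"
      by (metis order_trans)
    then show "norm (\<Phi> G0 x) \<le> 2 * (C\<^sup>2 * (C / N * (norm f / a))) / x\<^sup>2"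
      by (simp only: mult_2 add_divide_distrib)
  qed
  then obtain v where v: "((\<lambda>t. integral {-t..t} (\<Phi> G0)) \<longlongrightarrow> v) at_top" by blast
  have vW: "v \<in> W"
  proof (rule Lim_in_closed_set [OF W(2) _ _ v])
    show "\<forall>\<^sub>F t in at_top. integral {-t..t} (\<Phi> G0) \<in> W"
      by (intro always_eventually allI integral_in_closed_subspace int c0 W \<Phi>W)
  qed simp
  have I: "integral {-t..t} (\<Phi> G0) - \<mu> *\<^sub>R B (integral {-t..t} (\<Phi> G0)) = B (integral {-t..t} (\<Phi> G1) - integral {-t..t} (\<Phi> G2))" for t
  proof -
    have iB: "(\<lambda>x. B (\<Phi> G0 x)) integrable_on {-t..t}"
      using integrable_linear [OF int [OF c0] blinfun.bounded_linear_right] by (simp add: o_def)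
    have "integral {-t..t} (\<Phi> G0) - \<mu> *\<^sub>R B (integral {-t..t} (\<Phi> G0)) = integral {-t..t} (\<lambda>x. \<Phi> G0 x - \<mu> *\<^sub>R B (\<Phi> G0 x))"
      using int [OF c0] iB by (simp add: integral_diff integral_cmul integrable_cmul integral_blinfun)
    also have "\<dots> = B (integral {-t..t} (\<Phi> G1) - integral {-t..t} (\<Phi> G2))"
      unfolding \<Phi>pt using int [OF c1] int [OF c2] by (simp only: integral_blinfun integrable_diff integral_diff)
    finally show ?thesis .
  qed
  have "((\<lambda>t. integral {-t..t} (\<Phi> G0) - \<mu> *\<^sub>R B (integral {-t..t} (\<Phi> G0))) \<longlongrightarrow> v - \<mu> *\<^sub>R B v) at_top"
    by (intro tendsto_intros v)
  moreover have "((\<lambda>t. integral {-t..t} (\<Phi> G0) - \<mu> *\<^sub>R B (integral {-t..t} (\<Phi> G0))) \<longlongrightarrow> B ((2 * pi) *\<^sub>R B (B f) - 0)) at_top"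
    unfolding I by (intro tendsto_intros lim1 lim2)
  ultimately have "v - \<mu> *\<^sub>R B v = B ((2 * pi) *\<^sub>R B (B f) - 0)" by (rule tendsto_unique [rotated]) simp
  then have vB: "v - \<mu> *\<^sub>R B v = (2 * pi) *\<^sub>R B (B (B f))" by (simp add: blinfun.scaleR_right)
  \<comment> \<open>This is (D - A)^-1 B^2 f, normalized so that u - \<mu> B u = B^3 f.\<close>
  define u where "u = (1 / (2 * pi)) *\<^sub>R v"
  have uW: "u \<in> W" unfolding u_def using W vW by (intro subspace_scale)
  have uB: "u = \<mu> *\<^sub>R B u + B (B (B f))"
  proof -
    have "(1 / (2 * pi)) *\<^sub>R (v - \<mu> *\<^sub>R B v) = B (B (B f))" using vB by simp
    moreover have "u - \<mu> *\<^sub>R B u = (1 / (2 * pi)) *\<^sub>R (v - \<mu> *\<^sub>R B v)"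
      by (simp add: u_def blinfun.scaleR_right scaleR_diff_right mult.commute)
    ultimately have "u - \<mu> *\<^sub>R B u = B (B (B f))" by simp
    then show ?thesis by (simp add: diff_eq_eq add.commute)
  qed
  \<comment> \<open>Iterating w = B f + \<mu> B w once leaves the remainder \<mu>^2 B^2 w, and u
    stands for B^2 w.\<close>
  define w where "w = B f + \<mu> *\<^sub>R B (B f) + (\<mu> * \<mu>) *\<^sub>R u"
  have "w \<in> W" unfolding w_def using W uW by (intro subspace_add subspace_scale) auto
  moreover have "w = B f + \<mu> *\<^sub>R B w"
  proof -
    have "\<mu> *\<^sub>R B w = \<mu> *\<^sub>R B (B f) + (\<mu> * \<mu>) *\<^sub>R (\<mu> *\<^sub>R B u + B (B (B f)))"
      unfolding w_def by (simp add: blinfun.add_right blinfun.scaleR_right scaleR_add_right mult.commute mult.left_commute add.assoc)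
    then have "\<mu> *\<^sub>R B w = \<mu> *\<^sub>R B (B f) + (\<mu> * \<mu>) *\<^sub>R u" using uB by simp
    then show ?thesis by (simp add: w_def add.assoc)
  qed
  ultimately show ?thesis by blast
qed

end

section \<open>The quotient space and its derivative\<close>

lemma BUC_diff: "f \<in> BUC \<Longrightarrow> g \<in> BUC \<Longrightarrow> (\<lambda>t. f t - g t) \<in> BUC"
  for f :: "real \<Rightarrow> 'a::complex_normed_vector"
  using BUC_add [OF _ BUC_scaleC [of g "-1"], of f] by (simp add: scaleC_minus1)

lemma C0_diff: "f \<in> C0 \<Longrightarrow> g \<in> C0 \<Longrightarrow> (\<lambda>t. f t - g t) \<in> C0"
  for f :: "real \<Rightarrow> 'a::complex_normed_vector"
  using C0_add [OF _ C0_uminus, of f g] by simp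

lemma C0_BUC: "f \<in> C0 \<Longrightarrow> f \<in> BUC"
  by (simp add: C0_def)

lemma BUC_continuous: "f \<in> BUC \<Longrightarrow> S \<subseteq> {0..} \<Longrightarrow> continuous_on S f"
  unfolding BUC_def by (auto intro: continuous_on_subset uniformly_continuous_imp_continuous)

lemma BUC_bound: "f \<in> BUC \<Longrightarrow> \<exists>M\<ge>0. \<forall>t\<ge>0. norm (f t) \<le> M"
  by (rule exI [of _ "sup_norm f"]) (simp add: norm_le_sup_norm sup_norm_nonneg)

lemma BUC_dist: "f \<in> BUC \<Longrightarrow> 0 < e \<Longrightarrow> \<exists>d>0. \<forall>s\<ge>0. \<forall>t\<ge>0. \<bar>s - t\<bar> < d \<longrightarrow> norm (f s - f t) < e"
proof -
  assume "f \<in> BUC" "0 < e"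
  then obtain d where "0 < d" and d: "\<And>s t. s \<in> {0..} \<Longrightarrow> t \<in> {0..} \<Longrightarrow> dist t s < d \<Longrightarrow> dist (f t) (f s) < e"
    unfolding BUC_def uniformly_continuous_on_def by blast
  have "norm (f s - f t) < e" if "0 \<le> s" "0 \<le> t" "\<bar>s - t\<bar> < d" for s t
    using d [of t s] that by (simp add: dist_norm dist_real_def)
  with \<open>0 < d\<close> show ?thesis by blast
qed

lemma BUC_I:
  fixes f :: "real \<Rightarrow> 'a::real_normed_vector"
  assumes "\<And>e. 0 < e \<Longrightarrow> \<exists>d>0. \<forall>s\<ge>0. \<forall>t\<ge>0. \<bar>s - t\<bar> < d \<longrightarrow> norm (f s - f t) < e"
    and "\<And>t. 0 \<le> t \<Longrightarrow> norm (f t) \<le> M"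
  shows "f \<in> BUC"
  unfolding BUC_def uniformly_continuous_on_def
proof (intro CollectI conjI allI impI)
  fix e :: real assume "0 < e"
  from assms(1) [OF this]
  obtain d where "0 < d" and d: "\<And>s t. 0 \<le> s \<Longrightarrow> 0 \<le> t \<Longrightarrow> \<bar>s - t\<bar> < d \<Longrightarrow> norm (f s - f t) < e"
    by metis
  then show "\<exists>d>0. \<forall>x\<in>{0..}. \<forall>x'\<in>{0..}. dist x' x < d \<longrightarrow> dist (f x') (f x) < e"
    by (intro exI [of _ d]) (auto simp: dist_norm dist_real_def)
next
  show "bounded (f ` {0..})" using assms(2) by (auto simp: bounded_iff)
qed

lemma BUC_uniform_approx:
  fixes g :: "real \<Rightarrow> 'a::real_normed_vector"
  assumes "\<And>e. 0 < e \<Longrightarrow> \<exists>h\<in>BUC. \<forall>t\<ge>0. norm (g t - h t) < e"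
  shows "g \<in> BUC"
proof -
  obtain h M where h: "h \<in> BUC" "\<And>t. 0 \<le> t \<Longrightarrow> norm (g t - h t) < 1" "\<And>t. 0 \<le> t \<Longrightarrow> norm (h t) \<le> M"
    using assms [of 1] BUC_bound by (metis zero_less_one)
  show ?thesis
  proof (rule BUC_I)
    show "norm (g t) \<le> 1 + M" if "0 \<le> t" for t
      using h(2,3) [OF that] norm_triangle_sub [of "g t" "h t"] by simp
    fix e :: real assume e: "0 < e"
    obtain k where k: "k \<in> BUC" "\<And>t. 0 \<le> t \<Longrightarrow> norm (g t - k t) < e / 3"
      using assms [of "e / 3"] e by auto
    obtain d where d: "0 < d" "\<And>s t. 0 \<le> s \<Longrightarrow> 0 \<le> t \<Longrightarrow> \<bar>s - t\<bar> < d \<Longrightarrow> norm (k s - k t) < e / 3"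
      using BUC_dist [OF k(1), of "e / 3"] e by auto
    have "norm (g s - g t) < e" if "0 \<le> s" "0 \<le> t" "\<bar>s - t\<bar> < d" for s t
    proof -
      have "g s - g t = (g s - k s) + (k s - k t) - (g t - k t)" by simp
      also have "norm \<dots> \<le> norm (g s - k s) + norm (k s - k t) + norm (g t - k t)"
        by (intro order_trans [OF norm_triangle_ineq4] add_right_mono norm_triangle_ineq)
      finally show ?thesis using k(2) [OF that(1)] k(2) [OF that(2)] d(2) [OF that] by linarith
    qed
    then show "\<exists>d>0. \<forall>s\<ge>0. \<forall>t\<ge>0. \<bar>s - t\<bar> < d \<longrightarrow> norm (g s - g t) < e" using d(1) by blast
  qed
qed

lemma C0_I: "f \<in> BUC \<Longrightarrow> (\<And>e. 0 < e \<Longrightarrow> \<exists>N. \<forall>t\<ge>N. norm (f t) < e) \<Longrightarrow> f \<in> C0"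
  unfolding C0_def tendsto_iff eventually_at_top_linorder by simp

lemma C0_D: "f \<in> C0 \<Longrightarrow> 0 < e \<Longrightarrow> \<exists>N\<ge>0. \<forall>t\<ge>N. norm (f t) < e"
proof -
  assume "f \<in> C0" "0 < e"
  then obtain N where "\<And>t. N \<le> t \<Longrightarrow> norm (f t) < e"
    unfolding C0_def tendsto_iff eventually_at_top_linorder dist_norm diff_zero by blast
  then show ?thesis by (intro exI [of _ "max 0 N"]) auto
qed

lemma abs_BUC_quot_eqI: "f \<in> BUC \<Longrightarrow> g \<in> BUC \<Longrightarrow> (\<lambda>t. f t - g t) \<in> C0 \<Longrightarrow> abs_BUC_quot f = abs_BUC_quot g"
  by (simp add: abs_BUC_quot_eq_iff)

lemma abs_BUC_quot_diff:
  "f \<in> BUC \<Longrightarrow> g \<in> BUC \<Longrightarrow> abs_BUC_quot f - abs_BUC_quot g = abs_BUC_quot (\<lambda>t. f t - g t)"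
  using abs_BUC_quot_add [of "\<lambda>t. f t - g t" g] by (simp add: BUC_diff diff_eq_eq)

lemma zero_BUC_quot: "(0 :: 'a::complex_normed_vector BUC_quot) = abs_BUC_quot (\<lambda>_. 0)"
  by (simp add: zero_BUC_quot_def)

lemma abs_BUC_quot_eq_0_iff: "f \<in> BUC \<Longrightarrow> abs_BUC_quot f = 0 \<longleftrightarrow> f \<in> C0"
  by (simp add: zero_BUC_quot abs_BUC_quot_eq_iff BUC_zero)

lemma abs_BUC_quot_scaleR:
  "f \<in> BUC \<Longrightarrow> r *\<^sub>R abs_BUC_quot f = abs_BUC_quot (\<lambda>t. r *\<^sub>R f t)"
  for f :: "real \<Rightarrow> 'a::complex_normed_vector"
  by (simp flip: scaleC_of_real add: abs_BUC_quot_scaleC)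

lemma fast_Cauchy_subseq:
  fixes X :: "nat \<Rightarrow> 'b::metric_space"
  assumes "Cauchy X"
  obtains r where "strict_mono r" "\<And>n. dist (X (r (Suc n))) (X (r n)) < (1 / 2) ^ n"
proof -
  have "\<exists>N. \<forall>p\<ge>N. \<forall>q\<ge>N. dist (X p) (X q) < (1 / 2) ^ n" for n :: nat
    using metric_CauchyD [OF assms, of "(1 / 2) ^ n"] by auto
  then obtain N where N: "\<And>n p q. p \<ge> N n \<Longrightarrow> q \<ge> N n \<Longrightarrow> dist (X p) (X q) < (1 / 2) ^ n" by metis
  define r where "r n = (\<Sum>i\<le>n. N i) + n" for n
  have "strict_mono r" unfolding strict_mono_Suc_iff r_def by simp
  moreover have "N n \<le> r n" "N n \<le> r (Suc n)" for n
    unfolding r_def using member_le_sum [of n "{..n}" N] by auto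
  ultimately show thesis using that N by blast
qed

text \<open>Along a fast subsequence the differences have representatives of sup norm below 2^-n;
  the series of these converges uniformly and yields a representative of the limit.\<close>

instance BUC_quot :: ("{complex_normed_vector, banach}") banach
proof
  fix X :: "nat \<Rightarrow> 'a BUC_quot"
  assume X: "Cauchy X"
  obtain r where r: "strict_mono r" "\<And>n. dist (X (r (Suc n))) (X (r n)) < (1 / 2) ^ n"
    by (rule fast_Cauchy_subseq [OF X]) blast
  have "\<exists>d\<in>BUC. abs_BUC_quot d = X (r (Suc n)) - X (r n) \<and> sup_norm d < (1 / 2) ^ n" for n
    using norm_BUC_quot_less [of "X (r (Suc n)) - X (r n)" "(1 / 2) ^ n"] r(2) [of n]
    by (auto simp: dist_norm)
  then obtain d where d: "\<And>n. d n \<in> BUC" "\<And>n. abs_BUC_quot (d n) = X (r (Suc n)) - X (r n)"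
    "\<And>n. sup_norm (d n) < (1 / 2) ^ n" by metis
  obtain g0 where g0: "g0 \<in> BUC" "X (r 0) = abs_BUC_quot g0" by (rule BUC_quot_cases)
  define G where "G n t = g0 t + (\<Sum>i<n. d i t)" for n t
  have G: "G n \<in> BUC \<and> abs_BUC_quot (G n) = X (r n)" for n
  proof (induction n)
    case 0
    then show ?case using g0 by (simp add: G_def [abs_def])
  next
    case (Suc n)
    have "G (Suc n) = (\<lambda>t. G n t + d n t)" by (simp add: G_def fun_eq_iff add.assoc)
    then show ?case using Suc d abs_BUC_quot_add [of "G n" "d n"] by (simp add: BUC_add)
  qed
  have "uniform_limit {0..} (\<lambda>n t. \<Sum>i<n. d i t) (\<lambda>t. suminf (\<lambda>i. d i t)) sequentially"
  proof (rule Weierstrass_m_test [where M = "\<lambda>n. (1 / 2) ^ n"])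
    show "norm (d n t) \<le> (1 / 2) ^ n" if "t \<in> {0..}" for n t
      using norm_le_sup_norm [OF d(1), of t n] d(3) [of n] that by simp
  qed simp
  then have lim: "uniform_limit {0..} (\<lambda>n t. \<Sum>i<n. d i t) (\<lambda>t. suminf (\<lambda>i. d i t)) sequentially" .
  define g where "g t = g0 t + suminf (\<lambda>i. d i t)" for t
  have ev: "\<forall>\<^sub>F n in sequentially. \<forall>t\<ge>0. norm (G n t - g t) < e" if "0 < e" for e
    using uniform_limitD [OF lim that] by (simp add: G_def g_def dist_norm Ball_def)
  have g: "g \<in> BUC"
  proof (rule BUC_uniform_approx)
    fix e :: real assume "0 < e"
    then obtain n where "\<forall>t\<ge>0. norm (G n t - g t) < e"
      using eventually_happens' [OF sequentially_bot ev] by blast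
    then show "\<exists>h\<in>BUC. \<forall>t\<ge>0. norm (g t - h t) < e"
      using G [of n] by (intro bexI [of _ "G n"]) (auto simp: norm_minus_commute)
  qed
  have sub: "(\<lambda>n. X (r n)) \<longlonglongrightarrow> abs_BUC_quot g"
  proof (rule metric_LIMSEQ_I)
    fix e :: real assume e: "0 < e"
    have "\<forall>\<^sub>F n in sequentially. \<forall>t\<ge>0. norm (G n t - g t) < e / 2" using e by (intro ev) simp
    then have "\<forall>\<^sub>F n in sequentially. dist (X (r n)) (abs_BUC_quot g) < e"
    proof eventually_elim
      case (elim n)
      have "dist (X (r n)) (abs_BUC_quot g) = norm (abs_BUC_quot (\<lambda>t. G n t - g t))"
        using G [of n] g abs_BUC_quot_diff [of "G n" g] by (simp add: dist_norm)
      also have "\<dots> \<le> sup_norm (\<lambda>t. G n t - g t)" using G g by (intro norm_BUC_quot_le BUC_diff) auto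
      also have "\<dots> \<le> e / 2" using elim by (intro sup_norm_leI) (auto intro: less_imp_le)
      finally show ?case using e by linarith
    qed
    then show "\<exists>n0. \<forall>n\<ge>n0. dist (X (r n)) (abs_BUC_quot g) < e" by (simp add: eventually_sequentially)
  qed
  have "X \<longlonglongrightarrow> abs_BUC_quot g"
  proof (rule metric_LIMSEQ_I)
    fix e :: real assume e: "0 < e"
    obtain M1 where M1: "\<And>p q. p \<ge> M1 \<Longrightarrow> q \<ge> M1 \<Longrightarrow> dist (X p) (X q) < e / 2"
      using metric_CauchyD [OF X, of "e / 2"] e by auto
    obtain M2 where M2: "\<And>n. n \<ge> M2 \<Longrightarrow> dist (X (r n)) (abs_BUC_quot g) < e / 2"
      using metric_LIMSEQ_D [OF sub, of "e / 2"] e by auto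
    have "dist (X n) (abs_BUC_quot g) < e" if "n \<ge> M1" for n
    proof -
      let ?m = "max M1 M2"
      have "?m \<le> r ?m" using seq_suble [OF r(1)] by blast
      then have "dist (X n) (X (r ?m)) < e / 2" using M1 that by auto
      with M2 [of ?m] dist_triangle [of "X n" "abs_BUC_quot g" "X (r ?m)"] show ?thesis by auto
    qed
    then show "\<exists>n0. \<forall>n\<ge>n0. dist (X n) (abs_BUC_quot g) < e" by blast
  qed
  then show "convergent X" by (auto simp: convergent_def)
qed

lemma norm_exp_scaleC [simp]: "norm (exp z *\<^sub>C x) = exp (Re z) * norm x"
  by (simp add: norm_scaleC)

section \<open>Resolvents of the derivative on the half-line\<close>

lemma has_integral_exp_conv:
  fixes \<kappa> :: real
  assumes "\<kappa> \<noteq> 0" "s \<le> t"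
  shows "((\<lambda>r. exp (- \<kappa> * (t - r))) has_integral (1 - exp (- \<kappa> * (t - s))) / \<kappa>) {s..t}"
proof -
  have "((\<lambda>r. exp (- \<kappa> * (t - r))) has_integral exp (- \<kappa> * (t - t)) / \<kappa> - exp (- \<kappa> * (t - s)) / \<kappa>) {s..t}"
  proof (rule fundamental_theorem_of_calculus [OF assms(2)])
    fix x
    have "((\<lambda>r. exp (- \<kappa> * (t - r)) / \<kappa>) has_real_derivative exp (- \<kappa> * (t - x))) (at x within {s..t})"
      using assms(1) by (auto intro!: derivative_eq_intros)
    then show "((\<lambda>r. exp (- \<kappa> * (t - r)) / \<kappa>) has_vector_derivative exp (- \<kappa> * (t - x))) (at x within {s..t})"
      by (simp add: has_real_derivative_iff_has_vector_derivative)
  qed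
  then show ?thesis by (simp add: diff_divide_distrib)
qed

lemma norm_integral_exp_conv:
  fixes h :: "real \<Rightarrow> 'a::banach"
  assumes "h integrable_on {s..t}" "0 < \<kappa>" "s \<le> t" "0 \<le> C" "\<And>r. s \<le> r \<Longrightarrow> r \<le> t \<Longrightarrow> norm (h r) \<le> C * exp (- \<kappa> * (t - r))"
  shows "norm (integral {s..t} h) \<le> C / \<kappa>"
proof -
  have i: "((\<lambda>r. C * exp (- \<kappa> * (t - r))) has_integral C * ((1 - exp (- \<kappa> * (t - s))) / \<kappa>)) {s..t}"
    using assms by (intro has_integral_mult_right has_integral_exp_conv) auto
  have "norm (integral {s..t} h) \<le> integral {s..t} (\<lambda>r. C * exp (- \<kappa> * (t - r)))"
    using assms by (intro integral_norm_bound_integral has_integral_integrable [OF i]) auto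
  also have "\<dots> = C * ((1 - exp (- \<kappa> * (t - s))) / \<kappa>)" using i by (rule integral_unique)
  also have "\<dots> \<le> C * (1 / \<kappa>)" using assms by (intro mult_left_mono divide_right_mono) auto
  finally show ?thesis by simp
qed

lemma deriv_opD:
  assumes "(u, v) \<in> deriv_op"
  shows "u \<in> BUC" "v \<in> BUC" "0 \<le> t \<Longrightarrow> (u has_vector_derivative v t) (at t within {0..})"
  using assms by (auto simp: deriv_op_def)

text \<open>A bounded derivative makes u Lipschitz continuous.\<close>

lemma bounded_derivative_BUC:
  fixes u :: "real \<Rightarrow> 'a::real_normed_vector"
  assumes "\<And>t. 0 \<le> t \<Longrightarrow> (u has_vector_derivative v t) (at t within {0..})"
    "\<And>t. 0 \<le> t \<Longrightarrow> norm (v t) \<le> L" "\<And>t. 0 \<le> t \<Longrightarrow> norm (u t) \<le> M"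
  shows "u \<in> BUC"
proof (rule BUC_I [OF _ assms(3)])
  have lip: "norm (u s - u t) \<le> L * norm (s - t)" if "0 \<le> s" "0 \<le> t" for s t
  proof (rule differentiable_bound [of "{0..}"])
    show "(u has_derivative (\<lambda>h. h *\<^sub>R v x)) (at x within {0..})" if "x \<in> {0..}" for x
      using assms(1) [of x] that by (simp add: has_vector_derivative_def)
    show "onorm (\<lambda>h. h *\<^sub>R v x) \<le> L" if "x \<in> {0..}" for x
      using assms(2) [of x] that order_trans [OF norm_ge_zero assms(2) [of x]]
      by (intro onorm_bound) (auto simp: mult.commute [of L] intro: mult_left_mono)
  qed (use that in auto)
  have L: "0 \<le> L" using order_trans [OF norm_ge_zero assms(2) [of 0]] by simp
  fix e :: real assume e: "0 < e"
  show "\<exists>d>0. \<forall>s\<ge>0. \<forall>t\<ge>0. \<bar>s - t\<bar> < d \<longrightarrow> norm (u s - u t) < e"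
  proof (intro exI [of _ "e / (L + 1)"] conjI allI impI)
    show "0 < e / (L + 1)" using e L by simp
    fix s t assume st: "0 \<le> s" "0 \<le> t" "\<bar>s - t\<bar> < e / (L + 1)"
    have "norm (u s - u t) \<le> L * \<bar>s - t\<bar>" using lip [OF st(1,2)] by simp
    also have "\<dots> \<le> (L + 1) * \<bar>s - t\<bar>" by (simp add: mult_right_mono)
    also have "\<dots> < e" using st(3) L by (simp add: field_simps)
    finally show "norm (u s - u t) < e" .
  qed
qed

text \<open>Variation of constants for u' = l u - f. The constant c is free: c = 0 serves Re l < 0,
  while for Re l > 0 the full Laplace integral of f is the choice that keeps u bounded.\<close>

lemma exp_ode_solution:
  fixes f :: "real \<Rightarrow> 'a::{complex_normed_vector, banach}" and l :: complex and c :: 'a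
  assumes f: "continuous_on {0..} f" and t: "0 \<le> t"
  defines "k \<equiv> \<lambda>s. exp (- l * of_real s) *\<^sub>C f s"
  defines "u \<equiv> \<lambda>t. exp (l * of_real t) *\<^sub>C (c - integral {0..t} k)"
  shows "(u has_vector_derivative l *\<^sub>C u t - f t) (at t within {0..})"
proof -
  have k: "continuous_on {0..} k" unfolding k_def by (intro scaleC.continuous_on continuous_intros f)
  have dI: "((\<lambda>t. integral {0..t} k) has_vector_derivative k t) (at t within {0..})"
  proof -
    have "((\<lambda>t. integral {0..t} k) has_vector_derivative k t) (at t within {0..t + 1})"
      using t by (intro integral_has_vector_derivative continuous_on_subset [OF k]) auto
    moreover have "at t within {0..t + 1} = at t within {0..}"
      by (rule at_within_nhd [of _ "{..<t + 1}"]) (use t in auto)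
    ultimately show ?thesis by simp
  qed
  have dE: "((\<lambda>t. exp (l * of_real t)) has_vector_derivative l * exp (l * of_real t)) (at t within {0..})"
    by (rule has_vector_derivative_real_field [THEN has_vector_derivative_at_within]) (auto intro!: derivative_eq_intros)
  have "((\<lambda>t. c - integral {0..t} k) has_vector_derivative 0 - k t) (at t within {0..})"
    by (intro has_vector_derivative_diff has_vector_derivative_const dI)
  from bounded_bilinear.has_vector_derivative [OF scaleC.bounded_bilinear_axioms dE this]
  have "(u has_vector_derivative exp (l * of_real t) *\<^sub>C (0 - k t) + (l * exp (l * of_real t)) *\<^sub>C (c - integral {0..t} k)) (at t within {0..})"
    unfolding u_def .
  moreover have "exp (l * of_real t) *\<^sub>C (0 - k t) = - f t"
    by (simp add: k_def scaleC.minus_right scaleC_scaleC flip: exp_add)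
  moreover have "(l * exp (l * of_real t)) *\<^sub>C (c - integral {0..t} k) = l *\<^sub>C u t" by (simp add: u_def scaleC_scaleC)
  ultimately show ?thesis by simp
qed

lemma deriv_resolvent_left:
  fixes f :: "real \<Rightarrow> 'a::{complex_normed_vector, banach}"
  assumes f: "f \<in> BUC" and l: "Re l < 0"
  defines "u \<equiv> \<lambda>t. - integral {0..t} (\<lambda>s. exp (l * of_real (t - s)) *\<^sub>C f s)"
  shows "(u, \<lambda>t. l *\<^sub>C u t - f t) \<in> deriv_op" "0 \<le> t \<Longrightarrow> norm (u t) \<le> sup_norm f / \<bar>Re l\<bar>"
proof -
  let ?k = "\<lambda>s. exp (- l * of_real s) *\<^sub>C f s"
  have fc: "continuous_on S f" if "S \<subseteq> {0..}" for S using BUC_continuous [OF f that] .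
  have kint: "?k integrable_on {0..t}" for t
    by (intro integrable_continuous_real scaleC.continuous_on continuous_intros fc) auto
  have u_eq: "u = (\<lambda>t. exp (l * of_real t) *\<^sub>C (0 - integral {0..t} ?k))"
  proof
    fix t
    have "exp (l * of_real t) *\<^sub>C integral {0..t} ?k = integral {0..t} (\<lambda>s. exp (l * of_real t) *\<^sub>C ?k s)"
      by (rule integral_scaleC [symmetric, OF kint])
    also have "\<dots> = integral {0..t} (\<lambda>s. exp (l * of_real (t - s)) *\<^sub>C f s)"
      by (rule arg_cong [of _ _ "integral {0..t}"]) (auto simp: scaleC_scaleC exp_add [symmetric] algebra_simps)
    finally show "u t = exp (l * of_real t) *\<^sub>C (0 - integral {0..t} ?k)"
      by (simp add: u_def scaleC.minus_right)
  qed
  have b: "norm (u t) \<le> sup_norm f / \<bar>Re l\<bar>" if t: "0 \<le> t" for t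
  proof -
    have "norm (integral {0..t} (\<lambda>s. exp (l * of_real (t - s)) *\<^sub>C f s)) \<le> sup_norm f / - Re l"
    proof (rule norm_integral_exp_conv)
      show "(\<lambda>s. exp (l * of_real (t - s)) *\<^sub>C f s) integrable_on {0..t}"
        by (intro integrable_continuous_real scaleC.continuous_on continuous_intros fc) auto
      show "norm (exp (l * of_real (t - r)) *\<^sub>C f r) \<le> sup_norm f * exp (- (- Re l) * (t - r))" if "0 \<le> r" for r
        using norm_le_sup_norm [OF f that] by (simp add: mult.commute mult_left_mono)
    qed (use l t sup_norm_nonneg [OF f] in auto)
    then show ?thesis using l by (simp add: u_def)
  qed
  then show "0 \<le> t \<Longrightarrow> norm (u t) \<le> sup_norm f / \<bar>Re l\<bar>" .
  have d: "(u has_vector_derivative l *\<^sub>C u t - f t) (at t within {0..})" if "0 \<le> t" for t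
    using exp_ode_solution [OF fc [OF order_refl] that, of l 0] unfolding u_eq .
  have "norm (l *\<^sub>C u t - f t) \<le> cmod l * (sup_norm f / \<bar>Re l\<bar>) + sup_norm f" if "0 \<le> t" for t
  proof (rule order_trans [OF norm_triangle_ineq4], rule add_mono)
    show "norm (l *\<^sub>C u t) \<le> cmod l * (sup_norm f / \<bar>Re l\<bar>)"
      unfolding norm_scaleC by (intro mult_left_mono b that norm_ge_zero)
  qed (rule norm_le_sup_norm [OF f that])
  then have "u \<in> BUC" by (intro bounded_derivative_BUC [OF d]) (auto intro: b)
  then show "(u, \<lambda>t. l *\<^sub>C u t - f t) \<in> deriv_op"
    using d f by (simp add: deriv_op_def BUC_diff BUC_scaleC)
qed

text \<open>The last clause says that u is, uniformly in t, a limit of integrals over bounded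
  windows of translates of f; through it precompactness of the range passes from f to u.\<close>

lemma deriv_resolvent_right:
  fixes f :: "real \<Rightarrow> 'a::{complex_normed_vector, banach}"
  assumes f: "f \<in> BUC" and l: "0 < Re l"
  shows "\<exists>u. (u, \<lambda>t. l *\<^sub>C u t - f t) \<in> deriv_op \<and> (\<forall>t\<ge>0. norm (u t) \<le> sup_norm f / \<bar>Re l\<bar>) \<and>
    (\<forall>t\<ge>0. \<forall>n\<ge>0. norm (u t - integral {0..n} (\<lambda>s. exp (- l * of_real s) *\<^sub>C f (t + s))) \<le> sup_norm f / Re l * exp (- Re l * n))"
proof -
  let ?k = "\<lambda>s. exp (- l * of_real s) *\<^sub>C f s"
  have fc: "continuous_on S f" if "S \<subseteq> {0..}" for S using BUC_continuous [OF f that] .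
  have kc: "continuous_on {0..} ?k" by (intro scaleC.continuous_on continuous_intros fc) auto
  have kint: "?k integrable_on {s..t}" if "0 \<le> s" for s t
    by (intro integrable_continuous_real continuous_on_subset [OF kc]) (use that in auto)
  have kb: "norm (?k x) \<le> sup_norm f * exp (- Re l * x)" if "0 \<le> x" for x
    using norm_le_sup_norm [OF f that] by (simp add: mult.commute mult_left_mono)
  obtain c where c: "\<And>t. 0 \<le> t \<Longrightarrow> norm (c - integral {0..t} ?k) \<le> sup_norm f / Re l * exp (- Re l * t)"
    using improper_integral_exp [OF kc l sup_norm_nonneg [OF f] kb] by blast
  define u where "u t = exp (l * of_real t) *\<^sub>C (c - integral {0..t} ?k)" for t
  have tail: "norm (u t - integral {0..n} (\<lambda>s. exp (- l * of_real s) *\<^sub>C f (t + s))) \<le> sup_norm f / Re l * exp (- Re l * n)"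
    if t: "0 \<le> t" and n: "0 \<le> n" for t n
  proof -
    have "((\<lambda>s. ?k (1 *\<^sub>R s + t)) has_integral (1 / \<bar>1\<bar>) *\<^sub>R integral {t..t + n} ?k) ((\<lambda>x. (1 / 1) *\<^sub>R x + - ((1 / 1) *\<^sub>R t)) ` {t..t + n})"
      using has_integral_affinity [of ?k "integral {t..t + n} ?k" t "t + n" 1 t] kint [OF t, of "t + n"]
      by (simp add: integrable_integral)
    moreover have "(\<lambda>x. x - t) ` {t..t + n} = {0..n}"
      using image_add_atLeastAtMost [of "-t" t "t + n"] by simp
    ultimately have h: "((\<lambda>s. ?k (s + t)) has_integral integral {t..t + n} ?k) {0..n}" by simp
    have "exp (l * of_real t) *\<^sub>C integral {t..t + n} ?k = exp (l * of_real t) *\<^sub>C integral {0..n} (\<lambda>s. ?k (s + t))"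
      using integral_unique [OF h] by simp
    also have "\<dots> = integral {0..n} (\<lambda>s. exp (l * of_real t) *\<^sub>C ?k (s + t))"
      by (rule integral_scaleC [symmetric]) (use h in \<open>auto simp: has_integral_integrable\<close>)
    also have "\<dots> = integral {0..n} (\<lambda>s. exp (- l * of_real s) *\<^sub>C f (t + s))"
      by (rule arg_cong [of _ _ "integral {0..n}"]) (auto simp: scaleC_scaleC exp_add [symmetric] algebra_simps)
    finally have 1: "exp (l * of_real t) *\<^sub>C integral {t..t + n} ?k = integral {0..n} (\<lambda>s. exp (- l * of_real s) *\<^sub>C f (t + s))" .
    have 2: "integral {0..t + n} ?k = integral {0..t} ?k + integral {t..t + n} ?k"
      using t n by (intro Henstock_Kurzweil_Integration.integral_combine [symmetric] kint) auto
    have "u t - integral {0..n} (\<lambda>s. exp (- l * of_real s) *\<^sub>C f (t + s)) = exp (l * of_real t) *\<^sub>C (c - integral {0..t + n} ?k)"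
      unfolding u_def 1 [symmetric] 2 by (simp add: scaleC_diff_right [symmetric] diff_diff_add)
    also have "norm \<dots> \<le> exp (Re l * t) * (sup_norm f / Re l * exp (- Re l * (t + n)))"
      unfolding norm_exp_scaleC using c [of "t + n"] t n by (intro mult_mono) auto
    also have "\<dots> = sup_norm f / Re l * exp (- Re l * n)"
    proof -
      have "exp (Re l * t) * exp (- Re l * (t + n)) = exp (- Re l * n)"
        by (simp add: exp_add [symmetric] algebra_simps)
      then show ?thesis by (metis mult.left_commute)
    qed
    finally show ?thesis .
  qed
  have b: "norm (u t) \<le> sup_norm f / \<bar>Re l\<bar>" if t: "0 \<le> t" for t
    using tail [OF t order_refl] l by simp
  have d: "(u has_vector_derivative l *\<^sub>C u t - f t) (at t within {0..})" if "0 \<le> t" for t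
    using exp_ode_solution [OF fc [OF order_refl] that, of l c] unfolding u_def [abs_def] .
  have "norm (l *\<^sub>C u t - f t) \<le> cmod l * (sup_norm f / \<bar>Re l\<bar>) + sup_norm f" if "0 \<le> t" for t
  proof (rule order_trans [OF norm_triangle_ineq4], rule add_mono)
    show "norm (l *\<^sub>C u t) \<le> cmod l * (sup_norm f / \<bar>Re l\<bar>)"
      unfolding norm_scaleC by (intro mult_left_mono b that norm_ge_zero)
  qed (rule norm_le_sup_norm [OF f that])
  then have "u \<in> BUC" by (intro bounded_derivative_BUC [OF d]) (auto intro: b)
  then have "(u, \<lambda>t. l *\<^sub>C u t - f t) \<in> deriv_op"
    using d f by (simp add: deriv_op_def BUC_diff BUC_scaleC)
  then show ?thesis using b tail by blast
qed

text \<open>With g = l u - v in \<open>C0\<close>, the function exp(- l t) u has derivative - exp(-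
  l t) g. For Re l > 0 it is integrated from t to infinity, where boundedness of u removes the end
  value; for Re l < 0 it is integrated from a late time N on, and the value at N is damped.\<close>

lemma deriv_unique:
  fixes u :: "real \<Rightarrow> 'a::{complex_normed_vector, banach}"
  assumes uv: "(u, v) \<in> deriv_op" and g: "(\<lambda>t. l *\<^sub>C u t - v t) \<in> C0" and l: "Re l \<noteq> 0"
  shows "u \<in> C0"
proof (rule C0_I [OF deriv_opD(1) [OF uv]])
  fix e :: real assume e: "0 < e"
  define \<rho> where "\<rho> = Re l"
  define \<epsilon> where "\<epsilon> = e * \<bar>\<rho>\<bar> / 2"
  have \<epsilon>: "0 < \<epsilon>" using e l by (simp add: \<epsilon>_def \<rho>_def)
  obtain N where N: "0 \<le> N" "\<And>t. N \<le> t \<Longrightarrow> norm (l *\<^sub>C u t - v t) < \<epsilon>" using C0_D [OF g \<epsilon>] by auto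
  obtain M where M: "0 \<le> M" "\<And>t. 0 \<le> t \<Longrightarrow> norm (u t) \<le> M" using BUC_bound [OF deriv_opD(1) [OF uv]] by auto
  have key: "norm (exp (- l * of_real t) *\<^sub>C u t - exp (- l * of_real s) *\<^sub>C u s) \<le> \<epsilon> * (exp (- \<rho> * s) - exp (- \<rho> * t)) / \<rho>"
    if st: "N \<le> s" "s \<le> t" for s t
  proof -
    have "((\<lambda>r. - (exp (- l * of_real r) *\<^sub>C (l *\<^sub>C u r - v r))) has_integral (exp (- l * of_real t) *\<^sub>C u t - exp (- l * of_real s) *\<^sub>C u s)) {s..t}"
    proof (rule fundamental_theorem_of_calculus [OF st(2)])
      fix x assume x: "x \<in> {s..t}"
      then have x0: "0 \<le> x" using N st by auto
      have dE: "((\<lambda>t. exp (- l * of_real t)) has_vector_derivative - l * exp (- l * of_real x)) (at x within {0..})"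
        by (rule has_vector_derivative_real_field [THEN has_vector_derivative_at_within]) (auto intro!: derivative_eq_intros)
      from bounded_bilinear.has_vector_derivative [OF scaleC.bounded_bilinear_axioms dE deriv_opD(3) [OF uv x0]]
      have "((\<lambda>r. exp (- l * of_real r) *\<^sub>C u r) has_vector_derivative
        exp (- l * of_real x) *\<^sub>C v x + (- l * exp (- l * of_real x)) *\<^sub>C u x) (at x within {0..})" .
      moreover have "exp (- l * of_real x) *\<^sub>C v x + (- l * exp (- l * of_real x)) *\<^sub>C u x =
        - (exp (- l * of_real x) *\<^sub>C (l *\<^sub>C u x - v x))"
        by (simp add: scaleC_diff_right scaleC_scaleC scaleC.minus_left mult.commute)
      ultimately show "((\<lambda>r. exp (- l * of_real r) *\<^sub>C u r) has_vector_derivative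
        - (exp (- l * of_real x) *\<^sub>C (l *\<^sub>C u x - v x))) (at x within {s..t})"
        using N st by (auto intro: has_vector_derivative_within_subset)
    qed
    moreover have i: "((\<lambda>r. \<epsilon> * exp (- \<rho> * r)) has_integral \<epsilon> * (- exp (- \<rho> * t) / \<rho>) - \<epsilon> * (- exp (- \<rho> * s) / \<rho>)) {s..t}"
    proof (rule fundamental_theorem_of_calculus [OF st(2)])
      fix x
      show "((\<lambda>r. \<epsilon> * (- exp (- \<rho> * r) / \<rho>)) has_vector_derivative \<epsilon> * exp (- \<rho> * x)) (at x within {s..t})"
        unfolding has_real_derivative_iff_has_vector_derivative [symmetric]
        using l by (auto intro!: derivative_eq_intros simp: \<rho>_def)
    qed
    moreover have "norm (- (exp (- l * of_real x) *\<^sub>C (l *\<^sub>C u x - v x))) \<le> \<epsilon> * exp (- \<rho> * x)" if "x \<in> {s..t}" for x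
    proof -
      have "norm (l *\<^sub>C u x - v x) \<le> \<epsilon>" using N(2) [of x] st that by auto
      then show ?thesis by (simp add: \<rho>_def mult.commute mult_left_mono)
    qed
    ultimately have "norm (exp (- l * of_real t) *\<^sub>C u t - exp (- l * of_real s) *\<^sub>C u s) \<le> \<epsilon> * (- exp (- \<rho> * t) / \<rho>) - \<epsilon> * (- exp (- \<rho> * s) / \<rho>)"
      by (metis (no_types, lifting) integral_norm_bound_integral has_integral_integrable integral_unique)
    then show ?thesis by (simp add: diff_divide_distrib right_diff_distrib)
  qed
  \<comment> \<open>One inequality for both directions: b is the time of interest and a the time of
    comparison, which is later than b when \<rho> > 0 and earlier when \<rho> < 0.\<close>
  have est: "exp (- \<rho> * b) * norm (u b) \<le> exp (- \<rho> * a) * norm (u a) + \<epsilon> * (exp (- \<rho> * min a b) - exp (- \<rho> * max a b)) / \<rho>"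
    if "N \<le> a" "N \<le> b" for a b
  proof -
    have "norm (exp (- l * of_real b) *\<^sub>C u b - exp (- l * of_real a) *\<^sub>C u a) \<le> \<epsilon> * (exp (- \<rho> * min a b) - exp (- \<rho> * max a b)) / \<rho>"
      using key [of a b] key [of b a] that by (cases "a \<le> b") (auto simp: min_def max_def norm_minus_commute)
    moreover have "norm (exp (- l * of_real b) *\<^sub>C u b) \<le> norm (exp (- l * of_real a) *\<^sub>C u a) + norm (exp (- l * of_real b) *\<^sub>C u b - exp (- l * of_real a) *\<^sub>C u a)"
      by (rule norm_triangle_sub)
    ultimately show ?thesis unfolding norm_exp_scaleC by (simp add: \<rho>_def)
  qed
  show "\<exists>N. \<forall>t\<ge>N. norm (u t) < e"
  proof (cases "0 < \<rho>")
    case True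
    have "norm (u t) \<le> e / 2" if t: "N \<le> t" for t
    proof (rule tendsto_lowerbound)
      show "((\<lambda>a. exp (- \<rho> * (a - t)) * M + e / 2) \<longlongrightarrow> e / 2) at_top"
        using True by real_asymp
      show "\<forall>\<^sub>F a in at_top. norm (u t) \<le> exp (- \<rho> * (a - t)) * M + e / 2"
        using eventually_ge_at_top [of t]
      proof eventually_elim
        case (elim a)
        have "exp (- \<rho> * t) * norm (u t) \<le> exp (- \<rho> * a) * norm (u a) + \<epsilon> * (exp (- \<rho> * t) - exp (- \<rho> * a)) / \<rho>"
          using est [of a t] elim t by (simp add: min_def max_def split: if_splits)
        also have "\<dots> \<le> exp (- \<rho> * a) * M + \<epsilon> * exp (- \<rho> * t) / \<rho>"
          using True \<epsilon> M(2) [of a] N t elim by (intro add_mono mult_left_mono divide_right_mono) auto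
        also have "\<dots> = exp (- \<rho> * t) * (exp (- \<rho> * (a - t)) * M + e / 2)"
        proof -
          have "exp (- \<rho> * a) = exp (- \<rho> * t) * exp (- \<rho> * (a - t))" by (simp add: exp_add [symmetric] algebra_simps)
          then show ?thesis using True by (simp add: \<epsilon>_def algebra_simps)
        qed
        finally show ?case by simp
      qed
    qed simp
    then show ?thesis using e by (intro exI [of _ N]) force
  next
    case False
    then have neg: "\<rho> < 0" using l by (simp add: \<rho>_def)
    have "((\<lambda>t. exp (\<rho> * (t - N)) * M) \<longlongrightarrow> 0) at_top" using neg by real_asymp
    then have "\<forall>\<^sub>F t in at_top. exp (\<rho> * (t - N)) * M < e / 2" using e by (intro order_tendstoD) auto
    then obtain N' where N': "\<And>t. N' \<le> t \<Longrightarrow> exp (\<rho> * (t - N)) * M < e / 2" by (auto simp: eventually_at_top_linorder)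
    have "norm (u t) < e" if t: "max N N' \<le> t" for t
    proof -
      have "exp (- \<rho> * t) * norm (u t) \<le> exp (- \<rho> * N) * norm (u N) + \<epsilon> * (exp (- \<rho> * N) - exp (- \<rho> * t)) / \<rho>"
        using est [of N t] t by (simp add: min_def max.absorb2)
      also have "\<epsilon> * (exp (- \<rho> * N) - exp (- \<rho> * t)) / \<rho> = \<epsilon> * (exp (- \<rho> * t) - exp (- \<rho> * N)) / - \<rho>"
        using neg by (simp add: field_simps)
      also have "exp (- \<rho> * N) * norm (u N) + \<epsilon> * (exp (- \<rho> * t) - exp (- \<rho> * N)) / - \<rho> \<le> exp (- \<rho> * N) * M + \<epsilon> * exp (- \<rho> * t) / - \<rho>"
        using neg \<epsilon> M(2) [of N] N(1) by (intro add_mono mult_left_mono divide_right_mono) auto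
      also have "\<dots> = exp (- \<rho> * t) * (exp (\<rho> * (t - N)) * M + e / 2)"
      proof -
        have "exp (- \<rho> * N) = exp (- \<rho> * t) * exp (\<rho> * (t - N))" by (simp add: exp_add [symmetric] algebra_simps)
        then show ?thesis using neg by (simp add: \<epsilon>_def algebra_simps)
      qed
      finally show ?thesis using N' [of t] t by auto
    qed
    then show ?thesis by blast
  qed
qed

text \<open>By uniform continuity v is close to the difference quotient of u over a fixed step h,
  and that quotient tends to 0. This is what makes \<open>deriv_quot\<close> single-valued.\<close>

lemma deriv_C0:
  fixes u :: "real \<Rightarrow> 'a::{complex_normed_vector, banach}"
  assumes uv: "(u, v) \<in> deriv_op" and u: "u \<in> C0"
  shows "v \<in> C0"
proof (rule C0_I [OF deriv_opD(2) [OF uv]])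
  fix e :: real assume e: "0 < e"
  obtain d where d: "0 < d" "\<And>s t. 0 \<le> s \<Longrightarrow> 0 \<le> t \<Longrightarrow> \<bar>s - t\<bar> < d \<Longrightarrow> norm (v s - v t) < e / 4"
    using BUC_dist [OF deriv_opD(2) [OF uv], of "e / 4"] e by auto
  define h where "h = d / 2"
  have h: "0 < h" "h < d" using d by (auto simp: h_def)
  obtain N where N: "0 \<le> N" "\<And>t. N \<le> t \<Longrightarrow> norm (u t) < e * h / 4"
    using C0_D [OF u, of "e * h / 4"] e h by auto
  have "norm (v t) < e" if t: "N \<le> t" for t
  proof -
    have i: "(v has_integral (u (t + h) - u t)) {t..t + h}"
    proof (rule fundamental_theorem_of_calculus)
      show "(u has_vector_derivative v x) (at x within {t..t + h})" if "x \<in> {t..t + h}" for x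
        using deriv_opD(3) [OF uv, of x] that N(1) t by (auto intro: has_vector_derivative_within_subset)
    qed (use h in simp)
    have "((\<lambda>x. v x - v t) has_integral (u (t + h) - u t) - h *\<^sub>R v t) {t..t + h}"
      using has_integral_diff [OF i has_integral_const_real [of "v t" t "t + h"]] h by simp
    then have "norm ((u (t + h) - u t) - h *\<^sub>R v t) \<le> e / 4 * h"
    proof -
      assume a: "((\<lambda>x. v x - v t) has_integral (u (t + h) - u t) - h *\<^sub>R v t) {t..t + h}"
      have "norm ((u (t + h) - u t) - h *\<^sub>R v t) \<le> e / 4 * measure lborel (cbox t (t + h))"
        by (rule has_integral_bound [of _ "\<lambda>x. v x - v t"]) (use a e h d(2) [of _ t] N(1) t in \<open>auto intro!: less_imp_le\<close>)
      then show ?thesis using h by simp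
    qed
    moreover have "h *\<^sub>R v t = (u (t + h) - u t) - ((u (t + h) - u t) - h *\<^sub>R v t)" by simp
    then have "norm (h *\<^sub>R v t) \<le> norm (u (t + h)) + norm (u t) + norm ((u (t + h) - u t) - h *\<^sub>R v t)"
      by (metis norm_triangle_ineq4 add_right_mono order_trans)
    moreover have "norm (h *\<^sub>R v t) = h * norm (v t)" using h by simp
    moreover have "norm (u t) < e * h / 4" "norm (u (t + h)) < e * h / 4" using N(2) t h by auto
    moreover have "e / 4 * h = e * h / 4" by simp
    ultimately have "h * norm (v t) < e * h / 4 + e * h / 4 + e * h / 4" by linarith
    moreover have "0 < e * h" using e h by simp
    ultimately have "h * norm (v t) < h * e" by (simp add: mult.commute)
    then show ?thesis using h by simp
  qed
  then show "\<exists>N. \<forall>t\<ge>N. norm (v t) < e" by blast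
qed

section \<open>The derivative on the quotient and its resolvent\<close>

lemma clinear_graph_deriv_quot: "clinear_graph (deriv_quot :: ('a::{complex_normed_vector, banach} BUC_quot \<times> 'a BUC_quot) set)"
  unfolding clinear_graph_def
proof (intro conjI allI impI)
  fix x z y w :: "'a BUC_quot"
  assume "(x, z) \<in> deriv_quot" "(y, w) \<in> deriv_quot"
  then obtain u v p q where uv: "(u, v) \<in> deriv_op" "x = abs_BUC_quot u" "z = abs_BUC_quot v"
    and pq: "(p, q) \<in> deriv_op" "y = abs_BUC_quot p" "w = abs_BUC_quot q"
    by (auto simp: deriv_quot_def)
  have "(\<lambda>t. u t + p t, \<lambda>t. v t + q t) \<in> deriv_op"
    using uv(1) pq(1) by (auto simp: deriv_op_def BUC_add intro: has_vector_derivative_add)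
  then show "(x + y, z + w) \<in> deriv_quot"
    unfolding deriv_quot_def using uv pq by (auto simp: abs_BUC_quot_add deriv_opD intro!: exI)
next
  fix c and x z :: "'a BUC_quot"
  assume "(x, z) \<in> deriv_quot"
  then obtain u v where uv: "(u, v) \<in> deriv_op" "x = abs_BUC_quot u" "z = abs_BUC_quot v"
    by (auto simp: deriv_quot_def)
  have "(\<lambda>t. c *\<^sub>C u t, \<lambda>t. c *\<^sub>C v t) \<in> deriv_op"
    using uv(1) by (auto simp: deriv_op_def BUC_scaleC intro: bounded_linear.has_vector_derivative [OF bounded_linear_scaleC_right])
  then show "(c *\<^sub>C x, c *\<^sub>C z) \<in> deriv_quot"
    unfolding deriv_quot_def using uv by (auto simp: abs_BUC_quot_scaleC deriv_opD intro!: exI)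
qed

lemma deriv_quot_single_valued:
  assumes "(x, z) \<in> deriv_quot" "(x, z') \<in> deriv_quot"
  shows "z = (z' :: 'a::{complex_normed_vector, banach} BUC_quot)"
proof -
  obtain u v u' v' where uv: "(u, v) \<in> deriv_op" "x = abs_BUC_quot u" "z = abs_BUC_quot v"
    and uv': "(u', v') \<in> deriv_op" "x = abs_BUC_quot u'" "z' = abs_BUC_quot v'"
    using assms by (auto simp: deriv_quot_def)
  have "(\<lambda>t. u t - u' t, \<lambda>t. v t - v' t) \<in> deriv_op"
    using uv(1) uv'(1) by (auto simp: deriv_op_def BUC_diff intro: has_vector_derivative_diff)
  moreover have "(\<lambda>t. u t - u' t) \<in> C0"
    using uv uv' by (simp add: abs_BUC_quot_eq_iff [symmetric] deriv_opD)
  ultimately have "(\<lambda>t. v t - v' t) \<in> C0" by (rule deriv_C0)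
  then show ?thesis using uv uv' by (simp add: abs_BUC_quot_eq_iff deriv_opD)
qed

lemma deriv_quot_resolvent_unique:
  fixes x :: "'a::{complex_normed_vector, banach} BUC_quot"
  assumes "(x, z) \<in> deriv_quot" "(x', z') \<in> deriv_quot" "l *\<^sub>C x - z = l *\<^sub>C x' - z'" "Re l \<noteq> 0"
  shows "x = x'"
proof -
  obtain u v u' v' where uv: "(u, v) \<in> deriv_op" "x = abs_BUC_quot u" "z = abs_BUC_quot v"
    and uv': "(u', v') \<in> deriv_op" "x' = abs_BUC_quot u'" "z' = abs_BUC_quot v'"
    using assms by (auto simp: deriv_quot_def)
  have b: "u \<in> BUC" "v \<in> BUC" "u' \<in> BUC" "v' \<in> BUC" using uv uv' by (auto simp: deriv_opD)
  have "abs_BUC_quot (\<lambda>t. l *\<^sub>C u t - v t) = abs_BUC_quot (\<lambda>t. l *\<^sub>C u' t - v' t)"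
    using assms(3) b uv uv' by (simp add: abs_BUC_quot_scaleC abs_BUC_quot_diff BUC_scaleC)
  then have "(\<lambda>t. (l *\<^sub>C u t - v t) - (l *\<^sub>C u' t - v' t)) \<in> C0"
    using b by (simp add: abs_BUC_quot_eq_iff BUC_diff BUC_scaleC)
  then have "(\<lambda>t. l *\<^sub>C (u t - u' t) - (v t - v' t)) \<in> C0"
    by (simp add: scaleC_diff_right algebra_simps)
  moreover have "(\<lambda>t. u t - u' t, \<lambda>t. v t - v' t) \<in> deriv_op"
    using uv(1) uv'(1) by (auto simp: deriv_op_def BUC_diff intro: has_vector_derivative_diff)
  ultimately have "(\<lambda>t. u t - u' t) \<in> C0" using assms(4) deriv_unique by blast
  then show ?thesis using uv uv' b by (simp add: abs_BUC_quot_eq_iff)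
qed

lemma deriv_op_resolvent_exists:
  fixes f :: "real \<Rightarrow> 'a::{complex_normed_vector, banach}"
  assumes "f \<in> BUC" "Re l \<noteq> 0"
  obtains u where "(u, \<lambda>t. l *\<^sub>C u t - f t) \<in> deriv_op" "sup_norm u \<le> sup_norm f / \<bar>Re l\<bar>"
proof (cases "Re l < 0")
  case True
  show thesis
    by (rule that [OF deriv_resolvent_left(1) [OF assms(1) True]])
      (rule sup_norm_leI, rule deriv_resolvent_left(2) [OF assms(1) True])
next
  case False
  then have "0 < Re l" using assms by simp
  from deriv_resolvent_right [OF assms(1) this] show thesis
    using that by (metis sup_norm_leI)
qed

definition Pres :: "complex \<Rightarrow> 'a::{complex_normed_vector, banach} BUC_quot \<Rightarrow>\<^sub>L 'a BUC_quot"
  where "Pres l = Res deriv_quot l"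

text \<open>For every b > norm y some representative has sup norm below b, and its solution is
  bounded by b / |Re l|. Since the class of the solution does not depend on the representative, b
  may tend to norm y.\<close>

lemma deriv_quot_resolvent:
  fixes y :: "'a::{complex_normed_vector, banach} BUC_quot"
  assumes l: "Re l \<noteq> 0"
  shows "l \<in> resolvent_set (deriv_quot :: ('a BUC_quot \<times> 'a BUC_quot) set)"
    "norm (Pres l y) \<le> norm y / \<bar>Re l\<bar>"
proof -
  have ex: "\<exists>x. (x, l *\<^sub>C x - y) \<in> deriv_quot \<and> norm x \<le> b / \<bar>Re l\<bar>" if lt: "norm y < b" for b and y :: "'a BUC_quot"
  proof -
    obtain f where f: "f \<in> BUC" "abs_BUC_quot f = y" "sup_norm f < b"
      by (rule norm_BUC_quot_less [OF lt])
    obtain u where u: "(u, \<lambda>t. l *\<^sub>C u t - f t) \<in> deriv_op" "sup_norm u \<le> sup_norm f / \<bar>Re l\<bar>"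
      by (rule deriv_op_resolvent_exists [OF f(1) l])
    have ub: "u \<in> BUC" using u(1) by (rule deriv_opD)
    have "l *\<^sub>C abs_BUC_quot u - y = abs_BUC_quot (\<lambda>t. l *\<^sub>C u t - f t)"
      using f ub by (auto simp: abs_BUC_quot_scaleC abs_BUC_quot_diff BUC_scaleC)
    then have "(abs_BUC_quot u, l *\<^sub>C abs_BUC_quot u - y) \<in> deriv_quot" using u(1) by (auto simp: deriv_quot_def)
    moreover have "norm (abs_BUC_quot u) \<le> b / \<bar>Re l\<bar>"
      using norm_BUC_quot_le [OF ub] u(2) f(3) l by (meson order_trans divide_right_mono less_imp_le abs_ge_zero)
    ultimately show ?thesis by blast
  qed
  define L where "L y = (SOME x. (x, l *\<^sub>C x - y) \<in> deriv_quot)" for y :: "'a BUC_quot"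
  have L: "(L y, l *\<^sub>C L y - y) \<in> deriv_quot" for y
  proof -
    have "\<exists>x. (x, l *\<^sub>C x - y) \<in> deriv_quot" using ex [of y "norm y + 1"] by auto
    then show ?thesis unfolding L_def by (rule someI_ex)
  qed
  have Lu: "L (l *\<^sub>C x - z) = x" if "(x, z) \<in> deriv_quot" for x z
    by (rule deriv_quot_resolvent_unique [OF L that _ l]) simp
  have Lb: "norm (L y) \<le> norm y / \<bar>Re l\<bar>" for y
  proof (rule tendsto_lowerbound)
    show "((\<lambda>b. b / \<bar>Re l\<bar>) \<longlongrightarrow> norm y / \<bar>Re l\<bar>) (at_right (norm y))"
      using l by (intro tendsto_intros) auto
    have "norm (L y) \<le> b / \<bar>Re l\<bar>" if lt: "norm y < b" for b
    proof -
      obtain x where x: "(x, l *\<^sub>C x - y) \<in> deriv_quot" "norm x \<le> b / \<bar>Re l\<bar>" using ex [OF lt] by blast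
      have "L y = x" using Lu [OF x(1)] by simp
      then show ?thesis using x(2) by simp
    qed
    then show "\<forall>\<^sub>F b in at_right (norm y). norm (L y) \<le> b / \<bar>Re l\<bar>" by (auto simp: eventually_at_filter)
  qed simp
  note cg = clinear_graph_deriv_quot [unfolded clinear_graph_def]
  have "bounded_linear L"
  proof (rule bounded_linear_intro [of L "1 / \<bar>Re l\<bar>"])
    fix x y :: "'a BUC_quot" and r :: real
    have "(L x + L y, (l *\<^sub>C L x - x) + (l *\<^sub>C L y - y)) \<in> deriv_quot" using cg L by blast
    from Lu [OF this] show "L (x + y) = L x + L y" by (simp add: scaleC_add_right add.commute [of x y])
    have "(of_real r *\<^sub>C L x, of_real r *\<^sub>C (l *\<^sub>C L x - x)) \<in> deriv_quot" using cg L by blast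
    from Lu [OF this] show "L (r *\<^sub>R x) = r *\<^sub>R L x"
      by (simp add: scaleC_of_real scaleC.scaleR_right scaleR_diff_right)
    show "norm (L x) \<le> norm x * (1 / \<bar>Re l\<bar>)" using Lb [of x] by simp
  qed
  from resolvent_setI [OF this L Lu]
  show "l \<in> resolvent_set (deriv_quot :: ('a BUC_quot \<times> 'a BUC_quot) set)" and "norm (Pres l y) \<le> norm y / \<bar>Re l\<bar>"
    using Lb by (auto simp: Pres_def)
qed

lemma pseudo_resolvent_Pres:
  "pseudo_resolvent (Pres :: complex \<Rightarrow> 'a::{complex_normed_vector, banach} BUC_quot \<Rightarrow>\<^sub>L _) {l. Re l \<noteq> 0}"
  unfolding pseudo_resolvent_def
proof (intro conjI ballI allI)
  show "open {l. Re l \<noteq> 0}" by (intro open_Collect_neq continuous_intros)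
  fix l assume "l \<in> {l. Re l \<noteq> 0}"
  then have l: "Re l \<noteq> 0" by simp
  note lr = deriv_quot_resolvent(1) [OF l, where 'a = 'a]
  show "clinear_op (Pres l :: 'a BUC_quot \<Rightarrow>\<^sub>L _)" unfolding Pres_def by (rule clinear_op_Res [OF lr clinear_graph_deriv_quot])
  show "Pres l y - Pres m y = (m - l) *\<^sub>C Pres l (Pres m y)" if "m \<in> {l. Re l \<noteq> 0}" for m and y :: "'a BUC_quot"
    unfolding Pres_def using that deriv_quot_resolvent(1) [of m, where 'a = 'a]
    by (intro Res_identity [OF lr _ clinear_graph_deriv_quot]) auto
  from Res_locally_bounded [OF clinear_graph_deriv_quot lr]
  show "\<exists>e>0. \<exists>M. \<forall>m\<in>{l. Re l \<noteq> 0}. dist m l < e \<longrightarrow> norm (Pres m :: 'a BUC_quot \<Rightarrow>\<^sub>L _) \<le> M"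
    unfolding Pres_def by blast
qed

lemma Pres_bound: "Re l \<noteq> 0 \<Longrightarrow> norm (Pres l :: 'a::{complex_normed_vector, banach} BUC_quot \<Rightarrow>\<^sub>L _) * \<bar>Re l\<bar> \<le> 1"
proof -
  assume l: "Re l \<noteq> 0"
  have "norm (Pres l :: 'a BUC_quot \<Rightarrow>\<^sub>L _) \<le> 1 / \<bar>Re l\<bar>"
    using deriv_quot_resolvent(2) [OF l, where 'a = 'a] by (intro norm_blinfun_bound) auto
  then show ?thesis using l by (simp add: field_simps)
qed

lemma Pres_eqI:
  fixes u :: "real \<Rightarrow> 'a::{complex_normed_vector, banach}"
  assumes "(u, v) \<in> deriv_op" "f \<in> BUC" "(\<lambda>t. l *\<^sub>C u t - v t - f t) \<in> C0" "Re l \<noteq> 0"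
  shows "Pres l (abs_BUC_quot f) = abs_BUC_quot u"
proof -
  have b: "u \<in> BUC" "v \<in> BUC" using assms(1) by (auto simp: deriv_opD)
  have "abs_BUC_quot f = abs_BUC_quot (\<lambda>t. l *\<^sub>C u t - v t)"
    using C0_uminus [OF assms(3)] b assms(2) by (simp add: abs_BUC_quot_eq_iff BUC_diff BUC_scaleC)
  also have "\<dots> = l *\<^sub>C abs_BUC_quot u - abs_BUC_quot v"
    using b by (simp add: abs_BUC_quot_scaleC abs_BUC_quot_diff BUC_scaleC)
  finally show ?thesis
    using resolvent_setD(2) [OF deriv_quot_resolvent(1) [OF assms(4)], of "abs_BUC_quot u" "abs_BUC_quot v"] assms(1)
    by (auto simp: Pres_def deriv_quot_def)
qed

text \<open>If the resolvent kills y, the graph of \<open>deriv_quot\<close> contains (0, - y), and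
  it is single-valued.\<close>

lemma Pres_inj:
  fixes y :: "'a::{complex_normed_vector, banach} BUC_quot"
  assumes "Re l \<noteq> 0" "Pres l y = 0"
  shows "y = 0"
proof -
  have "(0, - y) \<in> deriv_quot"
    using resolvent_setD(1) [OF deriv_quot_resolvent(1) [OF assms(1)], of y] assms(2) by (simp add: Pres_def)
  moreover have "(0, 0) \<in> (deriv_quot :: ('a BUC_quot \<times> 'a BUC_quot) set)"
    using clinear_graph_deriv_quot [unfolded clinear_graph_def, where 'a = 'a] calculation scaleC.zero_left by metis
  ultimately show ?thesis using deriv_quot_single_valued by fastforce
qed

lemma hat_eq_Pres: "Re l \<noteq> 0 \<Longrightarrow> hat g l = Pres l (abs_BUC_quot g)"
  unfolding hat_def Pres_def by (subst resolvent_setD(3) [OF deriv_quot_resolvent(1)]) auto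

section \<open>Semigroups and the resolvents of their generators\<close>

text \<open>The Banach-Steinhaus theorem: by Baire one of the closed sets \<open>F k\<close>
  contains a ball, and a ball bounds all the operators at once.\<close>

lemma uniform_boundedness:
  fixes A :: "nat \<Rightarrow> 'a::banach \<Rightarrow>\<^sub>L 'b::real_normed_vector"
  assumes pw: "\<And>x. \<exists>K. \<forall>n. norm (A n x) \<le> K"
  shows "\<exists>K. \<forall>n. norm (A n) \<le> K"
proof -
  define F where "F k = {x. \<forall>n. norm (A n x) \<le> real k}" for k :: nat
  have cl: "closed (F k)" for k
  proof -
    have "F k = (\<Inter>n. {x. norm (A n x) \<le> real k})" by (auto simp: F_def)
    moreover have "closed {x. norm (A n x) \<le> real k}" for n
      by (intro closed_Collect_le continuous_intros)
    ultimately show ?thesis by auto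
  qed
  have un: "(\<Union>k. F k) = UNIV"
  proof -
    have "x \<in> (\<Union>k. F k)" for x
    proof -
      obtain K where "\<And>n. norm (A n x) \<le> K" using pw by blast
      moreover obtain k :: nat where "K \<le> real k" using real_arch_simple by blast
      ultimately have "x \<in> F k" by (auto simp: F_def intro: order_trans)
      then show ?thesis by blast
    qed
    then show ?thesis by blast
  qed
  have "\<exists>k. interior (F k) \<noteq> {}"
  proof (rule ccontr)
    assume "\<not> (\<exists>k. interior (F k) \<noteq> {})"
    then have "Met_TC.mtopology interior_of \<Union> (range F) = {}"
      by (intro Met_TC.metric_Baire_category_alt) (auto simp: cl complete_UNIV)
    then have "interior (\<Union> (range F)) = {}" by simp
    then show False using un by simp
  qed
  then obtain k x0 where "x0 \<in> interior (F k)" by blast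
  then obtain r where r: "0 < r" "cball x0 r \<subseteq> F k" by (meson mem_interior_cball)
  have "norm (A n) \<le> 2 * real k / r" for n
  proof (rule norm_blinfun_bound)
    fix x
    show "norm (A n x) \<le> 2 * real k / r * norm x"
    proof (cases "x = 0")
      case False
      define y where "y = (r / norm x) *\<^sub>R x"
      have "norm y = r" using False r by (simp add: y_def)
      then have "x0 + y \<in> F k" "x0 \<in> F k" using r by (auto simp: dist_norm intro!: subsetD [OF r(2)])
      then have "norm (A n (x0 + y)) \<le> real k" "norm (A n x0) \<le> real k" by (auto simp: F_def)
      moreover have "A n y = A n (x0 + y) - A n x0" by (simp add: blinfun.add_right)
      ultimately have "norm (A n y) \<le> 2 * real k"
        using norm_triangle_ineq4 [of "A n (x0 + y)" "A n x0"] by simp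
      then have "r / norm x * norm (A n x) \<le> 2 * real k" using r by (simp add: y_def blinfun.scaleR_right)
      then show ?thesis using r False by (simp add: field_simps)
    qed simp
  qed (use r in simp)
  then show ?thesis by blast
qed

lemma C0_semigroupD:
  assumes "C0_semigroup U"
  shows "0 \<le> t \<Longrightarrow> clinear_op (U t)" "U 0 = id_blinfun" "0 \<le> s \<Longrightarrow> 0 \<le> t \<Longrightarrow> U (s + t) = U s o\<^sub>L U t"
    "((\<lambda>t. U t x) \<longlongrightarrow> x) (at_right 0)"
  using assms by (auto simp: C0_semigroup_def)

text \<open>Otherwise the norms would be unbounded along some positive times tending to 0, although
  every orbit converges along them.\<close>

lemma C0_semigroup_bounded_near_0:
  fixes U :: "real \<Rightarrow> 'a::{complex_normed_vector, banach} \<Rightarrow>\<^sub>L 'a"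
  assumes U: "C0_semigroup U"
  obtains d M where "0 < d" "1 \<le> M" "\<And>t. 0 \<le> t \<Longrightarrow> t \<le> d \<Longrightarrow> norm (U t) \<le> M"
proof -
  have "\<exists>n::nat. \<forall>t. 0 < t \<and> t \<le> 1 / (real n + 1) \<longrightarrow> norm (U t) \<le> real n"
  proof (rule ccontr)
    assume "\<not> (\<exists>n::nat. \<forall>t. 0 < t \<and> t \<le> 1 / (real n + 1) \<longrightarrow> norm (U t) \<le> real n)"
    then obtain t where t: "\<And>n::nat. 0 < t n" "\<And>n. t n \<le> 1 / (real n + 1)" "\<And>n. real n < norm (U (t n))"
      by (metis not_le)
    have "t \<longlonglongrightarrow> 0"
    proof (rule tendsto_sandwich [OF _ _ tendsto_const])
      show "(\<lambda>n. 1 / (real n + 1)) \<longlonglongrightarrow> 0" by real_asymp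
    qed (use t(1,2) less_imp_le [OF t(1)] in \<open>auto intro!: always_eventually\<close>)
    then have lim: "filterlim t (at_right 0) sequentially"
      using t(1) less_imp_neq [OF t(1), symmetric] by (simp add: filterlim_at)
    have "\<exists>K. \<forall>n. norm (U (t n) x) \<le> K" for x
    proof -
      have "(\<lambda>n. U (t n) x) \<longlonglongrightarrow> x" by (rule filterlim_compose [OF C0_semigroupD(4) [OF U] lim])
      then have "Bseq (\<lambda>n. U (t n) x)" using convergent_imp_Bseq convergent_def by blast
      then show ?thesis by (auto simp: Bseq_def)
    qed
    from uniform_boundedness [OF this] obtain K where K: "\<And>n. norm (U (t n)) \<le> K" by blast
    obtain n :: nat where "K \<le> real n" using real_arch_simple by blast
    with K [of n] t(3) [of n] show False by linarith
  qed
  then obtain n :: nat where n: "\<And>t. 0 < t \<Longrightarrow> t \<le> 1 / (real n + 1) \<Longrightarrow> norm (U t) \<le> real n" by blast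
  show thesis
  proof (rule that [of "1 / (real n + 1)" "max 1 (real n)"])
    fix t assume t: "0 \<le> t" "t \<le> 1 / (real n + 1)"
    show "norm (U t) \<le> max 1 (real n)"
    proof (cases "t = 0")
      case True
      then show ?thesis
        using C0_semigroupD(2) [OF U] by (simp add: norm_blinfun_id_le max.coboundedI1)
    qed (use n [of t] t in auto)
  qed auto
qed

lemma C0_semigroup_bound:
  fixes U :: "real \<Rightarrow> 'a::{complex_normed_vector, banach} \<Rightarrow>\<^sub>L 'a"
  assumes U: "C0_semigroup U"
  obtains M \<omega> where "1 \<le> M" "0 \<le> \<omega>" "\<And>t. 0 \<le> t \<Longrightarrow> norm (U t) \<le> M * exp (\<omega> * t)"
proof -
  obtain d M where d: "0 < d" and M: "1 \<le> M" "\<And>t. 0 \<le> t \<Longrightarrow> t \<le> d \<Longrightarrow> norm (U t) \<le> M"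
    using C0_semigroup_bounded_near_0 [OF U] by metis
  have pw: "norm (U (real n * s + s)) \<le> M ^ Suc n" if "0 \<le> s" "s \<le> d" for n s
  proof (induction n)
    case 0
    then show ?case using M that by simp
  next
    case (Suc n)
    have "real (Suc n) * s + s = s + (real n * s + s)" by (simp add: algebra_simps)
    moreover have "0 \<le> real n * s + s" using that by simp
    ultimately have "U (real (Suc n) * s + s) = U s o\<^sub>L U (real n * s + s)"
      by (simp only: C0_semigroupD(3) [OF U that(1)])
    then have "norm (U (real (Suc n) * s + s)) \<le> norm (U s) * norm (U (real n * s + s))"
      by (simp add: norm_blinfun_compose)
    also have "\<dots> \<le> M * M ^ Suc n" using Suc M that by (intro mult_mono) auto
    finally show ?case by simp
  qed
  define \<omega> where "\<omega> = ln M / d"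
  show thesis
  proof (rule that [of "M * M" \<omega>])
    show "1 \<le> M * M" using M mult_mono [of 1 M 1 M] by simp
    show "0 \<le> \<omega>" using M d by (simp add: \<omega>_def)
    fix t :: real assume t: "0 \<le> t"
    \<comment> \<open>The time t is cut into n + 1 equal steps of length at most d. Of the resulting
      power of M, n factors go into the exponential and the extra one into the constant.\<close>
    define n where "n = nat \<lfloor>t / d\<rfloor>"
    have n: "real n \<le> t / d" "t / d \<le> real n + 1" using t d by (auto simp: n_def)
    define s where "s = t / (real n + 1)"
    have "(real n + 1) * s = t" using of_nat_0_le_iff [of n, where 'a = real] by (simp add: s_def)
    then have s3: "t = real n * s + s" by (simp add: distrib_right)
    have s: "0 \<le> s" "s \<le> d" using t d n by (auto simp: s_def field_simps)
    have "norm (U t) \<le> M ^ Suc n" using pw [OF s, of n] by (simp only: s3 [symmetric])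
    also have "M ^ Suc n = M * exp (ln M * real n)"
      using M exp_of_nat_mult [of n "ln M"] by (simp add: mult.commute)
    also have "\<dots> \<le> M * exp (\<omega> * t)"
    proof -
      have "ln M * real n \<le> ln M * (t / d)" using n M by (intro mult_left_mono) auto
      then show ?thesis using M by (simp add: \<omega>_def)
    qed
    also have "\<dots> \<le> (M * M) * exp (\<omega> * t)" using M by (simp add: mult_right_mono)
    finally show "norm (U t) \<le> (M * M) * exp (\<omega> * t)" .
  qed
qed

lemma C0_semigroup_continuous:
  fixes U :: "real \<Rightarrow> 'a::{complex_normed_vector, banach} \<Rightarrow>\<^sub>L 'a"
  assumes U: "C0_semigroup U"
  shows "continuous_on {0..} (\<lambda>t. U t x)"
  unfolding continuous_on_def
proof
  fix t0 :: real assume "t0 \<in> {0..}"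
  then have t0: "0 \<le> t0" by simp
  obtain M \<omega> where M: "1 \<le> M" "0 \<le> \<omega>" "\<And>t. 0 \<le> t \<Longrightarrow> norm (U t) \<le> M * exp (\<omega> * t)"
    using C0_semigroup_bound [OF U] by metis
  have r: "((\<lambda>h. norm (U h x - x)) \<longlongrightarrow> 0) (at_right 0)"
    using C0_semigroupD(4) [OF U, of x] by (simp add: tendsto_norm_zero LIM_zero)
  have a: "filterlim (\<lambda>t. \<bar>t - t0\<bar>) (at_right 0) (at t0 within {0..})"
    unfolding filterlim_at
  proof
    show "((\<lambda>t. \<bar>t - t0\<bar>) \<longlongrightarrow> 0) (at t0 within {0..})" by (auto intro!: tendsto_eq_intros)
    show "\<forall>\<^sub>F t in at t0 within {0..}. \<bar>t - t0\<bar> \<in> {0<..} \<and> \<bar>t - t0\<bar> \<noteq> 0"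
      by (auto simp: eventually_at_filter)
  qed
  have "((\<lambda>t. M * exp (\<omega> * (t0 + 1)) * norm (U \<bar>t - t0\<bar> x - x)) \<longlongrightarrow> M * exp (\<omega> * (t0 + 1)) * 0) (at t0 within {0..})"
    by (intro tendsto_intros filterlim_compose [OF r a])
  then have lim: "((\<lambda>t. M * exp (\<omega> * (t0 + 1)) * norm (U \<bar>t - t0\<bar> x - x)) \<longlongrightarrow> 0) (at t0 within {0..})" by simp
  have "\<forall>\<^sub>F t in at t0 within {0..}. dist t t0 < 1 \<and> t \<in> {0..}"
    by (auto simp: eventually_at intro!: exI [of _ 1])
  then have "\<forall>\<^sub>F t in at t0 within {0..}. norm (U t x - U t0 x) \<le> M * exp (\<omega> * (t0 + 1)) * norm (U \<bar>t - t0\<bar> x - x)"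
  proof eventually_elim
    case (elim t)
    have b: "norm (U s) \<le> M * exp (\<omega> * (t0 + 1))" if "0 \<le> s" "s \<le> t0 + 1" for s
    proof -
      have "\<omega> * s \<le> \<omega> * (t0 + 1)" using that M by (intro mult_left_mono) auto
      then show ?thesis using M(3) [OF that(1)] M(1) by (smt (verit) exp_le_cancel_iff mult_left_mono)
    qed
    \<comment> \<open>Factoring out the smaller of the two times leaves an increment |t - t0| at
      time 0, so one estimate covers continuity from both sides.\<close>
    define m where "m = min t t0"
    have m: "0 \<le> m" "m \<le> t0 + 1" using elim t0 by (auto simp: m_def)
    have dec: "U (m + h) y = U m (U h y)" if "0 \<le> h" for h y
      using C0_semigroupD(3) [OF U m(1) that] by simp
    have "norm (U t x - U t0 x) = norm (U m (U \<bar>t - t0\<bar> x - x))"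
    proof (cases "t \<le> t0")
      case True
      then have "m = t" "m + \<bar>t - t0\<bar> = t0" by (auto simp: m_def)
      then show ?thesis using dec [of "\<bar>t - t0\<bar>" x] by (simp add: blinfun.diff_right norm_minus_commute)
    next
      case False
      then have "m = t0" "m + \<bar>t - t0\<bar> = t" by (auto simp: m_def)
      then show ?thesis using dec [of "\<bar>t - t0\<bar>" x] by (simp add: blinfun.diff_right)
    qed
    also have "\<dots> \<le> norm (U m) * norm (U \<bar>t - t0\<bar> x - x)" by (rule norm_blinfun)
    also have "\<dots> \<le> M * exp (\<omega> * (t0 + 1)) * norm (U \<bar>t - t0\<bar> x - x)" using m by (intro mult_right_mono b) auto
    finally show ?case .
  qed
  from Lim_null_comparison [OF this lim] show "((\<lambda>t. U t x) \<longlongrightarrow> U t0 x) (at t0 within {0..})"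
    by (simp add: LIM_zero_iff)
qed

section \<open>Laplace transforms of operator families and the resolvent of the generator\<close>

definition laplace :: "(real \<Rightarrow> 'a::{complex_normed_vector, banach} \<Rightarrow>\<^sub>L 'a) \<Rightarrow> complex \<Rightarrow> 'a \<Rightarrow> 'a"
  where "laplace U l x = Lim at_top (\<lambda>n. integral {0..n} (\<lambda>t. exp (- l * of_real t) *\<^sub>C U t x))"

locale exp_bounded =
  fixes U :: "real \<Rightarrow> 'a::{complex_normed_vector, banach} \<Rightarrow>\<^sub>L 'a" and M \<omega> :: real
  assumes cont: "\<And>x. continuous_on {0..} (\<lambda>t. U t x)"
    and bound: "\<And>t. 0 \<le> t \<Longrightarrow> norm (U t) \<le> M * exp (\<omega> * t)" and M: "0 \<le> M"
begin

lemma laplace_integrand: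
  shows "S \<subseteq> {0..} \<Longrightarrow> continuous_on S (\<lambda>t. exp (- l * of_real t) *\<^sub>C U t x)"
    and "0 \<le> t \<Longrightarrow> norm (exp (- l * of_real t) *\<^sub>C U t x) \<le> (M * norm x) * exp (- (Re l - \<omega>) * t)"
proof -
  show "continuous_on S (\<lambda>t. exp (- l * of_real t) *\<^sub>C U t x)" if "S \<subseteq> {0..}"
    by (intro scaleC.continuous_on continuous_intros continuous_on_subset [OF cont that])
  assume t: "0 \<le> t"
  have "norm (exp (- l * of_real t) *\<^sub>C U t x) = exp (- Re l * t) * norm (U t x)" by simp
  also have "\<dots> \<le> exp (- Re l * t) * ((M * exp (\<omega> * t)) * norm x)"
    using bound [OF t] by (intro mult_left_mono order_trans [OF norm_blinfun] mult_right_mono) auto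
  also have "\<dots> = (M * norm x) * (exp (- Re l * t) * exp (\<omega> * t))" by simp
  also have "exp (- Re l * t) * exp (\<omega> * t) = exp (- (Re l - \<omega>) * t)" by (simp add: exp_add [symmetric] algebra_simps)
  finally show "norm (exp (- l * of_real t) *\<^sub>C U t x) \<le> (M * norm x) * exp (- (Re l - \<omega>) * t)" .
qed

lemma laplace_tendsto:
  assumes "\<omega> < Re l"
  shows "((\<lambda>n. integral {0..n} (\<lambda>t. exp (- l * of_real t) *\<^sub>C U t x)) \<longlongrightarrow> laplace U l x) at_top"
proof -
  have "\<exists>I. ((\<lambda>n. integral {0..n} (\<lambda>t. exp (- l * of_real t) *\<^sub>C U t x)) \<longlongrightarrow> I) at_top"
    using improper_integral_exp [where \<kappa> = "Re l - \<omega>" and C = "M * norm x",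
      OF laplace_integrand(1) [OF order_refl] _ _ laplace_integrand(2)] assms M
    by auto
  then show ?thesis unfolding laplace_def using tendsto_Lim trivial_limit_at_top_linorder by blast
qed

lemma norm_laplace:
  assumes "\<omega> < Re l"
  shows "norm (laplace U l x) \<le> M / (Re l - \<omega>) * norm x"
proof -
  have "norm (laplace U l x) \<le> M * norm x / (Re l - \<omega>)"
    by (rule norm_improper_integral_exp(1) [where \<kappa> = "Re l - \<omega>" and C = "M * norm x",
      OF laplace_integrand(1) [OF order_refl] _ _ laplace_integrand(2) laplace_tendsto [OF assms]]) (use assms M in auto)
  then show ?thesis by simp
qed

lemma laplace_integrable: "0 \<le> s \<Longrightarrow> (\<lambda>t. exp (- l * of_real t) *\<^sub>C U t x) integrable_on {s..n}"
  by (intro integrable_continuous_real laplace_integrand(1)) auto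

lemma laplace_image:
  assumes l: "\<omega> < Re l" and V: "clinear_op V" "\<And>t y. 0 \<le> t \<Longrightarrow> V (U t y) = U t (V y)"
  shows "V (laplace U l x) = laplace U l (V x)"
proof (rule tendsto_unique [OF _ _ laplace_tendsto [OF l]])
  have eq: "V (integral {0..n} (\<lambda>t. exp (- l * of_real t) *\<^sub>C U t x)) = integral {0..n} (\<lambda>t. exp (- l * of_real t) *\<^sub>C U t (V x))" for n
  proof -
    have "integral {0..n} (\<lambda>t. exp (- l * of_real t) *\<^sub>C U t (V x)) = integral {0..n} (\<lambda>t. V (exp (- l * of_real t) *\<^sub>C U t x))"
      by (intro integral_cong) (simp add: clinear_opD [OF V(1)] V(2))
    then show ?thesis by (simp only: integral_blinfun [OF laplace_integrable [OF order_refl]])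
  qed
  have "((\<lambda>n. V (integral {0..n} (\<lambda>t. exp (- l * of_real t) *\<^sub>C U t x))) \<longlongrightarrow> V (laplace U l x)) at_top"
    by (intro tendsto_intros laplace_tendsto l)
  then show "((\<lambda>n. integral {0..n} (\<lambda>t. exp (- l * of_real t) *\<^sub>C U t (V x))) \<longlongrightarrow> V (laplace U l x)) at_top"
    by (simp only: eq)
qed simp

lemma bounded_linear_laplace:
  assumes l: "\<omega> < Re l"
  shows "bounded_linear (laplace U l)"
proof (rule bounded_linear_intro [of _ "M / (Re l - \<omega>)"])
  fix x y and r :: real
  show "laplace U l (x + y) = laplace U l x + laplace U l y"
  proof (rule tendsto_unique [OF _ laplace_tendsto [OF l]])
    have "((\<lambda>n. integral {0..n} (\<lambda>t. exp (- l * of_real t) *\<^sub>C U t x) + integral {0..n} (\<lambda>t. exp (- l * of_real t) *\<^sub>C U t y))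
      \<longlongrightarrow> laplace U l x + laplace U l y) at_top"
      by (intro tendsto_intros laplace_tendsto l)
    then show "((\<lambda>n. integral {0..n} (\<lambda>t. exp (- l * of_real t) *\<^sub>C U t (x + y))) \<longlongrightarrow> laplace U l x + laplace U l y) at_top"
      by (simp only: blinfun.add_right scaleC_add_right integral_add [OF laplace_integrable [OF order_refl] laplace_integrable [OF order_refl]])
  qed simp
  show "laplace U l (r *\<^sub>R x) = r *\<^sub>R laplace U l x"
  proof (rule tendsto_unique [OF _ laplace_tendsto [OF l]])
    have "((\<lambda>n. r *\<^sub>R integral {0..n} (\<lambda>t. exp (- l * of_real t) *\<^sub>C U t x)) \<longlongrightarrow> r *\<^sub>R laplace U l x) at_top"
      by (intro tendsto_intros laplace_tendsto l)
    then show "((\<lambda>n. integral {0..n} (\<lambda>t. exp (- l * of_real t) *\<^sub>C U t (r *\<^sub>R x))) \<longlongrightarrow> r *\<^sub>R laplace U l x) at_top"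
      by (simp add: blinfun.scaleR_right scaleC.scaleR_right)
  qed simp
  show "norm (laplace U l x) \<le> norm x * (M / (Re l - \<omega>))" using norm_laplace [OF l, of x] by (simp add: mult.commute)
qed

end

lemma at_right_nontriv: "at_right (0::real) \<noteq> bot"
  by simp

lemma generator_unique: "(x, y) \<in> generator T \<Longrightarrow> (x, z) \<in> generator T \<Longrightarrow> y = z"
  unfolding generator_def using tendsto_unique [OF at_right_nontriv] by blast

lemma generator_image:
  fixes T :: "real \<Rightarrow> 'a::complex_normed_vector \<Rightarrow>\<^sub>L 'a" and V :: "'a \<Rightarrow>\<^sub>L 'a"
  assumes "\<And>h y. 0 < h \<Longrightarrow> V (T h y) = T h (V y)" "(u, z) \<in> generator T"
  shows "(blinfun_apply V u, blinfun_apply V z) \<in> generator T"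
proof -
  have "((\<lambda>h. V ((1 / h) *\<^sub>R (T h u - u))) \<longlongrightarrow> V z) (at_right 0)"
    using assms(2) by (intro tendsto_intros) (simp add: generator_def)
  moreover have "\<forall>\<^sub>F h in at_right 0. V ((1 / h) *\<^sub>R (T h u - u)) = (1 / h) *\<^sub>R (T h (V u) - V u)"
    using assms(1) by (auto simp: eventually_at_filter blinfun.scaleR_right blinfun.diff_right)
  ultimately show ?thesis by (simp add: generator_def tendsto_cong)
qed

lemma clinear_graph_generator:
  assumes "C0_semigroup T"
  shows "clinear_graph (generator T)"
  unfolding clinear_graph_def
proof (intro conjI allI impI)
  fix x z y w
  assume "(x, z) \<in> generator T" "(y, w) \<in> generator T"
  then have "((\<lambda>h. (1 / h) *\<^sub>R (T h x - x) + (1 / h) *\<^sub>R (T h y - y)) \<longlongrightarrow> z + w) (at_right 0)"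
    by (intro tendsto_intros) (auto simp: generator_def)
  then show "(x + y, z + w) \<in> generator T"
    by (simp add: generator_def blinfun.add_right algebra_simps)
next
  fix c x z
  assume "(x, z) \<in> generator T"
  then have "((\<lambda>h. c *\<^sub>C (1 / h) *\<^sub>R (T h x - x)) \<longlongrightarrow> c *\<^sub>C z) (at_right 0)"
    by (intro tendsto_intros scaleC.tendsto) (auto simp: generator_def)
  moreover have "\<forall>\<^sub>F h in at_right 0. c *\<^sub>C (1 / h) *\<^sub>R (T h x - x) = (1 / h) *\<^sub>R (T h (c *\<^sub>C x) - c *\<^sub>C x)"
    using clinear_opD [OF C0_semigroupD(1) [OF assms]]
    by (auto simp: eventually_at_filter scaleC.scaleR_right scaleC_diff_right)
  ultimately show "(c *\<^sub>C x, c *\<^sub>C z) \<in> generator T"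
    by (simp add: generator_def tendsto_cong)
qed

text \<open>That L is also a left inverse follows from commutation: L maps the graph of the
  generator into itself, and since the generator is single-valued, L z is the second component
  already known for L u.\<close>

lemma generator_resolventI:
  fixes T :: "real \<Rightarrow> 'a::{complex_normed_vector, banach} \<Rightarrow>\<^sub>L 'a"
  assumes T: "C0_semigroup T" and L: "bounded_linear L" "\<And>h y. 0 < h \<Longrightarrow> L (T h y) = T h (L y)"
    and g: "\<And>x. (L x, l *\<^sub>C L x - x) \<in> generator T" and cl: "\<And>x. L (l *\<^sub>C x) = l *\<^sub>C L x"
  shows "l \<in> resolvent_set (generator T)" "blinfun_apply (Res (generator T) l) = L"
proof -
  have V: "blinfun_apply (Blinfun L) = L" by (rule bounded_linear_Blinfun_apply [OF L(1)])
  interpret L: bounded_linear L by (rule L(1))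
  have "L (l *\<^sub>C u - z) = u" if uz: "(u, z) \<in> generator T" for u z
  proof -
    have "(L u, L z) \<in> generator T" using generator_image [of "Blinfun L" T u z] L(2) uz by (simp add: V)
    then have "L z = l *\<^sub>C L u - u" using g generator_unique by blast
    then show ?thesis by (simp add: L.diff cl)
  qed
  then show "l \<in> resolvent_set (generator T)" "blinfun_apply (Res (generator T) l) = L"
    using resolvent_setI [OF L(1) g] by auto
qed

lemma vector_derivative_at_right:
  fixes u :: "real \<Rightarrow> 'a::real_normed_vector"
  assumes "(u has_vector_derivative v) (at 0 within {0..})"
  shows "((\<lambda>h. (1 / h) *\<^sub>R (u h - u 0)) \<longlongrightarrow> v) (at_right 0)"
proof -
  have "((\<lambda>y. norm (u y - u 0 - y *\<^sub>R v) / norm y) \<longlongrightarrow> 0) (at 0 within {0..})"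
    using assms by (simp add: has_vector_derivative_def has_derivative_iff_norm)
  then have "((\<lambda>y. norm (u y - u 0 - y *\<^sub>R v) / norm y) \<longlongrightarrow> 0) (at_right 0)"
    by (rule tendsto_within_subset) auto
  then have "((\<lambda>h. (1 / h) *\<^sub>R (u h - u 0) - v) \<longlongrightarrow> 0) (at_right 0)"
  proof (rule Lim_null_comparison [rotated])
    show "\<forall>\<^sub>F h in at_right 0. norm ((1 / h) *\<^sub>R (u h - u 0) - v) \<le> norm (u h - u 0 - h *\<^sub>R v) / norm h"
      unfolding eventually_at_filter
    proof (rule always_eventually, intro allI impI)
      fix h :: real assume h: "h \<noteq> 0"
      have "(1 / h) *\<^sub>R (u h - u 0) - v = (1 / h) *\<^sub>R (u h - u 0 - h *\<^sub>R v)" using h by (simp add: scaleR_diff_right)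
      then show "norm ((1 / h) *\<^sub>R (u h - u 0) - v) \<le> norm (u h - u 0 - h *\<^sub>R v) / norm h" by simp
    qed
  qed
  then show ?thesis by (simp add: LIM_zero_iff)
qed

locale bounded_C0_semigroup = exp_bounded T M \<omega>
  for T :: "real \<Rightarrow> 'a::{complex_normed_vector, banach} \<Rightarrow>\<^sub>L 'a" and M \<omega> +
  assumes T: "C0_semigroup T"
begin

text \<open>The semigroup law shifts the variable of integration. As a function of h the right-hand
  side has the form treated in \<open>exp_ode_solution\<close>.\<close>

lemma T_laplace:
  assumes l: "\<omega> < Re l" and h: "0 \<le> h"
  shows "T h (laplace T l x) = exp (l * of_real h) *\<^sub>C (laplace T l x - integral {0..h} (\<lambda>s. exp (- l * of_real s) *\<^sub>C T s x))"
proof (rule tendsto_unique)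
  let ?k = "\<lambda>s. exp (- l * of_real s) *\<^sub>C T s x"
  show "((\<lambda>n. T h (integral {0..n} ?k)) \<longlongrightarrow> T h (laplace T l x)) at_top"
    by (intro tendsto_intros laplace_tendsto l)
  have "filterlim (\<lambda>n::real. n + h) at_top at_top" by real_asymp
  from filterlim_compose [OF laplace_tendsto [OF l] this]
  have lim: "((\<lambda>n. exp (l * of_real h) *\<^sub>C (integral {0..n + h} ?k - integral {0..h} ?k)) \<longlongrightarrow>
    exp (l * of_real h) *\<^sub>C (laplace T l x - integral {0..h} ?k)) at_top"
    by (intro tendsto_intros scaleC.tendsto)
  have "\<forall>\<^sub>F n in at_top. T h (integral {0..n} ?k) = exp (l * of_real h) *\<^sub>C (integral {0..n + h} ?k - integral {0..h} ?k)"
    using eventually_ge_at_top [of 0]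
  proof eventually_elim
    case (elim n)
    have "(?k has_integral integral {h..n + h} ?k) (cbox h (n + h))"
      using laplace_integrable [OF h] by (simp add: integrable_integral)
    from has_integral_affinity [OF this, of 1 h]
    have i: "((\<lambda>s. ?k (s + h)) has_integral integral {h..n + h} ?k) {0..n}"
      using image_add_atLeastAtMost [of "-h" h "n + h"] by simp
    have "T h (integral {0..n} ?k) = integral {0..n} (\<lambda>s. T h (?k s))"
      by (rule integral_blinfun [OF laplace_integrable [OF order_refl], symmetric])
    also have "\<dots> = integral {0..n} (\<lambda>s. exp (l * of_real h) *\<^sub>C ?k (s + h))"
    proof (rule integral_cong)
      fix s assume s: "s \<in> {0..n}"
      have "T h (T s x) = T (s + h) x" using C0_semigroupD(3) [OF T h, of s] s by (simp add: add.commute)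
      then show "T h (?k s) = exp (l * of_real h) *\<^sub>C ?k (s + h)"
        using clinear_opD [OF C0_semigroupD(1) [OF T h]]
        by (simp add: scaleC_scaleC exp_add [symmetric] algebra_simps)
    qed
    also have "\<dots> = exp (l * of_real h) *\<^sub>C integral {h..n + h} ?k"
      using integral_scaleC [OF has_integral_integrable [OF i]] integral_unique [OF i] by simp
    also have "integral {h..n + h} ?k = integral {0..n + h} ?k - integral {0..h} ?k"
    proof -
      have "integral {0..h} ?k + integral {h..n + h} ?k = integral {0..n + h} ?k"
        by (rule Henstock_Kurzweil_Integration.integral_combine [OF h _ laplace_integrable [OF order_refl]]) (use elim in simp)
      then show ?thesis by (intro add_implies_diff) (simp only: add.commute)
    qed
    finally show ?case .
  qed
  then show "((\<lambda>n. T h (integral {0..n} ?k)) \<longlongrightarrow> exp (l * of_real h) *\<^sub>C (laplace T l x - integral {0..h} ?k)) at_top"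
    using lim by (rule tendsto_cong [THEN iffD2])
qed simp

lemma T_laplace_derivative:
  assumes l: "\<omega> < Re l" and t: "0 \<le> t"
  shows "((\<lambda>h. T h (laplace T l x)) has_vector_derivative l *\<^sub>C T t (laplace T l x) - T t x) (at t within {0..})"
proof -
  have "((\<lambda>h. exp (l * of_real h) *\<^sub>C (laplace T l x - integral {0..h} (\<lambda>s. exp (- l * of_real s) *\<^sub>C T s x)))
    has_vector_derivative l *\<^sub>C T t (laplace T l x) - T t x) (at t within {0..})"
    using exp_ode_solution [OF cont t, of l "laplace T l x"] by (simp only: T_laplace [OF l t])
  then show ?thesis
    by (rule has_vector_derivative_transform [rotated 2]) (use t T_laplace [OF l] in auto)
qed

lemma laplace_generator:
  assumes l: "\<omega> < Re l"
  shows "(laplace T l x, l *\<^sub>C laplace T l x - x) \<in> generator T"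
  using vector_derivative_at_right [OF T_laplace_derivative [OF l order_refl, of x]]
  by (simp add: generator_def C0_semigroupD(2) [OF T])

lemma T_commute: "0 \<le> s \<Longrightarrow> 0 \<le> t \<Longrightarrow> T s (T t y) = T t (T s y)"
  using C0_semigroupD(3) [OF T, of s t] C0_semigroupD(3) [OF T, of t s]
  by (metis add.commute blinfun_apply_blinfun_compose)

lemma scaleC_blinfun_ex: "\<exists>V :: 'a \<Rightarrow>\<^sub>L 'a. clinear_op V \<and> (\<forall>y. V y = c *\<^sub>C y)"
  by (rule exI [of _ "c *\<^sub>C id_blinfun"]) (simp add: clinear_op_def scaleC_scaleC mult.commute)

lemma laplace_scaleC:
  assumes "\<omega> < Re l" "\<And>t. 0 \<le> t \<Longrightarrow> clinear_op (T t)"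
  shows "laplace T l (c *\<^sub>C x) = c *\<^sub>C laplace T l x"
proof -
  obtain V :: "'a \<Rightarrow>\<^sub>L 'a" where V: "clinear_op V" "\<And>y. V y = c *\<^sub>C y" using scaleC_blinfun_ex by blast
  show ?thesis using laplace_image [OF assms(1) V(1), of x] assms(2) by (simp add: V(2) clinear_opD)
qed

lemma resolvent_laplace:
  assumes l: "\<omega> < Re l"
  shows "l \<in> resolvent_set (generator T)" "blinfun_apply (Res (generator T) l) = laplace T l"
proof -
  have c: "laplace T l (T h y) = T h (laplace T l y)" if "0 < h" for h y
  proof -
    have "0 \<le> h" using that by simp
    then show ?thesis
      using laplace_image [OF l C0_semigroupD(1) [OF T] T_commute, of h y] by simp
  qed
  note a = generator_resolventI [OF T bounded_linear_laplace [OF l] c laplace_generator [OF l]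
      laplace_scaleC [OF l C0_semigroupD(1) [OF T]]]
  show "l \<in> resolvent_set (generator T)" "blinfun_apply (Res (generator T) l) = laplace T l"
    by (rule a; assumption)+
qed

end

section \<open>Analytic semigroups and the decay of the resolvent in vertical strips\<close>

lemma ray_in_sector:
  assumes "\<bar>\<phi>\<bar> < \<theta>" "\<theta> \<le> pi / 2" "0 < r"
  shows "of_real r * cis \<phi> \<in> sector \<theta>"
proof -
  have "Arg (of_real r * cis \<phi>) = \<phi>"
    using assms by (subst Arg_times_of_real, simp) (rule Arg_cis, use pi_gt_zero in auto)
  then show ?thesis using assms by (simp add: sector_def)
qed

text \<open>Arg is discontinuous on the negative axis, but there its value pi is outside the allowed
  range.\<close>

lemma open_sector:
  assumes "\<theta> \<le> pi / 2"
  shows "open (sector \<theta>)"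
proof -
  have "Arg z = pi" if "z \<in> \<real>\<^sub>\<le>\<^sub>0" "z \<noteq> 0" for z
    using that by (auto simp: complex_nonpos_Reals_iff Arg_eq_pi complex_eq_iff less_le complex_is_Real_iff)
  then have "sector \<theta> = (- \<real>\<^sub>\<le>\<^sub>0) \<inter> Arg -` {- \<theta><..<\<theta>}"
  proof -
    have "z \<in> sector \<theta> \<longleftrightarrow> z \<in> (- \<real>\<^sub>\<le>\<^sub>0) \<inter> Arg -` {- \<theta><..<\<theta>}" for z
    proof (cases "z \<in> \<real>\<^sub>\<le>\<^sub>0")
      case True
      have "\<not> pi < \<theta>" using assms pi_gt_zero by linarith
      then show ?thesis using \<open>\<And>z. z \<in> \<real>\<^sub>\<le>\<^sub>0 \<Longrightarrow> z \<noteq> 0 \<Longrightarrow> Arg z = pi\<close> [of z] True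
        by (auto simp: sector_def)
    next
      case False
      then have "z \<noteq> 0" by auto
      with False show ?thesis by (auto simp: sector_def)
    qed
    then show ?thesis by blast
  qed
  moreover have "open ((- \<real>\<^sub>\<le>\<^sub>0) \<inter> Arg -` {- \<theta><..<\<theta>})"
  proof (rule continuous_open_preimage)
    show "continuous_on (- \<real>\<^sub>\<le>\<^sub>0) Arg"
      by (intro continuous_at_imp_continuous_on ballI continuous_at_Arg) simp
    show "open (- (\<real>\<^sub>\<le>\<^sub>0 :: complex set))" by (simp add: open_Compl)
  qed simp
  ultimately show ?thesis by simp
qed

locale analytic_semigroup =
  fixes T :: "real \<Rightarrow> 'a::{complex_normed_vector, banach} \<Rightarrow>\<^sub>L 'a" and S :: "complex \<Rightarrow> 'a \<Rightarrow>\<^sub>L 'a" and \<theta> :: real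
  assumes T: "C0_semigroup T" and \<theta>: "0 < \<theta>" "\<theta> \<le> pi / 2"
    and ST: "\<And>t. 0 \<le> t \<Longrightarrow> S (of_real t) = T t"
    and S_clinear: "\<And>z. z \<in> sector \<theta> \<Longrightarrow> clinear_op (S z)"
    and S_add: "\<And>z w. z \<in> sector \<theta> \<Longrightarrow> w \<in> sector \<theta> \<Longrightarrow> S (z + w) = S z o\<^sub>L S w"
    and S_hol: "vholomorphic_on S (sector \<theta>)"
    and S_lim: "\<And>\<theta>' x. 0 < \<theta>' \<Longrightarrow> \<theta>' < \<theta> \<Longrightarrow> ((\<lambda>z. S z x) \<longlongrightarrow> x) (at 0 within sector \<theta>')"
begin

definition ray :: "real \<Rightarrow> real \<Rightarrow> 'a \<Rightarrow>\<^sub>L 'a"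
  where "ray \<phi> t = (if t \<le> 0 then id_blinfun else S (of_real t * cis \<phi>))"

lemma ray_sector: "\<bar>\<phi>\<bar> < \<theta> \<Longrightarrow> 0 < t \<Longrightarrow> of_real t * cis \<phi> \<in> sector \<theta>"
  by (rule ray_in_sector [OF _ \<theta>(2)])

lemma C0_semigroup_ray:
  assumes \<phi>: "\<bar>\<phi>\<bar> < \<theta>"
  shows "C0_semigroup (ray \<phi>)"
  unfolding C0_semigroup_def
proof (intro conjI allI impI)
  fix t :: real assume "0 \<le> t"
  show "clinear_op (ray \<phi> t)"
    using S_clinear ray_sector [OF \<phi>] by (simp add: ray_def clinear_op_def)
  fix s :: real assume "0 \<le> s"
  show "ray \<phi> (t + s) = ray \<phi> t o\<^sub>L ray \<phi> s"
  proof (cases "t = 0 \<or> s = 0")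
    case True
    then show ?thesis using \<open>0 \<le> t\<close> \<open>0 \<le> s\<close> by (auto simp: ray_def intro!: blinfun_eqI)
  next
    case False
    then have "0 < t" "0 < s" using \<open>0 \<le> t\<close> \<open>0 \<le> s\<close> by auto
    then show ?thesis
      using S_add [OF ray_sector [OF \<phi>] ray_sector [OF \<phi>], of t s] by (simp add: ray_def distrib_right)
  qed
next
  show "ray \<phi> 0 = id_blinfun" by (simp add: ray_def)
  fix x
  define \<theta>' where "\<theta>' = (\<bar>\<phi>\<bar> + \<theta>) / 2"
  have \<theta>': "0 < \<theta>'" "\<theta>' < \<theta>" "\<bar>\<phi>\<bar> < \<theta>'" using \<phi> by (auto simp: \<theta>'_def)
  have "filterlim (\<lambda>t. of_real t * cis \<phi>) (at 0 within sector \<theta>') (at_right 0)"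
    unfolding filterlim_at
  proof
    show "((\<lambda>t. of_real t * cis \<phi>) \<longlongrightarrow> 0) (at_right 0)" by (auto intro!: tendsto_eq_intros)
    show "\<forall>\<^sub>F t in at_right 0. of_real t * cis \<phi> \<in> sector \<theta>' \<and> of_real t * cis \<phi> \<noteq> 0"
      using ray_in_sector [OF \<theta>'(3)] \<theta>' \<theta> by (auto simp: eventually_at_filter)
  qed
  from filterlim_compose [OF S_lim [OF \<theta>'(1,2)] this]
  have "((\<lambda>t. S (of_real t * cis \<phi>) x) \<longlongrightarrow> x) (at_right 0)" .
  moreover have "\<forall>\<^sub>F t in at_right 0. S (of_real t * cis \<phi>) x = ray \<phi> t x"
    by (auto simp: eventually_at_filter ray_def)
  ultimately show "((\<lambda>t. ray \<phi> t x) \<longlongrightarrow> x) (at_right 0)"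
    by (rule Lim_transform_eventually)
qed

definition S' :: "complex \<Rightarrow> 'a \<Rightarrow>\<^sub>L 'a"
  where "S' z = (SOME F. (S has_derivative (\<lambda>h. h *\<^sub>C F)) (at z))"

lemma S_derivative: "z \<in> sector \<theta> \<Longrightarrow> (S has_derivative (\<lambda>h. h *\<^sub>C S' z)) (at z)"
proof -
  assume "z \<in> sector \<theta>"
  then have "\<exists>F. (S has_derivative (\<lambda>h. h *\<^sub>C F)) (at z)"
    using S_hol by (simp add: vholomorphic_on_open [OF open_sector [OF \<theta>(2)]])
  then show ?thesis unfolding S'_def by (rule someI_ex)
qed

lemma S_line_derivative:
  assumes z: "z + of_real t * \<zeta> \<in> sector \<theta>"
  shows "((\<lambda>t. S (z + of_real t * \<zeta>) x) has_vector_derivative \<zeta> *\<^sub>C S' (z + of_real t * \<zeta>) x) (at t within X)"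
proof -
  have 1: "((\<lambda>t. z + of_real t * \<zeta>) has_derivative (\<lambda>h. of_real h * \<zeta>)) (at t within X)"
    by (auto intro!: derivative_eq_intros)
  have "((\<lambda>t. S (z + of_real t * \<zeta>)) has_derivative (\<lambda>h. (of_real h * \<zeta>) *\<^sub>C S' (z + of_real t * \<zeta>))) (at t within X)"
    by (rule has_derivative_compose [OF 1 S_derivative [OF z]])
  from bounded_linear.has_derivative [OF blinfun.bounded_linear_left this, of x]
  show ?thesis
    by (simp add: has_vector_derivative_def scaleC_scaleC [symmetric] scaleC_of_real blinfun.scaleR_left)
qed

text \<open>The complex derivative can be computed along the positive direction, where S(z + h) =
  T(h) S(z).\<close>

lemma S_generator:
  assumes z: "z \<in> sector \<theta>"
  shows "(S z x, S' z x) \<in> generator T"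
proof -
  have "((\<lambda>t. S (z + of_real t * 1) x) has_vector_derivative 1 *\<^sub>C S' (z + of_real 0 * 1) x) (at 0 within {0..})"
    by (rule S_line_derivative) (use z in simp)
  from vector_derivative_at_right [OF this]
  have "((\<lambda>h. (1 / h) *\<^sub>R (S (z + of_real h) x - S z x)) \<longlongrightarrow> S' z x) (at_right 0)" by simp
  moreover have "\<forall>\<^sub>F h in at_right 0. (1 / h) *\<^sub>R (S (z + of_real h) x - S z x) = (1 / h) *\<^sub>R (T h (S z x) - S z x)"
    unfolding eventually_at_filter
  proof (intro always_eventually allI impI)
    fix h :: real assume h: "h \<in> {0<..}"
    have "of_real h \<in> sector \<theta>" using ray_sector [of 0 h] h \<theta> by simp
    then have "S (of_real h + z) = S (of_real h) o\<^sub>L S z" using z by (rule S_add)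
    then show "(1 / h) *\<^sub>R (S (z + of_real h) x - S z x) = (1 / h) *\<^sub>R (T h (S z x) - S z x)"
      using ST [of h] h by (simp add: add.commute)
  qed
  ultimately show ?thesis unfolding generator_def by (auto intro: Lim_transform_eventually)
qed

lemma T_S_commute: "z \<in> sector \<theta> \<Longrightarrow> 0 < h \<Longrightarrow> S z (T h y) = T h (S z y)"
proof -
  assume z: "z \<in> sector \<theta>" and h: "0 < h"
  have "of_real h \<in> sector \<theta>" using ray_sector [of 0 h] h \<theta> by simp
  then have "S (of_real h + z) = S (of_real h) o\<^sub>L S z" "S (z + of_real h) = S z o\<^sub>L S (of_real h)"
    using z by (auto intro: S_add)
  then have "(S z o\<^sub>L S (of_real h)) y = (S (of_real h) o\<^sub>L S z) y" by (simp only: add.commute)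
  then show ?thesis using ST [of h] h by simp
qed

text \<open>Along the ray of angle \<phi> the semigroup has generator \<zeta> A with \<zeta> = cis
  \<phi>, so (l - A)^-1 = \<zeta> (l \<zeta> - \<zeta> A)^-1 is \<zeta> times the Laplace transform
  along the ray at l \<zeta>. The condition for convergence thereby describes a rotated half-plane
  of l.\<close>

lemma ray_resolvent:
  assumes \<phi>: "\<bar>\<phi>\<bar> < \<theta>" and b: "\<And>t. 0 \<le> t \<Longrightarrow> norm (ray \<phi> t) \<le> M * exp (\<omega> * t)" and M: "0 \<le> M"
    and l: "\<omega> < Re (l * cis \<phi>)"
  shows "l \<in> resolvent_set (generator T)" "norm (Res (generator T) l) \<le> M / (Re (l * cis \<phi>) - \<omega>)"
proof -
  let ?A = "generator T" and ?\<zeta> = "cis \<phi>" and ?m = "l * cis \<phi>"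
  have C0: "C0_semigroup (ray \<phi>)" by (rule C0_semigroup_ray [OF \<phi>])
  interpret ray: exp_bounded "ray \<phi>" M \<omega>
    by unfold_locales (use C0_semigroup_continuous [OF C0] b M in auto)
  obtain M0 \<omega>0 where M0: "1 \<le> M0" "0 \<le> \<omega>0" "\<And>t. 0 \<le> t \<Longrightarrow> norm (T t) \<le> M0 * exp (\<omega>0 * t)"
    using C0_semigroup_bound [OF T] by metis
  interpret T: bounded_C0_semigroup T M0 \<omega>0
    by unfold_locales (use C0_semigroup_continuous [OF T] M0 T in auto)
  \<comment> \<open>A point of the resolvent set known from the real semigroup. The bounded operator
    R0 = (l0 - A)^-1 stands in for closedness of A: from K x = R0 (l0 K x - (l K x - x)) it follows
    that K x is in the domain and A K x = l K x - x.\<close>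
  define l0 where "l0 = complex_of_real (\<omega>0 + 1)"
  have l0: "l0 \<in> resolvent_set ?A" by (rule T.resolvent_laplace) (simp add: l0_def)
  have cg: "clinear_graph ?A" by (rule clinear_graph_generator [OF T])
  define K where "K x = ?\<zeta> *\<^sub>C laplace (ray \<phi>) ?m x" for x
  have blK: "bounded_linear K"
    unfolding K_def by (rule bounded_linear_compose [OF bounded_linear_scaleC_right ray.bounded_linear_laplace [OF l]])
  have comm: "laplace (ray \<phi>) ?m (V x) = V (laplace (ray \<phi>) ?m x)"
    if "clinear_op V" "\<And>z y. z \<in> sector \<theta> \<Longrightarrow> V (S z y) = S z (V y)" for V :: "'a \<Rightarrow>\<^sub>L 'a" and x
    using ray.laplace_image [OF l that(1), of x] that(2) ray_sector [OF \<phi>] by (simp add: ray_def)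
  have KT: "K (T h y) = T h (K y)" if "0 < h" for h y
    using comm [of "T h" y] that T_S_commute [of _ h] C0_semigroupD(1) [OF T, of h]
    by (simp add: K_def clinear_opD)
  have Kc: "K (c *\<^sub>C y) = c *\<^sub>C K y" for c y
  proof -
    obtain V :: "'a \<Rightarrow>\<^sub>L 'a" where V: "clinear_op V" "\<And>y. V y = c *\<^sub>C y" using T.scaleC_blinfun_ex by blast
    show ?thesis using comm [OF V(1), of y] S_clinear by (simp add: V(2) clinear_opD K_def scaleC_scaleC mult.commute)
  qed
  have gen: "(K x, l *\<^sub>C K x - x) \<in> ?A" for x
  proof -
    define e where "e t = exp (- ?m * of_real t) *\<^sub>C ray \<phi> t x" for t
    have ec: "continuous_on X e" if "X \<subseteq> {0..}" for X unfolding e_def by (rule ray.laplace_integrand(1) [OF that])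
    have ei: "e integrable_on {s..t}" if "0 \<le> s" for s t by (intro integrable_continuous_real ec) (use that in auto)
    define R0 where "R0 = Res ?A l0"
    have R0c: "R0 (c *\<^sub>C y) = c *\<^sub>C R0 y" for c y unfolding R0_def by (rule clinear_opD [OF clinear_op_Res [OF l0 cg]])
    \<comment> \<open>This is A applied to \<zeta> e(t), and at the same time the part of e' in
      which S is differentiated.\<close>
    define w where "w t = exp (- ?m * of_real t) *\<^sub>C (?\<zeta> *\<^sub>C S' (of_real t * ?\<zeta>) x)" for t
    have pt: "?\<zeta> *\<^sub>C e t = R0 (l0 *\<^sub>C (?\<zeta> *\<^sub>C e t) - w t)" if "0 < t" for t
    proof -
      let ?z = "of_real t * ?\<zeta>"
      have "R0 (l0 *\<^sub>C S ?z x - S' ?z x) = S ?z x"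
        unfolding R0_def by (rule resolvent_setD(2) [OF l0 S_generator [OF ray_sector [OF \<phi> that]]])
      moreover have "l0 *\<^sub>C (?\<zeta> *\<^sub>C e t) - w t = (?\<zeta> * exp (- ?m * of_real t)) *\<^sub>C (l0 *\<^sub>C S ?z x - S' ?z x)"
        using that by (simp add: e_def w_def ray_def scaleC_scaleC scaleC_diff_right mult.commute mult.left_commute)
      ultimately show ?thesis using that by (simp add: R0c e_def ray_def scaleC_scaleC)
    qed
    have ftc: "(w has_integral (e t - e s) + l *\<^sub>C (?\<zeta> *\<^sub>C integral {s..t} e)) {s..t}" if "0 < s" "s \<le> t" for s t
    proof -
      have "((\<lambda>r. w r - ?m *\<^sub>C e r) has_integral (e t - e s)) {s..t}"
      proof (rule fundamental_theorem_of_calculus [OF that(2)])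
        fix r assume r: "r \<in> {s..t}"
        then have r0: "0 < r" using that by auto
        have dE: "((\<lambda>t. exp (- ?m * of_real t)) has_vector_derivative - ?m * exp (- ?m * of_real r)) (at r within {s..t})"
          by (rule has_vector_derivative_real_field [THEN has_vector_derivative_at_within]) (auto intro!: derivative_eq_intros)
        have dS: "((\<lambda>t. S (0 + of_real t * ?\<zeta>) x) has_vector_derivative ?\<zeta> *\<^sub>C S' (0 + of_real r * ?\<zeta>) x) (at r within {s..t})"
          by (rule S_line_derivative) (use ray_sector [OF \<phi> r0] in simp)
        from bounded_bilinear.has_vector_derivative [OF scaleC.bounded_bilinear_axioms dE dS]
        have "((\<lambda>r. exp (- ?m * of_real r) *\<^sub>C S (of_real r * ?\<zeta>) x) has_vector_derivative
          w r + (- ?m * exp (- ?m * of_real r)) *\<^sub>C S (of_real r * ?\<zeta>) x) (at r within {s..t})"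
          by (simp add: w_def)
        moreover have "(- ?m * exp (- ?m * of_real r)) *\<^sub>C S (of_real r * ?\<zeta>) x = - (?m *\<^sub>C e r)"
          using r0 by (simp add: e_def ray_def scaleC_scaleC scaleC.minus_left)
        ultimately have "((\<lambda>r. exp (- ?m * of_real r) *\<^sub>C S (of_real r * ?\<zeta>) x) has_vector_derivative w r - ?m *\<^sub>C e r) (at r within {s..t})"
          by simp
        then show "(e has_vector_derivative w r - ?m *\<^sub>C e r) (at r within {s..t})"
          by (rule has_vector_derivative_transform [rotated 2]) (use r that in \<open>auto simp: e_def ray_def\<close>)
      qed
      moreover have "((\<lambda>r. ?m *\<^sub>C e r) has_integral ?m *\<^sub>C integral {s..t} e) {s..t}"
        using has_integral_linear [OF integrable_integral [OF ei] bounded_linear_scaleC_right] that by (simp add: o_def)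
      ultimately have "((\<lambda>r. (w r - ?m *\<^sub>C e r) + ?m *\<^sub>C e r) has_integral (e t - e s) + ?m *\<^sub>C integral {s..t} e) {s..t}"
        by (rule has_integral_add)
      then show ?thesis by (simp add: scaleC_scaleC)
    qed
    have fin: "?\<zeta> *\<^sub>C integral {s..t} e = R0 (l0 *\<^sub>C (?\<zeta> *\<^sub>C integral {s..t} e) - ((e t - e s) + l *\<^sub>C (?\<zeta> *\<^sub>C integral {s..t} e)))"
      if "0 < s" "s \<le> t" for s t
    proof -
      have ez: "(\<lambda>r. ?\<zeta> *\<^sub>C e r) integrable_on {s..t}" and el: "(\<lambda>r. l0 *\<^sub>C (?\<zeta> *\<^sub>C e r)) integrable_on {s..t}"
        using that by (auto intro!: integrable_continuous_real scaleC.continuous_on ec)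
      have iw: "w integrable_on {s..t}" "integral {s..t} w = (e t - e s) + l *\<^sub>C (?\<zeta> *\<^sub>C integral {s..t} e)"
        using ftc [OF that] by (auto simp: has_integral_integrable integral_unique)
      have I1: "integral {s..t} (\<lambda>r. ?\<zeta> *\<^sub>C e r) = ?\<zeta> *\<^sub>C integral {s..t} e"
        using that by (intro integral_scaleC ei) simp
      have I2: "integral {s..t} (\<lambda>r. l0 *\<^sub>C (?\<zeta> *\<^sub>C e r)) = l0 *\<^sub>C (?\<zeta> *\<^sub>C integral {s..t} e)"
        unfolding I1 [symmetric] by (rule integral_scaleC [OF ez])
      have "integral {s..t} (\<lambda>r. ?\<zeta> *\<^sub>C e r) = integral {s..t} (\<lambda>r. R0 (l0 *\<^sub>C (?\<zeta> *\<^sub>C e r) - w r))"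
        using that by (intro integral_cong pt) auto
      also have "\<dots> = R0 (integral {s..t} (\<lambda>r. l0 *\<^sub>C (?\<zeta> *\<^sub>C e r) - w r))"
        by (rule integral_blinfun [OF integrable_diff [OF el iw(1)]])
      also have "integral {s..t} (\<lambda>r. l0 *\<^sub>C (?\<zeta> *\<^sub>C e r) - w r) = l0 *\<^sub>C (?\<zeta> *\<^sub>C integral {s..t} e) - integral {s..t} w"
        unfolding I2 [symmetric] by (rule integral_diff [OF el iw(1)])
      finally show ?thesis unfolding I1 iw(2) .
    qed
    \<comment> \<open>The derivative of S is available only inside the sector, so the integrals
      start at a positive time. The end points are sent to 0 and to infinity only after R0 has
      absorbed this derivative.\<close>
    define \<sigma> where "\<sigma> n = inverse (real (Suc n))" for n
    define \<tau> where "\<tau> n = real (Suc n)" for n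
    have \<sigma>\<tau>: "0 < \<sigma> n" "\<sigma> n \<le> \<tau> n" "\<sigma> n \<le> 1" for n by (auto simp: \<sigma>_def \<tau>_def field_simps)
    have \<sigma>0: "\<sigma> \<longlonglongrightarrow> 0" unfolding \<sigma>_def by (rule LIMSEQ_inverse_real_of_nat)
    have \<tau>inf: "filterlim \<tau> at_top sequentially" unfolding \<tau>_def by real_asymp
    have e\<tau>: "(\<lambda>n. e (\<tau> n)) \<longlonglongrightarrow> 0"
    proof (rule Lim_null_comparison)
      show "\<forall>\<^sub>F n in sequentially. norm (e (\<tau> n)) \<le> (M * norm x) * exp (- (Re ?m - \<omega>) * \<tau> n)"
        unfolding e_def by (intro always_eventually allI ray.laplace_integrand(2)) (simp add: \<tau>_def)
      have "((\<lambda>t. (M * norm x) * exp (- (Re ?m - \<omega>) * t)) \<longlongrightarrow> 0) at_top"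
        using l by real_asymp
      from filterlim_compose [OF this \<tau>inf]
      show "(\<lambda>n. (M * norm x) * exp (- (Re ?m - \<omega>) * \<tau> n)) \<longlonglongrightarrow> 0" .
    qed
    have e\<sigma>: "(\<lambda>n. e (\<sigma> n)) \<longlonglongrightarrow> x"
    proof -
      have "(\<lambda>n. e (\<sigma> n)) \<longlonglongrightarrow> e 0"
        by (rule continuous_on_tendsto_compose [OF ec [OF order_refl] \<sigma>0])
          (use less_imp_le [OF \<sigma>\<tau>(1)] in auto)
      then show ?thesis by (simp add: e_def ray_def)
    qed
    have small: "(\<lambda>n. integral {0..\<sigma> n} e) \<longlonglongrightarrow> 0"
    proof -
      have "compact (e ` {0..1})" by (intro compact_continuous_image ec) auto
      then have "bounded (e ` {0..1})" by (rule compact_imp_bounded)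
      then obtain B where "\<forall>y\<in>e ` {0..1}. norm y \<le> B" unfolding bounded_iff by blast
      then have B: "norm (e t) \<le> B" if "0 \<le> t" "t \<le> 1" for t using that by simp
      have b: "norm (integral {0..\<sigma> n} e) \<le> B * (\<sigma> n - 0)" for n
        using less_imp_le [OF \<sigma>\<tau>(1) [of n]] \<sigma>\<tau>(3) [of n] by (intro integral_bound ec B) auto
      have "(\<lambda>n. B * (\<sigma> n - 0)) \<longlonglongrightarrow> B * (0 - 0)" by (intro tendsto_intros \<sigma>0)
      then have "(\<lambda>n. B * (\<sigma> n - 0)) \<longlonglongrightarrow> 0" by simp
      then show ?thesis by (rule Lim_null_comparison [rotated]) (use b in auto)
    qed
    have big: "(\<lambda>n. integral {0..\<tau> n} e) \<longlonglongrightarrow> laplace (ray \<phi>) ?m x"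
      unfolding e_def by (rule filterlim_compose [OF ray.laplace_tendsto [OF l] \<tau>inf])
    have split: "integral {\<sigma> n..\<tau> n} e = integral {0..\<tau> n} e - integral {0..\<sigma> n} e" for n
    proof -
      have "integral {0..\<sigma> n} e + integral {\<sigma> n..\<tau> n} e = integral {0..\<tau> n} e"
        by (rule Henstock_Kurzweil_Integration.integral_combine [OF _ _ ei]) (use \<sigma>\<tau> [of n] in auto)
      then show ?thesis by (metis add_diff_cancel_left')
    qed
    have I: "(\<lambda>n. ?\<zeta> *\<^sub>C integral {\<sigma> n..\<tau> n} e) \<longlonglongrightarrow> K x"
    proof -
      have "(\<lambda>n. ?\<zeta> *\<^sub>C (integral {0..\<tau> n} e - integral {0..\<sigma> n} e)) \<longlonglongrightarrow> ?\<zeta> *\<^sub>C (laplace (ray \<phi>) ?m x - 0)"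
        by (intro tendsto_intros scaleC.tendsto big small)
      then show ?thesis by (simp add: split K_def)
    qed
    have "(\<lambda>n. R0 (l0 *\<^sub>C (?\<zeta> *\<^sub>C integral {\<sigma> n..\<tau> n} e) - ((e (\<tau> n) - e (\<sigma> n)) + l *\<^sub>C (?\<zeta> *\<^sub>C integral {\<sigma> n..\<tau> n} e))))
      \<longlonglongrightarrow> R0 (l0 *\<^sub>C K x - ((0 - x) + l *\<^sub>C K x))"
      by (intro tendsto_intros scaleC.tendsto I e\<tau> e\<sigma>)
    then have "(\<lambda>n. ?\<zeta> *\<^sub>C integral {\<sigma> n..\<tau> n} e) \<longlonglongrightarrow> R0 (l0 *\<^sub>C K x - ((0 - x) + l *\<^sub>C K x))"
      using fin [OF \<sigma>\<tau>(1,2)] by simp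
    from LIMSEQ_unique [OF I this] have Kx: "K x = R0 (l0 *\<^sub>C K x - (l *\<^sub>C K x - x))" by simp
    have "(R0 (l0 *\<^sub>C K x - (l *\<^sub>C K x - x)), l0 *\<^sub>C R0 (l0 *\<^sub>C K x - (l *\<^sub>C K x - x)) - (l0 *\<^sub>C K x - (l *\<^sub>C K x - x))) \<in> ?A"
      unfolding R0_def by (rule resolvent_setD(1) [OF l0])
    then show ?thesis by (simp flip: Kx)
  qed
  have res: "l \<in> resolvent_set ?A" "blinfun_apply (Res ?A l) = K"
    by (rule generator_resolventI [OF T blK KT gen Kc], assumption)+
  show "l \<in> resolvent_set ?A" by (rule res)
  show "norm (Res ?A l) \<le> M / (Re ?m - \<omega>)"
  proof (rule norm_blinfun_bound)
    show "norm (Res ?A l x) \<le> M / (Re ?m - \<omega>) * norm x" for x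
      using ray.norm_laplace [OF l, of x] by (simp only: res(2) K_def norm_scaleC norm_cis mult_1)
  qed (use l M in simp)
qed

text \<open>The ray of angle - \<phi> is used for Im l \<ge> 0 and that of angle \<phi> for Im l <
  0. In both cases Re (l \<zeta>) = Re l cos \<phi> + |Im l| sin \<phi>, which grows with |Im
  l|.\<close>

lemma resolvent_decay:
  obtains N C where "0 < N" "0 \<le> C"
    "\<And>l. -1 \<le> Re l \<Longrightarrow> N \<le> \<bar>Im l\<bar> \<Longrightarrow> l \<in> resolvent_set (generator T) \<and> norm (Res (generator T) l) \<le> C / \<bar>Im l\<bar>"
proof -
  define \<phi> where "\<phi> = \<theta> / 2"
  have \<phi>: "0 < \<phi>" "\<phi> < \<theta>" "\<phi> < pi / 2" using \<theta> by (auto simp: \<phi>_def)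
  have \<phi>': "\<bar>\<phi>\<bar> < \<theta>" "\<bar>- \<phi>\<bar> < \<theta>" using \<phi> by auto
  obtain M1 \<omega>1 where 1: "1 \<le> M1" "0 \<le> \<omega>1" "\<And>t. 0 \<le> t \<Longrightarrow> norm (ray \<phi> t) \<le> M1 * exp (\<omega>1 * t)"
    using C0_semigroup_bound [OF C0_semigroup_ray [OF \<phi>'(1)]] by metis
  obtain M2 \<omega>2 where 2: "1 \<le> M2" "0 \<le> \<omega>2" "\<And>t. 0 \<le> t \<Longrightarrow> norm (ray (- \<phi>) t) \<le> M2 * exp (\<omega>2 * t)"
    using C0_semigroup_bound [OF C0_semigroup_ray [OF \<phi>'(2)]] by metis
  have s: "0 < sin \<phi>" "0 < cos \<phi>" using \<phi> by (auto intro: sin_gt_zero cos_gt_zero)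
  define \<omega> where "\<omega> = max \<omega>1 \<omega>2"
  define M where "M = max M1 M2"
  \<comment> \<open>Beyond N, half of |Im l| sin \<phi> outweighs \<omega> + 1, where the 1 accounts
    for Re l cos \<phi> \<ge> -1; the other half yields the decay.\<close>
  define N where "N = 2 * (\<omega> + 1) / sin \<phi>"
  have N: "0 < N" using s 1 by (simp add: N_def \<omega>_def max_def)
  show thesis
  proof (rule that [OF N, of "2 * M / sin \<phi>"])
    show "0 \<le> 2 * M / sin \<phi>" using s 1 by (simp add: M_def max_def)
    fix l assume l: "-1 \<le> Re l" "N \<le> \<bar>Im l\<bar>"
    have key: "l \<in> resolvent_set (generator T) \<and> norm (Res (generator T) l) \<le> 2 * M / sin \<phi> / \<bar>Im l\<bar>"
      if "\<bar>\<psi>\<bar> < \<theta>" "\<And>t. 0 \<le> t \<Longrightarrow> norm (ray \<psi> t) \<le> m * exp (w * t)" "1 \<le> m" "m \<le> M" "w \<le> \<omega>"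
        "Re (l * cis \<psi>) = Re l * cos \<phi> + \<bar>Im l\<bar> * sin \<phi>" for \<psi> m w
    proof -
      have "-1 \<le> Re l * cos \<phi>"
      proof (cases "0 \<le> Re l")
        case False
        then have "- Re l * cos \<phi> \<le> 1 * 1" using l s by (intro mult_mono) auto
        then show ?thesis by simp
      qed (use s in \<open>auto intro: order_trans [of _ 0]\<close>)
      moreover have "2 * (\<omega> + 1) \<le> \<bar>Im l\<bar> * sin \<phi>" using l(2) s by (simp add: N_def field_simps)
      moreover have "X / 2 \<le> Y + X - w" if "-1 \<le> Y" "2 * (\<omega> + 1) \<le> X" for X Y
        using that \<open>w \<le> \<omega>\<close> by simp
      ultimately have r: "\<bar>Im l\<bar> * sin \<phi> / 2 \<le> Re (l * cis \<psi>) - w" unfolding that(6) by blast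
      have p: "0 < \<bar>Im l\<bar> * sin \<phi> / 2" using N l(2) s by simp
      then have w: "w < Re (l * cis \<psi>)" using r by linarith
      have m: "0 \<le> m" using that(3) by simp
      have "norm (Res (generator T) l) \<le> m / (Re (l * cis \<psi>) - w)" by (rule ray_resolvent(2) [OF that(1,2) m w])
      also have "\<dots> \<le> M / (\<bar>Im l\<bar> * sin \<phi> / 2)" using r p m that(4) w by (intro frac_le) auto
      finally show ?thesis using ray_resolvent(1) [OF that(1,2) m w] by (simp add: mult.commute)
    qed
    show "l \<in> resolvent_set (generator T) \<and> norm (Res (generator T) l) \<le> 2 * M / sin \<phi> / \<bar>Im l\<bar>"
    proof (cases "0 \<le> Im l")
      case True
      show ?thesis by (rule key [OF \<phi>'(2) 2(3,1)]) (use True in \<open>auto simp: M_def \<omega>_def\<close>)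
    next
      case False
      show ?thesis by (rule key [OF \<phi>'(1) 1(3,1)]) (use False in \<open>auto simp: M_def \<omega>_def\<close>)
    qed
  qed
qed

end

section \<open>Convolution with a decaying operator family\<close>

text \<open>The uniform bound upgrades strong continuity to joint continuity in time and
  vector.\<close>

lemma strong_continuous_apply:
  fixes V :: "real \<Rightarrow> 'a::real_normed_vector \<Rightarrow>\<^sub>L 'b::real_normed_vector" and a :: "'c::t2_space \<Rightarrow> real"
  assumes V: "\<And>x. continuous_on {0..} (\<lambda>t. V t x)" and M: "\<And>t. 0 \<le> t \<Longrightarrow> norm (V t) \<le> M"
    and a: "continuous_on S a" "\<And>s. s \<in> S \<Longrightarrow> 0 \<le> a s" and b: "continuous_on S b"
  shows "continuous_on S (\<lambda>s. V (a s) (b s))"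
  unfolding continuous_on_def
proof
  fix s0 assume s0: "s0 \<in> S"
  have c: "continuous_on S (\<lambda>s. V (a s) (b s0))"
    by (rule continuous_on_compose2 [OF V a(1)]) (use a in auto)
  then have 1: "((\<lambda>s. V (a s) (b s0)) \<longlongrightarrow> V (a s0) (b s0)) (at s0 within S)"
    using s0 by (auto simp: continuous_on_def)
  have "((\<lambda>s. M * norm (b s - b s0)) \<longlongrightarrow> M * norm (b s0 - b s0)) (at s0 within S)"
    using b s0 by (intro tendsto_intros) (auto simp: continuous_on_def)
  then have lim: "((\<lambda>s. M * norm (b s - b s0)) \<longlongrightarrow> 0) (at s0 within S)" by simp
  have "\<forall>\<^sub>F s in at s0 within S. s \<in> S" by (simp add: eventually_at_filter)
  then have "\<forall>\<^sub>F s in at s0 within S. norm (V (a s) (b s - b s0)) \<le> M * norm (b s - b s0)"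
  proof eventually_elim
    case (elim s)
    show ?case using M [OF a(2) [OF elim]] by (intro order_trans [OF norm_blinfun] mult_right_mono) auto
  qed
  from tendsto_add [OF Lim_null_comparison [OF this lim] 1]
  show "((\<lambda>s. V (a s) (b s)) \<longlongrightarrow> V (a s0) (b s0)) (at s0 within S)"
    by (simp add: blinfun.diff_right)
qed

text \<open>The denominator a + 1 avoids a case distinction at a = 0 when a tolerance is divided by
  a nonnegative constant.\<close>

lemma scaled_le:
  fixes a e :: real
  assumes "0 \<le> a" "0 \<le> e"
  shows "a * (e / (a + 1)) \<le> e"
proof -
  have "e * (a / (a + 1)) \<le> e * 1" using assms by (intro mult_left_mono) (auto simp: field_simps)
  then show ?thesis by (simp add: mult.commute)
qed

lemma has_integral_reflect0:
  fixes h :: "real \<Rightarrow> 'a::banach"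
  assumes "h integrable_on {0..t}" "0 \<le> t"
  shows "((\<lambda>s. h (t - s)) has_integral integral {0..t} h) {0..t}"
proof -
  have "(h has_integral integral {0..t} h) (cbox 0 t)" using assms by (simp add: integrable_integral)
  from has_integral_affinity [OF this, of "-1" t]
  have "((\<lambda>s. h (t - s)) has_integral integral {0..t} h) ((\<lambda>x. t - x) ` {0..t})" by simp
  moreover have "(\<lambda>x. t - x) ` {0..t} = {0..t}"
    by simp
  ultimately show ?thesis by simp
qed

definition conv :: "(real \<Rightarrow> 'a::real_normed_vector \<Rightarrow>\<^sub>L 'a) \<Rightarrow> (real \<Rightarrow> 'a) \<Rightarrow> real \<Rightarrow> 'a"
  where "conv V g t = integral {0..t} (\<lambda>s. V (t - s) (g s))"

lemma conv_nonpos: "t \<le> 0 \<Longrightarrow> conv V g t = 0"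
  by (cases "t = 0") (auto simp: conv_def)

locale decaying_family =
  fixes V :: "real \<Rightarrow> 'a::{complex_normed_vector, banach} \<Rightarrow>\<^sub>L 'a" and M \<kappa> :: real
  assumes V_cont: "\<And>x. continuous_on {0..} (\<lambda>t. V t x)"
    and V_decay: "\<And>t. 0 \<le> t \<Longrightarrow> norm (V t) \<le> M * exp (- \<kappa> * t)" and M: "0 \<le> M" and \<kappa>: "0 < \<kappa>"
    and V_clinear: "\<And>t. 0 \<le> t \<Longrightarrow> clinear_op (V t)"
begin

lemma V_bound: "0 \<le> t \<Longrightarrow> norm (V t) \<le> M"
  using V_decay [of t] mult_left_mono [OF _ M, of "exp (- \<kappa> * t)" 1] \<kappa> by (simp add: zero_le_mult_iff)

lemmas V_apply_continuous = strong_continuous_apply [OF V_cont V_bound]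

lemma norm_V_le: "0 \<le> t \<Longrightarrow> norm (V t x) \<le> M * norm x"
  by (intro order_trans [OF norm_blinfun] mult_right_mono V_bound) auto

lemma norm_V_decay: "0 \<le> t \<Longrightarrow> norm x \<le> G \<Longrightarrow> norm (V t x) \<le> (M * G) * exp (- \<kappa> * t)"
proof -
  assume "0 \<le> t" "norm x \<le> G"
  then have "norm (V t x) \<le> (M * exp (- \<kappa> * t)) * G"
    using M by (intro order_trans [OF norm_blinfun] mult_mono V_decay) auto
  then show ?thesis by (simp add: mult_ac)
qed

lemma conv_integrand:
  assumes "continuous_on {0..} g" "0 \<le> s" "t' \<le> t"
  shows "continuous_on {s..t'} (\<lambda>s. V (t - s) (g s))" "(\<lambda>s. V (t - s) (g s)) integrable_on {s..t'}"
proof -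
  show "continuous_on {s..t'} (\<lambda>s. V (t - s) (g s))"
    by (intro V_apply_continuous continuous_intros continuous_on_subset [OF assms(1)]) (use assms in auto)
  then show "(\<lambda>s. V (t - s) (g s)) integrable_on {s..t'}" by (rule integrable_continuous_real)
qed

lemma conv_integrand':
  assumes "continuous_on {0..} g" "0 \<le> s" "t' \<le> t"
  shows "continuous_on {s..t'} (\<lambda>s. V s (g (t - s)))" "(\<lambda>s. V s (g (t - s))) integrable_on {s..t'}"
proof -
  show "continuous_on {s..t'} (\<lambda>s. V s (g (t - s)))"
    by (intro V_apply_continuous continuous_intros continuous_on_compose2 [OF assms(1)]) (use assms in auto)
  then show "(\<lambda>s. V s (g (t - s))) integrable_on {s..t'}" by (rule integrable_continuous_real)
qed

lemma conv_reflect: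
  assumes "continuous_on {0..} g" "0 \<le> t"
  shows "conv V g t = integral {0..t} (\<lambda>s. V s (g (t - s)))"
  using integral_unique [OF has_integral_reflect0 [OF conv_integrand(2) [OF assms(1) order_refl order_refl, of t] assms(2)]]
  by (simp add: conv_def)

lemma norm_conv_le:
  assumes g: "continuous_on {0..} g" and b: "\<And>s. 0 \<le> s \<Longrightarrow> s \<le> t \<Longrightarrow> norm (g s) \<le> G" and "0 \<le> t"
  shows "norm (conv V g t) \<le> M / \<kappa> * G"
proof -
  have G: "0 \<le> G" using order_trans [OF norm_ge_zero b [of 0]] assms(3) by simp
  have "norm (conv V g t) \<le> (M * G) / \<kappa>"
    unfolding conv_def
    by (rule norm_integral_exp_conv [OF conv_integrand(2) [OF g order_refl order_refl] \<kappa>])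
      (use assms M G norm_V_decay b in \<open>auto simp del: mult_minus_left\<close>)
  then show ?thesis by simp
qed

lemma conv_add:
  assumes "continuous_on {0..} f" "continuous_on {0..} g"
  shows "conv V (\<lambda>t. f t + g t) = (\<lambda>t. conv V f t + conv V g t)"
  using conv_integrand(2) [OF assms(1) order_refl order_refl] conv_integrand(2) [OF assms(2) order_refl order_refl]
  by (simp add: conv_def fun_eq_iff blinfun.add_right integral_add)

lemma conv_diff:
  assumes "continuous_on {0..} f" "continuous_on {0..} g"
  shows "conv V (\<lambda>t. f t - g t) = (\<lambda>t. conv V f t - conv V g t)"
  using conv_integrand(2) [OF assms(1) order_refl order_refl] conv_integrand(2) [OF assms(2) order_refl order_refl]
  by (simp add: conv_def fun_eq_iff blinfun.diff_right integral_diff)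

lemma conv_scaleC:
  assumes "continuous_on {0..} f"
  shows "conv V (\<lambda>t. c *\<^sub>C f t) = (\<lambda>t. c *\<^sub>C conv V f t)"
proof
  fix t
  have "integral {0..t} (\<lambda>s. V (t - s) (c *\<^sub>C f s)) = integral {0..t} (\<lambda>s. c *\<^sub>C V (t - s) (f s))"
    by (intro integral_cong) (simp add: clinear_opD [OF V_clinear])
  then show "conv V (\<lambda>t. c *\<^sub>C f t) t = c *\<^sub>C conv V f t"
    unfolding conv_def using integral_scaleC [OF conv_integrand(2) [OF assms order_refl order_refl]] by simp
qed

text \<open>In the reflected form the time shift acts on g. The increment of the convolution from s
  to t is then the convolution of an increment of g, plus an integral over the short interval from s
  to t.\<close>

lemma conv_BUC:
  assumes g: "g \<in> BUC"
  shows "conv V g \<in> BUC"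
proof -
  have gc: "continuous_on {0..} g" using BUC_continuous [OF g] by simp
  obtain G where G: "0 \<le> G" "\<And>t. 0 \<le> t \<Longrightarrow> norm (g t) \<le> G" using BUC_bound [OF g] by blast
  have est: "norm (conv V g t - conv V g s) \<le> M * G * (t - s) + M / \<kappa> * e"
    if st: "0 \<le> s" "s \<le> t" and e: "\<And>q. 0 \<le> q \<Longrightarrow> norm (g (q + (t - s)) - g q) \<le> e" for s t e
  proof -
    define d where "d = t - s"
    have d: "0 \<le> d" using st by (simp add: d_def)
    have gd: "continuous_on {0..} (\<lambda>q. g (q + d))"
      by (intro continuous_on_compose2 [OF gc] continuous_intros) (use d in auto)
    have i: "(\<lambda>r. V r (g (t - r))) integrable_on {0..s}" "(\<lambda>r. V r (g (s - r))) integrable_on {0..s}"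
      "(\<lambda>r. V r (g (t - r))) integrable_on {0..t}"
      using conv_integrand'(2) [OF gc] st by auto
    have "conv V g t = integral {0..s} (\<lambda>r. V r (g (t - r))) + integral {s..t} (\<lambda>r. V r (g (t - r)))"
      using Henstock_Kurzweil_Integration.integral_combine [OF st i(3)] conv_reflect [OF gc, of t] st by simp
    moreover have "conv V (\<lambda>q. g (q + d)) s = integral {0..s} (\<lambda>r. V r (g (t - r)))"
      using conv_reflect [OF gd st(1)] by (simp add: d_def)
    ultimately have "conv V g t - conv V g s = conv V (\<lambda>q. g (q + d) - g q) s + integral {s..t} (\<lambda>r. V r (g (t - r)))"
      by (simp add: conv_diff [OF gd gc])
    also have "norm \<dots> \<le> M / \<kappa> * e + (M * G) * (t - s)"
    proof (rule norm_triangle_mono)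
      show "norm (conv V (\<lambda>q. g (q + d) - g q) s) \<le> M / \<kappa> * e"
        by (intro norm_conv_le continuous_on_diff gd gc st) (use e in \<open>simp add: d_def\<close>)
      show "norm (integral {s..t} (\<lambda>r. V r (g (t - r)))) \<le> (M * G) * (t - s)"
      proof (rule integral_bound [OF st(2) conv_integrand'(1) [OF gc st(1) order_refl]])
        fix r assume "r \<in> {s..t}"
        then show "norm (V r (g (t - r))) \<le> M * G"
          using st G(2) [of "t - r"] M by (intro order_trans [OF norm_V_le] mult_left_mono) auto
      qed
    qed
    finally show ?thesis by simp
  qed
  show ?thesis
  proof (rule BUC_I)
    show "norm (conv V g t) \<le> M / \<kappa> * G" if "0 \<le> t" for t
      by (rule norm_conv_le [OF gc _ that]) (use G in auto)
    fix e :: real assume e: "0 < e"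
    define e1 where "e1 = e / 3 / (M / \<kappa> + 1)"
    have Mk: "0 \<le> M / \<kappa>" using M \<kappa> by simp
    have e1: "0 < e1" using e Mk by (simp add: e1_def)
    have e1': "M / \<kappa> * e1 \<le> e / 3" using scaled_le [OF Mk, of "e / 3"] e unfolding e1_def by simp
    obtain d where d: "0 < d" "\<And>s t. 0 \<le> s \<Longrightarrow> 0 \<le> t \<Longrightarrow> \<bar>s - t\<bar> < d \<Longrightarrow> norm (g s - g t) < e1"
      using BUC_dist [OF g e1] by auto
    define d2 where "d2 = min d (e / 3 / (M * G + 1))"
    have MG: "0 \<le> M * G" using M G by simp
    have d2: "0 < d2" using d e MG by (simp add: d2_def)
    have main: "norm (conv V g t - conv V g s) < e" if st: "0 \<le> s" "s \<le> t" "t - s < d2" for s t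
    proof -
      have "norm (conv V g t - conv V g s) \<le> M * G * (t - s) + M / \<kappa> * e1"
      proof (rule est [OF st(1,2)])
        fix q :: real assume "0 \<le> q"
        then show "norm (g (q + (t - s)) - g q) \<le> e1"
          using d(2) [of "q + (t - s)" q] st by (auto simp: d2_def)
      qed
      moreover have "M * G * (t - s) \<le> e / 3"
      proof -
        have "M * G * (t - s) \<le> M * G * (e / 3 / (M * G + 1))"
          using st MG by (intro mult_left_mono) (auto simp: d2_def)
        also have "\<dots> \<le> e / 3" using scaled_le [OF MG, of "e / 3"] e by simp
        finally show ?thesis .
      qed
      ultimately show ?thesis using e1' e by linarith
    qed
    have "norm (conv V g s - conv V g t) < e" if "0 \<le> s" "0 \<le> t" "\<bar>s - t\<bar> < d2" for s t
      using main [of s t] main [of t s] that by (cases "s \<le> t") (auto simp: norm_minus_commute)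
    then show "\<exists>d>0. \<forall>s\<ge>0. \<forall>t\<ge>0. \<bar>s - t\<bar> < d \<longrightarrow> norm (conv V g s - conv V g t) < e" using d2 by blast
  qed
qed

text \<open>What g contributes before time N is damped by the kernel, and after N the function g
  itself is small.\<close>

lemma conv_C0:
  assumes g: "g \<in> C0"
  shows "conv V g \<in> C0"
proof (rule C0_I [OF conv_BUC [OF C0_BUC [OF g]]])
  have gc: "continuous_on {0..} g" using BUC_continuous [OF C0_BUC [OF g]] by simp
  obtain G where G: "0 \<le> G" "\<And>t. 0 \<le> t \<Longrightarrow> norm (g t) \<le> G" using BUC_bound [OF C0_BUC [OF g]] by blast
  fix e :: real assume e: "0 < e"
  define e1 where "e1 = e / 2 / (M / \<kappa> + 1)"
  have Mk: "0 \<le> M / \<kappa>" using M \<kappa> by simp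
  have e1: "0 < e1" using e Mk by (simp add: e1_def)
  have e1': "M * e1 / \<kappa> \<le> e / 2" using scaled_le [OF Mk, of "e / 2"] e unfolding e1_def by (simp add: mult_ac)
  obtain N where N: "0 \<le> N" "\<And>t. N \<le> t \<Longrightarrow> norm (g t) < e1" using C0_D [OF g e1] by auto
  have "((\<lambda>t. M * G * exp (- \<kappa> * (t - N)) * N) \<longlongrightarrow> 0) at_top" using \<kappa> by real_asymp
  then have "\<forall>\<^sub>F t in at_top. M * G * exp (- \<kappa> * (t - N)) * N < e / 2" using e by (intro order_tendstoD) auto
  then obtain N' where N': "\<And>t. N' \<le> t \<Longrightarrow> M * G * exp (- \<kappa> * (t - N)) * N < e / 2"
    unfolding eventually_at_top_linorder by blast
  have "norm (conv V g t) < e" if t: "max N N' \<le> t" for t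
  proof -
    have tN: "N \<le> t" "N' \<le> t" using t by auto
    have "conv V g t = integral {0..N} (\<lambda>s. V (t - s) (g s)) + integral {N..t} (\<lambda>s. V (t - s) (g s))"
      unfolding conv_def
      by (rule Henstock_Kurzweil_Integration.integral_combine [symmetric, OF N(1) tN(1) conv_integrand(2) [OF gc order_refl order_refl]])
    moreover have "norm (integral {0..N} (\<lambda>s. V (t - s) (g s))) \<le> M * G * exp (- \<kappa> * (t - N)) * (N - 0)"
    proof (rule integral_bound [OF N(1) conv_integrand(1) [OF gc order_refl tN(1)]])
      fix s assume s: "s \<in> {0..N}"
      have "norm (V (t - s) (g s)) \<le> M * G * exp (- \<kappa> * (t - s))" using s tN G by (intro norm_V_decay) auto
      also have "\<dots> \<le> M * G * exp (- \<kappa> * (t - N))" using s M G \<kappa> by (intro mult_left_mono) auto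
      finally show "norm (V (t - s) (g s)) \<le> M * G * exp (- \<kappa> * (t - N))" .
    qed
    moreover have "norm (integral {N..t} (\<lambda>s. V (t - s) (g s))) \<le> (M * e1) / \<kappa>"
    proof (rule norm_integral_exp_conv [OF conv_integrand(2) [OF gc N(1) order_refl] \<kappa> tN(1)])
      show "0 \<le> M * e1" using M e1 by simp
      show "norm (V (t - r) (g r)) \<le> M * e1 * exp (- \<kappa> * (t - r))" if "N \<le> r" "r \<le> t" for r
        using that N(2) [of r] by (intro norm_V_decay) auto
    qed
    ultimately have "norm (conv V g t) \<le> M * G * exp (- \<kappa> * (t - N)) * (N - 0) + M * e1 / \<kappa>"
      by (simp only: norm_triangle_mono)
    also have "\<dots> < e" using N' [OF tN(2)] e1' unfolding diff_zero by linarith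
    finally show ?thesis .
  qed
  then show "\<exists>N. \<forall>t\<ge>N. norm (conv V g t) < e" by blast
qed

end

section \<open>Operators on the quotient\<close>

text \<open>The sup norm estimate holds for every representative, so taking the infimum over
  representatives carries it over to the quotient norm.\<close>

lemma quotient_operator:
  fixes \<Phi> :: "(real \<Rightarrow> 'a::complex_normed_vector) \<Rightarrow> real \<Rightarrow> 'a"
  assumes maps: "\<And>f. f \<in> BUC \<Longrightarrow> \<Phi> f \<in> BUC" and C0: "\<And>f. f \<in> C0 \<Longrightarrow> \<Phi> f \<in> C0"
    and add: "\<And>f g. f \<in> BUC \<Longrightarrow> g \<in> BUC \<Longrightarrow> \<Phi> (\<lambda>t. f t + g t) = (\<lambda>t. \<Phi> f t + \<Phi> g t)"
    and sc: "\<And>f c. f \<in> BUC \<Longrightarrow> \<Phi> (\<lambda>t. c *\<^sub>C f t) = (\<lambda>t. c *\<^sub>C \<Phi> f t)"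
    and bd: "\<And>f. f \<in> BUC \<Longrightarrow> sup_norm (\<Phi> f) \<le> K * sup_norm f" and K: "0 \<le> K"
  obtains L :: "'a BUC_quot \<Rightarrow>\<^sub>L 'a BUC_quot"
  where "clinear_op L" "\<And>f. f \<in> BUC \<Longrightarrow> L (abs_BUC_quot f) = abs_BUC_quot (\<Phi> f)" "norm L \<le> K"
proof -
  define l :: "'a BUC_quot \<Rightarrow> 'a BUC_quot" where "l y = abs_BUC_quot (\<Phi> (SOME f. f \<in> BUC \<and> y = abs_BUC_quot f))" for y
  have l: "l (abs_BUC_quot f) = abs_BUC_quot (\<Phi> f)" if f: "f \<in> BUC" for f
  proof -
    define g where "g = (SOME g. g \<in> BUC \<and> abs_BUC_quot f = abs_BUC_quot g)"
    have g: "g \<in> BUC" "abs_BUC_quot f = abs_BUC_quot g"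
      using someI [of "\<lambda>g. g \<in> BUC \<and> abs_BUC_quot f = abs_BUC_quot g" f] f by (auto simp: g_def)
    have d: "(\<lambda>t. g t - f t) \<in> C0" using g f abs_BUC_quot_eq_iff by metis
    have "\<Phi> (\<lambda>t. (g t - f t) + f t) = (\<lambda>t. \<Phi> (\<lambda>t. g t - f t) t + \<Phi> f t)"
      by (rule add [OF C0_BUC [OF d] f])
    then have "(\<lambda>t. \<Phi> g t - \<Phi> f t) = \<Phi> (\<lambda>t. g t - f t)" by simp
    then have "(\<lambda>t. \<Phi> g t - \<Phi> f t) \<in> C0" using C0 [OF d] by simp
    then show ?thesis unfolding l_def g_def [symmetric] using maps f g by (intro abs_BUC_quot_eqI) auto
  qed
  have lb: "norm (l y) \<le> K * norm y" for y
  proof (rule tendsto_lowerbound)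
    show "((\<lambda>b. K * b) \<longlongrightarrow> K * norm y) (at_right (norm y))" by (intro tendsto_intros)
    have "norm (l y) \<le> K * b" if lt: "norm y < b" for b
    proof -
      obtain f where f: "f \<in> BUC" "abs_BUC_quot f = y" "sup_norm f < b" by (rule norm_BUC_quot_less [OF lt])
      have "norm (l y) \<le> sup_norm (\<Phi> f)" using l [OF f(1)] f norm_BUC_quot_le [OF maps [OF f(1)]] by simp
      also have "\<dots> \<le> K * sup_norm f" by (rule bd [OF f(1)])
      also have "\<dots> \<le> K * b" using f K by (intro mult_left_mono) auto
      finally show ?thesis .
    qed
    then show "\<forall>\<^sub>F b in at_right (norm y). norm (l y) \<le> K * b" by (auto simp: eventually_at_filter)
  qed simp
  have lsc: "l (c *\<^sub>C x) = c *\<^sub>C l x" for c x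
  proof -
    obtain f where f: "f \<in> BUC" "x = abs_BUC_quot f" by (rule BUC_quot_cases)
    then show ?thesis using sc maps by (simp add: abs_BUC_quot_scaleC l BUC_scaleC)
  qed
  have bl: "bounded_linear l"
  proof (rule bounded_linear_intro [of l K])
    fix x y :: "'a BUC_quot" and r :: real
    obtain f where f: "f \<in> BUC" "x = abs_BUC_quot f" by (rule BUC_quot_cases)
    obtain g where g: "g \<in> BUC" "y = abs_BUC_quot g" by (rule BUC_quot_cases)
    show "l (x + y) = l x + l y" using f g add maps by (simp add: abs_BUC_quot_add l BUC_add)
    show "l (r *\<^sub>R x) = r *\<^sub>R l x" using lsc [of "of_real r" x] by (simp add: scaleC_of_real)
    show "norm (l x) \<le> norm x * K" using lb [of x] by (simp add: mult.commute)
  qed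
  show thesis
  proof (rule that [of "Blinfun l"])
    note e = bounded_linear_Blinfun_apply [OF bl]
    show "clinear_op (Blinfun l)" by (simp add: clinear_op_def e lsc)
    show "Blinfun l (abs_BUC_quot f) = abs_BUC_quot (\<Phi> f)" if "f \<in> BUC" for f using l [OF that] by (simp add: e)
    show "norm (Blinfun l) \<le> K" using lb K by (intro norm_blinfun_bound) (auto simp: e)
  qed
qed

lemma BUC_blinfun:
  assumes f: "f \<in> BUC"
  shows "(\<lambda>t. blinfun_apply R (f t)) \<in> BUC"
  using assms bounded_linear.uniformly_continuous_on [OF blinfun.bounded_linear_right, of "{0..}" f R]
    bounded_linear_image [OF _ blinfun.bounded_linear_right, of "f ` {0..}" R]
  unfolding BUC_def by (auto simp: image_image)

lemma C0_blinfun: "f \<in> C0 \<Longrightarrow> (\<lambda>t. blinfun_apply R (f t)) \<in> C0"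
  unfolding C0_def using bounded_linear.tendsto_zero [OF blinfun.bounded_linear_right, of f _ R] by (auto intro: BUC_blinfun)

text \<open>The pointwise action of R on classes, selected by its properties;
  \<open>quotient_operator\<close> provides it for complex-linear R.\<close>

definition lift :: "('a::complex_normed_vector \<Rightarrow>\<^sub>L 'a) \<Rightarrow> 'a BUC_quot \<Rightarrow>\<^sub>L 'a BUC_quot"
  where "lift R = (SOME L. clinear_op L \<and> (\<forall>f\<in>BUC. L (abs_BUC_quot f) = abs_BUC_quot (\<lambda>t. R (f t))) \<and> norm L \<le> norm R)"

lemma lift:
  assumes "clinear_op R"
  shows "clinear_op (lift R)" "f \<in> BUC \<Longrightarrow> lift R (abs_BUC_quot f) = abs_BUC_quot (\<lambda>t. R (f t))" "norm (lift R) \<le> norm R"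
proof -
  have "\<exists>L. clinear_op L \<and> (\<forall>f\<in>BUC. L (abs_BUC_quot f) = abs_BUC_quot (\<lambda>t. R (f t))) \<and> norm L \<le> norm R"
  proof (rule quotient_operator [of "\<lambda>f t. R (f t)" "norm R"])
    show "(\<lambda>t. R (f t)) \<in> BUC" if "f \<in> BUC" for f using that by (rule BUC_blinfun)
    show "(\<lambda>t. R (f t)) \<in> C0" if "f \<in> C0" for f using that by (rule C0_blinfun)
    show "sup_norm (\<lambda>t. R (f t)) \<le> norm R * sup_norm f" if "f \<in> BUC" for f
      by (intro sup_norm_leI order_trans [OF norm_blinfun] mult_left_mono norm_le_sup_norm that) auto
  qed (auto simp: blinfun.add_right clinear_opD [OF assms])
  from someI_ex [OF this]
  show "clinear_op (lift R)" "f \<in> BUC \<Longrightarrow> lift R (abs_BUC_quot f) = abs_BUC_quot (\<lambda>t. R (f t))" "norm (lift R) \<le> norm R"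
    by (auto simp: lift_def [symmetric])
qed

definition conv_op :: "(real \<Rightarrow> 'a::{complex_normed_vector, banach} \<Rightarrow>\<^sub>L 'a) \<Rightarrow> 'a BUC_quot \<Rightarrow>\<^sub>L 'a BUC_quot"
  where "conv_op V = (SOME L. clinear_op L \<and> (\<forall>f\<in>BUC. L (abs_BUC_quot f) = abs_BUC_quot (conv V f)))"

lemma (in decaying_family) conv_op:
  shows "clinear_op (conv_op V)" "f \<in> BUC \<Longrightarrow> conv_op V (abs_BUC_quot f) = abs_BUC_quot (conv V f)"
proof -
  have c: "continuous_on {0..} f" if "f \<in> BUC" for f :: "real \<Rightarrow> 'a" using BUC_continuous [OF that] by simp
  have "\<exists>L. clinear_op L \<and> (\<forall>f\<in>BUC. L (abs_BUC_quot f) = abs_BUC_quot (conv V f))"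
  proof (rule quotient_operator [of "conv V" "M / \<kappa>"])
    show "sup_norm (conv V f) \<le> M / \<kappa> * sup_norm f" if "f \<in> BUC" for f
      by (intro sup_norm_leI norm_conv_le c that norm_le_sup_norm)
    show "conv V (\<lambda>t. f t + g t) = (\<lambda>t. conv V f t + conv V g t)" if "f \<in> BUC" "g \<in> BUC" for f g
      by (intro conv_add c that)
    show "conv V (\<lambda>t. k *\<^sub>C f t) = (\<lambda>t. k *\<^sub>C conv V f t)" if "f \<in> BUC" for f k
      by (intro conv_scaleC c that)
    show "0 \<le> M / \<kappa>" using M \<kappa> by simp
  qed (use conv_BUC conv_C0 in auto)
  from someI_ex [OF this]
  show "clinear_op (conv_op V)" "f \<in> BUC \<Longrightarrow> conv_op V (abs_BUC_quot f) = abs_BUC_quot (conv V f)"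
    by (auto simp: conv_op_def [symmetric])
qed

section \<open>Precompact ranges\<close>

text \<open>In a complete space this is equivalent to compactness of the closure, and it passes
  directly to subsets, sums and uniform limits. The centres may lie outside S.\<close>

definition totbd :: "'a::metric_space set \<Rightarrow> bool"
  where "totbd S \<longleftrightarrow> (\<forall>e>0. \<exists>k. finite k \<and> S \<subseteq> (\<Union>x\<in>k. ball x e))"

lemma totbd_subset: "totbd T \<Longrightarrow> S \<subseteq> T \<Longrightarrow> totbd S"
  unfolding totbd_def by (meson subset_trans)

lemma compact_imp_totbd: "compact S \<Longrightarrow> totbd S"
  by (simp add: totbd_def compact_eq_totally_bounded)

lemma compact_closure_iff_totbd: "compact (closure S) \<longleftrightarrow> totbd (S :: 'a::complete_space set)"
proof
  assume "compact (closure S)"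
  then show "totbd S" using compact_imp_totbd totbd_subset closure_subset by blast
next
  assume S: "totbd S"
  show "compact (closure S)"
    unfolding compact_eq_totally_bounded
  proof (intro conjI allI impI)
    show "complete (closure S)" by (simp add: complete_eq_closed)
    fix e :: real assume "0 < e"
    then obtain k where k: "finite k" "S \<subseteq> (\<Union>x\<in>k. ball x (e / 2))" using S unfolding totbd_def by (meson half_gt_zero)
    have "S \<subseteq> (\<Union>x\<in>k. cball x (e / 2))" by (rule order_trans [OF k(2)]) (intro UN_mono order_refl ball_subset_cball)
    moreover have "closed (\<Union>x\<in>k. cball x (e / 2))" using k(1) by (intro closed_UN) auto
    ultimately have "closure S \<subseteq> (\<Union>x\<in>k. cball x (e / 2))" by (rule closure_minimal)
    also have "\<dots> \<subseteq> (\<Union>x\<in>k. ball x e)" using \<open>0 < e\<close> by (intro UN_mono order_refl) auto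
    finally show "\<exists>k. finite k \<and> closure S \<subseteq> (\<Union>x\<in>k. ball x e)" using k(1) by blast
  qed
qed

lemma totbd_approx:
  assumes "\<And>e. 0 < e \<Longrightarrow> \<exists>T. totbd T \<and> (\<forall>x\<in>S. \<exists>y\<in>T. dist x y < e)"
  shows "totbd S"
  unfolding totbd_def
proof (intro allI impI)
  fix e :: real assume e: "0 < e"
  obtain T where T: "totbd T" "\<forall>x\<in>S. \<exists>y\<in>T. dist x y < e / 2" using assms [of "e / 2"] e by auto
  obtain k where k: "finite k" "T \<subseteq> (\<Union>x\<in>k. ball x (e / 2))" using T(1) e unfolding totbd_def by (meson half_gt_zero)
  have "x \<in> (\<Union>z\<in>k. ball z e)" if xS: "x \<in> S" for x
  proof -
    obtain y where y: "y \<in> T" "dist x y < e / 2" using T(2) xS by blast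
    obtain z where z: "z \<in> k" "dist z y < e / 2" using k(2) y(1) by auto
    have "dist z x \<le> dist z y + dist x y" by (metis dist_commute dist_triangle)
    then have "dist z x < e" using y z by linarith
    then show ?thesis using z(1) by auto
  qed
  then show "\<exists>k. finite k \<and> S \<subseteq> (\<Union>x\<in>k. ball x e)" using k(1) by blast
qed

lemma totbd_Un: "totbd S \<Longrightarrow> totbd T \<Longrightarrow> totbd (S \<union> T)"
  unfolding totbd_def
proof (intro allI impI)
  fix e :: real
  assume a: "\<forall>e>0. \<exists>k. finite k \<and> S \<subseteq> (\<Union>x\<in>k. ball x e)" "\<forall>e>0. \<exists>k. finite k \<and> T \<subseteq> (\<Union>x\<in>k. ball x e)" "0 < e"
  obtain k where "finite k" "S \<subseteq> (\<Union>x\<in>k. ball x e)" using a(1) [rule_format, OF a(3)] by blast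
  moreover obtain k' where "finite k'" "T \<subseteq> (\<Union>x\<in>k'. ball x e)" using a(2) [rule_format, OF a(3)] by blast
  ultimately have "finite (k \<union> k')" "S \<union> T \<subseteq> (\<Union>x\<in>k \<union> k'. ball x e)" by auto
  then show "\<exists>k. finite k \<and> S \<union> T \<subseteq> (\<Union>x\<in>k. ball x e)" by blast
qed

lemma totbd_blinfun_image:
  assumes S: "totbd S"
  shows "totbd (blinfun_apply R ` S)"
  unfolding totbd_def
proof (intro allI impI)
  fix e :: real assume e: "0 < e"
  let ?d = "e / (norm R + 1)"
  have d: "0 < ?d" using e by (simp add: add_nonneg_pos)
  obtain k where k: "finite k" "S \<subseteq> (\<Union>x\<in>k. ball x ?d)" using S [unfolded totbd_def, rule_format, OF d] by blast
  have "R y \<in> (\<Union>x\<in>blinfun_apply R ` k. ball x e)" if yS: "y \<in> S" for y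
  proof -
    obtain x where x: "x \<in> k" "dist x y < ?d" using k(2) \<open>y \<in> S\<close> by auto
    have "dist (R x) (R y) \<le> norm R * dist x y" using norm_blinfun [of R "x - y"] by (simp add: dist_norm blinfun.diff_right)
    also have "\<dots> \<le> (norm R + 1) * dist x y" by (intro mult_right_mono) auto
    also have "\<dots> < (norm R + 1) * ?d" using x(2) by (intro mult_strict_left_mono) (auto simp: add_nonneg_pos)
    also have "\<dots> = e" by (simp add: add_nonneg_eq_0_iff)
    finally show ?thesis using x(1) by auto
  qed
  then show "\<exists>k. finite k \<and> blinfun_apply R ` S \<subseteq> (\<Union>x\<in>k. ball x e)" using k(1) by (intro exI [of _ "blinfun_apply R ` k"]) auto
qed

lemma totbd_add:
  fixes f g :: "'c \<Rightarrow> 'a::real_normed_vector"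
  assumes f: "totbd (f ` D)" and g: "totbd (g ` D)"
  shows "totbd ((\<lambda>t. f t + g t) ` D)"
  unfolding totbd_def
proof (intro allI impI)
  fix e :: real assume e: "0 < e"
  then have e2: "0 < e / 2" by simp
  obtain k where k: "finite k" "f ` D \<subseteq> (\<Union>x\<in>k. ball x (e / 2))" using f [unfolded totbd_def, rule_format, OF e2] by blast
  obtain k' where k': "finite k'" "g ` D \<subseteq> (\<Union>x\<in>k'. ball x (e / 2))" using g [unfolded totbd_def, rule_format, OF e2] by blast
  have "f t + g t \<in> (\<Union>x\<in>(\<lambda>(x, y). x + y) ` (k \<times> k'). ball x e)" if tD: "t \<in> D" for t
  proof -
    obtain x where x: "x \<in> k" "dist x (f t) < e / 2" using subsetD [OF k(2) imageI [OF tD]] by auto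
    obtain y where y: "y \<in> k'" "dist y (g t) < e / 2" using subsetD [OF k'(2) imageI [OF tD]] by auto
    have "dist (x + y) (f t + g t) \<le> dist x (f t) + dist y (g t)" by (rule dist_triangle_add)
    then have "dist (x + y) (f t + g t) < e" using x y by linarith
    then show ?thesis using x(1) y(1) by force
  qed
  then show "\<exists>k. finite k \<and> (\<lambda>t. f t + g t) ` D \<subseteq> (\<Union>x\<in>k. ball x e)"
    using k(1) k'(1) by (intro exI [of _ "(\<lambda>(x, y). x + y) ` (k \<times> k')"]) auto
qed

lemma totbd_scaleR:
  fixes f :: "'c \<Rightarrow> 'a::real_normed_vector"
  assumes "totbd (f ` D)"
  shows "totbd ((\<lambda>t. r *\<^sub>R f t) ` D)"
  using totbd_blinfun_image [OF assms, of "r *\<^sub>R id_blinfun"] by (simp add: image_image scaleR_blinfun.rep_eq)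

lemma totbd_sum:
  fixes f :: "nat \<Rightarrow> 'c \<Rightarrow> 'a::real_normed_vector"
  assumes "\<And>i. i < n \<Longrightarrow> totbd (f i ` D)"
  shows "totbd ((\<lambda>t. \<Sum>i<n. f i t) ` D)"
  using assms
proof (induction n)
  case 0
  have "totbd {0::'a}" by (intro compact_imp_totbd) simp
  then show ?case by (rule totbd_subset) auto
next
  case (Suc n)
  then show ?case using totbd_add [of "\<lambda>t. \<Sum>i<n. f i t" D "f n"] by simp
qed

text \<open>Equicontinuity in s, uniform over the parameter t, lets Riemann sums over one fixed
  partition approximate the integrals for all t at once, and such a sum is a finite combination of
  totally bounded families.\<close>

lemma totbd_parametric_integral:
  fixes k :: "real \<Rightarrow> 'c \<Rightarrow> 'a::banach"
  assumes n: "0 < n" and tb: "\<And>s. 0 \<le> s \<Longrightarrow> s \<le> n \<Longrightarrow> totbd (k s ` D)"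
    and eq: "\<And>e. 0 < e \<Longrightarrow> \<exists>d>0. \<forall>s\<in>{0..n}. \<forall>s'\<in>{0..n}. \<bar>s - s'\<bar> < d \<longrightarrow> (\<forall>t\<in>D. norm (k s t - k s' t) \<le> e)"
    and int: "\<And>t. t \<in> D \<Longrightarrow> (\<lambda>s. k s t) integrable_on {0..n}"
  shows "totbd ((\<lambda>t. integral {0..n} (\<lambda>s. k s t)) ` D)"
proof (rule totbd_approx)
  fix e :: real assume e: "0 < e"
  \<comment> \<open>The Riemann sums then err by at most n e1 = e / 2.\<close>
  define e1 where "e1 = e / (2 * n)"
  have e1: "0 < e1" using e n by (simp add: e1_def)
  obtain d where d: "0 < d" "\<And>s s' t. s \<in> {0..n} \<Longrightarrow> s' \<in> {0..n} \<Longrightarrow> \<bar>s - s'\<bar> < d \<Longrightarrow> t \<in> D \<Longrightarrow> norm (k s t - k s' t) \<le> e1"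
    using eq [OF e1] by metis
  obtain m :: nat where m: "n / d < real m" using reals_Archimedean2 by blast
  have m0: "0 < real m" using m n d by (smt (verit) divide_pos_pos)
  define h where "h = n / real m"
  have h: "0 < h" "h < d" "real m * h = n" using m m0 n d by (auto simp: h_def field_simps)
  have app: "norm (integral {0..real j * h} (\<lambda>s. k s t) - (\<Sum>i<j. h *\<^sub>R k (real i * h) t)) \<le> real j * h * e1"
    if "j \<le> m" "t \<in> D" for j t
    using that(1)
  proof (induction j)
    case (Suc j)
    have jm: "real (Suc j) * h \<le> n"
    proof -
      have "real (Suc j) * h \<le> real m * h" using Suc.prems h by (intro mult_right_mono) auto
      then show ?thesis using h by simp
    qed
    have j0: "0 \<le> real j * h" "real j * h \<le> real (Suc j) * h" using h by (auto simp: mult_right_mono)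
    have i: "(\<lambda>s. k s t) integrable_on {p..q}" if "0 \<le> p" "q \<le> n" for p q
      by (rule integrable_subinterval_real [OF int [OF \<open>t \<in> D\<close>]]) (use that in auto)
    have "integral {0..real (Suc j) * h} (\<lambda>s. k s t) =
      integral {0..real j * h} (\<lambda>s. k s t) + integral {real j * h..real (Suc j) * h} (\<lambda>s. k s t)"
      by (rule Henstock_Kurzweil_Integration.integral_combine [symmetric, OF j0 i]) (use jm in auto)
    then have "integral {0..real (Suc j) * h} (\<lambda>s. k s t) - (\<Sum>i<Suc j. h *\<^sub>R k (real i * h) t) =
      (integral {0..real j * h} (\<lambda>s. k s t) - (\<Sum>i<j. h *\<^sub>R k (real i * h) t)) +
      (integral {real j * h..real (Suc j) * h} (\<lambda>s. k s t) - h *\<^sub>R k (real j * h) t)" by simp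
    also have "norm \<dots> \<le> real j * h * e1 + e1 * h"
    proof (rule norm_triangle_mono)
      show "norm (integral {0..real j * h} (\<lambda>s. k s t) - (\<Sum>i<j. h *\<^sub>R k (real i * h) t)) \<le> real j * h * e1"
        using Suc by simp
      have len: "real (Suc j) * h - real j * h = h" by (simp add: algebra_simps)
      have len': "Henstock_Kurzweil_Integration.content {real j * h..real (Suc j) * h} = h"
        using content_real [OF j0(2)] len by simp
      have "((\<lambda>s. k s t - k (real j * h) t) has_integral
        (integral {real j * h..real (Suc j) * h} (\<lambda>s. k s t) - h *\<^sub>R k (real j * h) t)) {real j * h..real (Suc j) * h}"
        using has_integral_diff [OF integrable_integral [OF i [OF j0(1) jm]] has_integral_const_real [of "k (real j * h) t" "real j * h" "real (Suc j) * h"]]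
          by (simp only: len')
      then have "norm (integral {real j * h..real (Suc j) * h} (\<lambda>s. k s t) - h *\<^sub>R k (real j * h) t) \<le>
        e1 * measure lborel {real j * h..real (Suc j) * h}"
      proof (rule has_integral_bound_real [of e1 "{}", rotated 2])
        fix s assume s: "s \<in> {real j * h..real (Suc j) * h} - {}"
        show "norm (k s t - k (real j * h) t) \<le> e1"
        proof (rule d(2) [OF _ _ _ \<open>t \<in> D\<close>])
          have "real j * h \<le> s" "s \<le> real (Suc j) * h" using s by auto
          then show "s \<in> {0..n}" "real j * h \<in> {0..n}" "\<bar>s - real j * h\<bar> < d"
            using j0 jm len h(2) unfolding atLeastAtMost_iff by linarith+
        qed
      qed (use e1 in auto)
      then show "norm (integral {real j * h..real (Suc j) * h} (\<lambda>s. k s t) - h *\<^sub>R k (real j * h) t) \<le> e1 * h"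
        using j0(2) len by simp
    qed
    also have "\<dots> = real (Suc j) * h * e1" by (simp add: algebra_simps)
    finally show ?case .
  qed simp
  have "totbd ((\<lambda>t. \<Sum>i<m. h *\<^sub>R k (real i * h) t) ` D)"
  proof (intro totbd_sum totbd_scaleR tb)
    fix i assume "i < m"
    then have "real i * h \<le> real m * h" using h by (intro mult_right_mono) auto
    then show "real i * h \<le> n" "0 \<le> real i * h" using h by auto
  qed
  moreover have "dist (integral {0..n} (\<lambda>s. k s t)) (\<Sum>i<m. h *\<^sub>R k (real i * h) t) < e" if "t \<in> D" for t
  proof -
    have "norm (integral {0..n} (\<lambda>s. k s t) - (\<Sum>i<m. h *\<^sub>R k (real i * h) t)) \<le> n * e1"
      using app [of m t] that h(3) by simp
    also have "\<dots> < e" using n e by (simp add: e1_def)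
    finally show ?thesis by (simp add: dist_norm)
  qed
  ultimately show "\<exists>T. totbd T \<and> (\<forall>x\<in>(\<lambda>t. integral {0..n} (\<lambda>s. k s t)) ` D. \<exists>y\<in>T. dist x y < e)"
    by (intro exI [of _ "(\<lambda>t. \<Sum>i<m. h *\<^sub>R k (real i * h) t) ` D"]) auto
qed

lemma BUC_C_iff: "f \<in> BUC_C \<longleftrightarrow> f \<in> BUC \<and> totbd (f ` {0..})" for f :: "real \<Rightarrow> 'a::banach"
  by (simp add: BUC_C_def compact_closure_iff_totbd)

lemma BUC_C_BUC: "f \<in> BUC_C \<Longrightarrow> f \<in> BUC"
  by (simp add: BUC_C_def)

lemma C0_BUC_C:
  fixes c :: "real \<Rightarrow> 'a::banach"
  assumes c: "c \<in> C0"
  shows "c \<in> BUC_C"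
  unfolding BUC_C_iff
proof (intro conjI totbd_approx)
  show "c \<in> BUC" by (rule C0_BUC [OF c])
  fix e :: real assume e: "0 < e"
  obtain N where N: "0 \<le> N" "\<And>t. N \<le> t \<Longrightarrow> norm (c t) < e" using C0_D [OF c e] by auto
  have "compact (c ` {0..N})"
    by (intro compact_continuous_image BUC_continuous [OF C0_BUC [OF c]]) auto
  then have "totbd (insert 0 (c ` {0..N}))" by (intro compact_imp_totbd compact_insert)
  moreover have "\<exists>y\<in>insert 0 (c ` {0..N}). dist x y < e" if "x \<in> c ` {0..}" for x
  proof -
    obtain t where t: "0 \<le> t" "x = c t" using \<open>x \<in> c ` {0..}\<close> by auto
    show ?thesis
    proof (cases "t \<le> N")
      case True
      then show ?thesis using t e by (intro bexI [of _ x]) auto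
    next
      case False
      then show ?thesis using N(2) [of t] t by auto
    qed
  qed
  ultimately show "\<exists>T. totbd T \<and> (\<forall>x\<in>c ` {0..}. \<exists>y\<in>T. dist x y < e)" by blast
qed

lemma BUC_C_add: "f \<in> BUC_C \<Longrightarrow> g \<in> BUC_C \<Longrightarrow> (\<lambda>t. f t + g t) \<in> BUC_C" for f g :: "real \<Rightarrow> 'a::banach"
  unfolding BUC_C_iff by (blast intro: BUC_add totbd_add)

lemma BUC_C_blinfun: "f \<in> BUC_C \<Longrightarrow> (\<lambda>t. blinfun_apply R (f t)) \<in> BUC_C" for f :: "real \<Rightarrow> 'a::banach" and R :: "'a \<Rightarrow>\<^sub>L 'b::banach"
  unfolding BUC_C_iff using totbd_blinfun_image [of "f ` {0..}" R] by (simp add: BUC_blinfun image_image)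

lemma BUC_C_scaleC: "f \<in> BUC_C \<Longrightarrow> (\<lambda>t. c *\<^sub>C f t) \<in> BUC_C" for f :: "real \<Rightarrow> 'a::{complex_normed_vector, banach}"
  using BUC_C_blinfun [of f "c *\<^sub>C id_blinfun"] by (simp add: scaleC_blinfun_apply)

lemma BUC_C_scaleR: "f \<in> BUC_C \<Longrightarrow> (\<lambda>t. r *\<^sub>R f t) \<in> BUC_C" for f :: "real \<Rightarrow> 'a::{complex_normed_vector, banach}"
  using BUC_C_scaleC [of f "of_real r"] by (simp add: scaleC_of_real)

lemma BUC_C_uniform_approx:
  fixes g :: "real \<Rightarrow> 'a::banach"
  assumes g: "g \<in> BUC" and ap: "\<And>e. 0 < e \<Longrightarrow> \<exists>h\<in>BUC_C. \<forall>t\<ge>0. norm (g t - h t) < e"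
  shows "g \<in> BUC_C"
  unfolding BUC_C_iff
proof (intro conjI totbd_approx)
  show "g \<in> BUC" by (rule g)
  fix e :: real assume "0 < e"
  from ap [OF this] obtain h where h: "h \<in> BUC_C" "\<forall>t\<ge>0. norm (g t - h t) < e" by blast
  have "\<exists>y\<in>h ` {0..}. dist x y < e" if xg: "x \<in> g ` {0..}" for x
    using xg h(2) by (auto simp: dist_norm)
  then show "\<exists>T. totbd T \<and> (\<forall>x\<in>g ` {0..}. \<exists>y\<in>T. dist x y < e)" using h(1) by (auto simp: BUC_C_iff)
qed

context decaying_family
begin

text \<open>Precompactness of the range of f enters twice: each V(r) maps the range to a totally
  bounded set, and V is uniformly continuous on [0, n] times the closure of the range, which gives
  equicontinuity in r. The map \<open>a\<close> covers both shifts t - r and t + r, clipped so that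
  the argument of f is never negative.\<close>

lemma totbd_window:
  assumes f: "f \<in> BUC_C" and n: "0 < n"
    and a: "\<And>r t. 0 \<le> t \<Longrightarrow> 0 \<le> a r t" "\<And>r s t. 0 \<le> t \<Longrightarrow> \<bar>a r t - a s t\<bar> \<le> \<bar>r - s\<bar>"
  shows "totbd ((\<lambda>t. integral {0..n} (\<lambda>r. V r (f (a r t)))) ` {0..})"
proof (rule totbd_parametric_integral [OF n])
  note fB = BUC_C_BUC [OF f]
  show "totbd ((\<lambda>t. V s (f (a s t))) ` {0..})" for s
  proof (rule totbd_subset [OF totbd_blinfun_image])
    show "totbd (f ` {0..})" using f by (simp add: BUC_C_iff)
    show "(\<lambda>t. V s (f (a s t))) ` {0..} \<subseteq> V s ` f ` {0..}" using a(1) by auto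
  qed
  have ac: "continuous_on {0..n} (\<lambda>r. a r t)" if t: "0 \<le> t" for t
    unfolding continuous_on_iff
  proof (intro ballI allI impI)
    fix x e :: real assume "0 < e"
    then show "\<exists>d>0. \<forall>x'\<in>{0..n}. dist x' x < d \<longrightarrow> dist (a x' t) (a x t) < e"
      using a(2) [OF t] by (intro exI [of _ e]) (auto simp: dist_real_def intro: le_less_trans)
  qed
  show "(\<lambda>s. V s (f (a s t))) integrable_on {0..n}" if "t \<in> {0..}" for t
  proof (intro integrable_continuous_real V_apply_continuous continuous_on_id)
    show "continuous_on {0..n} (\<lambda>s. f (a s t))"
      by (rule continuous_on_compose2 [OF BUC_continuous [OF fB order_refl] ac]) (use that a(1) in auto)
  qed auto
  fix e :: real assume e: "0 < e"
  let ?K = "{0..n} \<times> closure (f ` {0..})"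
  have "compact ?K" using f by (intro compact_Times) (auto simp: BUC_C_def)
  moreover have "continuous_on ?K (\<lambda>p. V (fst p) (snd p))"
    by (intro V_apply_continuous continuous_intros) auto
  ultimately have "uniformly_continuous_on ?K (\<lambda>p. V (fst p) (snd p))" by (intro compact_uniformly_continuous)
  then obtain d where d: "0 < d" "\<And>p q. p \<in> ?K \<Longrightarrow> q \<in> ?K \<Longrightarrow> dist q p < d \<Longrightarrow> dist (V (fst q) (snd q)) (V (fst p) (snd p)) < e"
    unfolding uniformly_continuous_on_def using e by metis
  obtain d' where d': "0 < d'" "\<forall>s\<ge>0. \<forall>t\<ge>0. \<bar>s - t\<bar> < d' \<longrightarrow> norm (f s - f t) < d / 2"
    using BUC_dist [OF fB, of "d / 2"] d(1) by auto
  have "norm (V s (f (a s t)) - V s' (f (a s' t))) \<le> e"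
    if s: "s \<in> {0..n}" "s' \<in> {0..n}" "\<bar>s - s'\<bar> < min d' (d / 2)" and t: "t \<in> {0..}" for s s' t
  proof -
    have t0: "0 \<le> t" using t by simp
    have mem: "f (a r t) \<in> closure (f ` {0..})" for r
      by (rule subsetD [OF closure_subset]) (use a(1) [OF t0] in auto)
    have "\<bar>a s t - a s' t\<bar> < d'" using a(2) [OF t0, of s s'] s(3) by simp
    then have "norm (f (a s t) - f (a s' t)) < d / 2" using d'(2) a(1) [OF t0] by simp
    moreover have "dist (s, f (a s t)) (s', f (a s' t)) \<le> \<bar>s - s'\<bar> + norm (f (a s t) - f (a s' t))"
      unfolding dist_norm [of "f _"] dist_Pair_Pair
      using sqrt_sum_squares_le_sum [of "dist s s'" "norm (f (a s t) - f (a s' t))"] by (simp add: dist_real_def)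
    ultimately have "dist (s, f (a s t)) (s', f (a s' t)) < d" using s(3) by simp
    then show ?thesis using d(2) [of "(s', f (a s' t))" "(s, f (a s t))"] s mem by (simp add: dist_norm)
  qed
  then show "\<exists>d>0. \<forall>s\<in>{0..n}. \<forall>s'\<in>{0..n}. \<bar>s - s'\<bar> < d \<longrightarrow> (\<forall>t\<in>{0..}. norm (V s (f (a s t)) - V s' (f (a s' t))) \<le> e)"
    using d(1) d'(1) by (intro exI [of _ "min d' (d / 2)"]) auto
qed

lemma norm_tail_le:
  assumes g: "continuous_on {0..} g" and b: "\<And>s. 0 \<le> s \<Longrightarrow> norm (g s) \<le> G" and n: "0 \<le> n" "n \<le> t"
  shows "norm (integral {n..t} (\<lambda>r. V r (g (t - r)))) \<le> (M * G * exp (- \<kappa> * n)) / \<kappa>"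
proof -
  have G: "0 \<le> G" using order_trans [OF norm_ge_zero b [of 0]] by simp
  let ?h = "\<lambda>r. V r (g (t - r))"
  have int: "?h integrable_on {n..t}" by (rule conv_integrand'(2) [OF g n(1) order_refl])
  have hi: "((\<lambda>r. ?h (- r)) has_integral integral {n..t} ?h) {- t..- n}"
    unfolding has_integral_reflect_real [where f = ?h] by (rule integrable_integral [OF int])
  note i = has_integral_integrable [OF hi]
  have "norm (integral {- t..- n} (\<lambda>r. ?h (- r))) \<le> (M * G * exp (- \<kappa> * n)) / \<kappa>"
  proof (rule norm_integral_exp_conv [OF i \<kappa>])
    show "- t \<le> - n" using n by simp
    show "0 \<le> M * G * exp (- \<kappa> * n)" using M G by simp
    fix r assume r: "- t \<le> r" "r \<le> - n"
    have "norm (?h (- r)) \<le> (M * G) * exp (- \<kappa> * - r)" using r n by (intro norm_V_decay b) auto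
    also have "\<dots> = M * G * exp (- \<kappa> * n) * exp (- \<kappa> * (- n - r))"
      by (simp add: algebra_simps flip: exp_add)
    finally show "norm (?h (- r)) \<le> M * G * exp (- \<kappa> * n) * exp (- \<kappa> * (- n - r))" .
  qed
  then show ?thesis by (simp only: integral_unique [OF hi])
qed

text \<open>For t \<ge> n the convolution is an integral over the window [0, n] up to an
  exponentially small tail, and the times t \<le> n contribute a compact set.\<close>

lemma conv_BUC_C:
  assumes g: "g \<in> BUC_C"
  shows "conv V g \<in> BUC_C"
  unfolding BUC_C_iff
proof (intro conjI totbd_approx)
  note gB = BUC_C_BUC [OF g]
  show "conv V g \<in> BUC" by (rule conv_BUC [OF gB])
  have gc: "continuous_on {0..} g" by (rule BUC_continuous [OF gB order_refl])
  obtain G where G: "0 \<le> G" "\<And>t. 0 \<le> t \<Longrightarrow> norm (g t) \<le> G" using BUC_bound [OF gB] by blast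
  fix e :: real assume e: "0 < e"
  have "((\<lambda>n. (M * G * exp (- \<kappa> * n)) / \<kappa>) \<longlongrightarrow> 0) at_top" using \<kappa> by real_asymp
  then have "\<forall>\<^sub>F n in at_top. (M * G * exp (- \<kappa> * n)) / \<kappa> < e" using e by (intro order_tendstoD)
  then have "\<forall>\<^sub>F n in at_top. (M * G * exp (- \<kappa> * n)) / \<kappa> < e \<and> 0 < n"
    using eventually_gt_at_top by (rule eventually_conj)
  then obtain n where n: "(M * G * exp (- \<kappa> * n)) / \<kappa> < e" "0 < n" unfolding eventually_at_top_linorder by blast
  let ?h = "\<lambda>t. integral {0..n} (\<lambda>r. V r (g (max 0 (t - r))))"
  let ?T = "conv V g ` {0..n} \<union> ?h ` {0..}"
  have "totbd (?h ` {0..})" by (intro totbd_window g n(2)) auto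
  moreover have "totbd (conv V g ` {0..n})"
    by (intro compact_imp_totbd compact_continuous_image BUC_continuous [OF conv_BUC [OF gB]]) auto
  ultimately have T: "totbd ?T" by (intro totbd_Un)
  have "\<exists>y\<in>?T. dist x y < e" if "x \<in> conv V g ` {0..}" for x
  proof -
    obtain t where t: "0 \<le> t" "x = conv V g t" using \<open>x \<in> _\<close> by auto
    show ?thesis
    proof (cases "t \<le> n")
      case True
      then show ?thesis using t e by (intro bexI [of _ x]) auto
    next
      case False
      then have nt: "0 \<le> n" "n \<le> t" using n by auto
      have "conv V g t = integral {0..n} (\<lambda>r. V r (g (t - r))) + integral {n..t} (\<lambda>r. V r (g (t - r)))"
        unfolding conv_reflect [OF gc t(1)]
        by (rule Henstock_Kurzweil_Integration.integral_combine [symmetric, OF nt conv_integrand'(2) [OF gc order_refl order_refl]])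
      moreover have "integral {0..n} (\<lambda>r. V r (g (t - r))) = ?h t" using nt by (intro integral_cong) auto
      ultimately have "dist x (?h t) < e"
        using norm_tail_le [OF gc G(2) nt] n(1) t(2) by (simp add: dist_norm)
      then show ?thesis using t by (intro bexI [of _ "?h t"]) auto
    qed
  qed
  with T show "\<exists>T. totbd T \<and> (\<forall>x\<in>conv V g ` {0..}. \<exists>y\<in>T. dist x y < e)" by blast
qed

end

text \<open>For Re l < 0 the resolvent of the derivative is minus the convolution with this scalar
  family, so all results on convolutions apply to it.\<close>

lemma decaying_family_exp:
  assumes "Re l < 0"
  shows "decaying_family (\<lambda>t. exp (l * of_real t) *\<^sub>C (id_blinfun :: 'a::{complex_normed_vector, banach} \<Rightarrow>\<^sub>L 'a)) 1 (- Re l)"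
proof
  show "continuous_on {0..} (\<lambda>t. (exp (l * complex_of_real t) *\<^sub>C (id_blinfun :: 'a \<Rightarrow>\<^sub>L 'a)) x)" for x
    unfolding scaleC_blinfun_apply by (intro scaleC.continuous_on continuous_intros)
  show "norm (exp (l * complex_of_real t) *\<^sub>C (id_blinfun :: 'a \<Rightarrow>\<^sub>L 'a)) \<le> 1 * exp (- (- Re l) * t)" if "0 \<le> t" for t
    using mult_left_mono [OF norm_blinfun_id_le, of "exp (Re l * t)"] by (simp)
  show "clinear_op (exp (l * complex_of_real t) *\<^sub>C (id_blinfun :: 'a \<Rightarrow>\<^sub>L 'a))" for t
    by (simp add: clinear_op_def scaleC_blinfun_apply scaleC_scaleC mult.commute)
qed (use assms in auto)

lemma Pres_left:
  fixes f :: "real \<Rightarrow> 'a::{complex_normed_vector, banach}"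
  assumes f: "f \<in> BUC" and l: "Re l < 0"
  shows "Pres l (abs_BUC_quot f) = abs_BUC_quot (\<lambda>t. - conv (\<lambda>t. exp (l * of_real t) *\<^sub>C id_blinfun) f t)"
  using Pres_eqI [OF deriv_resolvent_left(1) [OF f l] f] l
  by (simp add: conv_def scaleC_blinfun_apply C0_zero)

lemma Pres_BUC_C:
  fixes f :: "real \<Rightarrow> 'a::{complex_normed_vector, banach}"
  assumes f: "f \<in> BUC_C" and l: "Re l \<noteq> 0"
  shows "\<exists>g\<in>BUC_C. Pres l (abs_BUC_quot f) = abs_BUC_quot g"
proof (cases "Re l < 0")
  case True
  interpret decaying_family "\<lambda>t. exp (l * of_real t) *\<^sub>C (id_blinfun :: 'a \<Rightarrow>\<^sub>L 'a)" 1 "- Re l"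
    by (rule decaying_family_exp [OF True])
  have "(\<lambda>t. - conv (\<lambda>t. exp (l * of_real t) *\<^sub>C id_blinfun) f t) \<in> BUC_C"
    using BUC_C_scaleR [OF conv_BUC_C [OF f], of "-1"] by simp
  then show ?thesis using Pres_left [OF BUC_C_BUC [OF f] True] by blast
next
  case False
  then have l: "0 < Re l" using l by simp
  note fB = BUC_C_BUC [OF f]
  obtain u where u: "(u, \<lambda>t. l *\<^sub>C u t - f t) \<in> deriv_op"
    "\<And>t n. 0 \<le> t \<Longrightarrow> 0 \<le> n \<Longrightarrow> norm (u t - integral {0..n} (\<lambda>s. exp (- l * of_real s) *\<^sub>C f (t + s))) \<le> sup_norm f / Re l * exp (- Re l * n)"
    using deriv_resolvent_right [OF fB l] by blast
  interpret decaying_family "\<lambda>t. exp (- l * of_real t) *\<^sub>C (id_blinfun :: 'a \<Rightarrow>\<^sub>L 'a)" 1 "- Re (- l)"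
    by (rule decaying_family_exp) (use l in simp)
  have "u \<in> BUC_C"
    unfolding BUC_C_iff
  proof (intro conjI totbd_approx)
    show "u \<in> BUC" using u(1) by (auto simp: deriv_opD)
    fix e :: real assume e: "0 < e"
    have "((\<lambda>n. c / r * exp (- r * n)) \<longlongrightarrow> 0) at_top" if "0 < r" for c r :: real using that by real_asymp
    from this [OF l, of "sup_norm f"] have "\<forall>\<^sub>F n in at_top. sup_norm f / Re l * exp (- Re l * n) < e" using e by (intro order_tendstoD)
    then have "\<forall>\<^sub>F n in at_top. sup_norm f / Re l * exp (- Re l * n) < e \<and> 0 < n"
      using eventually_gt_at_top by (rule eventually_conj)
    then obtain n where n: "sup_norm f / Re l * exp (- Re l * n) < e" "0 < n" unfolding eventually_at_top_linorder by blast
    \<comment> \<open>The window integral of \<open>deriv_resolvent_right\<close>;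
      \<open>max 0 r\<close> keeps the shift nonnegative for every r, as \<open>totbd_window\<close>
      asks.\<close>
    let ?h = "\<lambda>t. integral {0..n} (\<lambda>r. (exp (- l * of_real r) *\<^sub>C id_blinfun) (f (t + max 0 r)))"
    have "totbd (?h ` {0..})" by (intro totbd_window f n(2)) auto
    moreover have "dist (u t) (?h t) < e" if t: "0 \<le> t" for t
    proof -
      have "?h t = integral {0..n} (\<lambda>s. exp (- l * of_real s) *\<^sub>C f (t + s))"
        by (intro integral_cong) (simp add: scaleC_blinfun_apply)
      then show ?thesis using u(2) [OF t, of n] n by (simp add: dist_norm del: mult_minus_left)
    qed
    ultimately show "\<exists>T. totbd T \<and> (\<forall>x\<in>u ` {0..}. \<exists>y\<in>T. dist x y < e)"
      by (intro exI [of _ "?h ` {0..}"] conjI) auto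
  qed
  then show ?thesis using Pres_eqI [OF u(1) fB, of l] l by (auto simp: C0_zero)
qed

definition BUC_C_quot :: "'a::{complex_normed_vector, banach} BUC_quot set"
  where "BUC_C_quot = abs_BUC_quot ` BUC_C"

text \<open>Two representatives differ by a function in \<open>C0\<close>, and such a function has
  precompact range.\<close>

lemma BUC_C_quot_rep:
  assumes "f \<in> BUC" "abs_BUC_quot f \<in> BUC_C_quot"
  shows "f \<in> BUC_C"
proof -
  obtain g where g: "g \<in> BUC_C" "abs_BUC_quot f = abs_BUC_quot g" using assms(2) by (auto simp: BUC_C_quot_def)
  have "(\<lambda>t. f t - g t) \<in> BUC_C"
    using abs_BUC_quot_eq_iff [OF assms(1) BUC_C_BUC [OF g(1)]] g(2) by (intro C0_BUC_C) simp
  from BUC_C_add [OF this g(1)] show ?thesis by simp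
qed

lemma BUC_C_quot_I: "f \<in> BUC_C \<Longrightarrow> abs_BUC_quot f \<in> BUC_C_quot"
  by (auto simp: BUC_C_quot_def)

lemma BUC_C_quot_add: "x \<in> BUC_C_quot \<Longrightarrow> y \<in> BUC_C_quot \<Longrightarrow> x + y \<in> BUC_C_quot"
  by (auto simp: BUC_C_quot_def BUC_C_BUC abs_BUC_quot_add intro!: imageI BUC_C_add)

lemma BUC_C_quot_scaleC: "x \<in> BUC_C_quot \<Longrightarrow> c *\<^sub>C x \<in> BUC_C_quot"
  by (auto simp: BUC_C_quot_def BUC_C_BUC abs_BUC_quot_scaleC intro!: imageI BUC_C_scaleC)

lemma zero_BUC_C_quot: "0 \<in> BUC_C_quot"
  by (auto simp: BUC_C_quot_def zero_BUC_quot intro!: imageI C0_BUC_C C0_zero)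

lemma BUC_C_quot_closed: "closed BUC_C_quot"
  unfolding closure_subset_eq [symmetric]
proof
  fix y :: "'a BUC_quot" assume "y \<in> closure BUC_C_quot"
  then have ap: "\<forall>e>0. \<exists>z\<in>BUC_C_quot. dist z y < e" by (simp add: closure_approachable)
  obtain f where f: "f \<in> BUC" "y = abs_BUC_quot f" by (rule BUC_quot_cases)
  have "f \<in> BUC_C"
  proof (rule BUC_C_uniform_approx [OF f(1)])
    fix e :: real assume "0 < e"
    with ap obtain z where z: "z \<in> BUC_C_quot" "dist z y < e" by blast
    have "norm (y - z) < e" using z(2) by (simp add: dist_norm norm_minus_commute)
    then obtain h where h: "h \<in> BUC" "abs_BUC_quot h = y - z" "sup_norm h < e" by (rule norm_BUC_quot_less)
    have "abs_BUC_quot (\<lambda>t. f t - h t) \<in> BUC_C_quot" using f h z by (simp flip: abs_BUC_quot_diff)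
    then have "(\<lambda>t. f t - h t) \<in> BUC_C" using f h by (intro BUC_C_quot_rep BUC_diff)
    moreover have "norm (f t - (f t - h t)) < e" if "0 \<le> t" for t
      using norm_le_sup_norm [OF h(1) that] h(3) by simp
    ultimately show "\<exists>h\<in>BUC_C. \<forall>t\<ge>0. norm (f t - h t) < e" by (intro bexI [of _ "\<lambda>t. f t - h t"]) auto
  qed
  then show "y \<in> BUC_C_quot" using f BUC_C_quot_I by simp
qed

lemma BUC_C_quot_Pres: "x \<in> BUC_C_quot \<Longrightarrow> Re l \<noteq> 0 \<Longrightarrow> Pres l x \<in> BUC_C_quot"
  using Pres_BUC_C BUC_C_quot_I by (fastforce simp: BUC_C_quot_def)

lemma BUC_C_quot_lift: "clinear_op R \<Longrightarrow> x \<in> BUC_C_quot \<Longrightarrow> lift R x \<in> BUC_C_quot"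
  by (auto simp: BUC_C_quot_def lift(2) BUC_C_BUC intro!: imageI BUC_C_blinfun)

lemma (in decaying_family) BUC_C_quot_conv_op: "x \<in> BUC_C_quot \<Longrightarrow> conv_op V x \<in> BUC_C_quot"
  by (auto simp: BUC_C_quot_def conv_op(2) BUC_C_BUC intro!: imageI conv_BUC_C)

section \<open>Commuting operators on the quotient\<close>

text \<open>
  If \<open>f 0 = 0\<close>, then \<open>f\<close> extends continuously by \<open>0\<close> to negative times, so that Fubini's theorem
  can be applied on a square instead of a triangle.
\<close>

lemma (in decaying_family) conv_extended:
  assumes f: "continuous_on {0..} f" "f 0 = 0" and s: "0 \<le> s" "s \<le> t"
  shows "conv V f s = integral {0..t} (\<lambda>r. V r (f (max 0 (s - r))))"
proof -
  let ?h = "\<lambda>r. V r (f (max 0 (s - r)))"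
  have "continuous_on {0..t} ?h"
    by (intro V_apply_continuous continuous_on_id continuous_on_compose2 [OF f(1)] continuous_intros) auto
  then have i: "?h integrable_on {0..t}" by (rule integrable_continuous_real)
  have "integral {0..t} ?h = integral {0..s} ?h + integral {s..t} ?h"
    by (rule Henstock_Kurzweil_Integration.integral_combine [symmetric, OF s i])
  moreover have "integral {s..t} ?h = integral {s..t} (\<lambda>_. 0)"
    by (intro integral_cong) (auto simp: f(2) blinfun.zero_right max_absorb1)
  moreover have "integral {0..s} ?h = integral {0..s} (\<lambda>r. V r (f (s - r)))"
    by (intro integral_cong) (auto simp: max_absorb2)
  ultimately show ?thesis by (simp add: conv_reflect [OF f(1) s(1)])
qed

lemma conv_conv_commute:
  fixes V :: "real \<Rightarrow> 'a::{complex_normed_vector, banach} \<Rightarrow>\<^sub>L 'a"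
  assumes V: "decaying_family V M \<kappa>" and E: "decaying_family E N \<nu>"
    and com: "\<And>s r x. 0 \<le> s \<Longrightarrow> 0 \<le> r \<Longrightarrow> V s (E r x) = E r (V s x)" and f: "f \<in> BUC" "f 0 = 0"
  shows "conv V (conv E f) = conv E (conv V f)"
proof
  fix t
  interpret V: decaying_family V M \<kappa> by (rule V)
  interpret E: decaying_family E N \<nu> by (rule E)
  have fc: "continuous_on {0..} f" by (rule BUC_continuous [OF f(1) order_refl])
  show "conv V (conv E f) t = conv E (conv V f) t"
  proof (cases "0 \<le> t")
    case True
    let ?f = "\<lambda>s r. f (max 0 (t - s - r))"
    have fc2: "continuous_on S (\<lambda>x. f (max 0 (g x)))" if "continuous_on S g" for S :: "'c::topological_space set" and g
      by (intro continuous_on_compose2 [OF fc] continuous_intros that) auto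
    have Ei: "(\<lambda>r. E r (?f s r)) integrable_on {0..t}" for s
      by (intro integrable_continuous_real E.V_apply_continuous continuous_on_id fc2 continuous_intros) auto
    have Vi: "(\<lambda>s. V s (?f s r)) integrable_on {0..t}" for r
      by (intro integrable_continuous_real V.V_apply_continuous continuous_on_id fc2 continuous_intros) auto
    have Vi': "(\<lambda>s. V s (f (max 0 (t - r - s)))) integrable_on {0..t}" for r
      by (intro integrable_continuous_real V.V_apply_continuous continuous_on_id fc2 continuous_intros) auto
    have "conv V (conv E f) t = integral {0..t} (\<lambda>s. V s (conv E f (t - s)))"
      by (rule V.conv_reflect [OF BUC_continuous [OF E.conv_BUC [OF f(1)] order_refl] True])
    also have "\<dots> = integral {0..t} (\<lambda>s. integral {0..t} (\<lambda>r. V s (E r (?f s r))))"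
    proof (rule integral_cong)
      fix s assume "s \<in> {0..t}"
      then show "V s (conv E f (t - s)) = integral {0..t} (\<lambda>r. V s (E r (?f s r)))"
        using E.conv_extended [OF fc f(2), of "t - s" t] integral_blinfun [OF Ei, of "V s" s] by auto
    qed
    also have "\<dots> = integral {0..t} (\<lambda>r. integral {0..t} (\<lambda>s. V s (E r (?f s r))))"
    proof -
      have "continuous_on (cbox (0, 0) (t, t)) (\<lambda>p. V (fst p) (E (snd p) (f (max 0 (t - fst p - snd p)))))"
        by (intro V.V_apply_continuous E.V_apply_continuous fc2 continuous_intros) (auto simp: cbox_Pair_eq)
      from integral_swap_continuous [of 0 0 t t "\<lambda>s r. V s (E r (?f s r))"] this show ?thesis
        by (simp add: case_prod_beta')
    qed
    also have "\<dots> = integral {0..t} (\<lambda>r. E r (conv V f (t - r)))"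
    proof (rule integral_cong)
      fix r assume r: "r \<in> {0..t}"
      have "integral {0..t} (\<lambda>s. V s (E r (?f s r))) = integral {0..t} (\<lambda>s. E r (V s (f (max 0 (t - r - s)))))"
        by (intro integral_cong) (use com r in \<open>auto simp: algebra_simps\<close>)
      also have "\<dots> = E r (conv V f (t - r))"
        using V.conv_extended [OF fc f(2), of "t - r" t] r integral_blinfun [OF Vi'] by auto
      finally show "integral {0..t} (\<lambda>s. V s (E r (?f s r))) = E r (conv V f (t - r))" .
    qed
    also have "\<dots> = conv E (conv V f) t"
      by (rule E.conv_reflect [OF BUC_continuous [OF V.conv_BUC [OF f(1)] order_refl] True, symmetric])
    finally show ?thesis .
  qed (simp add: conv_nonpos)
qed

text \<open>Subtracting a ramp that vanishes from time 1 on does not change the class; it supplies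
  the condition f(0) = 0 of \<open>conv_conv_commute\<close>.\<close>

lemma BUC_rep_vanishing_at_0:
  obtains f where "f \<in> BUC" "f 0 = 0" "x = abs_BUC_quot f"
proof -
  obtain g where g: "g \<in> BUC" "x = abs_BUC_quot g" by (rule BUC_quot_cases)
  define c where "c t = max 0 (1 - t) *\<^sub>R g 0" for t :: real
  have c: "c \<in> C0"
  proof (rule C0_I)
    show "c \<in> BUC"
    proof (rule BUC_I)
      show "norm (c t) \<le> norm (g 0)" if "0 \<le> t" for t
        using that mult_right_mono [of "max 0 (1 - t)" 1 "norm (g 0)"] by (simp add: c_def)
      fix e :: real assume e: "0 < e"
      let ?d = "e / (norm (g 0) + 1)"
      have d: "0 < ?d" using e by (simp add: add_nonneg_pos)
      have "norm (c s - c t) < e" if "\<bar>s - t\<bar> < ?d" for s t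
      proof -
        have "norm (c s - c t) = \<bar>max 0 (1 - s) - max 0 (1 - t)\<bar> * norm (g 0)"
          by (simp add: c_def flip: scaleR_diff_left)
        also have "\<dots> \<le> \<bar>s - t\<bar> * (norm (g 0) + 1)" by (intro mult_mono) auto
        also have "\<dots> < ?d * (norm (g 0) + 1)" using that by (intro mult_strict_right_mono) (auto simp: add_nonneg_pos)
        also have "\<dots> = e" by (simp add: add_nonneg_eq_0_iff)
        finally show ?thesis .
      qed
      then show "\<exists>d>0. \<forall>s\<ge>0. \<forall>t\<ge>0. \<bar>s - t\<bar> < d \<longrightarrow> norm (c s - c t) < e" using d by blast
    qed
    show "\<exists>N. \<forall>t\<ge>N. norm (c t) < e" if "0 < e" for e
      using that by (intro exI [of _ 1]) (auto simp: c_def)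
  qed
  show thesis
  proof (rule that [of "\<lambda>t. g t - c t"])
    show b: "(\<lambda>t. g t - c t) \<in> BUC" by (rule BUC_diff [OF g(1) C0_BUC [OF c]])
    show "x = abs_BUC_quot (\<lambda>t. g t - c t)" unfolding g(2) by (rule abs_BUC_quot_eqI [OF g(1) b]) (simp add: c)
  qed (simp add: c_def)
qed

text \<open>By the resolvent identity the commutator z at l satisfies z = (n - l) P(n) z. Applying
  P(l) gives P(l) z = P(l) z - P(n) z, so z = 0 by injectivity. Commutation thus has to be checked
  for one resolvent only, and for the derivative the one at n = -1 is a convolution.\<close>

lemma pseudo_resolvent_commute_all:
  assumes P: "pseudo_resolvent P U" and n: "n \<in> U" and inj: "\<And>x. P n x = 0 \<Longrightarrow> x = 0"
    and B: "clinear_op B" "\<And>x. B (P n x) = P n (B x)" and l: "l \<in> U"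
  shows "B (P l x) = P l (B x)"
proof (cases "l = n")
  case False
  have id: "P l y - P n y = (n - l) *\<^sub>C P l (P n y)" "P n (P l y) = P l (P n y)" and cl: "clinear_op (P l)" "clinear_op (P n)" for y
    using P n l pseudo_resolvent_commute [OF P n l] by (auto simp: pseudo_resolvent_def)
  define z where "z = B (P l x) - P l (B x)"
  have "B (P l x) - B (P n x) = B ((n - l) *\<^sub>C P l (P n x))"
    unfolding id(1) [symmetric] by (simp add: blinfun.diff_right)
  also have "\<dots> = (n - l) *\<^sub>C P n (B (P l x))"
    by (simp only: clinear_opD [OF B(1)] B(2) id(2) [symmetric])
  finally have 1: "B (P l x) - B (P n x) = (n - l) *\<^sub>C P n (B (P l x))" .
  have 2: "P l (B x) - P n (B x) = (n - l) *\<^sub>C P n (P l (B x))" by (simp only: id)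
  have "z = (B (P l x) - B (P n x)) - (P l (B x) - P n (B x))" unfolding z_def B(2) by simp
  also have "\<dots> = (n - l) *\<^sub>C P n z"
    unfolding 1 2 z_def by (simp only: blinfun.diff_right scaleC_diff_right)
  finally have z: "z = (n - l) *\<^sub>C P n z" .
  have "P l z = P l ((n - l) *\<^sub>C P n z)" using z by simp
  also have "\<dots> = P l z - P n z" by (simp only: clinear_opD [OF cl(1)] id(1))
  finally have "P n z = 0" by simp
  from inj [OF this] show ?thesis by (simp add: z_def)
qed (simp add: B)

text \<open>
  The relation for one pair \<open>(n0, l0)\<close> gives it for all others, since
  \<open>P n = (1 + (n0 - n) P n) P n0\<close> and \<open>Q l = (1 + (l0 - l) Q l) Q l0\<close>.
\<close>

lemma star_extend:
  fixes P Q :: "complex \<Rightarrow> 'b::complex_normed_vector \<Rightarrow>\<^sub>L 'b" and B :: "'b \<Rightarrow>\<^sub>L 'b"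
  assumes P: "pseudo_resolvent P U" and Q: "pseudo_resolvent Q \<rho>" and B: "clinear_op B"
    and PQ: "\<And>n l x. n \<in> U \<Longrightarrow> l \<in> \<rho> \<Longrightarrow> P n (Q l x) = Q l (P n x)"
    and m: "n0 \<in> U" "l0 \<in> \<rho>" "l0 = n0 + \<mu>"
    and star: "\<And>x. Q l0 (P n0 x) = B (P n0 x - Q l0 x)" and nl: "n \<in> U" "l \<in> \<rho>"
  shows "Q l (P n x) = B (P n x - Q l x + (\<mu> + n - l) *\<^sub>C Q l (P n x))"
proof -
  have Pid: "P n y - P n0 y = (n0 - n) *\<^sub>C P n (P n0 y)" "P n0 (P n y) = P n (P n0 y)" for y
    using P m nl pseudo_resolvent_commute [OF P m(1) nl(1)] by (auto simp: pseudo_resolvent_def)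
  have Qid: "Q l y - Q l0 y = (l0 - l) *\<^sub>C Q l (Q l0 y)" "Q l0 (Q l y) = Q l (Q l0 y)" for y
    using Q m nl pseudo_resolvent_commute [OF Q m(2) nl(2)] by (auto simp: pseudo_resolvent_def)
  have cl: "clinear_op (P n)" "clinear_op (P n0)" "clinear_op (Q l)" "clinear_op (Q l0)"
    using P Q m nl by (auto simp: pseudo_resolvent_def)
  define w where "w = x + (l0 - l) *\<^sub>C Q l x"
  define y where "y = w + (n0 - n) *\<^sub>C P n w"
  have Pw: "P n w = P n x + (l0 - l) *\<^sub>C Q l (P n x)"
    by (simp only: w_def blinfun.add_right clinear_opD [OF cl(1)] PQ [OF nl])
  have Qw: "Q l0 w = Q l x"
  proof -
    have "Q l0 w = Q l0 x + (l0 - l) *\<^sub>C Q l (Q l0 x)"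
      by (simp only: w_def blinfun.add_right clinear_opD [OF cl(4)] Qid(2))
    also have "\<dots> = Q l x" unfolding Qid(1) [symmetric] by simp
    finally show ?thesis .
  qed
  have Py: "P n0 y = P n w"
  proof -
    have "P n0 y = P n0 w + (n0 - n) *\<^sub>C P n (P n0 w)"
      by (simp only: y_def blinfun.add_right clinear_opD [OF cl(2)] Pid(2))
    also have "\<dots> = P n w" unfolding Pid(1) [symmetric] by simp
    finally show ?thesis .
  qed
  have Qy: "Q l0 y = Q l x + (n0 - n) *\<^sub>C Q l (P n x)"
    by (simp only: y_def blinfun.add_right clinear_opD [OF cl(4)] PQ [OF nl(1) m(2), symmetric] Qw PQ [OF nl])
  have "Q l (P n x) = P n (Q l0 w)" by (simp only: Qw PQ [OF nl])
  also have "\<dots> = Q l0 (P n0 y)" by (simp only: Py PQ [OF nl(1) m(2)])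
  also have "\<dots> = B (P n w - Q l0 y)" by (subst star) (simp only: Py)
  also have "P n w - Q l0 y = P n x - Q l x + (\<mu> + n - l) *\<^sub>C Q l (P n x)"
    unfolding Pw Qy unfolding m(3) by (simp add: scaleC_add_left scaleC.diff_left algebra_simps)
  finally show ?thesis .
qed

text \<open>W is assumed differentiable only along the vector u(s), not in operator norm; the
  uniform bound M controls W(r) on the first-order remainder of u.\<close>

lemma strong_product_rule:
  fixes W :: "real \<Rightarrow> 'a::real_normed_vector \<Rightarrow>\<^sub>L 'b::real_normed_vector" and u :: "real \<Rightarrow> 'a"
  assumes u: "(u has_vector_derivative u') (at s within S)"
    and W: "((\<lambda>r. W r (u s)) has_vector_derivative d) (at s within S)"
    and Wb: "\<And>r. r \<in> S \<Longrightarrow> norm (W r) \<le> M" and Wc: "((\<lambda>r. W r u') \<longlongrightarrow> W s u') (at s within S)"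
  shows "((\<lambda>r. W r (u r)) has_vector_derivative d + W s u') (at s within S)"
proof -
  have "((\<lambda>r. W r (u r - u s)) has_vector_derivative W s u') (at s within S)"
    unfolding has_vector_derivative_def has_derivative_iff_norm
  proof
    have "((\<lambda>r. norm (u r - u s - (r - s) *\<^sub>R u') / norm (r - s)) \<longlongrightarrow> 0) (at s within S)"
      using u by (simp add: has_vector_derivative_def has_derivative_iff_norm)
    then have "((\<lambda>r. M * (norm (u r - u s - (r - s) *\<^sub>R u') / norm (r - s)) + norm (W r u' - W s u')) \<longlongrightarrow> M * 0 + norm (W s u' - W s u')) (at s within S)"
      by (intro tendsto_intros Wc)
    then have lim: "((\<lambda>r. M * (norm (u r - u s - (r - s) *\<^sub>R u') / norm (r - s)) + norm (W r u' - W s u')) \<longlongrightarrow> 0) (at s within S)"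
      by simp
    show "((\<lambda>r. norm (W r (u r - u s) - W s (u s - u s) - (r - s) *\<^sub>R W s u') / norm (r - s)) \<longlongrightarrow> 0) (at s within S)"
    proof (rule Lim_null_comparison [OF _ lim])
      have "\<forall>\<^sub>F r in at s within S. r \<in> S \<and> r \<noteq> s" by (auto simp: eventually_at_filter)
      then show "\<forall>\<^sub>F r in at s within S. norm (norm (W r (u r - u s) - W s (u s - u s) - (r - s) *\<^sub>R W s u') / norm (r - s)) \<le>
        M * (norm (u r - u s - (r - s) *\<^sub>R u') / norm (r - s)) + norm (W r u' - W s u')"
      proof eventually_elim
        case (elim r)
        have "W r (u r - u s) - (r - s) *\<^sub>R W s u' = W r (u r - u s - (r - s) *\<^sub>R u') + (r - s) *\<^sub>R (W r u' - W s u')"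
          by (simp add: blinfun.diff_right blinfun.scaleR_right scaleR_diff_right)
        also have "norm \<dots> \<le> M * norm (u r - u s - (r - s) *\<^sub>R u') + norm (r - s) * norm (W r u' - W s u')"
          using elim by (intro norm_triangle_mono order_trans [OF norm_blinfun] mult_right_mono Wb) auto
        finally have "norm (W r (u r - u s) - (r - s) *\<^sub>R W s u') / norm (r - s) \<le>
          (M * norm (u r - u s - (r - s) *\<^sub>R u') + norm (r - s) * norm (W r u' - W s u')) / norm (r - s)"
          by (intro divide_right_mono) auto
        also have "\<dots> = M * (norm (u r - u s - (r - s) *\<^sub>R u') / norm (r - s)) + norm (W r u' - W s u')"
          using elim by (simp add: add_divide_distrib)
        finally show ?case by (simp add: blinfun.zero_right)
      qed
    qed
  qed (rule bounded_linear_scaleR_left)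
  from has_vector_derivative_add [OF W this] show ?thesis by (simp add: blinfun.diff_right)
qed

lemma Pres_solution:
  fixes x :: "'a::{complex_normed_vector, banach} BUC_quot"
  assumes "Re l \<noteq> 0"
  obtains f u where "f \<in> BUC" "x = abs_BUC_quot f" "(u, \<lambda>t. l *\<^sub>C u t - f t) \<in> deriv_op" "Pres l x = abs_BUC_quot u"
proof -
  obtain f where f: "f \<in> BUC" "x = abs_BUC_quot f" by (rule BUC_quot_cases)
  obtain u where u: "(u, \<lambda>t. l *\<^sub>C u t - f t) \<in> deriv_op"
    using deriv_resolvent_left(1) [OF f(1), of l] deriv_resolvent_right [OF f(1), of l] assms by (meson linorder_neqE)
  then have "Pres l x = abs_BUC_quot u" unfolding f(2) by (intro Pres_eqI [OF u f(1)]) (use assms in \<open>auto simp: C0_zero\<close>)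
  from that [OF f u this] show thesis .
qed

lemma Pres_lift:
  fixes R :: "'a::{complex_normed_vector, banach} \<Rightarrow>\<^sub>L 'a"
  assumes l: "Re l \<noteq> 0" and R: "clinear_op R"
  shows "Pres l (lift R x) = lift R (Pres l x)"
proof -
  obtain f u where f: "f \<in> BUC" "x = abs_BUC_quot f" and u: "(u, \<lambda>t. l *\<^sub>C u t - f t) \<in> deriv_op" "Pres l x = abs_BUC_quot u"
    by (rule Pres_solution [OF l])
  have "(\<lambda>t. R (u t), \<lambda>t. R (l *\<^sub>C u t - f t)) \<in> deriv_op"
    unfolding deriv_op_def
  proof (intro CollectI case_prodI conjI allI impI)
    show "(\<lambda>t. R (u t)) \<in> BUC" "(\<lambda>t. R (l *\<^sub>C u t - f t)) \<in> BUC"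
      by (rule BUC_blinfun, rule deriv_opD [OF u(1)])+
    show "((\<lambda>t. R (u t)) has_vector_derivative R (l *\<^sub>C u t - f t)) (at t within {0..})" if "0 \<le> t" for t
      by (rule bounded_linear.has_vector_derivative [OF blinfun.bounded_linear_right deriv_opD(3) [OF u(1) that]])
  qed
  then have "Pres l (abs_BUC_quot (\<lambda>t. R (f t))) = abs_BUC_quot (\<lambda>t. R (u t))"
    by (rule Pres_eqI [OF _ BUC_blinfun [OF f(1)] _ l]) (simp add: blinfun.diff_right clinear_opD [OF R] C0_zero)
  then show ?thesis using f u deriv_opD(1) [OF u(1)] by (simp add: lift(2) [OF R])
qed

lemma pseudo_resolvent_lift:
  fixes A :: "('a::{complex_normed_vector, banach} \<times> 'a) set"
  assumes A: "clinear_graph A"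
  shows "pseudo_resolvent (\<lambda>l. lift (Res A l)) (resolvent_set A)"
  unfolding pseudo_resolvent_def
proof (intro conjI ballI allI)
  show "open (resolvent_set A)" by (rule open_resolvent_set [OF A])
  note cl = clinear_op_Res [OF _ A]
  show "clinear_op (lift (Res A l))" if "l \<in> resolvent_set A" for l by (rule lift(1) [OF cl [OF that]])
  show "lift (Res A l) y - lift (Res A m) y = (m - l) *\<^sub>C lift (Res A l) (lift (Res A m) y)"
    if lm: "l \<in> resolvent_set A" "m \<in> resolvent_set A" for l m y
  proof -
    obtain f where f: "f \<in> BUC" "y = abs_BUC_quot f" by (rule BUC_quot_cases)
    then show ?thesis
      by (simp add: lift(2) [OF cl] lm BUC_blinfun abs_BUC_quot_diff abs_BUC_quot_scaleC Res_identity [OF lm A])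
  qed
  show "\<exists>e>0. \<exists>M. \<forall>m\<in>resolvent_set A. dist m l < e \<longrightarrow> norm (lift (Res A m)) \<le> M" if "l \<in> resolvent_set A" for l
    using Res_locally_bounded [OF A that] order_trans [OF lift(3) [OF cl]] by meson
qed

context bounded_C0_semigroup
begin

text \<open>The kernel of (D - A + \<mu>)^-1 with \<mu> = \<omega> + 2. The margin 2 leaves \<mu> -
  1 > \<omega>, so that the half-plane Re l \<ge> \<mu> - 1 lies in the resolvent set of the
  generator.\<close>

definition V :: "real \<Rightarrow> 'a \<Rightarrow>\<^sub>L 'a"
  where "V t = exp (- (\<omega> + 2) * t) *\<^sub>R T t"

lemma V_decaying: "decaying_family V M 2"
proof
  show "continuous_on {0..} (\<lambda>t. V t x)" for x
    unfolding V_def scaleR_blinfun.rep_eq by (intro continuous_intros cont)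
  fix t :: real assume t: "0 \<le> t"
  have "norm (V t) \<le> exp (- (\<omega> + 2) * t) * (M * exp (\<omega> * t))"
    unfolding V_def norm_scaleR abs_exp_cancel by (intro mult_left_mono bound t) auto
  also have "\<dots> = M * exp (- 2 * t)" by (simp add: algebra_simps flip: exp_add)
  finally show "norm (V t) \<le> M * exp (- 2 * t)" .
  show "clinear_op (V t)"
    using C0_semigroupD(1) [OF T t] by (simp add: V_def clinear_op_def scaleR_blinfun.rep_eq scaleC.scaleR_right)
qed (use M in auto)

sublocale V: decaying_family V M 2 by (rule V_decaying)

lemma T_Res:
  assumes t: "0 \<le> t" and l: "l \<in> resolvent_set (generator T)"
  shows "T t (Res (generator T) l x) = Res (generator T) l (T t x)"
proof -
  let ?R = "Res (generator T) l"
  have "(T t (?R x), T t (l *\<^sub>C ?R x - x)) \<in> generator T"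
    by (rule generator_image [OF T_commute resolvent_setD(1) [OF l]]) (use t in auto)
  from resolvent_setD(2) [OF l this] show ?thesis
    by (simp add: blinfun.diff_right clinear_opD [OF C0_semigroupD(1) [OF T t]])
qed

lemma V_Res: "0 \<le> t \<Longrightarrow> l \<in> resolvent_set (generator T) \<Longrightarrow> V t (Res (generator T) l x) = Res (generator T) l (V t x)"
  by (simp add: V_def scaleR_blinfun.rep_eq T_Res blinfun.scaleR_right)

lemma conv_op_lift:
  assumes l: "l \<in> resolvent_set (generator T)"
  shows "conv_op V (lift (Res (generator T) l) x) = lift (Res (generator T) l) (conv_op V x)"
proof -
  let ?R = "Res (generator T) l"
  note R = lift(2) [OF clinear_op_Res [OF l clinear_graph_generator [OF T]]]
  obtain f where f: "f \<in> BUC" "x = abs_BUC_quot f" by (rule BUC_quot_cases)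
  have "conv V (\<lambda>t. ?R (f t)) = (\<lambda>t. ?R (conv V f t))"
  proof
    fix t
    have "conv V (\<lambda>t. ?R (f t)) t = integral {0..t} (\<lambda>s. ?R (V (t - s) (f s)))"
      unfolding conv_def by (intro integral_cong) (simp add: V_Res l)
    also have "\<dots> = ?R (conv V f t)"
      unfolding conv_def
      by (rule integral_blinfun [OF V.conv_integrand(2) [OF BUC_continuous [OF f(1) order_refl] order_refl order_refl]])
    finally show "conv V (\<lambda>t. ?R (f t)) t = ?R (conv V f t)" .
  qed
  then show ?thesis by (simp add: f R V.conv_op(2) BUC_blinfun V.conv_BUC)
qed

lemma conv_op_Pres:
  assumes l: "Re l \<noteq> 0"
  shows "conv_op V (Pres l x) = Pres l (conv_op V x)"
proof (rule pseudo_resolvent_commute_all [OF pseudo_resolvent_Pres, where n = "- 1"])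
  show "- 1 \<in> {l. Re l \<noteq> 0}" "l \<in> {l. Re l \<noteq> 0}" using l by auto
  show "clinear_op (conv_op V)" by (rule V.conv_op(1))
  fix x :: "'a BUC_quot"
  show "Pres (- 1) x = 0 \<Longrightarrow> x = 0" by (rule Pres_inj [of "- 1"]) auto
  obtain f where f: "f \<in> BUC" "f 0 = 0" "x = abs_BUC_quot f" by (rule BUC_rep_vanishing_at_0)
  let ?E = "\<lambda>t. exp (- 1 * complex_of_real t) *\<^sub>C (id_blinfun :: 'a \<Rightarrow>\<^sub>L 'a)"
  interpret E: decaying_family ?E 1 "- Re (- 1)" by (rule decaying_family_exp) simp
  have com: "conv V (conv ?E f) = conv ?E (conv V f)"
    by (rule conv_conv_commute [OF V_decaying E.decaying_family_axioms _ f(1,2)]) (simp add: clinear_opD [OF V.V_clinear])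
  have P: "Pres (- 1) (abs_BUC_quot g) = (- 1) *\<^sub>C abs_BUC_quot (conv ?E g)" if "g \<in> BUC" for g
    unfolding abs_BUC_quot_scaleC [OF E.conv_BUC [OF that]] using Pres_left [OF that, of "- 1"] by (simp add: scaleC_minus1)
  show "conv_op V (Pres (- 1) x) = Pres (- 1) (conv_op V x)"
    using f E.conv_BUC [OF f(1)] V.conv_BUC [OF f(1)] com
    by (simp only: P V.conv_op(2) clinear_opD [OF V.conv_op(1)])
qed

text \<open>By \<open>star_extend\<close> it suffices to treat n = -1 and l = \<omega> + 1. There
  P(-1) f is represented by an explicit convolution u with u(0) = 0, and the identity holds already
  for functions at each time t \<ge> 0, not only for classes.\<close>

lemma conv_op_star:
  assumes nl: "Re n \<noteq> 0" "l \<in> resolvent_set (generator T)"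
  shows "lift (Res (generator T) l) (Pres n x) =
    conv_op V (Pres n x - lift (Res (generator T) l) x + (of_real (\<omega> + 2) + n - l) *\<^sub>C lift (Res (generator T) l) (Pres n x))"
proof (rule star_extend [OF pseudo_resolvent_Pres pseudo_resolvent_lift [OF clinear_graph_generator [OF T]] V.conv_op(1)])
  let ?A = "generator T"
  let ?l = "of_real (\<omega> + 1) :: complex"
  have l0: "\<omega> < Re ?l" by simp
  note mem = resolvent_laplace(1) [OF l0]
  have cR: "clinear_op (Res ?A ?l)" by (rule clinear_op_Res [OF mem clinear_graph_generator [OF T]])
  show "- 1 \<in> {l. Re l \<noteq> 0}" "?l \<in> resolvent_set ?A" "?l = - 1 + of_real (\<omega> + 2)" "n \<in> {l. Re l \<noteq> 0}" "l \<in> resolvent_set ?A"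
    using nl mem by auto
  show "Pres n (lift (Res ?A l) x) = lift (Res ?A l) (Pres n x)" if "n \<in> {l. Re l \<noteq> 0}" "l \<in> resolvent_set ?A" for n l x
    by (rule Pres_lift [OF _ clinear_op_Res [OF that(2) clinear_graph_generator [OF T]]]) (use that in simp)
  fix x :: "'a BUC_quot"
  obtain f where f: "f \<in> BUC" "x = abs_BUC_quot f" by (rule BUC_quot_cases)
  define u where "u t = - conv (\<lambda>t. exp (- 1 * complex_of_real t) *\<^sub>C (id_blinfun :: 'a \<Rightarrow>\<^sub>L 'a)) f t" for t
  have m1: "Re (- 1) < 0" by simp
  have u: "(u, \<lambda>t. (- 1) *\<^sub>C u t - f t) \<in> deriv_op"
    using deriv_resolvent_left(1) [OF f(1) m1] unfolding u_def conv_def by simp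
  have Px: "Pres (- 1) x = abs_BUC_quot u" unfolding f(2) u_def by (rule Pres_left [OF f(1) m1])
  have uB: "u \<in> BUC" by (rule deriv_opD(1) [OF u])
  have u0: "u 0 = 0" by (simp add: u_def conv_nonpos)
  let ?R = "Res ?A ?l"

  \<comment> \<open>The fundamental theorem of calculus for s |-> V(t - s) R u(s), where R is the
    resolvent; the value at s = 0 vanishes because u(0) = 0.\<close>
  have main: "?R (u t) = conv V (\<lambda>t. u t - ?R (f t)) t" if t: "0 \<le> t" for t
  proof -
    \<comment> \<open>For l = \<omega> + 1 one has A R = l R - 1, and the exponential weight
      subtracts \<omega> + 2, which leaves the coefficient -1 of V(r) R y.\<close>
    have V': "((\<lambda>r. V r (?R y)) has_vector_derivative - V r (?R y) - V r y) (at r within {0..})" if r: "0 \<le> r" for r y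
    proof -
      have e: "((\<lambda>r. exp (- (\<omega> + 2) * r)) has_real_derivative - (\<omega> + 2) * exp (- (\<omega> + 2) * r)) (at r within {0..})"
        by (auto intro!: derivative_eq_intros)
      have d: "((\<lambda>r. T r (?R y)) has_vector_derivative ?l *\<^sub>C T r (?R y) - T r y) (at r within {0..})"
        using T_laplace_derivative [OF l0 r, of y] by (simp only: resolvent_laplace(2) [OF l0])
      have "a *\<^sub>R ((\<omega> + 1) *\<^sub>R y - z) + (- (\<omega> + 2) * a) *\<^sub>R y = - (a *\<^sub>R y) - a *\<^sub>R z" for a and y z :: 'a
      proof -
        have "a *\<^sub>R ((\<omega> + 1) *\<^sub>R y - z) + (- (\<omega> + 2) * a) *\<^sub>R y = (a * (\<omega> + 1) - (\<omega> + 2) * a) *\<^sub>R y - a *\<^sub>R z"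
          by (simp only: scaleR_diff_right scaleR_diff_left scaleR_scaleR) (simp add: algebra_simps)
        also have "a * (\<omega> + 1) - (\<omega> + 2) * a = - a" by (simp add: algebra_simps)
        finally show ?thesis by simp
      qed
      from has_vector_derivative_scaleR [OF e d, unfolded scaleC_of_real this] show ?thesis
        unfolding V_def scaleR_blinfun.rep_eq .
    qed
    have "((\<lambda>s. V (t - s) (u s - ?R (f s))) has_integral V (t - t) (?R (u t)) - V (t - 0) (?R (u 0))) {0..t}"
    proof (rule fundamental_theorem_of_calculus [OF t])
      fix s assume s: "s \<in> {0..t}"
      \<comment> \<open>The terms V(t - s) R u(s) that come from differentiating V and from u' = - u
        - f cancel.\<close>
      have "((\<lambda>r. (V (t - r) o\<^sub>L ?R) (u r)) has_vector_derivative
        (V (t - s) (?R (u s)) + V (t - s) (u s)) + (V (t - s) o\<^sub>L ?R) ((- 1) *\<^sub>C u s - f s)) (at s within {0..t})"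
      proof (rule strong_product_rule [where M = "M * norm ?R"])
        show "(u has_vector_derivative (- 1) *\<^sub>C u s - f s) (at s within {0..t})"
          by (rule has_vector_derivative_within_subset [OF deriv_opD(3) [OF u]]) (use s in auto)
        have "((\<lambda>r. t - r) has_vector_derivative - 1) (at s within {0..t})"
          by (auto intro!: derivative_eq_intros)
        moreover have "((\<lambda>r. V r (?R (u s))) has_vector_derivative - V (t - s) (?R (u s)) - V (t - s) (u s)) (at (t - s) within (\<lambda>r. t - r) ` {0..t})"
          by (rule has_vector_derivative_within_subset [OF V']) (use s in auto)
        ultimately have "((\<lambda>r. V r (?R (u s))) \<circ> (\<lambda>r. t - r) has_vector_derivative (- 1) *\<^sub>R (- V (t - s) (?R (u s)) - V (t - s) (u s))) (at s within {0..t})"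
          by (rule vector_diff_chain_within)
        then show "((\<lambda>r. (V (t - r) o\<^sub>L ?R) (u s)) has_vector_derivative V (t - s) (?R (u s)) + V (t - s) (u s)) (at s within {0..t})"
          by (simp add: o_def add.commute)
        show "norm (V (t - r) o\<^sub>L ?R) \<le> M * norm ?R" if "r \<in> {0..t}" for r
          using that by (intro order_trans [OF norm_blinfun_compose] mult_right_mono V.V_bound) auto
        have "continuous_on {0..t} (\<lambda>r. V (t - r) (?R ((- 1) *\<^sub>C u s - f s)))"
          by (intro V.V_apply_continuous continuous_intros) auto
        then show "((\<lambda>r. (V (t - r) o\<^sub>L ?R) ((- 1) *\<^sub>C u s - f s)) \<longlongrightarrow> (V (t - s) o\<^sub>L ?R) ((- 1) *\<^sub>C u s - f s)) (at s within {0..t})"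
          using s by (simp add: continuous_on_def)
      qed
      then show "((\<lambda>s. V (t - s) (?R (u s))) has_vector_derivative V (t - s) (u s - ?R (f s))) (at s within {0..t})"
        by (simp add: scaleC_minus1 blinfun.diff_right blinfun.minus_right)
    qed
    from integral_unique [OF this] show ?thesis
      by (simp add: conv_def u0 blinfun.zero_right V_def C0_semigroupD(2) [OF T])
  qed
  have B: "(\<lambda>t. u t - ?R (f t)) \<in> BUC" by (intro BUC_diff uB BUC_blinfun f)
  have "lift ?R (Pres (- 1) x) = abs_BUC_quot (\<lambda>t. ?R (u t))" by (simp only: Px lift(2) [OF cR uB])
  also have "\<dots> = abs_BUC_quot (conv V (\<lambda>t. u t - ?R (f t)))"
  proof (rule abs_BUC_quot_eqI [OF BUC_blinfun [OF uB] V.conv_BUC [OF B] C0_I])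
    show "(\<lambda>t. ?R (u t) - conv V (\<lambda>t. u t - ?R (f t)) t) \<in> BUC" by (intro BUC_diff BUC_blinfun uB V.conv_BUC B)
    show "\<exists>N. \<forall>t\<ge>N. norm (?R (u t) - conv V (\<lambda>t. u t - ?R (f t)) t) < e" if "0 < e" for e
      using that main by (intro exI [of _ 0]) auto
  qed
  also have "\<dots> = conv_op V (Pres (- 1) x - lift ?R x)"
    unfolding Px unfolding f(2) by (simp only: lift(2) [OF cR f(1)] abs_BUC_quot_diff [OF uB BUC_blinfun [OF f(1)]] V.conv_op(2) [OF B])
  finally show "lift ?R (Pres (- 1) x) = conv_op V (Pres (- 1) x - lift ?R x)" .
qed

end

section \<open>Extensions across the imaginary axis\<close>

definition extends_Pres :: "(complex \<Rightarrow> 'a::{complex_normed_vector, banach} BUC_quot) \<Rightarrow> complex set \<Rightarrow> 'a BUC_quot \<Rightarrow> bool"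
  where "extends_Pres F U y \<longleftrightarrow> vholomorphic_on F U \<and> (\<forall>l\<in>U. Re l \<noteq> 0 \<longrightarrow> F l = Pres l y)"

lemma extends_Pres_subset: "extends_Pres F U y \<Longrightarrow> V \<subseteq> U \<Longrightarrow> extends_Pres F V y"
  unfolding extends_Pres_def by (blast intro: vholomorphic_on_subset)

lemma extends_Pres_add: "extends_Pres F U x \<Longrightarrow> extends_Pres G U y \<Longrightarrow> extends_Pres (\<lambda>l. F l + G l) U (x + y)"
  unfolding extends_Pres_def by (simp add: vholomorphic_on_add blinfun.add_right)

lemma extends_Pres_diff: "extends_Pres F U x \<Longrightarrow> extends_Pres G U y \<Longrightarrow> extends_Pres (\<lambda>l. F l - G l) U (x - y)"
  unfolding extends_Pres_def by (simp add: vholomorphic_on_diff blinfun.diff_right)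

lemma extends_Pres_zero: "extends_Pres (\<lambda>_. 0) U 0"
  unfolding extends_Pres_def by (simp add: vholomorphic_on_const blinfun.zero_right)

lemma extends_Pres_op:
  assumes "extends_Pres F U y" "clinear_op K" "\<And>l. Re l \<noteq> 0 \<Longrightarrow> K (Pres l y) = Pres l (K y)"
  shows "extends_Pres (\<lambda>l. K (F l)) U (K y)"
  using assms vholomorphic_on_apply [OF vholomorphic_on_const [of K], of U F] by (auto simp: extends_Pres_def)

lemma Pres_clinear: "Re l \<noteq> 0 \<Longrightarrow> clinear_op (Pres l)"
  using pseudo_resolvent_Pres unfolding pseudo_resolvent_def by blast

lemma extends_Pres_scaleC:
  assumes "extends_Pres F U y"
  shows "extends_Pres (\<lambda>l. c *\<^sub>C F l) U (c *\<^sub>C y)"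
proof -
  have "clinear_op (c *\<^sub>C id_blinfun)" by (simp add: clinear_op_def scaleC_scaleC mult.commute)
  from extends_Pres_op [OF assms this] show ?thesis by (simp add: clinear_opD [OF Pres_clinear])
qed

lemma norm_Pres_le: "Re l \<noteq> 0 \<Longrightarrow> norm (Pres l y) * \<bar>Re l\<bar> \<le> norm y"
  for y :: "'a::{complex_normed_vector, banach} BUC_quot"
proof -
  assume l: "Re l \<noteq> 0"
  let ?P = "Pres l :: 'a BUC_quot \<Rightarrow>\<^sub>L 'a BUC_quot"
  have "norm (?P y) * \<bar>Re l\<bar> \<le> (norm ?P * norm y) * \<bar>Re l\<bar>"
    by (intro mult_right_mono norm_blinfun) auto
  also have "\<dots> = (norm ?P * \<bar>Re l\<bar>) * norm y" by simp
  also have "\<dots> \<le> 1 * norm y" by (intro mult_right_mono Pres_bound l) auto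
  finally show ?thesis by simp
qed

text \<open>Apply \<open>imaginary_bound\<close> with C = norm y. The constant depends on the two
  radii only, neither on y nor on the extension, so that extensions depend continuously on
  y.\<close>

lemma extends_Pres_bound:
  assumes s: "0 \<le> s" "s < r"
  obtains K where "0 \<le> K" "\<And>F y z. extends_Pres F (ball (\<i> * of_real \<xi>) r) y \<Longrightarrow> cmod (z - \<i> * of_real \<xi>) \<le> s \<Longrightarrow> norm (F z) \<le> K * norm y"
proof -
  define r' where "r' = (s + r) / 2"
  have r': "s < r'" "r' < r" using s by (auto simp: r'_def)
  show thesis
  proof (rule that [of "4 * r' / (r'\<^sup>2 - s\<^sup>2)"])
    show "0 \<le> 4 * r' / (r'\<^sup>2 - s\<^sup>2)" using s r' by (intro divide_nonneg_nonneg) (auto simp: power_mono)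
    fix F z and y :: "'a BUC_quot"
    assume F: "extends_Pres F (ball (\<i> * of_real \<xi>) r) y" and z: "cmod (z - \<i> * of_real \<xi>) \<le> s"
    have "norm (F z) \<le> 4 * r' * norm y / (r'\<^sup>2 - s\<^sup>2)"
      by (rule imaginary_bound [OF _ _ s(1) r' z]) (use F norm_Pres_le in \<open>auto simp: extends_Pres_def\<close>)
    then show "norm (F z) \<le> 4 * r' / (r'\<^sup>2 - s\<^sup>2) * norm y" by simp
  qed
qed

text \<open>Applied to differences, \<open>extends_Pres_bound\<close> makes the extensions converge
  locally uniformly. Their limit is holomorphic after composition with each functional, hence
  holomorphic. The radius is held fixed: with radii shrinking along the sequence no common ball
  would be left.\<close>

lemma closed_extends_Pres:
  fixes \<xi> r :: real
  shows "closed {y :: 'a::{complex_normed_vector, banach} BUC_quot. \<exists>F. extends_Pres F (ball (\<i> * of_real \<xi>) r) y}"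
  unfolding closed_sequential_limits
proof (intro allI impI, elim conjE)
  fix y :: "nat \<Rightarrow> 'a BUC_quot" and y0
  let ?b = "\<i> * complex_of_real \<xi>"
  assume "\<forall>n. y n \<in> {y. \<exists>F. extends_Pres F (ball ?b r) y}" and y: "y \<longlonglongrightarrow> y0"
  then obtain F where F: "\<And>n. extends_Pres (F n) (ball ?b r) (y n)"
    using choice [of "\<lambda>n F. extends_Pres F (ball ?b r) (y n)"] by auto
  have cauchy: "Cauchy y" using y by (rule LIMSEQ_imp_Cauchy)
  have conv: "convergent (\<lambda>n. F n z)" if z: "z \<in> ball ?b r" for z
  proof -
    define s where "s = cmod (z - ?b)"
    have s: "0 \<le> s" "s < r" using z by (auto simp: s_def dist_norm norm_minus_commute)
    obtain K where K: "0 \<le> K" "\<And>F y z. extends_Pres F (ball ?b r) (y::'a BUC_quot) \<Longrightarrow> cmod (z - ?b) \<le> s \<Longrightarrow> norm (F z) \<le> K * norm y"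
      using extends_Pres_bound [OF s] by metis
    have le: "norm (F m z - F n z) \<le> K * norm (y m - y n)" for m n
      by (rule K(2) [OF extends_Pres_diff [OF F F]]) (simp add: s_def)
    have "Cauchy (\<lambda>n. F n z)"
    proof (rule CauchyI)
      fix e :: real assume e: "0 < e"
      have "0 < e / (K + 1)" using e K by simp
      from CauchyD [OF cauchy this] obtain M where M: "\<And>m n. M \<le> m \<Longrightarrow> M \<le> n \<Longrightarrow> norm (y m - y n) < e / (K + 1)" by blast
      have "norm (F m z - F n z) < e" if "M \<le> m" "M \<le> n" for m n
      proof -
        have "norm (F m z - F n z) \<le> (K + 1) * norm (y m - y n)"
          using order_trans [OF le mult_right_mono [of K "K + 1"]] by simp
        also have "\<dots> < e" using M [OF that] K by (simp add: field_simps)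
        finally show ?thesis .
      qed
      then show "\<exists>M. \<forall>m\<ge>M. \<forall>n\<ge>M. norm (F m z - F n z) < e" by blast
    qed
    then show ?thesis by (rule Cauchy_convergent)
  qed
  define G where "G z = lim (\<lambda>n. F n z)" for z
  have G: "(\<lambda>n. F n z) \<longlonglongrightarrow> G z" if "z \<in> ball ?b r" for z
    unfolding G_def using conv [OF that] by (simp add: convergent_LIMSEQ_iff)
  have le_all: "\<exists>K\<ge>0. \<forall>z. cmod (z - ?b) \<le> s \<longrightarrow> norm (G z) \<le> K * norm y0 \<and> (\<forall>n. norm (F n z - G z) \<le> K * norm (y n - y0))"
    if s: "0 \<le> s" "s < r" for s
  proof -
    obtain K where K: "0 \<le> K" "\<And>F y z. extends_Pres F (ball ?b r) (y::'a BUC_quot) \<Longrightarrow> cmod (z - ?b) \<le> s \<Longrightarrow> norm (F z) \<le> K * norm y"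
      using extends_Pres_bound [OF s] by metis
    have "norm (G z) \<le> K * norm y0" "norm (F n z - G z) \<le> K * norm (y n - y0)" if z: "cmod (z - ?b) \<le> s" for z n
    proof -
      have zb: "z \<in> ball ?b r" using z s by (simp add: dist_norm norm_minus_commute)
      show "norm (G z) \<le> K * norm y0"
        by (rule LIMSEQ_le [OF tendsto_norm [OF G [OF zb]] tendsto_mult [OF tendsto_const tendsto_norm [OF y]]])
          (use K(2) [OF F z] in auto)
      show "norm (F n z - G z) \<le> K * norm (y n - y0)"
        by (rule LIMSEQ_le [OF tendsto_norm [OF tendsto_diff [OF tendsto_const G [OF zb]]]
              tendsto_mult [OF tendsto_const tendsto_norm [OF tendsto_diff [OF tendsto_const y]]]])
          (use K(2) [OF extends_Pres_diff [OF F F] z] in auto)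
    qed
    then show ?thesis using K(1) by blast
  qed
  have sub: "\<exists>d>0. \<exists>s\<ge>0. s < r \<and> cball z d \<subseteq> ball ?b r \<and> (\<forall>w\<in>cball z d. cmod (w - ?b) \<le> s)" if z: "z \<in> ball ?b r" for z
  proof (intro exI conjI ballI)
    let ?d = "(r - cmod (z - ?b)) / 2"
    let ?s = "(r + cmod (z - ?b)) / 2"
    have zr: "cmod (z - ?b) < r" using z by (simp add: dist_norm norm_minus_commute)
    show "0 < ?d" "?s < r" using zr by auto
    have "0 \<le> r" using le_less_trans [OF norm_ge_zero zr] by simp
    then show "0 \<le> ?s" by (intro divide_nonneg_nonneg add_nonneg_nonneg) auto
    show le: "cmod (w - ?b) \<le> ?s" if "w \<in> cball z ?d" for w
    proof -
      have "cmod (w - ?b) \<le> cmod (w - z) + cmod (z - ?b)" using norm_triangle_ineq [of "w - z" "z - ?b"] by simp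
      moreover have "cmod (w - z) \<le> ?d" using that by (simp add: dist_norm norm_minus_commute)
      ultimately show ?thesis by (simp add: field_simps)
    qed
    show "cball z ?d \<subseteq> ball ?b r"
    proof
      fix w assume "w \<in> cball z ?d"
      from le [OF this] zr have "cmod (w - ?b) < r" by (simp add: field_simps)
      then show "w \<in> ball ?b r" by (simp add: dist_norm norm_minus_commute)
    qed
  qed
  have weak: "(\<lambda>z. \<phi> (G z)) holomorphic_on ball ?b r" if p: "cfunctional \<phi>" for \<phi>
  proof (rule holomorphic_uniform_sequence [OF open_ball, where f = "\<lambda>n z. \<phi> (F n z)"])
    show "(\<lambda>z. \<phi> (F n z)) holomorphic_on ball ?b r" for n
      using F [of n] by (intro cfunctional_holomorphic p) (simp add: extends_Pres_def)
    fix z assume "z \<in> ball ?b r"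
    then obtain d s where ds: "0 < d" "0 \<le> s" "s < r" "cball z d \<subseteq> ball ?b r" "\<And>w. w \<in> cball z d \<Longrightarrow> cmod (w - ?b) \<le> s"
      using sub by blast
    obtain K where K: "0 \<le> K" "\<And>w n. cmod (w - ?b) \<le> s \<Longrightarrow> norm (F n w - G w) \<le> K * norm (y n - y0)"
      using le_all [OF ds(2,3)] by blast
    have "uniform_limit (cball z d) (\<lambda>n z. \<phi> (F n z)) (\<lambda>z. \<phi> (G z)) sequentially"
      unfolding uniform_limit_iff
    proof (intro allI impI)
      fix e :: real assume e: "0 < e"
      have "(\<lambda>n. 2 * (K * norm (y n - y0))) \<longlonglongrightarrow> 2 * (K * norm (y0 - y0))" by (intro tendsto_intros y)
      then have "\<forall>\<^sub>F n in sequentially. 2 * (K * norm (y n - y0)) < e" using e by (intro order_tendstoD) auto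
      then show "\<forall>\<^sub>F n in sequentially. \<forall>w\<in>cball z d. dist (\<phi> (F n w)) (\<phi> (G w)) < e"
      proof eventually_elim
        case (elim n)
        have "dist (\<phi> (F n w)) (\<phi> (G w)) < e" if "w \<in> cball z d" for w
        proof -
          have "dist (\<phi> (F n w)) (\<phi> (G w)) \<le> 2 * norm (F n w - G w)"
            using cfunctionalD(3) [OF p, of "F n w - G w"] by (simp add: dist_norm cfunctionalD(5) [OF p])
          also have "\<dots> \<le> 2 * (K * norm (y n - y0))" by (intro mult_left_mono K(2) ds(5) that) auto
          also have "\<dots> < e" by (rule elim)
          finally show ?thesis .
        qed
        then show ?case by blast
      qed
    qed
    then show "\<exists>d. 0 < d \<and> cball z d \<subseteq> ball ?b r \<and> uniform_limit (cball z d) (\<lambda>n z. \<phi> (F n z)) (\<lambda>z. \<phi> (G z)) sequentially"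
      using ds by blast
  qed
  have "extends_Pres G (ball ?b r) y0"
    unfolding extends_Pres_def vholomorphic_on_open [OF open_ball]
  proof (intro conjI ballI impI)
    fix z assume z: "z \<in> ball ?b r"
    then obtain d s where ds: "0 < d" "0 \<le> s" "s < r" "cball z d \<subseteq> ball ?b r" "\<And>w. w \<in> cball z d \<Longrightarrow> cmod (w - ?b) \<le> s"
      using sub by blast
    obtain K where K: "\<And>w. cmod (w - ?b) \<le> s \<Longrightarrow> norm (G w) \<le> K * norm y0"
      using le_all [OF ds(2,3)] by blast
    have bz: "ball z d \<subseteq> cball z d" by (rule ball_subset_cball)
    show "\<exists>F'. (G has_derivative (\<lambda>h. h *\<^sub>C F')) (at z)"
    proof (rule weakly_holomorphic_imp_vholomorphic [OF _ _ ds(1)])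
      show "(\<lambda>z. \<phi> (G z)) holomorphic_on ball z d" if "cfunctional \<phi>" for \<phi>
        using holomorphic_on_subset [OF weak [OF that]] ds(4) bz by blast
      show "norm (G w) \<le> K * norm y0" if "w \<in> ball z d" for w
        using K ds(5) bz that by blast
    qed
    assume "Re z \<noteq> 0"
    then have "F n z = Pres z (y n)" for n using F [of n] z by (simp add: extends_Pres_def)
    then have "(\<lambda>n. Pres z (y n)) \<longlonglongrightarrow> G z" using G [OF z] by simp
    moreover have "(\<lambda>n. Pres z (y n)) \<longlonglongrightarrow> Pres z y0" by (intro tendsto_intros y)
    ultimately show "G z = Pres z y0" by (rule LIMSEQ_unique)
  qed
  then show "y0 \<in> {y. \<exists>F. extends_Pres F (ball ?b r) y}" by blast
qed

lemma Re_limit_unique: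
  fixes G :: "complex \<Rightarrow> 'b::t2_space"
  assumes U: "open U" "z \<in> U" and G: "continuous_on U G" and eq: "\<And>l. l \<in> U \<Longrightarrow> Re l \<noteq> 0 \<Longrightarrow> H l = G l"
  shows "Lim (at z within {l. Re l \<noteq> 0}) H = G z"
proof (rule tendsto_Lim)
  show "at z within {l. Re l \<noteq> 0} \<noteq> bot"
  proof
    assume "at z within {l. Re l \<noteq> 0} = bot"
    then have ev: "\<forall>\<^sub>F l in at z within {l. Re l \<noteq> 0}. False" by simp
    obtain d where d: "0 < d" "\<And>l. Re l \<noteq> 0 \<Longrightarrow> l \<noteq> z \<Longrightarrow> dist l z < d \<Longrightarrow> False"
      using ev unfolding eventually_at by blast
    show False
    proof (cases "Re z = 0")
      case True
      then show False using d(2) [of "z + of_real (d / 2)"] d(1) by (simp add: dist_norm)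
    next
      case False
      then show False using d(2) [of "z + \<i> * of_real (d / 2)"] d(1) by (simp add: dist_norm norm_mult)
    qed
  qed
  have "G \<midarrow>z\<rightarrow> G z" using U G by (metis continuous_on_def at_within_open)
  then have "(G \<longlongrightarrow> G z) (at z within {l. Re l \<noteq> 0})" by (rule tendsto_within_subset) simp
  moreover have "\<forall>\<^sub>F l in at z within {l. Re l \<noteq> 0}. H l = G l"
    using eventually_at_in_open' [OF U] unfolding eventually_at_filter by (rule eventually_mono) (use eq in auto)
  ultimately show "(H \<longlongrightarrow> G z) (at z within {l. Re l \<noteq> 0})" by (simp add: tendsto_cong)
qed

lemma open_Re_Im: "closed \<Lambda> \<Longrightarrow> open {l. Re l \<noteq> 0 \<or> Im l \<notin> \<Lambda>}"
proof -
  assume \<Lambda>: "closed \<Lambda>"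
  have "{l. Re l \<noteq> 0 \<or> Im l \<notin> \<Lambda>} = {l. Re l \<noteq> 0} \<union> Im -` (- \<Lambda>)" by auto
  moreover have "open (Im -` (- \<Lambda>))"
    using \<Lambda> by (intro open_vimage continuous_intros) (simp add: open_Compl)
  moreover have "open {l. Re l \<noteq> 0}" by (intro open_Collect_neq continuous_intros)
  ultimately show ?thesis by auto
qed

lemma extends_Pres_plane: "extends_Pres (\<lambda>l. Pres l y) {l. Re l \<noteq> 0} y"
  unfolding extends_Pres_def
  using vholomorphic_on_apply [OF pseudo_resolvent_vholomorphic [OF pseudo_resolvent_Pres] _ vholomorphic_on_const]
  by (auto simp: Pres_clinear)

text \<open>At each point every local extension has as its value the limit of the resolvent from off
  the imaginary axis. A global function defined by this limit agrees with all of them, and no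
  compatibility has to be checked.\<close>

lemma extends_Pres_glue:
  assumes \<Lambda>: "closed \<Lambda>" and ext: "\<And>\<xi>. \<xi> \<notin> \<Lambda> \<Longrightarrow> \<exists>r>0. \<exists>F. extends_Pres F (ball (\<i> * of_real \<xi>) r) y"
  shows "\<exists>F. extends_Pres F {l. Re l \<noteq> 0 \<or> Im l \<notin> \<Lambda>} y"
proof -
  define F where "F l = Lim (at l within {l. Re l \<noteq> 0}) (\<lambda>l. Pres l y)" for l
  have loc: "F l = G l" if "open U" "l \<in> U" "extends_Pres G U y" for U G l
    unfolding F_def using that
    by (intro Re_limit_unique [where U = U]) (auto simp: extends_Pres_def vholomorphic_on_continuous)
  note open_Re = open_Re_Im [of UNIV, simplified]
  have "extends_Pres F {l. Re l \<noteq> 0 \<or> Im l \<notin> \<Lambda>} y"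
    unfolding extends_Pres_def vholomorphic_on_open [OF open_Re_Im [OF \<Lambda>]]
  proof (intro conjI ballI impI)
    fix l assume l: "l \<in> {l. Re l \<noteq> 0 \<or> Im l \<notin> \<Lambda>}"
    obtain U G where UG: "open U" "l \<in> U" "extends_Pres G U y"
    proof (cases "Re l = 0")
      case True
      then obtain r G where rG: "0 < r" "extends_Pres G (ball (\<i> * of_real (Im l)) r) y" using ext [of "Im l"] l by auto
      have "l = \<i> * of_real (Im l)" using True by (simp add: complex_eq_iff)
      then have "l \<in> ball (\<i> * of_real (Im l)) r" using rG(1) by simp
      then show thesis using rG(2) that by blast
    next
      case False
      then show thesis using that [OF open_Re _ extends_Pres_plane] by simp
    qed
    obtain G' where G': "(G has_derivative (\<lambda>h. h *\<^sub>C G')) (at l)"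
      using UG by (auto simp: extends_Pres_def vholomorphic_on_open)
    have "(F has_derivative (\<lambda>h. h *\<^sub>C G')) (at l)"
      by (rule has_derivative_transform_within_open [OF G' UG(1,2)]) (simp add: loc [OF UG(1) _ UG(3)])
    then show "\<exists>F'. (F has_derivative (\<lambda>h. h *\<^sub>C F')) (at l)" by blast
  next
    fix l :: complex assume "Re l \<noteq> 0"
    then show "F l = Pres l y" using loc [OF open_Re _ extends_Pres_plane] by simp
  qed
  then show ?thesis by blast
qed

lemma sp_iff: "\<xi> \<notin> sp g \<longleftrightarrow> (\<exists>r>0. \<exists>F. extends_Pres F (ball (\<i> * of_real \<xi>) r) (abs_BUC_quot g))"
  for g :: "real \<Rightarrow> 'a::{complex_normed_vector, banach}"
proof
  assume "\<xi> \<notin> sp g"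
  then obtain U F where UF: "open U" "\<i> * complex_of_real \<xi> \<in> U" "vholomorphic_on F U" "\<And>l. l \<in> U \<Longrightarrow> Re l \<noteq> 0 \<Longrightarrow> F l = hat g l"
    unfolding sp_def by blast
  obtain r where r: "0 < r" "ball (\<i> * of_real \<xi>) r \<subseteq> U" using UF(1,2) openE by blast
  have "extends_Pres F U (abs_BUC_quot g)" using UF by (simp add: extends_Pres_def hat_eq_Pres)
  from extends_Pres_subset [OF this r(2)]
  show "\<exists>r>0. \<exists>F. extends_Pres F (ball (\<i> * of_real \<xi>) r) (abs_BUC_quot g)" using r(1) by blast
next
  assume "\<exists>r>0. \<exists>F. extends_Pres F (ball (\<i> * of_real \<xi>) r) (abs_BUC_quot g)"
  then obtain r F where rF: "0 < r" "extends_Pres F (ball (\<i> * of_real \<xi>) r) (abs_BUC_quot g)" by blast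
  have "open (ball (\<i> * of_real \<xi>) r) \<and> \<i> * of_real \<xi> \<in> ball (\<i> * of_real \<xi>) r \<and> vholomorphic_on F (ball (\<i> * of_real \<xi>) r) \<and>
    (\<forall>l\<in>ball (\<i> * of_real \<xi>) r. Re l \<noteq> 0 \<longrightarrow> F l = hat g l)"
    using rF by (simp add: extends_Pres_def hat_eq_Pres)
  then show "\<xi> \<notin> sp g" unfolding sp_def by blast
qed

lemma closed_sp: "closed (sp g)" for g :: "real \<Rightarrow> 'a::{complex_normed_vector, banach}"
proof -
  have "open (- sp g)"
    unfolding open_dist
  proof
    fix \<xi> assume "\<xi> \<in> - sp g"
    then obtain r F where rF: "0 < r" "extends_Pres F (ball (\<i> * of_real \<xi>) r) (abs_BUC_quot g)" by (auto simp: sp_iff)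
    have "\<eta> \<in> - sp g" if "dist \<eta> \<xi> < r" for \<eta>
    proof -
      have "\<i> * complex_of_real \<eta> \<in> ball (\<i> * of_real \<xi>) r"
        using that by (simp add: dist_norm norm_mult norm_minus_commute flip: right_diff_distrib of_real_diff)
      then obtain e where "0 < e" "ball (\<i> * complex_of_real \<eta>) e \<subseteq> ball (\<i> * of_real \<xi>) r"
        using openE [OF open_ball] by blast
      then show ?thesis using extends_Pres_subset [OF rF(2)] by (auto simp: sp_iff)
    qed
    then show "\<exists>e>0. \<forall>\<eta>. dist \<eta> \<xi> < e \<longrightarrow> \<eta> \<in> - sp g" using rF(1) by blast
  qed
  then show ?thesis by (simp add: closed_def)
qed

lemma sp_empty_imp_C0:
  fixes g :: "real \<Rightarrow> 'a::{complex_normed_vector, banach}"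
  assumes g: "g \<in> BUC" and sp: "sp g = {}"
  shows "g \<in> C0"
proof -
  have "\<exists>F. extends_Pres F {l. Re l \<noteq> 0 \<or> Im l \<notin> {}} (abs_BUC_quot g)"
    by (rule extends_Pres_glue) (use sp in \<open>auto simp flip: sp_iff\<close>)
  then obtain F where F: "vholomorphic_on F UNIV" "\<And>l. Re l \<noteq> 0 \<Longrightarrow> F l = Pres l (abs_BUC_quot g)"
    by (auto simp: extends_Pres_def)
  have "F 1 = 0"
    by (rule imaginary_Liouville [OF F(1), of "norm (abs_BUC_quot g)"]) (use F(2) norm_Pres_le in auto)
  then have "Pres 1 (abs_BUC_quot g) = 0" using F(2) [of 1] by simp
  then have "abs_BUC_quot g = 0" using Pres_inj [of 1] by simp
  then show ?thesis using g by (simp add: abs_BUC_quot_eq_0_iff)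
qed

lemma sp_diff_subset:
  fixes g :: "real \<Rightarrow> 'a::{complex_normed_vector, banach}"
  assumes g: "g \<in> BUC" "h \<in> BUC"
  shows "sp (\<lambda>t. g t - h t) \<subseteq> sp g \<union> sp h"
proof
  fix \<xi> assume \<xi>: "\<xi> \<in> sp (\<lambda>t. g t - h t)"
  show "\<xi> \<in> sp g \<union> sp h"
  proof (rule ccontr)
    assume "\<xi> \<notin> sp g \<union> sp h"
    then obtain r r' F F' where *: "0 < r" "0 < r'" "extends_Pres F (ball (\<i> * of_real \<xi>) r) (abs_BUC_quot g)"
      "extends_Pres F' (ball (\<i> * of_real \<xi>) r') (abs_BUC_quot h)" by (auto simp: sp_iff)
    have le: "ball (\<i> * complex_of_real \<xi>) (min r r') \<subseteq> ball (\<i> * of_real \<xi>) r" "ball (\<i> * complex_of_real \<xi>) (min r r') \<subseteq> ball (\<i> * of_real \<xi>) r'"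
      by (auto intro!: subset_ball)
    from extends_Pres_diff [OF extends_Pres_subset [OF *(3) le(1)] extends_Pres_subset [OF *(4) le(2)]] have "\<xi> \<notin> sp (\<lambda>t. g t - h t)"
      unfolding sp_iff abs_BUC_quot_diff [OF g] using *(1,2) by (intro exI [of _ "min r r'"]) auto
    with \<xi> show False by simp
  qed
qed

section \<open>Mild solutions\<close>

text \<open>Integrate the derivative of exp(\<mu> s) p(s). For fixed t and p(s) built from T(t - s)
  v(s), this passes between mild equations for T and for the rescaled family V without
  differentiating v itself.\<close>

lemma exp_weighted_integral:
  fixes k :: "real \<Rightarrow> 'a::banach" and \<mu> :: real
  assumes k: "continuous_on {0..t} k" and t: "0 \<le> t" and p: "\<And>s. s \<in> {0..t} \<Longrightarrow> p s = x + integral {0..s} k"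
  shows "exp (\<mu> * t) *\<^sub>R p t = x + integral {0..t} (\<lambda>s. exp (\<mu> * s) *\<^sub>R (k s + \<mu> *\<^sub>R p s))"
proof -
  have "((\<lambda>s. exp (\<mu> * s) *\<^sub>R (k s + \<mu> *\<^sub>R p s)) has_integral exp (\<mu> * t) *\<^sub>R p t - exp (\<mu> * 0) *\<^sub>R p 0) {0..t}"
  proof (rule fundamental_theorem_of_calculus [OF t])
    fix s assume s: "s \<in> {0..t}"
    have "((\<lambda>s. x + integral {0..s} k) has_vector_derivative 0 + k s) (at s within {0..t})"
      by (intro derivative_intros has_vector_derivative_add integral_has_vector_derivative k s)
    then have p': "(p has_vector_derivative k s) (at s within {0..t})"
      using has_vector_derivative_transform [OF s p] by simp
    have e': "((\<lambda>s. exp (\<mu> * s)) has_real_derivative \<mu> * exp (\<mu> * s)) (at s within {0..t})"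
      by (auto intro!: derivative_eq_intros)
    from has_vector_derivative_scaleR [OF e' p']
    show "((\<lambda>s. exp (\<mu> * s) *\<^sub>R p s) has_vector_derivative exp (\<mu> * s) *\<^sub>R (k s + \<mu> *\<^sub>R p s)) (at s within {0..t})"
      by (simp add: scaleR_add_right mult.commute)
  qed
  from integral_unique [OF this] show ?thesis using p [of 0] t by simp
qed

context bounded_C0_semigroup
begin

lemma T_eq_V: "T r y = exp ((\<omega> + 2) * r) *\<^sub>R V r y"
proof -
  have "exp ((\<omega> + 2) * r) * exp (- (\<omega> + 2) * r) = 1" unfolding mult_exp_exp by (simp add: algebra_simps)
  then show ?thesis by (simp only: V_def scaleR_blinfun.rep_eq scaleR_scaleR scaleR_one)
qed

lemma T_integrand:
  assumes "continuous_on {0..} g" "s \<le> t"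
  shows "continuous_on {0..s} (\<lambda>r. T (t - r) (g r))" "(\<lambda>r. T (t - r) (g r)) integrable_on {0..s}"
proof -
  have "continuous_on {0..s} (\<lambda>r. exp ((\<omega> + 2) * (t - r)))" by (intro continuous_intros)
  from continuous_on_scaleR [OF this V.conv_integrand(1) [OF assms(1) order_refl assms(2)]]
  show "continuous_on {0..s} (\<lambda>r. T (t - r) (g r))"
    by (simp only: T_eq_V)
  then show "(\<lambda>r. T (t - r) (g r)) integrable_on {0..s}" by (rule integrable_continuous_real)
qed

lemma T_T: "0 \<le> r \<Longrightarrow> r \<le> s \<Longrightarrow> s \<le> t \<Longrightarrow> T (t - s) (T (s - r) x) = T (t - r) x"
  using C0_semigroupD(3) [OF T, of "t - s" "s - r"] by (simp add: blinfun_apply_blinfun_compose)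

text \<open>The convolution is the mild solution of w' = (A - \<mu>) w + g with w(0) = 0; the term -
  \<mu> w is moved into the inhomogeneity.\<close>

lemma conv_V_mild:
  assumes g: "continuous_on {0..} g" and t: "0 \<le> t"
  shows "conv V g t = integral {0..t} (\<lambda>s. T (t - s) (g s - (\<omega> + 2) *\<^sub>R conv V g s))"
proof -
  let ?\<mu> = "\<omega> + 2"
  let ?k = "\<lambda>r. exp (?\<mu> * r) *\<^sub>R T (t - r) (g r)"
  \<comment> \<open>The factor exp(\<mu> s) T(t - s) cancels the dependence of the kernel V(s - r)
    on s, so that \<open>?p\<close> becomes the integral of \<open>?k\<close> with variable upper
    limit.\<close>
  let ?p = "\<lambda>s. exp (?\<mu> * s) *\<^sub>R T (t - s) (conv V g s)"
  have kc: "continuous_on {0..t} ?k" by (intro continuous_intros T_integrand(1) g order_refl)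
  have p: "?p s = 0 + integral {0..s} ?k" if s: "s \<in> {0..t}" for s
  proof -
    have i: "(\<lambda>r. V (s - r) (g r)) integrable_on {0..s}" by (rule V.conv_integrand(2) [OF g order_refl order_refl])
    have "?p s = (exp (?\<mu> * s) *\<^sub>R T (t - s)) (conv V g s)" by (simp only: scaleR_blinfun.rep_eq)
    also have "\<dots> = integral {0..s} (\<lambda>r. (exp (?\<mu> * s) *\<^sub>R T (t - s)) (V (s - r) (g r)))"
      unfolding conv_def by (rule integral_blinfun [OF i, symmetric])
    also have "\<dots> = integral {0..s} ?k"
    proof (rule integral_cong)
      fix r assume r: "r \<in> {0..s}"
      have "(exp (?\<mu> * s) *\<^sub>R T (t - s)) (V (s - r) (g r)) = (exp (?\<mu> * s) * exp (- ?\<mu> * (s - r))) *\<^sub>R T (t - s) (T (s - r) (g r))"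
        by (simp only: V_def scaleR_blinfun.rep_eq blinfun.scaleR_right scaleR_scaleR)
      also have "exp (?\<mu> * s) * exp (- ?\<mu> * (s - r)) = exp (?\<mu> * r)" by (simp add: algebra_simps flip: exp_add)
      finally show "(exp (?\<mu> * s) *\<^sub>R T (t - s)) (V (s - r) (g r)) = ?k r" using T_T [of r s t] r s by simp
    qed
    finally show ?thesis by simp
  qed
  have "exp (- ?\<mu> * t) *\<^sub>R ?p t = 0 + integral {0..t} (\<lambda>s. exp (- ?\<mu> * s) *\<^sub>R (?k s + (- ?\<mu>) *\<^sub>R ?p s))"
    by (rule exp_weighted_integral [OF kc t p])
  moreover have "exp (- ?\<mu> * s) *\<^sub>R (?k s + (- ?\<mu>) *\<^sub>R ?p s) = T (t - s) (g s - ?\<mu> *\<^sub>R conv V g s)" for s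
  proof -
    have "exp (- ?\<mu> * s) *\<^sub>R (exp (?\<mu> * s) *\<^sub>R a + (- ?\<mu>) *\<^sub>R exp (?\<mu> * s) *\<^sub>R b) = a - ?\<mu> *\<^sub>R b" for a b :: 'a
    proof -
      have "exp (- ?\<mu> * s) *\<^sub>R (exp (?\<mu> * s) *\<^sub>R a + (- ?\<mu>) *\<^sub>R exp (?\<mu> * s) *\<^sub>R b) =
        (exp (- ?\<mu> * s) * exp (?\<mu> * s)) *\<^sub>R (a + (- ?\<mu>) *\<^sub>R b)"
        by (simp only: scaleR_add_right scaleR_scaleR mult_ac)
      also have "exp (- ?\<mu> * s) * exp (?\<mu> * s) = 1" unfolding mult_exp_exp by (simp add: algebra_simps)
      finally show ?thesis unfolding scaleR_one scaleR_minus_left by simp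
    qed
    then show ?thesis unfolding blinfun.diff_right blinfun.scaleR_right .
  qed
  moreover have "exp (- ?\<mu> * t) *\<^sub>R ?p t = conv V g t"
  proof -
    have "exp (- ?\<mu> * t) * exp (?\<mu> * t) = 1" unfolding mult_exp_exp by (simp add: algebra_simps)
    then show ?thesis unfolding scaleR_scaleR by (simp only: C0_semigroupD(2) [OF T] diff_self id_blinfun.rep_eq scaleR_one)
  qed
  ultimately show ?thesis by (simp only: add_0)
qed

lemma mild_imp_conv_V:
  assumes \<epsilon>: "continuous_on {0..} \<epsilon>" and v: "continuous_on {0..} v"
    and mild: "\<And>t. 0 \<le> t \<Longrightarrow> v t = T t x + integral {0..t} (\<lambda>s. T (t - s) (\<epsilon> s))" and t: "0 \<le> t"
  shows "v t = V t x + conv V (\<lambda>s. \<epsilon> s + (\<omega> + 2) *\<^sub>R v s) t"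
proof -
  let ?\<mu> = "\<omega> + 2"
  let ?k = "\<lambda>r. T (t - r) (\<epsilon> r)"
  let ?p = "\<lambda>s. T (t - s) (v s)"
  have kc: "continuous_on {0..t} ?k" by (rule T_integrand(1) [OF \<epsilon> order_refl])
  have p: "?p s = T t x + integral {0..s} ?k" if s: "s \<in> {0..t}" for s
  proof -
    have "?p s = T (t - s) (T s x) + integral {0..s} (\<lambda>r. T (t - s) (T (s - r) (\<epsilon> r)))"
    proof -
      have "v s = T s x + integral {0..s} (\<lambda>r. T (s - r) (\<epsilon> r))" by (rule mild) (use s in simp)
      then show ?thesis
        by (simp only: integral_blinfun [OF T_integrand(2) [OF \<epsilon> order_refl, of s], of "T (t - s)"] blinfun.add_right)
    qed
    also have "\<dots> = T t x + integral {0..s} ?k"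
    proof -
      have "T (t - s) (T s x) = T t x" using T_T [of 0 s t x] s by simp
      moreover have "integral {0..s} (\<lambda>r. T (t - s) (T (s - r) (\<epsilon> r))) = integral {0..s} ?k"
        by (rule integral_cong) (use s in \<open>simp add: T_T\<close>)
      ultimately show ?thesis by (simp only:)
    qed
    finally show ?thesis .
  qed
  have "exp (?\<mu> * t) *\<^sub>R ?p t = T t x + integral {0..t} (\<lambda>s. exp (?\<mu> * s) *\<^sub>R (?k s + ?\<mu> *\<^sub>R ?p s))"
    by (rule exp_weighted_integral [OF kc t p])
  also have "(\<lambda>s. exp (?\<mu> * s) *\<^sub>R (?k s + ?\<mu> *\<^sub>R ?p s)) = (\<lambda>s. exp (?\<mu> * t) *\<^sub>R V (t - s) (\<epsilon> s + ?\<mu> *\<^sub>R v s))"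
  proof
    fix s
    have "exp (?\<mu> * t) *\<^sub>R V (t - s) y = exp (?\<mu> * s) *\<^sub>R T (t - s) y" for y
    proof -
      have "?\<mu> * t + - ?\<mu> * (t - s) = ?\<mu> * s" by (simp add: algebra_simps)
      then show ?thesis by (simp only: V_def scaleR_blinfun.rep_eq scaleR_scaleR mult_exp_exp)
    qed
    note VT = this
    have "exp (?\<mu> * s) *\<^sub>R (?k s + ?\<mu> *\<^sub>R ?p s) = exp (?\<mu> * s) *\<^sub>R T (t - s) (\<epsilon> s + ?\<mu> *\<^sub>R v s)"
      by (simp only: blinfun.add_right blinfun.scaleR_right)
    also have "\<dots> = exp (?\<mu> * t) *\<^sub>R V (t - s) (\<epsilon> s + ?\<mu> *\<^sub>R v s)" by (rule VT [symmetric])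
    finally show "exp (?\<mu> * s) *\<^sub>R (?k s + ?\<mu> *\<^sub>R ?p s) = exp (?\<mu> * t) *\<^sub>R V (t - s) (\<epsilon> s + ?\<mu> *\<^sub>R v s)" .
  qed
  also have "T t x = exp (?\<mu> * t) *\<^sub>R V t x" by (rule T_eq_V)
  also have "exp (?\<mu> * t) *\<^sub>R V t x + integral {0..t} (\<lambda>s. exp (?\<mu> * t) *\<^sub>R V (t - s) (\<epsilon> s + ?\<mu> *\<^sub>R v s)) =
    exp (?\<mu> * t) *\<^sub>R (V t x + conv V (\<lambda>s. \<epsilon> s + ?\<mu> *\<^sub>R v s) t)"
    unfolding conv_def integral_cmul scaleR_add_right ..
  finally show ?thesis by (simp add: C0_semigroupD(2) [OF T])
qed

text \<open>In the form given by \<open>mild_imp_conv_V\<close>, the term V(t) x decays and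
  \<epsilon> is in \<open>C0\<close>, so both disappear in the quotient.\<close>

lemma mild_quotient:
  assumes v: "v \<in> BUC" and \<epsilon>: "\<epsilon> \<in> C0"
    and mild: "\<And>t. 0 \<le> t \<Longrightarrow> v t = T t x + integral {0..t} (\<lambda>s. T (t - s) (\<epsilon> s))"
  shows "abs_BUC_quot v = (\<omega> + 2) *\<^sub>R conv_op V (abs_BUC_quot v)"
proof -
  let ?\<mu> = "\<omega> + 2"
  let ?g = "\<lambda>s. \<epsilon> s + ?\<mu> *\<^sub>R v s"
  have \<mu>v: "(\<lambda>s. ?\<mu> *\<^sub>R v s) \<in> BUC" using BUC_scaleC [OF v, of "of_real ?\<mu>"] by (simp only: scaleC_of_real)
  have g: "?g \<in> BUC" by (rule BUC_add [OF C0_BUC [OF \<epsilon>] \<mu>v])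
  have eq: "v t - conv V ?g t = V t x" if "0 \<le> t" for t
    unfolding diff_eq_eq
  proof (rule mild_imp_conv_V [where v = v and \<epsilon> = \<epsilon> and t = t and x = x])
    show "continuous_on {0..} \<epsilon>" by (rule BUC_continuous [OF C0_BUC [OF \<epsilon>] order_refl])
    show "continuous_on {0..} v" by (rule BUC_continuous [OF v order_refl])
    show "v t = T t x + integral {0..t} (\<lambda>s. T (t - s) (\<epsilon> s))" if "0 \<le> t" for t by (rule mild [OF that])
  qed (rule that)
  have "abs_BUC_quot v = abs_BUC_quot (conv V ?g)"
  proof (rule abs_BUC_quot_eqI [OF v V.conv_BUC [OF g] C0_I])
    show "(\<lambda>t. v t - conv V ?g t) \<in> BUC" by (rule BUC_diff [OF v V.conv_BUC [OF g]])
    fix e :: real assume e: "0 < e"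
    have "((\<lambda>t. c * exp (- 2 * t)) \<longlongrightarrow> 0) at_top" for c :: real by real_asymp
    from this [of "M * norm x"] have "\<forall>\<^sub>F t in at_top. (M * norm x) * exp (- 2 * t) < e" using e by (intro order_tendstoD)
    then obtain N where N: "\<And>t. N \<le> t \<Longrightarrow> (M * norm x) * exp (- 2 * t) < e" unfolding eventually_at_top_linorder by blast
    have "norm (v t - conv V ?g t) < e" if "max 0 N \<le> t" for t
    proof -
      have t: "0 \<le> t" "N \<le> t" using that by auto
      show ?thesis unfolding eq [OF t(1)] by (rule le_less_trans [OF V.norm_V_decay [OF t(1) order_refl] N [OF t(2)]])
    qed
    then show "\<exists>N. \<forall>t\<ge>N. norm (v t - conv V ?g t) < e" by blast
  qed
  also have "\<dots> = conv_op V (abs_BUC_quot ?g)" by (rule V.conv_op(2) [OF g, symmetric])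
  also have "abs_BUC_quot ?g = ?\<mu> *\<^sub>R abs_BUC_quot v"
    unfolding abs_BUC_quot_scaleR [OF v] by (rule abs_BUC_quot_eqI [OF g \<mu>v]) (simp add: \<epsilon>)
  also have "conv_op V (?\<mu> *\<^sub>R abs_BUC_quot v) = ?\<mu> *\<^sub>R conv_op V (abs_BUC_quot v)" by (rule blinfun.scaleR_right)
  finally show ?thesis .
qed

text \<open>The hypothesis formally says (D - A) y = 0, so the resolvents of D and A agree on y. In
  the proof z is the difference of the two and a = Q(l) P(l) y. The relation
  \<open>conv_op_star\<close> with n = l reads a = B(z + \<mu> a); as \<mu> B fixes a, this leaves B
  z = 0, and \<mu> B also fixes z.\<close>

lemma homogeneous_Pres_eq:
  assumes y: "y = (\<omega> + 2) *\<^sub>R conv_op V y" and l: "l \<in> resolvent_set (generator T)" "Re l \<noteq> 0"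
  shows "Pres l y = lift (Res (generator T) l) y"
proof -
  let ?\<mu> = "\<omega> + 2" and ?B = "conv_op V" and ?Q = "lift (Res (generator T) l)"
  define z where "z = Pres l y - ?Q y"
  define a where "a = ?Q (Pres l y)"
  have BP: "?\<mu> *\<^sub>R ?B (Pres l y) = Pres l y"
  proof -
    have "?\<mu> *\<^sub>R ?B (Pres l y) = Pres l (?\<mu> *\<^sub>R ?B y)" by (simp only: conv_op_Pres [OF l(2)] blinfun.scaleR_right)
    then show ?thesis by (simp only: y [symmetric])
  qed
  have BQ: "?\<mu> *\<^sub>R ?B (?Q x) = ?Q (?\<mu> *\<^sub>R ?B x)" for x by (simp only: conv_op_lift [OF l(1)] blinfun.scaleR_right)
  have z: "z = ?\<mu> *\<^sub>R ?B z"
    by (simp only: z_def blinfun.diff_right scaleR_diff_right BP BQ y [symmetric])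
  have a: "?\<mu> *\<^sub>R ?B a = a" by (simp only: a_def BQ BP)
  have "a = ?B (z + of_real ?\<mu> *\<^sub>C a)"
    using conv_op_star [OF l(2,1), of y] unfolding z_def a_def add_diff_cancel_right' .
  also have "\<dots> = ?B z + a" by (simp only: blinfun.add_right scaleC_of_real blinfun.scaleR_right a)
  finally have "?B z = 0" by simp
  with z have "z = 0" by simp
  then show ?thesis by (simp add: z_def)
qed

lemma homogeneous_sp:
  assumes y: "abs_BUC_quot v = (\<omega> + 2) *\<^sub>R conv_op V (abs_BUC_quot v)" and \<xi>: "\<i> * of_real \<xi> \<in> resolvent_set (generator T)"
  shows "\<xi> \<notin> sp v"
proof -
  let ?A = "generator T"
  note Q = pseudo_resolvent_lift [OF clinear_graph_generator [OF T]]
  have op: "open (resolvent_set ?A)" and cl: "\<And>l. l \<in> resolvent_set ?A \<Longrightarrow> clinear_op (lift (Res ?A l))"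
    using Q unfolding pseudo_resolvent_def by blast+
  obtain r where r: "0 < r" "ball (\<i> * of_real \<xi>) r \<subseteq> resolvent_set ?A" using openE [OF op \<xi>] .
  have "extends_Pres (\<lambda>l. lift (Res ?A l) (abs_BUC_quot v)) (resolvent_set ?A) (abs_BUC_quot v)"
    unfolding extends_Pres_def
    using vholomorphic_on_apply [OF pseudo_resolvent_vholomorphic [OF Q] cl vholomorphic_on_const] homogeneous_Pres_eq [OF y]
    by auto
  from extends_Pres_subset [OF this r(2)] show ?thesis unfolding sp_iff using r(1) by blast
qed

end

section \<open>Existence and uniqueness\<close>

lemma mild_difference:
  fixes T :: "real \<Rightarrow> 'a::{complex_normed_vector, banach} \<Rightarrow>\<^sub>L 'a"
  assumes T: "C0_semigroup T" and f: "f \<in> BUC_C" and sp: "spectrum (generator T) \<inter> (\<lambda>\<xi>. \<i> * complex_of_real \<xi>) ` sp f = {}"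
    and w1: "asymptotic_mild_solution T f w1" "sp w1 \<subseteq> sp f" and w2: "asymptotic_mild_solution T f w2" "sp w2 \<subseteq> sp f"
  shows "(\<lambda>t. w1 t - w2 t) \<in> C0"
proof -
  obtain M \<omega> where bd: "1 \<le> M" "0 \<le> \<omega>" "\<And>t. 0 \<le> t \<Longrightarrow> norm (T t) \<le> M * exp (\<omega> * t)"
    using C0_semigroup_bound [OF T] by metis
  interpret bounded_C0_semigroup T M \<omega>
  proof
    show "continuous_on {0..} (\<lambda>t. T t x)" for x by (rule C0_semigroup_continuous [OF T])
    show "0 \<le> M" using bd(1) by simp
  qed (rule bd(3), assumption, rule T)
  let ?v = "\<lambda>t. w1 t - w2 t"
  have fc: "continuous_on {0..} f" by (rule BUC_continuous [OF BUC_C_BUC [OF f] order_refl])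
  have w: "w1 \<in> BUC" "w2 \<in> BUC" using w1 w2 by (auto simp: asymptotic_mild_solution_def)
  obtain e1 where e1: "e1 \<in> C0" "\<And>t. 0 \<le> t \<Longrightarrow> w1 t = T t (w1 0) + integral {0..t} (\<lambda>s. T (t - s) (f s + e1 s))"
    using w1 by (auto simp: asymptotic_mild_solution_def)
  obtain e2 where e2: "e2 \<in> C0" "\<And>t. 0 \<le> t \<Longrightarrow> w2 t = T t (w2 0) + integral {0..t} (\<lambda>s. T (t - s) (f s + e2 s))"
    using w2 by (auto simp: asymptotic_mild_solution_def)
  have i: "(\<lambda>s. T (t - s) (f s + e s)) integrable_on {0..t}" if "e \<in> C0" for e t
    by (intro T_integrand(2) continuous_on_add fc BUC_continuous [OF C0_BUC [OF that]] order_refl)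
  have v: "?v \<in> BUC" by (rule BUC_diff [OF w])
  have mild: "?v t = T t (w1 0 - w2 0) + integral {0..t} (\<lambda>s. T (t - s) (e1 s - e2 s))" if t: "0 \<le> t" for t
  proof -
    have "integral {0..t} (\<lambda>s. T (t - s) (f s + e1 s)) - integral {0..t} (\<lambda>s. T (t - s) (f s + e2 s)) =
      integral {0..t} (\<lambda>s. T (t - s) (e1 s - e2 s))"
      unfolding integral_diff [OF i [OF e1(1)] i [OF e2(1)], symmetric] by (simp flip: blinfun.diff_right)
    then show ?thesis using e1(2) [OF t] e2(2) [OF t] by (simp add: blinfun.diff_right)
  qed
  note y = mild_quotient [OF v C0_diff [OF e1(1) e2(1)] mild]
  have "sp ?v = {}"
  proof (rule ccontr)
    assume "sp ?v \<noteq> {}"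
    then obtain \<xi> where \<xi>: "\<xi> \<in> sp ?v" by blast
    then have "\<xi> \<in> sp f" using sp_diff_subset [OF w] w1(2) w2(2) by blast
    then have "\<i> * complex_of_real \<xi> \<in> resolvent_set (generator T)" using sp by (auto simp: spectrum_def)
    then show False using homogeneous_sp [OF y] \<xi> by blast
  qed
  then show ?thesis by (rule sp_empty_imp_C0 [OF v])
qed

lemma mild_existence:
  fixes T :: "real \<Rightarrow> 'a::{complex_normed_vector, banach} \<Rightarrow>\<^sub>L 'a"
  assumes T: "analytic_C0_semigroup T" and f: "f \<in> BUC_C" and sp: "spectrum (generator T) \<inter> (\<lambda>\<xi>. \<i> * complex_of_real \<xi>) ` sp f = {}"
  shows "\<exists>w\<in>BUC_C. asymptotic_mild_solution T f w \<and> sp w \<subseteq> sp f"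
proof -
  let ?A = "generator T"
  obtain \<theta> S where "analytic_semigroup T S \<theta>"
  proof -
    from T obtain \<theta> S where "C0_semigroup T" "0 < \<theta>" "\<theta> \<le> pi / 2" "\<forall>t\<ge>0. S (complex_of_real t) = T t"
      "\<forall>z\<in>sector \<theta>. clinear_op (S z)" "\<forall>z\<in>sector \<theta>. \<forall>w\<in>sector \<theta>. S (z + w) = S z o\<^sub>L S w"
      "vholomorphic_on S (sector \<theta>)"
      "\<forall>\<theta>'. 0 < \<theta>' \<and> \<theta>' < \<theta> \<longrightarrow> (\<forall>x. ((\<lambda>z. S z x) \<longlongrightarrow> x) (at 0 within sector \<theta>'))"
      unfolding analytic_C0_semigroup_def by blast
    then have "analytic_semigroup T S \<theta>" by unfold_locales simp_all
    then show thesis by (rule that)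
  qed
  then interpret an: analytic_semigroup T S \<theta> .
  obtain M \<omega> where bd: "1 \<le> M" "0 \<le> \<omega>" "\<And>t. 0 \<le> t \<Longrightarrow> norm (T t) \<le> M * exp (\<omega> * t)"
    using C0_semigroup_bound [OF an.T] by metis
  interpret bounded_C0_semigroup T M \<omega>
  proof
    show "continuous_on {0..} (\<lambda>t. T t x)" for x by (rule C0_semigroup_continuous [OF an.T])
    show "0 \<le> M" using bd(1) by simp
  qed (rule bd(3), assumption, rule an.T)
  obtain N C where NC: "0 < N" "0 \<le> C"
    "\<And>l. -1 \<le> Re l \<Longrightarrow> N \<le> \<bar>Im l\<bar> \<Longrightarrow> l \<in> resolvent_set ?A \<and> norm (Res ?A l) \<le> C / \<bar>Im l\<bar>"
    using an.resolvent_decay by blast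
  define Q where "Q l = lift (Res ?A l)" for l
  define B where "B = conv_op V"
  define \<mu> where "\<mu> = \<omega> + 2"
  note cg = clinear_graph_generator [OF an.T]
  note cR = clinear_op_Res [OF _ cg]
  \<comment> \<open>The width bound c = 1 matches both Re l \<ge> -1 in
    \<open>resolvent_decay\<close> and \<mu> - 1 > \<omega>.\<close>
  interpret cs: commuting_sum Pres Q B "resolvent_set ?A" \<mu> 1 N C
  proof
    show "pseudo_resolvent Q (resolvent_set ?A)" using pseudo_resolvent_lift [OF cg] by (simp add: Q_def [abs_def])
    show "clinear_op B" unfolding B_def by (rule V.conv_op(1))
    show "Pres l (Q m x) = Q m (Pres l x)" if "Re l \<noteq> 0" "m \<in> resolvent_set ?A" for l m x
      unfolding Q_def by (rule Pres_lift [OF that(1) cR [OF that(2)]])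
    show "B (Pres l x) = Pres l (B x)" if "Re l \<noteq> 0" for l x unfolding B_def by (rule conv_op_Pres [OF that])
    show "B (Q m x) = Q m (B x)" if "m \<in> resolvent_set ?A" for m x unfolding B_def Q_def by (rule conv_op_lift [OF that])
    show "Q l (Pres n x) = B (Pres n x - Q l x + (of_real \<mu> + n - l) *\<^sub>C Q l (Pres n x))"
      if "l \<in> resolvent_set ?A" "Re n \<noteq> 0" for l n x
      unfolding B_def Q_def \<mu>_def by (rule conv_op_star [OF that(2,1)])
    show "l \<in> resolvent_set ?A" if "\<mu> - 1 \<le> Re l" for l
      by (rule resolvent_laplace(1)) (use that in \<open>simp add: \<mu>_def\<close>)
    show "l \<in> resolvent_set ?A \<and> norm (Q l) \<le> C / \<bar>Im l\<bar>" if "- 1 \<le> Re l" "N \<le> \<bar>Im l\<bar>" for l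
      using NC(3) [OF that] order_trans [OF lift(3) [OF cR]] by (auto simp: Q_def)
  qed (use pseudo_resolvent_Pres Pres_bound Pres_inj NC bd(2) in \<open>auto simp: \<mu>_def\<close>)
  let ?f = "abs_BUC_quot f"
  note fB = BUC_C_BUC [OF f]
  have "\<exists>F. extends_Pres F {l. Re l \<noteq> 0 \<or> Im l \<notin> sp f} ?f"
    by (rule extends_Pres_glue [OF closed_sp]) (simp add: sp_iff)
  then obtain F where F: "vholomorphic_on F {l. Re l \<noteq> 0 \<or> Im l \<notin> sp f}" "\<And>l. Re l \<noteq> 0 \<Longrightarrow> F l = Pres l ?f"
    by (auto simp: extends_Pres_def)
  have \<Lambda>: "Complex 0 x \<in> resolvent_set ?A" if "x \<in> sp f" for x
    using sp that by (auto simp: spectrum_def Complex_eq)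
  define Z where "Z \<xi> r = {y :: 'a BUC_quot. \<exists>F. extends_Pres F (ball (\<i> * of_real \<xi>) r) y}" for \<xi> r
  \<comment> \<open>All points with a radius that works for f. Membership in
    \<open>Z \<xi> r\<close> for all these pairs forces the spectrum into sp(f), and with the radius
    part of the index it is a closed condition.\<close>
  define J where "J = {(\<xi>, r). ?f \<in> Z \<xi> r}"
  define W where "W = BUC_C_quot \<inter> (\<Inter>(\<xi>, r)\<in>J. Z \<xi> r)"
  have W_iff: "y \<in> W \<longleftrightarrow> y \<in> BUC_C_quot \<and> (\<forall>\<xi> r. (\<xi>, r) \<in> J \<longrightarrow> y \<in> Z \<xi> r)" for y
    unfolding W_def by blast
  have Zop: "K y \<in> Z \<xi> r" if "y \<in> Z \<xi> r" "clinear_op K" "\<And>l. Re l \<noteq> 0 \<Longrightarrow> K (Pres l y) = Pres l (K y)" for K :: "'a BUC_quot \<Rightarrow>\<^sub>L 'a BUC_quot" and y \<xi> r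
    using that extends_Pres_op unfolding Z_def by blast
  have Zadd: "x + y \<in> Z \<xi> r" if "x \<in> Z \<xi> r" "y \<in> Z \<xi> r" for x y \<xi> r
    using that extends_Pres_add unfolding Z_def by blast
  have Zsc: "k *\<^sub>C y \<in> Z \<xi> r" if "y \<in> Z \<xi> r" for k y \<xi> r
    using that extends_Pres_scaleC unfolding Z_def by blast
  have Z0: "0 \<in> Z \<xi> r" for \<xi> r using extends_Pres_zero unfolding Z_def by blast
  have "\<exists>w\<in>W. w = B ?f + \<mu> *\<^sub>R B w"
  proof (rule cs.existence [OF closed_sp \<Lambda> F])
    show Wsc: "k *\<^sub>C g \<in> W" if "g \<in> W" for k g using that by (simp add: W_iff BUC_C_quot_scaleC Zsc)
    show "subspace W"
      unfolding subspace_def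
    proof (intro conjI ballI allI)
      show "0 \<in> W" by (simp add: W_iff zero_BUC_C_quot Z0)
      show "x + y \<in> W" if "x \<in> W" "y \<in> W" for x y using that by (simp add: W_iff BUC_C_quot_add Zadd)
      show "k *\<^sub>R x \<in> W" if "x \<in> W" for k x using Wsc [OF that, of "of_real k"] by (simp add: scaleC_of_real)
    qed
    show "closed W" unfolding W_def using closed_extends_Pres by (auto simp: Z_def intro!: closed_Int closed_INT BUC_C_quot_closed)
    show "?f \<in> W" using BUC_C_quot_I [OF f] by (auto simp: W_iff J_def)
    show "Pres l g \<in> W" if l: "Re l \<noteq> 0" and g: "g \<in> W" for l g
    proof -
      have "Pres l (Pres m g) = Pres m (Pres l g)" if "Re m \<noteq> 0" for m
        using pseudo_resolvent_commute [OF pseudo_resolvent_Pres, of l m g] l that by simp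
      then show ?thesis using g BUC_C_quot_Pres [OF _ l] Zop [OF _ Pres_clinear [OF l]] by (auto simp: W_iff)
    qed
    show "Q m g \<in> W" if m: "m \<in> resolvent_set ?A" and g: "g \<in> W" for m g
      using g BUC_C_quot_lift [OF cR [OF m]] Zop [OF _ cs.Q_clinear [OF m]] cs.PQ [OF _ m] by (auto simp: W_iff Q_def)
    show "B g \<in> W" if g: "g \<in> W" for g
      using g V.BUC_C_quot_conv_op Zop [OF _ cs.B_clinear] cs.BP by (auto simp: W_iff B_def)
  qed auto
  then obtain w where w: "w \<in> W" "w = B ?f + \<mu> *\<^sub>R B w" by blast
  obtain w0 where w0: "w0 \<in> BUC_C" "w = abs_BUC_quot w0" using w(1) by (auto simp: W_iff BUC_C_quot_def)
  note w0B = BUC_C_BUC [OF w0(1)]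
  \<comment> \<open>The equation for w holds modulo \<open>C0\<close> only. One more convolution
    yields a representative \<open>w1\<close> that satisfies a mild equation exactly, with the
    difference c of the two representatives entering as the perturbation \<mu> c.\<close>
  define g where "g s = f s + \<mu> *\<^sub>R w0 s" for s
  define w1 where "w1 = conv V g"
  have \<mu>w0: "(\<lambda>s. \<mu> *\<^sub>R w0 s) \<in> BUC_C" by (rule BUC_C_scaleR [OF w0(1)])
  have gC: "g \<in> BUC_C" unfolding g_def [abs_def] by (rule BUC_C_add [OF f \<mu>w0])
  note gB = BUC_C_BUC [OF gC]
  have w1C: "w1 \<in> BUC_C" unfolding w1_def by (rule V.conv_BUC_C [OF gC])
  have "abs_BUC_quot w1 = B (abs_BUC_quot g)" unfolding w1_def B_def by (rule V.conv_op(2) [OF gB, symmetric])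
  also have "abs_BUC_quot g = ?f + \<mu> *\<^sub>R w"
    unfolding g_def [abs_def] w0(2) abs_BUC_quot_scaleR [OF w0B] by (rule abs_BUC_quot_add [OF fB BUC_C_BUC [OF \<mu>w0], symmetric])
  also have "B (?f + \<mu> *\<^sub>R w) = w" using w(2) by (simp only: blinfun.add_right blinfun.scaleR_right)
  finally have w1w: "abs_BUC_quot w1 = w" .
  define c where "c t = w0 t - w1 t" for t
  have c: "c \<in> C0" unfolding c_def [abs_def] using abs_BUC_quot_eq_iff [OF w0B BUC_C_BUC [OF w1C]] w1w w0 by simp
  have "asymptotic_mild_solution T f w1"
    unfolding asymptotic_mild_solution_def
  proof (intro conjI bexI allI impI)
    show "w1 \<in> BUC" by (rule BUC_C_BUC [OF w1C])
    show "(\<lambda>t. of_real \<mu> *\<^sub>C c t) \<in> C0" by (rule C0_scaleC [OF c])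
    fix t :: real assume t: "0 \<le> t"
    have "w1 0 = 0" by (simp add: w1_def conv_nonpos)
    moreover have "w1 t = integral {0..t} (\<lambda>s. T (t - s) (g s - \<mu> *\<^sub>R w1 s))"
      unfolding w1_def \<mu>_def by (rule conv_V_mild [OF BUC_continuous [OF gB order_refl] t])
    moreover have "g s - \<mu> *\<^sub>R w1 s = f s + of_real \<mu> *\<^sub>C c s" for s
      by (simp add: g_def c_def scaleC_of_real scaleR_diff_right)
    ultimately show "w1 t = T t (w1 0) + integral {0..t} (\<lambda>s. T (t - s) (f s + of_real \<mu> *\<^sub>C c s))"
      by (simp add: blinfun.zero_right)
  qed
  moreover have "sp w1 \<subseteq> sp f"
  proof
    fix \<xi> assume \<xi>: "\<xi> \<in> sp w1"
    show "\<xi> \<in> sp f"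
    proof (rule ccontr)
      assume "\<xi> \<notin> sp f"
      then obtain r where r: "0 < r" "(\<xi>, r) \<in> J" by (auto simp: sp_iff J_def Z_def)
      then have "w \<in> Z \<xi> r" using w(1) by (auto simp: W_iff)
      then have "\<xi> \<notin> sp w1" unfolding sp_iff w1w using r(1) by (auto simp: Z_def)
      with \<xi> show False by simp
    qed
  qed
  ultimately show ?thesis using w1C by blast
qed

theorem theorem3p7:
  fixes T :: "real \<Rightarrow> 'a::{complex_normed_vector, banach} \<Rightarrow>\<^sub>L 'a"
    and A :: "('a \<times> 'a) set"
    and f :: "real \<Rightarrow> 'a"
  assumes "analytic_C0_semigroup T"
    and "A = generator T"
    and "f \<in> BUC_C"
    and "spectrum A \<inter> (\<lambda>\<xi>. \<i> * complex_of_real \<xi>) ` sp f = {}"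
  shows "(\<exists>w\<in>BUC_C. asymptotic_mild_solution T f w \<and> sp w \<subseteq> sp f) \<and>
    (\<forall>w1\<in>BUC_C. \<forall>w2\<in>BUC_C.
      asymptotic_mild_solution T f w1 \<and> sp w1 \<subseteq> sp f \<and>
      asymptotic_mild_solution T f w2 \<and> sp w2 \<subseteq> sp f \<longrightarrow>
      (\<lambda>t. w1 t - w2 t) \<in> C0)"
proof -
  have T: "C0_semigroup T" using assms(1) by (simp add: analytic_C0_semigroup_def)
  note sp = assms(4) [unfolded assms(2)]
  show ?thesis using mild_existence [OF assms(1,3) sp] mild_difference [OF T assms(3) sp] by blast
qed

end
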